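(* Let $\mathcal{S}$ and $\mathcal{T}$ be rigidly-compactly generated tensor triangulated categories, and let $\pi^\ast \colon \mathcal{S} \to \mathcal{T}$ be a tensor-exact functor that preserves all small coproducts. Let $\pi_\ast \colon \mathcal{T} \to \mathcal{S}$ be the right adjoint of $\pi^\ast$. If $G$ is a strong $\bigoplus$-generator for $\mathcal{T}$, then the following are equivalent: (1) $\pi_\ast G$ is a strong $\bigoplus$-generator for $\mathcal{S}$; (2) $1_{\mathcal{S}}$ is an object of $\overline{\langle \pi_\ast G \rangle}_n$ in $\mathcal{S}$ for some $n \geq 0$. In particular, if $\overline{\langle G \rangle}_l = \mathcal{T}$ and $1_{\mathcal{S}} \in \overline{\langle \pi_\ast G \rangle}_n$, then $\overline{\langle \pi_\ast G \rangle}_{ln} = \mathcal{S}$.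
   Context: A tensor triangulated category is a triangulated category with a compatible closed symmetric monoidal structure (in the sense of Hovey-Palmieri-Strickland, Appendix A.2); its tensor product is $\otimes$ and the tensor unit of $\mathcal{T}$ is $1_{\mathcal{T}}$. It is rigidly-compactly generated if it is compactly generated (in particular it has all small coproducts) and its compact objects coincide with its rigid (strongly dualizable) objects. A tensor-exact functor is an exact functor that is strong symmetric monoidal. A tensor-exact functor between rigidly-compactly generated tensor triangulated categories which preserves small coproducts has a right adjoint. For an object $G$ of a triangulated category $\mathcal{T}$ with small coproducts: $\overline{\langle G \rangle}_0$ is the full subcategory of objects isomorphic to zero; $\overline{\langle G \rangle}_1$ is the full subcategory of retracts (direct summands) of small coproducts of shifts of $G$; for $n \geq 2$, $\overline{\langle G \rangle}_n$ is the full subcategory of retracts of objects $E$ appearing in a distinguished triangle $A \to E \to B \to A[1]$ with $A \in \overline{\langle G \rangle}_{n-1}$ and $B \in \overline{\langle G \rangle}_1$. The object $G$ is a strong $\bigoplus$-generator for $\mathcal{T}$ if $\overline{\langle G \rangle}_n = \mathcal{T}$ for some $n \geq 0$. *)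

theory Defs
  imports "HOL-Algebra.Free_Abelian_Groups"
begin

section \<open>Smallness\<close>

text \<open>
  ``Small'' means: of cardinality less than a fixed uncountable regular cardinal \<open>\<kappa>\<close>. The sets
  belonging to a Grothendieck universe are, up to bijection, those of cardinality less than a
  strongly inaccessible \<open>\<kappa>\<close>, so this covers the usual meaning of the word. Strong inaccessibility is
  not imposed, but it is automatic in the only case of interest: in a locally small category with
  small coproducts and an object \<open>X\<close> with two distinct endomorphisms, a small \<open>I\<close> has a small power
  set, since \<open>Hom(\<Coprod>\<^bsub>I\<^esub> X, X)\<close> has at least \<open>2\<^bsup>|I|\<^esup>\<close> elements.
\<close>

definition uncountable_regular :: "'i rel \<Rightarrow> bool" where
  "uncountable_regular \<kappa> \<longleftrightarrow> Card_order \<kappa> \<and> natLeq <o \<kappa> \<and> regularCard \<kappa>"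

definition small :: "'i rel \<Rightarrow> 'a set \<Rightarrow> bool" where
  "small \<kappa> A \<longleftrightarrow> |A| <o \<kappa>"


section \<open>Categories and functors\<close>

record ('o, 'm) cat =
  Obj :: "'o set"
  Arr :: "'m set"
  Dom :: "'m \<Rightarrow> 'o"
  Cod :: "'m \<Rightarrow> 'o"
  Ident :: "'o \<Rightarrow> 'm"
  Comp :: "'m \<Rightarrow> 'm \<Rightarrow> 'm" (infixl "\<cdot>\<index>" 70)

definition Hom :: "('o, 'm, 'z) cat_scheme \<Rightarrow> 'o \<Rightarrow> 'o \<Rightarrow> 'm set" where
  "Hom C X Y = {f \<in> Arr C. Dom C f = X \<and> Cod C f = Y}"

locale category =
  fixes C :: "('o, 'm, 'z) cat_scheme" (structure)
  assumes dom_cod: "f \<in> Arr C \<Longrightarrow> Dom C f \<in> Obj C \<and> Cod C f \<in> Obj C"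
    and ident: "X \<in> Obj C \<Longrightarrow> Ident C X \<in> Hom C X X"
    and comp: "\<lbrakk>f \<in> Hom C X Y; g \<in> Hom C Y Z\<rbrakk> \<Longrightarrow> g \<cdot> f \<in> Hom C X Z"
    and comp_assoc: "\<lbrakk>f \<in> Hom C W X; g \<in> Hom C X Y; h \<in> Hom C Y Z\<rbrakk> \<Longrightarrow> (h \<cdot> g) \<cdot> f = h \<cdot> (g \<cdot> f)"
    and comp_ident_left: "f \<in> Hom C X Y \<Longrightarrow> Ident C Y \<cdot> f = f"
    and comp_ident_right: "f \<in> Hom C X Y \<Longrightarrow> f \<cdot> Ident C X = f"

definition inverse_arrows :: "('o, 'm, 'z) cat_scheme \<Rightarrow> 'm \<Rightarrow> 'm \<Rightarrow> bool" where
  "inverse_arrows C f g \<longleftrightarrow> f \<in> Arr C \<and> g \<in> Hom C (Cod C f) (Dom C f)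
     \<and> g \<cdot>\<^bsub>C\<^esub> f = Ident C (Dom C f) \<and> f \<cdot>\<^bsub>C\<^esub> g = Ident C (Cod C f)"

definition is_iso :: "('o, 'm, 'z) cat_scheme \<Rightarrow> 'm \<Rightarrow> bool" where
  "is_iso C f \<longleftrightarrow> (\<exists>g. inverse_arrows C f g)"

definition inv_arr :: "('o, 'm, 'z) cat_scheme \<Rightarrow> 'm \<Rightarrow> 'm" where
  "inv_arr C f = (THE g. inverse_arrows C f g)"

definition Isos :: "('o, 'm, 'z) cat_scheme \<Rightarrow> 'o \<Rightarrow> 'o \<Rightarrow> 'm set" where
  "Isos C X Y = {f \<in> Hom C X Y. is_iso C f}"

definition is_zero :: "('o, 'm, 'z) cat_scheme \<Rightarrow> 'o \<Rightarrow> bool" where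
  "is_zero C X \<longleftrightarrow> X \<in> Obj C \<and> (\<forall>Y\<in>Obj C. (\<exists>!f. f \<in> Hom C X Y) \<and> (\<exists>!f. f \<in> Hom C Y X))"

definition retract :: "('o, 'm, 'z) cat_scheme \<Rightarrow> 'o \<Rightarrow> 'o \<Rightarrow> bool" where
  "retract C X E \<longleftrightarrow> X \<in> Obj C \<and> (\<exists>i\<in>Hom C X E. \<exists>p\<in>Hom C E X. p \<cdot>\<^bsub>C\<^esub> i = Ident C X)"

definition is_coproduct ::
    "('o, 'm, 'z) cat_scheme \<Rightarrow> 'i set \<Rightarrow> ('i \<Rightarrow> 'o) \<Rightarrow> 'o \<Rightarrow> ('i \<Rightarrow> 'm) \<Rightarrow> bool" where
  "is_coproduct C I X P \<iota> \<longleftrightarrow> P \<in> Obj C \<and> (\<forall>i\<in>I. \<iota> i \<in> Hom C (X i) P) \<and>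
     (\<forall>Y\<in>Obj C. \<forall>f. (\<forall>i\<in>I. f i \<in> Hom C (X i) Y) \<longrightarrow>
        (\<exists>!h. h \<in> Hom C P Y \<and> (\<forall>i\<in>I. h \<cdot>\<^bsub>C\<^esub> \<iota> i = f i)))"

definition has_small_coproducts :: "'i rel \<Rightarrow> ('o, 'm, 'z) cat_scheme \<Rightarrow> bool" where
  "has_small_coproducts \<kappa> C \<longleftrightarrow>
     (\<forall>(I :: 'i set) X. small \<kappa> I \<and> (\<forall>i\<in>I. X i \<in> Obj C) \<longrightarrow> (\<exists>P \<iota>. is_coproduct C I X P \<iota>))"

definition locally_small :: "'i rel \<Rightarrow> ('o, 'm, 'z) cat_scheme \<Rightarrow> bool" where
  "locally_small \<kappa> C \<longleftrightarrow> (\<forall>X\<in>Obj C. \<forall>Y\<in>Obj C. small \<kappa> (Hom C X Y))"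

record ('o, 'm, 'p, 'n) fctr =
  ob :: "'o \<Rightarrow> 'p"
  ar :: "'m \<Rightarrow> 'n"

definition is_functor ::
    "('o, 'm, 'y) cat_scheme \<Rightarrow> ('p, 'n, 'z) cat_scheme \<Rightarrow> ('o, 'm, 'p, 'n) fctr \<Rightarrow> bool" where
  "is_functor C D F \<longleftrightarrow>
     (\<forall>X\<in>Obj C. ob F X \<in> Obj D \<and> ar F (Ident C X) = Ident D (ob F X)) \<and>
     (\<forall>X Y. \<forall>f\<in>Hom C X Y. ar F f \<in> Hom D (ob F X) (ob F Y)) \<and>
     (\<forall>X Y Z. \<forall>f\<in>Hom C X Y. \<forall>g\<in>Hom C Y Z. ar F (g \<cdot>\<^bsub>C\<^esub> f) = ar F g \<cdot>\<^bsub>D\<^esub> ar F f)"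

definition preserves_small_coproducts ::
    "'i rel \<Rightarrow> ('o, 'm, 'y) cat_scheme \<Rightarrow> ('p, 'n, 'z) cat_scheme \<Rightarrow> ('o, 'm, 'p, 'n) fctr \<Rightarrow> bool" where
  "preserves_small_coproducts \<kappa> C D F \<longleftrightarrow>
     (\<forall>(I :: 'i set) X P \<iota>. small \<kappa> I \<and> is_coproduct C I X P \<iota> \<longrightarrow>
        is_coproduct D I (\<lambda>i. ob F (X i)) (ob F P) (\<lambda>i. ar F (\<iota> i)))"

definition is_right_adjoint ::
    "('o, 'm, 'y) cat_scheme \<Rightarrow> ('p, 'n, 'z) cat_scheme \<Rightarrow> ('o, 'm, 'p, 'n) fctr \<Rightarrow> ('p, 'n, 'o, 'm) fctr
      \<Rightarrow> bool" where
  "is_right_adjoint C D F R \<longleftrightarrow> is_functor D C R \<and>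
     (\<exists>\<Phi>. (\<forall>X\<in>Obj C. \<forall>Y\<in>Obj D. bij_betw (\<Phi> X Y) (Hom D (ob F X) Y) (Hom C X (ob R Y))) \<and>
          (\<forall>X X' Y Y'. \<forall>a\<in>Hom C X' X. \<forall>b\<in>Hom D Y Y'. \<forall>f\<in>Hom D (ob F X) Y.
             \<Phi> X' Y' (b \<cdot>\<^bsub>D\<^esub> f \<cdot>\<^bsub>D\<^esub> ar F a) = ar R b \<cdot>\<^bsub>C\<^esub> \<Phi> X Y f \<cdot>\<^bsub>C\<^esub> a))"


section \<open>Additive categories\<close>

record ('o, 'm) add_cat = "('o, 'm) cat" +
  Plus :: "'m \<Rightarrow> 'm \<Rightarrow> 'm"
  Null :: "'o \<Rightarrow> 'o \<Rightarrow> 'm"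

definition hom_group :: "('o, 'm, 'z) add_cat_scheme \<Rightarrow> 'o \<Rightarrow> 'o \<Rightarrow> 'm monoid" where
  "hom_group C X Y = \<lparr>carrier = Hom C X Y, mult = Plus C, one = Null C X Y\<rparr>"

definition neg :: "('o, 'm, 'z) add_cat_scheme \<Rightarrow> 'm \<Rightarrow> 'm" where
  "neg C f = inv\<^bsub>hom_group C (Dom C f) (Cod C f)\<^esub> f"

locale additive_category = category C for C :: "('o, 'm, 'z) add_cat_scheme" (structure) +
  assumes hom_comm_group: "\<lbrakk>X \<in> Obj C; Y \<in> Obj C\<rbrakk> \<Longrightarrow> comm_group (hom_group C X Y)"
    and comp_plus_left: "\<lbrakk>f \<in> Hom C X Y; f' \<in> Hom C X Y; g \<in> Hom C Y Z\<rbrakk>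
          \<Longrightarrow> g \<cdot> Plus C f f' = Plus C (g \<cdot> f) (g \<cdot> f')"
    and comp_plus_right: "\<lbrakk>f \<in> Hom C X Y; g \<in> Hom C Y Z; g' \<in> Hom C Y Z\<rbrakk>
          \<Longrightarrow> Plus C g g' \<cdot> f = Plus C (g \<cdot> f) (g' \<cdot> f)"
    and zero_object: "\<exists>Z. is_zero C Z"
    and binary_coproducts: "\<lbrakk>X \<in> Obj C; Y \<in> Obj C\<rbrakk>
          \<Longrightarrow> \<exists>P \<iota>. is_coproduct C (UNIV :: bool set) (\<lambda>b. if b then X else Y) P \<iota>"

definition is_additive_functor ::
    "('o, 'm, 'y) add_cat_scheme \<Rightarrow> ('p, 'n, 'z) add_cat_scheme \<Rightarrow> ('o, 'm, 'p, 'n) fctr \<Rightarrow> bool" where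
  "is_additive_functor C D F \<longleftrightarrow> is_functor C D F \<and>
     (\<forall>X Y. \<forall>f\<in>Hom C X Y. \<forall>g\<in>Hom C X Y. ar F (Plus C f g) = Plus D (ar F f) (ar F g))"


section \<open>Triangulated categories\<close>

text \<open>The triple \<open>(f, g, h)\<close> stands for the diagram
  \<open>X \<rightarrow> Y \<rightarrow> Z \<rightarrow> X[1]\<close> with arrows \<open>f\<close>, \<open>g\<close>, \<open>h\<close>; the suspension \<open>X[1]\<close> is \<open>ob (Susp C) X\<close>.\<close>

record ('o, 'm) tri_cat = "('o, 'm) add_cat" +
  Susp :: "('o, 'm, 'o, 'm) fctr"
  Tri :: "('m \<times> 'm \<times> 'm) set"

definition is_diagram ::
    "('o, 'm, 'z) tri_cat_scheme \<Rightarrow> 'o \<Rightarrow> 'o \<Rightarrow> 'o \<Rightarrow> 'm \<Rightarrow> 'm \<Rightarrow> 'm \<Rightarrow> bool" where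
  "is_diagram C X Y Z f g h \<longleftrightarrow> f \<in> Hom C X Y \<and> g \<in> Hom C Y Z \<and> h \<in> Hom C Z (ob (Susp C) X)"

definition is_triangle ::
    "('o, 'm, 'z) tri_cat_scheme \<Rightarrow> 'o \<Rightarrow> 'o \<Rightarrow> 'o \<Rightarrow> 'm \<Rightarrow> 'm \<Rightarrow> 'm \<Rightarrow> bool" where
  "is_triangle C X Y Z f g h \<longleftrightarrow> is_diagram C X Y Z f g h \<and> (f, g, h) \<in> Tri C"

definition Desusp :: "('o, 'm, 'z) tri_cat_scheme \<Rightarrow> ('o, 'm, 'o, 'm) fctr" where
  "Desusp C = \<lparr>ob = inv_into (Obj C) (ob (Susp C)), ar = inv_into (Arr C) (ar (Susp C))\<rparr>"

definition shift :: "('o, 'm, 'z) tri_cat_scheme \<Rightarrow> int \<Rightarrow> ('o, 'm, 'o, 'm) fctr" where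
  "shift C n = (if 0 \<le> n
     then \<lparr>ob = ob (Susp C) ^^ nat n, ar = ar (Susp C) ^^ nat n\<rparr>
     else \<lparr>ob = ob (Desusp C) ^^ nat (- n), ar = ar (Desusp C) ^^ nat (- n)\<rparr>)"

locale triangulated_category = additive_category C for C :: "('o, 'm, 'z) tri_cat_scheme" (structure) +
  assumes susp_functor: "is_additive_functor C C (Susp C)"
    and susp_automorphism: "bij_betw (ob (Susp C)) (Obj C) (Obj C)" "bij_betw (ar (Susp C)) (Arr C) (Arr C)"
    and tri_diagram: "(f, g, h) \<in> Tri C \<Longrightarrow> \<exists>X Y Z. is_diagram C X Y Z f g h"
    and tri_iso: "\<lbrakk>is_triangle C X Y Z f g h; is_diagram C X' Y' Z' f' g' h';
          a \<in> Isos C X X'; b \<in> Isos C Y Y'; c \<in> Isos C Z Z';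
          b \<cdot> f = f' \<cdot> a; c \<cdot> g = g' \<cdot> b; ar (Susp C) a \<cdot> h = h' \<cdot> c\<rbrakk>
        \<Longrightarrow> is_triangle C X' Y' Z' f' g' h'"
    and tri_ident: "\<lbrakk>X \<in> Obj C; is_zero C Z\<rbrakk>
        \<Longrightarrow> is_triangle C X X Z (Ident C X) (Null C X Z) (Null C Z (ob (Susp C) X))"
    and tri_complete: "f \<in> Hom C X Y \<Longrightarrow> \<exists>Z g h. is_triangle C X Y Z f g h"
    and tri_rotate: "is_diagram C X Y Z f g h \<Longrightarrow>
          is_triangle C X Y Z f g h \<longleftrightarrow> is_triangle C Y Z (ob (Susp C) X) g h (neg C (ar (Susp C) f))"
    and tri_fill: "\<lbrakk>is_triangle C X Y Z f g h; is_triangle C X' Y' Z' f' g' h';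
          a \<in> Hom C X X'; b \<in> Hom C Y Y'; b \<cdot> f = f' \<cdot> a\<rbrakk>
        \<Longrightarrow> \<exists>c\<in>Hom C Z Z'. c \<cdot> g = g' \<cdot> b \<and> ar (Susp C) a \<cdot> h = h' \<cdot> c"
    and tri_octahedron: "\<lbrakk>is_triangle C X Y Z' f f' f''; is_triangle C Y Z X' g g' g'';
          is_triangle C X Z Y' (g \<cdot> f) h' h''\<rbrakk>
        \<Longrightarrow> \<exists>u v. is_triangle C Z' Y' X' u v (ar (Susp C) f' \<cdot> g'')
              \<and> u \<cdot> f' = h' \<cdot> g \<and> h'' \<cdot> u = f'' \<and> v \<cdot> h' = g' \<and> g'' \<cdot> v = ar (Susp C) f \<cdot> h''"

definition is_exact_functor ::
    "('o, 'm, 'y) tri_cat_scheme \<Rightarrow> ('p, 'n, 'z) tri_cat_scheme \<Rightarrow> ('o, 'm, 'p, 'n) fctr \<Rightarrow> bool" where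
  "is_exact_functor C D F \<longleftrightarrow> is_additive_functor C D F \<and>
     (\<exists>\<phi>. (\<forall>X\<in>Obj C. \<phi> X \<in> Isos D (ob F (ob (Susp C) X)) (ob (Susp D) (ob F X))) \<and>
          (\<forall>X Y. \<forall>f\<in>Hom C X Y.
             \<phi> Y \<cdot>\<^bsub>D\<^esub> ar F (ar (Susp C) f) = ar (Susp D) (ar F f) \<cdot>\<^bsub>D\<^esub> \<phi> X) \<and>
          (\<forall>X Y Z f g h. is_triangle C X Y Z f g h \<longrightarrow>
             is_triangle D (ob F X) (ob F Y) (ob F Z) (ar F f) (ar F g) (\<phi> X \<cdot>\<^bsub>D\<^esub> ar F h)))"

text \<open>\<open>A\<close> is compact if \<open>Hom(A, -)\<close> preserves small coproducts, i.e. the canonical map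
  \<open>\<Oplus>\<^bsub>i\<^esub> Hom(A, X\<^bsub>i\<^esub>) \<rightarrow> Hom(A, \<Coprod>\<^bsub>i\<^esub> X\<^bsub>i\<^esub>)\<close> is an isomorphism of abelian groups.\<close>

definition is_compact :: "'i rel \<Rightarrow> ('o, 'm, 'z) add_cat_scheme \<Rightarrow> 'o \<Rightarrow> bool" where
  "is_compact \<kappa> C A \<longleftrightarrow> A \<in> Obj C \<and>
     (\<forall>(I :: 'i set) X P \<iota>. small \<kappa> I \<and> is_coproduct C I X P \<iota> \<longrightarrow>
        (\<lambda>f. gfinprod (hom_group C A P) (\<lambda>i. \<iota> i \<cdot>\<^bsub>C\<^esub> f i) I)
          \<in> iso (sum_group I (\<lambda>i. hom_group C A (X i))) (hom_group C A P))"

definition compactly_generated :: "'i rel \<Rightarrow> ('o, 'm, 'z) tri_cat_scheme \<Rightarrow> bool" where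
  "compactly_generated \<kappa> C \<longleftrightarrow> locally_small \<kappa> C \<and> has_small_coproducts \<kappa> C \<and>
     (\<exists>\<G>. small \<kappa> \<G> \<and> (\<forall>A\<in>\<G>. is_compact \<kappa> C A) \<and>
        (\<forall>X\<in>Obj C. (\<forall>A\<in>\<G>. \<forall>n. Hom C (ob (shift C n) A) X = {Null C (ob (shift C n) A) X})
           \<longrightarrow> is_zero C X))"


section \<open>Tensor triangulated categories\<close>

record ('o, 'm) tt_cat = "('o, 'm) tri_cat" +
  Tensor :: "'o \<Rightarrow> 'o \<Rightarrow> 'o" (infixr "\<odot>\<index>" 75)
  TensorA :: "'m \<Rightarrow> 'm \<Rightarrow> 'm" (infixr "\<star>\<index>" 75)
  Unit :: "'o"
  Assoc :: "'o \<Rightarrow> 'o \<Rightarrow> 'o \<Rightarrow> 'm"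
  LUnit :: "'o \<Rightarrow> 'm"
  RUnit :: "'o \<Rightarrow> 'm"
  Braid :: "'o \<Rightarrow> 'o \<Rightarrow> 'm"
  IHom :: "'o \<Rightarrow> 'o \<Rightarrow> 'o"
  Eval :: "'o \<Rightarrow> 'o \<Rightarrow> 'm"
  TSusp :: "'o \<Rightarrow> 'o \<Rightarrow> 'm"

locale symmetric_monoidal_category = category C for C :: "('o, 'm, 'z) tt_cat_scheme" (structure) +
  assumes tensor_ob: "\<lbrakk>X \<in> Obj C; Y \<in> Obj C\<rbrakk> \<Longrightarrow> X \<odot> Y \<in> Obj C"
    and tensor_ar: "\<lbrakk>f \<in> Hom C X X'; g \<in> Hom C Y Y'\<rbrakk> \<Longrightarrow> f \<star> g \<in> Hom C (X \<odot> Y) (X' \<odot> Y')"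
    and tensor_ident: "\<lbrakk>X \<in> Obj C; Y \<in> Obj C\<rbrakk> \<Longrightarrow> Ident C X \<star> Ident C Y = Ident C (X \<odot> Y)"
    and tensor_comp: "\<lbrakk>f \<in> Hom C X X'; f' \<in> Hom C X' X''; g \<in> Hom C Y Y'; g' \<in> Hom C Y' Y''\<rbrakk>
          \<Longrightarrow> (f' \<cdot> f) \<star> (g' \<cdot> g) = (f' \<star> g') \<cdot> (f \<star> g)"
    and unit_ob: "Unit C \<in> Obj C"
    and assoc_iso: "\<lbrakk>X \<in> Obj C; Y \<in> Obj C; Z \<in> Obj C\<rbrakk>
          \<Longrightarrow> Assoc C X Y Z \<in> Isos C ((X \<odot> Y) \<odot> Z) (X \<odot> (Y \<odot> Z))"
    and assoc_natural: "\<lbrakk>f \<in> Hom C X X'; g \<in> Hom C Y Y'; h \<in> Hom C Z Z'\<rbrakk>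
          \<Longrightarrow> Assoc C X' Y' Z' \<cdot> ((f \<star> g) \<star> h) = (f \<star> (g \<star> h)) \<cdot> Assoc C X Y Z"
    and lunit_iso: "X \<in> Obj C \<Longrightarrow> LUnit C X \<in> Isos C (Unit C \<odot> X) X"
    and lunit_natural: "f \<in> Hom C X Y \<Longrightarrow> LUnit C Y \<cdot> (Ident C (Unit C) \<star> f) = f \<cdot> LUnit C X"
    and runit_iso: "X \<in> Obj C \<Longrightarrow> RUnit C X \<in> Isos C (X \<odot> Unit C) X"
    and runit_natural: "f \<in> Hom C X Y \<Longrightarrow> RUnit C Y \<cdot> (f \<star> Ident C (Unit C)) = f \<cdot> RUnit C X"
    and braid_ar: "\<lbrakk>X \<in> Obj C; Y \<in> Obj C\<rbrakk> \<Longrightarrow> Braid C X Y \<in> Hom C (X \<odot> Y) (Y \<odot> X)"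
    and braid_natural: "\<lbrakk>f \<in> Hom C X X'; g \<in> Hom C Y Y'\<rbrakk>
          \<Longrightarrow> Braid C X' Y' \<cdot> (f \<star> g) = (g \<star> f) \<cdot> Braid C X Y"
    and braid_symmetric: "\<lbrakk>X \<in> Obj C; Y \<in> Obj C\<rbrakk> \<Longrightarrow> Braid C Y X \<cdot> Braid C X Y = Ident C (X \<odot> Y)"
    and pentagon: "\<lbrakk>W \<in> Obj C; X \<in> Obj C; Y \<in> Obj C; Z \<in> Obj C\<rbrakk>
          \<Longrightarrow> (Ident C W \<star> Assoc C X Y Z) \<cdot> Assoc C W (X \<odot> Y) Z \<cdot> (Assoc C W X Y \<star> Ident C Z)
              = Assoc C W X (Y \<odot> Z) \<cdot> Assoc C (W \<odot> X) Y Z"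
    and unit_triangle: "\<lbrakk>X \<in> Obj C; Y \<in> Obj C\<rbrakk>
          \<Longrightarrow> (Ident C X \<star> LUnit C Y) \<cdot> Assoc C X (Unit C) Y = RUnit C X \<star> Ident C Y"
    and hexagon: "\<lbrakk>X \<in> Obj C; Y \<in> Obj C; Z \<in> Obj C\<rbrakk>
          \<Longrightarrow> Assoc C Y Z X \<cdot> Braid C X (Y \<odot> Z) \<cdot> Assoc C X Y Z
              = (Ident C Y \<star> Braid C X Z) \<cdot> Assoc C Y X Z \<cdot> (Braid C X Y \<star> Ident C Z)"

locale closed_symmetric_monoidal_category =
  symmetric_monoidal_category C for C :: "('o, 'm, 'z) tt_cat_scheme" (structure) +
  assumes ihom_ob: "\<lbrakk>X \<in> Obj C; Y \<in> Obj C\<rbrakk> \<Longrightarrow> IHom C X Y \<in> Obj C"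
    and eval_ar: "\<lbrakk>X \<in> Obj C; Y \<in> Obj C\<rbrakk> \<Longrightarrow> Eval C X Y \<in> Hom C (IHom C X Y \<odot> X) Y"
    and eval_universal: "\<lbrakk>A \<in> Obj C; X \<in> Obj C; Y \<in> Obj C; f \<in> Hom C (A \<odot> X) Y\<rbrakk>
          \<Longrightarrow> \<exists>!g. g \<in> Hom C A (IHom C X Y) \<and> Eval C X Y \<cdot> (g \<star> Ident C X) = f"

definition curry_arr :: "('o, 'm, 'z) tt_cat_scheme \<Rightarrow> 'o \<Rightarrow> 'o \<Rightarrow> 'o \<Rightarrow> 'm \<Rightarrow> 'm" where
  "curry_arr C A X Y f =
     (THE g. g \<in> Hom C A (IHom C X Y) \<and> Eval C X Y \<cdot>\<^bsub>C\<^esub> (g \<star>\<^bsub>C\<^esub> Ident C X) = f)"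

definition ihom_cov :: "('o, 'm, 'z) tt_cat_scheme \<Rightarrow> 'o \<Rightarrow> 'm \<Rightarrow> 'm" where
  "ihom_cov C W f =
     curry_arr C (IHom C W (Dom C f)) W (Cod C f) (f \<cdot>\<^bsub>C\<^esub> Eval C W (Dom C f))"

definition ihom_contra :: "('o, 'm, 'z) tt_cat_scheme \<Rightarrow> 'm \<Rightarrow> 'o \<Rightarrow> 'm" where
  "ihom_contra C f W =
     curry_arr C (IHom C (Cod C f) W) (Dom C f) W
       (Eval C (Cod C f) W \<cdot>\<^bsub>C\<^esub> (Ident C (IHom C (Cod C f) W) \<star>\<^bsub>C\<^esub> f))"

text \<open>
  The natural isomorphism \<open>F(W, X)[1] \<rightarrow> F(W, X[1])\<close> of internal homs, adjoint to
  \<open>F(W, X)[1] \<otimes> W \<cong> (F(W, X) \<otimes> W)[1] \<rightarrow> X[1]\<close>.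
\<close>

definition ihom_susp_cov :: "('o, 'm, 'z) tt_cat_scheme \<Rightarrow> 'o \<Rightarrow> 'o \<Rightarrow> 'm" where
  "ihom_susp_cov C W X =
     curry_arr C (ob (Susp C) (IHom C W X)) W (ob (Susp C) X)
       (ar (Susp C) (Eval C W X) \<cdot>\<^bsub>C\<^esub> TSusp C (IHom C W X) W)"

text \<open>The natural isomorphism \<open>A[1] \<otimes> X \<cong> (A \<otimes> X)[1] \<cong> (X \<otimes> A)[1] \<cong> X[1] \<otimes> A \<cong> A \<otimes> X[1]\<close>.\<close>

definition susp_swap :: "('o, 'm, 'z) tt_cat_scheme \<Rightarrow> 'o \<Rightarrow> 'o \<Rightarrow> 'm" where
  "susp_swap C A X =
     Braid C (ob (Susp C) X) A \<cdot>\<^bsub>C\<^esub> inv_arr C (TSusp C X A)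
       \<cdot>\<^bsub>C\<^esub> ar (Susp C) (Braid C A X) \<cdot>\<^bsub>C\<^esub> TSusp C A X"

text \<open>
  The natural isomorphism \<open>F(X[1], W)[1] \<rightarrow> F(X, W)\<close>, adjoint to
  \<open>F(X[1], W)[1] \<otimes> X \<cong> F(X[1], W) \<otimes> X[1] \<rightarrow> W\<close>. Its desuspension is
  \<open>F(X[1], W) \<cong> F(X, W)[-1]\<close>.
\<close>

definition ihom_susp_contra :: "('o, 'm, 'z) tt_cat_scheme \<Rightarrow> 'o \<Rightarrow> 'o \<Rightarrow> 'm" where
  "ihom_susp_contra C X W =
     curry_arr C (ob (Susp C) (IHom C (ob (Susp C) X) W)) X W
       (Eval C (ob (Susp C) X) W \<cdot>\<^bsub>C\<^esub> susp_swap C (IHom C (ob (Susp C) X) W) X)"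

text \<open>The isomorphism \<open>X[n] \<otimes> Y \<rightarrow> (X \<otimes> Y)[n]\<close> obtained by iterating
  \<open>TSusp C X Y : X[1] \<otimes> Y \<rightarrow> (X \<otimes> Y)[1]\<close> or, for negative \<open>n\<close>, its inverse.\<close>

primrec tensor_shift_pos :: "('o, 'm, 'z) tt_cat_scheme \<Rightarrow> nat \<Rightarrow> 'o \<Rightarrow> 'o \<Rightarrow> 'm" where
  "tensor_shift_pos C 0 X Y = Ident C (X \<odot>\<^bsub>C\<^esub> Y)"
| "tensor_shift_pos C (Suc k) X Y =
     ar (Susp C) (tensor_shift_pos C k X Y) \<cdot>\<^bsub>C\<^esub> TSusp C ((ob (Susp C) ^^ k) X) Y"

primrec tensor_shift_neg :: "('o, 'm, 'z) tt_cat_scheme \<Rightarrow> nat \<Rightarrow> 'o \<Rightarrow> 'o \<Rightarrow> 'm" where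
  "tensor_shift_neg C 0 X Y = Ident C (X \<odot>\<^bsub>C\<^esub> Y)"
| "tensor_shift_neg C (Suc k) X Y =
     ar (Desusp C) (tensor_shift_neg C k X Y) \<cdot>\<^bsub>C\<^esub>
       inv_arr C (ar (Desusp C) (TSusp C (ob (Desusp C) ((ob (Desusp C) ^^ k) X)) Y))"

definition tensor_shift :: "('o, 'm, 'z) tt_cat_scheme \<Rightarrow> int \<Rightarrow> 'o \<Rightarrow> 'o \<Rightarrow> 'm" where
  "tensor_shift C n X Y =
     (if 0 \<le> n then tensor_shift_pos C (nat n) X Y else tensor_shift_neg C (nat (- n)) X Y)"

abbreviation sphere :: "('o, 'm, 'z) tt_cat_scheme \<Rightarrow> int \<Rightarrow> 'o" where
  "sphere C r \<equiv> ob (shift C r) (Unit C)"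

text \<open>The isomorphism \<open>1[r] \<otimes> 1[s] \<rightarrow> 1[r + s]\<close>.\<close>

definition sphere_mult :: "('o, 'm, 'z) tt_cat_scheme \<Rightarrow> int \<Rightarrow> int \<Rightarrow> 'm" where
  "sphere_mult C r s =
     ar (shift C r) (LUnit C (sphere C s)) \<cdot>\<^bsub>C\<^esub> tensor_shift C r (Unit C) (sphere C s)"

text \<open>
  The compatibility conditions of Hovey, Palmieri and Strickland (Axiomatic stable homotopy theory, Appendix A.2). The sign in
  \<open>ihom_exact_contra\<close> is relative to the identification \<open>F(X[1], W) \<cong> F(X, W)[-1]\<close> fixed above.
\<close>

locale tensor_triangulated_category =
  triangulated_category C + closed_symmetric_monoidal_category C
  for C :: "('o, 'm, 'z) tt_cat_scheme" (structure) +
  assumes tsusp_iso: "\<lbrakk>X \<in> Obj C; Y \<in> Obj C\<rbrakk>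
          \<Longrightarrow> TSusp C X Y \<in> Isos C (ob (Susp C) X \<odot> Y) (ob (Susp C) (X \<odot> Y))"
    and tsusp_natural: "\<lbrakk>f \<in> Hom C X X'; g \<in> Hom C Y Y'\<rbrakk>
          \<Longrightarrow> TSusp C X' Y' \<cdot> (ar (Susp C) f \<star> g) = ar (Susp C) (f \<star> g) \<cdot> TSusp C X Y"
    and tsusp_runit: "X \<in> Obj C
          \<Longrightarrow> ar (Susp C) (RUnit C X) \<cdot> TSusp C X (Unit C) = RUnit C (ob (Susp C) X)"
    and tsusp_assoc: "\<lbrakk>X \<in> Obj C; Y \<in> Obj C; Z \<in> Obj C\<rbrakk>
          \<Longrightarrow> TSusp C X (Y \<odot> Z) \<cdot> Assoc C (ob (Susp C) X) Y Z
              = ar (Susp C) (Assoc C X Y Z) \<cdot> TSusp C (X \<odot> Y) Z \<cdot> (TSusp C X Y \<star> Ident C Z)"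
    and tensor_exact: "\<lbrakk>is_triangle C X Y Z f g h; W \<in> Obj C\<rbrakk>
          \<Longrightarrow> is_triangle C (X \<odot> W) (Y \<odot> W) (Z \<odot> W)
                (f \<star> Ident C W) (g \<star> Ident C W) (TSusp C X W \<cdot> (h \<star> Ident C W))"
    and ihom_exact_cov: "\<lbrakk>is_triangle C X Y Z f g h; W \<in> Obj C\<rbrakk>
          \<Longrightarrow> is_triangle C (IHom C W X) (IHom C W Y) (IHom C W Z)
                (ihom_cov C W f) (ihom_cov C W g) (inv_arr C (ihom_susp_cov C W X) \<cdot> ihom_cov C W h)"
    and ihom_exact_contra: "\<lbrakk>is_triangle C X Y Z f g h; W \<in> Obj C\<rbrakk>
          \<Longrightarrow> is_triangle C (ob (Desusp C) (IHom C X W)) (IHom C Z W) (IHom C Y W)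
                (neg C (ihom_contra C h W \<cdot> inv_arr C (ar (Desusp C) (ihom_susp_contra C X W))))
                (ihom_contra C g W) (ihom_contra C f W)"
    and sphere_graded_commutative:
          "sphere_mult C s r \<cdot> Braid C (sphere C r) (sphere C s)
             = (if even (r * s) then sphere_mult C r s else neg C (sphere_mult C r s))"

text \<open>\<open>X\<close> is rigid (strongly dualizable) if the canonical map \<open>F(X, 1) \<otimes> Y \<rightarrow> F(X, Y)\<close>, adjoint to
  \<open>(F(X, 1) \<otimes> Y) \<otimes> X \<cong> (F(X, 1) \<otimes> X) \<otimes> Y \<rightarrow> 1 \<otimes> Y \<cong> Y\<close>, is an isomorphism for all \<open>Y\<close>.\<close>

definition dual_map :: "('o, 'm, 'z) tt_cat_scheme \<Rightarrow> 'o \<Rightarrow> 'o \<Rightarrow> 'm" where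
  "dual_map C X Y =
     (let D = IHom C X (Unit C) in
      curry_arr C (D \<odot>\<^bsub>C\<^esub> Y) X Y
        (LUnit C Y \<cdot>\<^bsub>C\<^esub> (Eval C X (Unit C) \<star>\<^bsub>C\<^esub> Ident C Y) \<cdot>\<^bsub>C\<^esub> inv_arr C (Assoc C D X Y)
           \<cdot>\<^bsub>C\<^esub> (Ident C D \<star>\<^bsub>C\<^esub> Braid C Y X) \<cdot>\<^bsub>C\<^esub> Assoc C D Y X))"

definition is_rigid :: "('o, 'm, 'z) tt_cat_scheme \<Rightarrow> 'o \<Rightarrow> bool" where
  "is_rigid C X \<longleftrightarrow> X \<in> Obj C \<and> (\<forall>Y\<in>Obj C. is_iso C (dual_map C X Y))"

definition rigidly_compactly_generated :: "'i rel \<Rightarrow> ('o, 'm, 'z) tt_cat_scheme \<Rightarrow> bool" where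
  "rigidly_compactly_generated \<kappa> C \<longleftrightarrow> tensor_triangulated_category C \<and> compactly_generated \<kappa> C \<and>
     (\<forall>X\<in>Obj C. is_compact \<kappa> C X \<longleftrightarrow> is_rigid C X)"

definition is_strong_symmetric_monoidal ::
    "('o, 'm, 'y) tt_cat_scheme \<Rightarrow> ('p, 'n, 'z) tt_cat_scheme \<Rightarrow> ('o, 'm, 'p, 'n) fctr \<Rightarrow> bool" where
  "is_strong_symmetric_monoidal C D F \<longleftrightarrow> is_functor C D F \<and>
     (\<exists>\<mu> \<eta>. \<eta> \<in> Isos D (Unit D) (ob F (Unit C)) \<and>
       (\<forall>X\<in>Obj C. \<forall>Y\<in>Obj C. \<mu> X Y \<in> Isos D (ob F X \<odot>\<^bsub>D\<^esub> ob F Y) (ob F (X \<odot>\<^bsub>C\<^esub> Y))) \<and>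
       (\<forall>X X' Y Y'. \<forall>f\<in>Hom C X X'. \<forall>g\<in>Hom C Y Y'.
          \<mu> X' Y' \<cdot>\<^bsub>D\<^esub> (ar F f \<star>\<^bsub>D\<^esub> ar F g) = ar F (f \<star>\<^bsub>C\<^esub> g) \<cdot>\<^bsub>D\<^esub> \<mu> X Y) \<and>
       (\<forall>X\<in>Obj C. \<forall>Y\<in>Obj C. \<forall>Z\<in>Obj C.
          ar F (Assoc C X Y Z) \<cdot>\<^bsub>D\<^esub> \<mu> (X \<odot>\<^bsub>C\<^esub> Y) Z \<cdot>\<^bsub>D\<^esub> (\<mu> X Y \<star>\<^bsub>D\<^esub> Ident D (ob F Z))
            = \<mu> X (Y \<odot>\<^bsub>C\<^esub> Z) \<cdot>\<^bsub>D\<^esub> (Ident D (ob F X) \<star>\<^bsub>D\<^esub> \<mu> Y Z)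
                \<cdot>\<^bsub>D\<^esub> Assoc D (ob F X) (ob F Y) (ob F Z)) \<and>
       (\<forall>X\<in>Obj C.
          ar F (LUnit C X) \<cdot>\<^bsub>D\<^esub> \<mu> (Unit C) X \<cdot>\<^bsub>D\<^esub> (\<eta> \<star>\<^bsub>D\<^esub> Ident D (ob F X)) = LUnit D (ob F X) \<and>
          ar F (RUnit C X) \<cdot>\<^bsub>D\<^esub> \<mu> X (Unit C) \<cdot>\<^bsub>D\<^esub> (Ident D (ob F X) \<star>\<^bsub>D\<^esub> \<eta>) = RUnit D (ob F X)) \<and>
       (\<forall>X\<in>Obj C. \<forall>Y\<in>Obj C.
          ar F (Braid C X Y) \<cdot>\<^bsub>D\<^esub> \<mu> X Y = \<mu> Y X \<cdot>\<^bsub>D\<^esub> Braid D (ob F X) (ob F Y)))"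

definition is_tensor_exact ::
    "('o, 'm, 'y) tt_cat_scheme \<Rightarrow> ('p, 'n, 'z) tt_cat_scheme \<Rightarrow> ('o, 'm, 'p, 'n) fctr \<Rightarrow> bool" where
  "is_tensor_exact C D F \<longleftrightarrow> is_exact_functor C D F \<and> is_strong_symmetric_monoidal C D F"


section \<open>Strong generation\<close>

fun gen_level :: "'i rel \<Rightarrow> ('o, 'm, 'z) tri_cat_scheme \<Rightarrow> 'o \<Rightarrow> nat \<Rightarrow> 'o set" where
  "gen_level \<kappa> C G 0 = {X. is_zero C X}"
| "gen_level \<kappa> C G (Suc 0) =
     {X. \<exists>(I :: 'i set) n P \<iota>. small \<kappa> I \<and> is_coproduct C I (\<lambda>i. ob (shift C (n i)) G) P \<iota> \<and> retract C X P}"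
| "gen_level \<kappa> C G (Suc (Suc k)) =
     {X. \<exists>A B E f g h. A \<in> gen_level \<kappa> C G (Suc k) \<and> B \<in> gen_level \<kappa> C G (Suc 0) \<and>
           is_triangle C A E B f g h \<and> retract C X E}"

definition strong_generator :: "'i rel \<Rightarrow> ('o, 'm, 'z) tri_cat_scheme \<Rightarrow> 'o \<Rightarrow> bool" where
  "strong_generator \<kappa> C G \<longleftrightarrow> G \<in> Obj C \<and> (\<exists>n. gen_level \<kappa> C G n = Obj C)"

end

theory Submission
  imports Defs
begin

text \<open>
  Write \<open>F = \<pi>\<^sup>*\<close>, \<open>R = \<pi>\<^sub>*\<close> and \<open>H = R G\<close>. If \<open>1 \<in> \<langle>H\<rangle>\<^sub>n\<close>, tensoring with \<open>X\<close> gives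
  \<open>X \<in> \<langle>X \<otimes> H\<rangle>\<^sub>n\<close>, and \<open>X \<otimes> H = R (F X \<otimes> G)\<close> by the projection formula. Since \<open>R\<close> is exact and
  preserves coproducts, \<open>R P \<in> \<langle>H\<rangle>\<^sub>l\<close> for every \<open>P\<close> in \<open>T = \<langle>G\<rangle>\<^sub>l\<close>; so coproducts of shifts of
  \<open>X \<otimes> H\<close> lie in \<open>\<langle>H\<rangle>\<^sub>l\<close>, and the octahedral axiom adds up the \<open>n\<close> extensions to \<open>\<langle>H\<rangle>\<^bsub>ln\<^esub>\<close>.

  The functor \<open>R\<close> preserves coproducts because \<open>F\<close> preserves dualizable, hence compact, objects.
  The projection formula is checked on \<open>Hom(A, -)\<close> for compact \<open>A\<close>: there it compares two
  coproduct-preserving homological functors of \<open>X\<close>, which agree for dualizable \<open>X\<close> by adjunction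
  and therefore for all \<open>X\<close>. The last step kills all maps from the compact generators to \<open>X\<close>, iterates
  this to a tower with vanishing colimit, and descends along the tower with the four lemma.
\<close>

section \<open>Small sets\<close>

text \<open>Exactness of \<open>R\<close> is not a formal consequence of the bijection on Hom sets:
  the triangle on \<open>R f\<close> has to be compared with the image of a given triangle, while
  \<open>F\<close> commutes with suspension only up to isomorphism. A four lemma chase on Hom sets
  settles this. The usual way from compact to arbitrary objects shows that the good objects are
  closed under triangles and coproducts and then that such a class is everything. The second half
  needs a tower anyway, so the tower is used directly on the elements to be compared. Compactness
  enters in one elementary form: a map from a compact object into a coproduct is a finite sum of
  maps through the injections. Isomorphisms are recognised on Hom sets, either by Yoneda or, in a
  compactly generated category, on compact sources only. Coproducts in the definitions are indexed
  by subsets of the type of \<kappa>, whereas the constructions index by natural numbers or by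
  arrows. This is why small sets are repeatedly moved along injections.\<close>

lemma small_image: "small \<kappa> A \<Longrightarrow> small \<kappa> (g ` A)"
  unfolding small_def by (rule ordLeq_ordLess_trans[OF card_of_image])

lemma uncountable_regularD:
  assumes "uncountable_regular \<kappa>"
  shows "Cinfinite \<kappa>" "regularCard \<kappa>" "natLeq <o \<kappa>"
proof -
  have "Card_order \<kappa>" "natLeq \<le>o \<kappa>" "natLeq <o \<kappa>" "regularCard \<kappa>"
    using assms by (auto simp: uncountable_regular_def ordLess_imp_ordLeq)
  moreover from this have "Cinfinite \<kappa>"
    using cinfinite_mono[OF _ natLeq_cinfinite] by simp
  ultimately show "Cinfinite \<kappa>" "regularCard \<kappa>" "natLeq <o \<kappa>"
    by simp_all
qed

text \<open>Here regularity of \<kappa> enters: a union of fewer than \<kappa> sets, each smaller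
  than \<kappa>, is smaller than \<kappa>. It bounds the family of all maps from shifts of
  generators into a fixed object.\<close>

lemma small_Sigma:
  assumes "uncountable_regular \<kappa>" "small \<kappa> I" "\<And>i. i \<in> I \<Longrightarrow> small \<kappa> (J i)"
  shows "small \<kappa> (Sigma I J)"
proof -
  have "small \<kappa> ((\<lambda>j. (i, j)) ` J i)" if "i \<in> I" for i
    using small_image assms(3)[OF that] .
  then have "|\<Union>i\<in>I. (\<lambda>j. (i, j)) ` J i| <o \<kappa>"
    using assms(2) uncountable_regularD[OF assms(1)]
    by (intro card_of_UNION_ordLess_infinite_Field_regularCard) (auto simp: small_def)
  moreover have "(\<Union>i\<in>I. (\<lambda>j. (i, j)) ` J i) = Sigma I J"
    by auto
  ultimately show ?thesis
    by (simp add: small_def)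
qed

text \<open>Uncountability of \<kappa> makes the stages of a tower, indexed by \<open>nat\<close>,
  and the shifts, indexed by \<open>int\<close>, small families.\<close>

lemma small_countable:
  assumes "uncountable_regular \<kappa>" "countable A"
  shows "small \<kappa> A"
proof -
  have "|A| \<le>o natLeq"
    using assms(2) card_of_ordLeqI[of _ A UNIV] ordLeq_ordIso_trans[OF _ card_of_nat]
    unfolding countable_def by blast
  then show ?thesis
    unfolding small_def by (rule ordLeq_ordLess_trans[OF _ uncountable_regularD(3)[OF assms(1)]])
qed

text \<open>The definitions quantify over index sets of type \<open>'i set\<close>, while the proof
  also indexes by natural numbers and by arrows. Being smaller than \<kappa>, the set
  \<open>J\<close> injects into \<open>Field \<kappa>\<close>.\<close>

lemma small_embedding:
  fixes \<kappa> :: "'i rel" and J :: "'b set"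
  assumes "uncountable_regular \<kappa>" "small \<kappa> J"
  obtains g :: "'b \<Rightarrow> 'i" where "inj_on g J" "small \<kappa> (g ` J)"
proof -
  have "Card_order \<kappa>"
    using assms(1) by (simp add: uncountable_regular_def)
  then have "|J| \<le>o |Field \<kappa>|"
    using assms(2) unfolding small_def
    by (meson card_of_Field_ordIso ordIso_symmetric ordLess_imp_ordLeq ordLess_ordIso_trans)
  then obtain g :: "'b \<Rightarrow> 'i" where "inj_on g J"
    using card_of_ordLeq[of J "Field \<kappa>"] by blast
  then show ?thesis
    using that small_image[OF assms(2)] by blast
qed


section \<open>Categories\<close>

lemma in_hom: "f \<in> Hom C X Y \<longleftrightarrow> f \<in> Arr C \<and> Dom C f = X \<and> Cod C f = Y"
  by (auto simp: Hom_def)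

context category
begin

lemma arr_obj [simp]: "f \<in> Arr C \<Longrightarrow> Dom C f \<in> Obj C" "f \<in> Arr C \<Longrightarrow> Cod C f \<in> Obj C"
  using dom_cod by auto

lemma hom_obj: "f \<in> Hom C X Y \<Longrightarrow> X \<in> Obj C \<and> Y \<in> Obj C"
  by (auto simp: in_hom)

lemma arr_comp [simp]:
  assumes "f \<in> Arr C" "g \<in> Arr C" "Cod C f = Dom C g"
  shows "g \<cdot> f \<in> Arr C" "Dom C (g \<cdot> f) = Dom C f" "Cod C (g \<cdot> f) = Cod C g"
  using comp[of f "Dom C f" "Cod C f" g "Cod C g"] assms by (auto simp: in_hom)

lemma arr_ident [simp]:
  assumes "X \<in> Obj C"
  shows "Ident C X \<in> Arr C" "Dom C (Ident C X) = X" "Cod C (Ident C X) = X"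
  using ident[OF assms] by (auto simp: in_hom)

lemma assoc_arr [simp]:
  "\<lbrakk>f \<in> Arr C; g \<in> Arr C; h \<in> Arr C; Cod C f = Dom C g; Cod C g = Dom C h\<rbrakk>
    \<Longrightarrow> (h \<cdot> g) \<cdot> f = h \<cdot> (g \<cdot> f)"
  by (rule comp_assoc) (auto simp: in_hom)

lemma ident_arr [simp]:
  "\<lbrakk>f \<in> Arr C; Cod C f = Y\<rbrakk> \<Longrightarrow> Ident C Y \<cdot> f = f"
  "\<lbrakk>f \<in> Arr C; Dom C f = X\<rbrakk> \<Longrightarrow> f \<cdot> Ident C X = f"
  using comp_ident_left comp_ident_right by (auto simp: in_hom)

text \<open>Simplification nests composites to the right, so in
  \<open>a \<cdot> (b \<cdot> x)\<close> the product \<open>a \<cdot> b\<close> is no longer a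
  subterm. This rule applies an equation for \<open>a \<cdot> b\<close> inside a longer
  composite.\<close>

lemma comp_reassoc:
  "\<lbrakk>a \<cdot> b = c; a \<in> Arr C; b \<in> Arr C; x \<in> Arr C; Cod C b = Dom C a; Cod C x = Dom C b\<rbrakk>
    \<Longrightarrow> a \<cdot> (b \<cdot> x) = c \<cdot> x"
  by (metis assoc_arr)

lemma Isos_iff:
  "f \<in> Isos C X Y \<longleftrightarrow> f \<in> Hom C X Y \<and> (\<exists>g\<in>Hom C Y X. g \<cdot> f = Ident C X \<and> f \<cdot> g = Ident C Y)"
  by (auto simp: Isos_def is_iso_def inverse_arrows_def in_hom)

lemma IsosI:
  "\<lbrakk>f \<in> Hom C X Y; g \<in> Hom C Y X; g \<cdot> f = Ident C X; f \<cdot> g = Ident C Y\<rbrakk> \<Longrightarrow> f \<in> Isos C X Y"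
  by (auto simp: Isos_iff)

lemma IsosE:
  assumes "f \<in> Isos C X Y"
  obtains g where "f \<in> Hom C X Y" "g \<in> Isos C Y X" "g \<in> Hom C Y X"
    "g \<cdot> f = Ident C X" "f \<cdot> g = Ident C Y"
  using assms unfolding Isos_iff by blast

lemma Isos_hom: "f \<in> Isos C X Y \<Longrightarrow> f \<in> Hom C X Y"
  by (simp add: Isos_iff)

lemma inv_arr_eq:
  assumes "f \<in> Hom C X Y" "g \<in> Hom C Y X" "g \<cdot> f = Ident C X" "f \<cdot> g = Ident C Y"
  shows "inv_arr C f = g"
  unfolding inv_arr_def
proof (rule the_equality)
  show "inverse_arrows C f g"
    using assms by (auto simp: inverse_arrows_def in_hom)
  fix g' assume "inverse_arrows C f g'"
  then have g': "g' \<in> Hom C Y X" "g' \<cdot> f = Ident C X"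
    using assms(1) by (auto simp: inverse_arrows_def in_hom)
  have "g' = g' \<cdot> (f \<cdot> g)"
    using assms g' by (simp add: in_hom)
  also have "\<dots> = (g' \<cdot> f) \<cdot> g"
    using assms(1,2) g'(1) by (simp add: in_hom)
  also have "\<dots> = g"
    using assms g' by (simp add: in_hom)
  finally show "g' = g" .
qed

lemma inv_arr:
  assumes "f \<in> Isos C X Y"
  shows "inv_arr C f \<in> Isos C Y X" "inv_arr C f \<in> Hom C Y X"
    "inv_arr C f \<cdot> f = Ident C X" "f \<cdot> inv_arr C f = Ident C Y"
proof -
  obtain g where g: "f \<in> Hom C X Y" "g \<in> Isos C Y X" "g \<in> Hom C Y X"
    "g \<cdot> f = Ident C X" "f \<cdot> g = Ident C Y"
    using assms by (rule IsosE)
  then have "inv_arr C f = g"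
    by (intro inv_arr_eq)
  with g show "inv_arr C f \<in> Isos C Y X" "inv_arr C f \<in> Hom C Y X"
    "inv_arr C f \<cdot> f = Ident C X" "f \<cdot> inv_arr C f = Ident C Y"
    by auto
qed

lemma Isos_ident: "X \<in> Obj C \<Longrightarrow> Ident C X \<in> Isos C X X"
  by (rule IsosI[where g = "Ident C X"]) (auto simp: in_hom)

lemma Isos_comp:
  assumes "f \<in> Isos C X Y" "g \<in> Isos C Y Z"
  shows "g \<cdot> f \<in> Isos C X Z"
proof -
  obtain f' where f: "f \<in> Hom C X Y" "f' \<in> Hom C Y X" "f' \<cdot> f = Ident C X" "f \<cdot> f' = Ident C Y"
    using assms(1) by (rule IsosE)
  obtain g' where g: "g \<in> Hom C Y Z" "g' \<in> Hom C Z Y" "g' \<cdot> g = Ident C Y" "g \<cdot> g' = Ident C Z"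
    using assms(2) by (rule IsosE)
  have "g' \<cdot> (g \<cdot> f) = f"
    using comp_reassoc[OF g(3)] f(1) g(1,2) by (simp add: in_hom)
  moreover have "f \<cdot> (f' \<cdot> g') = g'"
    using comp_reassoc[OF f(4)] g(2) f(1,2) by (simp add: in_hom)
  ultimately show ?thesis
    using f g by (intro IsosI[where g = "f' \<cdot> g'"]) (auto simp: in_hom)
qed

lemma iso_cancel_left:
  assumes "f \<in> Isos C Y Z" "g \<in> Hom C X Y" "h \<in> Hom C X Y" "f \<cdot> g = f \<cdot> h"
  shows "g = h"
proof -
  obtain f' where f: "f \<in> Hom C Y Z" "f' \<in> Hom C Z Y" "f' \<cdot> f = Ident C Y"
    using assms(1) by (rule IsosE)
  have "f' \<cdot> (f \<cdot> g) = g" "f' \<cdot> (f \<cdot> h) = h"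
    using comp_reassoc[OF f(3)] assms(2,3) f(1,2) by (simp_all add: in_hom)
  then show ?thesis
    using assms(4) by metis
qed

lemma iso_cancel_right:
  assumes "f \<in> Isos C X Y" "g \<in> Hom C Y Z" "h \<in> Hom C Y Z" "g \<cdot> f = h \<cdot> f"
  shows "g = h"
proof -
  obtain f' where f: "f \<in> Hom C X Y" "f' \<in> Hom C Y X" "f \<cdot> f' = Ident C Y"
    using assms(1) by (rule IsosE)
  have "g \<cdot> (f \<cdot> f') = h \<cdot> (f \<cdot> f')"
    using comp_assoc[OF f(2,1) assms(2)] comp_assoc[OF f(2,1) assms(3)] assms(4) by simp
  then show ?thesis
    using f(3) assms(2,3) by (simp add: in_hom)
qed

text \<open>Yoneda: a preimage \<open>g\<close> of \<open>Ident C Y\<close> is a right inverse, and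
  injectivity on \<open>Hom C X X\<close> turns \<open>f \<cdot> (g \<cdot> f) = f\<close> into
  \<open>g \<cdot> f = Ident C X\<close>.\<close>

lemma Isos_by_hom:
  assumes "f \<in> Hom C X Y" "\<And>W. W \<in> Obj C \<Longrightarrow> bij_betw ((\<cdot>) f) (Hom C W X) (Hom C W Y)"
  shows "f \<in> Isos C X Y"
proof -
  have obj: "X \<in> Obj C" "Y \<in> Obj C"
    using assms(1) hom_obj by auto
  have "Ident C Y \<in> (\<cdot>) f ` Hom C Y X"
    using assms(2)[OF obj(2)] ident[OF obj(2)] by (simp add: bij_betw_def)
  then obtain g where g: "g \<in> Hom C Y X" "f \<cdot> g = Ident C Y"
    by auto
  have "f \<cdot> (g \<cdot> f) = f \<cdot> Ident C X"
    using comp_reassoc[OF g(2)] assms(1) g(1) obj by (simp add: in_hom)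
  moreover have "inj_on ((\<cdot>) f) (Hom C X X)"
    using assms(2)[OF obj(1)] by (simp add: bij_betw_def)
  ultimately have "g \<cdot> f = Ident C X"
    using comp[OF assms(1) g(1)] ident[OF obj(1)] by (simp add: inj_on_def)
  then show ?thesis
    using IsosI assms(1) g by blast
qed

section \<open>Retracts\<close>

lemma retract_iso:
  assumes "retract C X E" "e \<in> Isos C E E'"
  shows "retract C X E'"
proof -
  obtain i p where ip: "X \<in> Obj C" "i \<in> Hom C X E" "p \<in> Hom C E X" "p \<cdot> i = Ident C X"
    using assms(1) by (auto simp: retract_def)
  obtain e' where e: "e \<in> Hom C E E'" "e' \<in> Hom C E' E" "e' \<cdot> e = Ident C E"
    using assms(2) by (rule IsosE)
  have "(p \<cdot> e') \<cdot> (e \<cdot> i) = Ident C X"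
    using comp_reassoc[OF e(3), of i] e ip by (simp add: in_hom)
  moreover have "e \<cdot> i \<in> Hom C X E'" "p \<cdot> e' \<in> Hom C E' X"
    using ip e by (auto simp: in_hom)
  ultimately show ?thesis
    using ip(1) by (auto simp: retract_def)
qed

lemma retract_trans:
  assumes "retract C X Y" "retract C Y Z"
  shows "retract C X Z"
proof -
  obtain i p where ip: "X \<in> Obj C" "i \<in> Hom C X Y" "p \<in> Hom C Y X" "p \<cdot> i = Ident C X"
    using assms(1) by (auto simp: retract_def)
  obtain j q where jq: "j \<in> Hom C Y Z" "q \<in> Hom C Z Y" "q \<cdot> j = Ident C Y"
    using assms(2) by (auto simp: retract_def)
  have "(p \<cdot> q) \<cdot> (j \<cdot> i) = Ident C X"
    using comp_reassoc[OF jq(3), of i] ip jq by (simp add: in_hom)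
  moreover have "j \<cdot> i \<in> Hom C X Z" "p \<cdot> q \<in> Hom C Z X"
    using ip jq by (auto simp: in_hom)
  ultimately show ?thesis
    using ip(1) by (auto simp: retract_def)
qed

lemma iso_retract: "e \<in> Isos C X Y \<Longrightarrow> retract C X Y"
  using hom_obj by (metis IsosE retract_def)

lemma retract_refl: "X \<in> Obj C \<Longrightarrow> retract C X X"
  using Isos_ident iso_retract by blast

section \<open>Coproducts and their universal property\<close>

lemma coprod_obj: "is_coproduct C I X P \<iota> \<Longrightarrow> P \<in> Obj C"
  and coprod_inj: "\<lbrakk>is_coproduct C I X P \<iota>; i \<in> I\<rbrakk> \<Longrightarrow> \<iota> i \<in> Hom C (X i) P"
  by (auto simp: is_coproduct_def)

lemma coprod_desc:
  assumes "is_coproduct C I X P \<iota>" "Y \<in> Obj C" "\<And>i. i \<in> I \<Longrightarrow> f i \<in> Hom C (X i) Y"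
  obtains h where "h \<in> Hom C P Y" "\<And>i. i \<in> I \<Longrightarrow> h \<cdot> \<iota> i = f i"
  using assms unfolding is_coproduct_def by blast

lemma coprod_ex:
  assumes "is_coproduct C I X P \<iota>" "Y \<in> Obj C" "\<And>i. i \<in> I \<Longrightarrow> f i \<in> Hom C (X i) Y"
  shows "\<exists>h\<in>Hom C P Y. \<forall>i\<in>I. h \<cdot> \<iota> i = f i"
proof -
  have "\<forall>i\<in>I. f i \<in> Hom C (X i) Y"
    using assms(3) by simp
  then show ?thesis
    using assms(1,2) unfolding is_coproduct_def by blast
qed

lemma coprod_unique:
  assumes "is_coproduct C I X P \<iota>" "g \<in> Hom C P Y" "h \<in> Hom C P Y"
    "\<And>i. i \<in> I \<Longrightarrow> g \<cdot> \<iota> i = h \<cdot> \<iota> i"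
  shows "g = h"
proof -
  have Y: "Y \<in> Obj C"
    using hom_obj[OF assms(2)] by simp
  have "\<forall>i\<in>I. h \<cdot> \<iota> i \<in> Hom C (X i) Y"
    using comp[OF coprod_inj[OF assms(1)] assms(3)] by blast
  moreover have "\<forall>Y\<in>Obj C. \<forall>f. (\<forall>i\<in>I. f i \<in> Hom C (X i) Y) \<longrightarrow>
      (\<exists>!k. k \<in> Hom C P Y \<and> (\<forall>i\<in>I. k \<cdot> \<iota> i = f i))"
    using assms(1) unfolding is_coproduct_def by (elim conjE)
  ultimately have "\<exists>!k. k \<in> Hom C P Y \<and> (\<forall>i\<in>I. k \<cdot> \<iota> i = h \<cdot> \<iota> i)"
    using Y by simp
  then obtain k where k: "\<And>k'. \<lbrakk>k' \<in> Hom C P Y; \<forall>i\<in>I. k' \<cdot> \<iota> i = h \<cdot> \<iota> i\<rbrakk> \<Longrightarrow> k' = k"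
    by (elim ex1E) metis
  show ?thesis
    using k[OF assms(2)] k[OF assms(3)] assms(4) by simp
qed

lemma coproductI:
  assumes "P \<in> Obj C" "\<And>i. i \<in> I \<Longrightarrow> \<iota> i \<in> Hom C (X i) P"
    and "\<And>Y f. \<lbrakk>Y \<in> Obj C; \<And>i. i \<in> I \<Longrightarrow> f i \<in> Hom C (X i) Y\<rbrakk>
      \<Longrightarrow> \<exists>h\<in>Hom C P Y. \<forall>i\<in>I. h \<cdot> \<iota> i = f i"
    and "\<And>Y g h. \<lbrakk>g \<in> Hom C P Y; h \<in> Hom C P Y; \<And>i. i \<in> I \<Longrightarrow> g \<cdot> \<iota> i = h \<cdot> \<iota> i\<rbrakk> \<Longrightarrow> g = h"
  shows "is_coproduct C I X P \<iota>"
  unfolding is_coproduct_def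
proof (intro conjI ballI allI impI)
  fix Y f assume Y: "Y \<in> Obj C" "\<forall>i\<in>I. f i \<in> Hom C (X i) Y"
  then obtain h where "h \<in> Hom C P Y" "\<forall>i\<in>I. h \<cdot> \<iota> i = f i"
    using assms(3)[of Y f] by blast
  then show "\<exists>!h. h \<in> Hom C P Y \<and> (\<forall>i\<in>I. h \<cdot> \<iota> i = f i)"
    using assms(4) by (intro ex1I[of _ h]) auto
qed (use assms in auto)

lemma coprod_iso:
  assumes "is_coproduct C I X P \<iota>" "e \<in> Isos C P Q" "\<And>i. i \<in> I \<Longrightarrow> e \<cdot> \<iota> i = \<iota>' i"
  shows "is_coproduct C I X Q \<iota>'"
proof -
  obtain e' where e: "e \<in> Hom C P Q" "e' \<in> Hom C Q P" "e' \<cdot> e = Ident C P" "e \<cdot> e' = Ident C Q"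
    using assms(2) by (rule IsosE)
  note \<iota> = coprod_inj[OF assms(1)]
  show ?thesis
  proof (rule coproductI)
    show "Q \<in> Obj C"
      using hom_obj[OF e(1)] by simp
    show "\<iota>' i \<in> Hom C (X i) Q" if "i \<in> I" for i
      using assms(3)[OF that] comp[OF \<iota>[OF that] e(1)] by simp
    fix Y f assume "Y \<in> Obj C" "\<And>i. i \<in> I \<Longrightarrow> f i \<in> Hom C (X i) Y"
    then obtain h where h: "h \<in> Hom C P Y" "\<And>i. i \<in> I \<Longrightarrow> h \<cdot> \<iota> i = f i"
      using coprod_desc[OF assms(1)] by blast
    have "(h \<cdot> e') \<cdot> \<iota>' i = f i" if "i \<in> I" for i
      using h(1) h(2)[OF that] e \<iota>[OF that] comp_reassoc[OF e(3), of "\<iota> i"]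
      by (simp add: in_hom flip: assms(3)[OF that])
    then show "\<exists>h\<in>Hom C Q Y. \<forall>i\<in>I. h \<cdot> \<iota>' i = f i"
      using comp[OF e(2) h(1)] by blast
  next
    fix Y g h
    assume gh: "g \<in> Hom C Q Y" "h \<in> Hom C Q Y" and eq: "\<And>i. i \<in> I \<Longrightarrow> g \<cdot> \<iota>' i = h \<cdot> \<iota>' i"
    have "g \<cdot> e = h \<cdot> e"
    proof (rule coprod_unique[OF assms(1)])
      show "(g \<cdot> e) \<cdot> \<iota> i = (h \<cdot> e) \<cdot> \<iota> i" if "i \<in> I" for i
        using eq[OF that] gh e(1) \<iota>[OF that] by (simp add: in_hom flip: assms(3)[OF that])
    qed (use gh e in \<open>auto intro: comp\<close>)
    then show "g = h"
      using iso_cancel_right assms(2) gh by blast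
  qed
qed

lemma coprod_iso_ex:
  assumes P: "is_coproduct C I X P \<iota>" and Q: "is_coproduct C I X Q \<iota>'"
  obtains e where "e \<in> Isos C P Q" "\<And>i. i \<in> I \<Longrightarrow> e \<cdot> \<iota> i = \<iota>' i"
proof -
  note i1 = coprod_inj[OF P] and i2 = coprod_inj[OF Q]
  have o: "P \<in> Obj C" "Q \<in> Obj C"
    using P Q by (auto intro: coprod_obj)
  obtain e where e: "e \<in> Hom C P Q" "\<And>i. i \<in> I \<Longrightarrow> e \<cdot> \<iota> i = \<iota>' i"
    using coprod_desc[OF P o(2) i2] by blast
  obtain e' where e': "e' \<in> Hom C Q P" "\<And>i. i \<in> I \<Longrightarrow> e' \<cdot> \<iota>' i = \<iota> i"
    using coprod_desc[OF Q o(1) i1] by blast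
  have "e' \<cdot> e = Ident C P"
    by (rule coprod_unique[OF P]) (use e e' o i1 in \<open>auto simp: in_hom\<close>)
  moreover have "e \<cdot> e' = Ident C Q"
    by (rule coprod_unique[OF Q]) (use e e' o i2 in \<open>auto simp: in_hom\<close>)
  ultimately show ?thesis
    using that e e' IsosI by blast
qed

lemma coprod_change:
  assumes P: "is_coproduct C I X P \<iota>" and a: "\<And>i. i \<in> I \<Longrightarrow> a i \<in> Isos C (X' i) (X i)"
  shows "is_coproduct C I X' P (\<lambda>i. \<iota> i \<cdot> a i)"
proof (rule coproductI)
  note i = coprod_inj[OF P]
  show "P \<in> Obj C"
    using P by (rule coprod_obj)
  show "\<iota> i \<cdot> a i \<in> Hom C (X' i) P" if "i \<in> I" for i
    using comp Isos_hom a i that by blast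
  fix Y f assume Y: "Y \<in> Obj C" "\<And>i. i \<in> I \<Longrightarrow> f i \<in> Hom C (X' i) Y"
  have inv: "inv_arr C (a i) \<in> Hom C (X i) (X' i)" "inv_arr C (a i) \<cdot> a i = Ident C (X' i)"
    if "i \<in> I" for i
    using inv_arr a that by blast+
  obtain h where h: "h \<in> Hom C P Y" "\<And>i. i \<in> I \<Longrightarrow> h \<cdot> \<iota> i = f i \<cdot> inv_arr C (a i)"
    using coprod_desc[OF P Y(1), of "\<lambda>i. f i \<cdot> inv_arr C (a i)"] Y comp inv by metis
  have "h \<cdot> (\<iota> i \<cdot> a i) = f i" if "i \<in> I" for i
    using comp_reassoc[OF h(2)[OF that], of "a i"] h(1) i[OF that] Isos_hom[OF a[OF that]]
      inv[OF that] Y(2)[OF that] by (simp add: in_hom)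
  then show "\<exists>h\<in>Hom C P Y. \<forall>i\<in>I. h \<cdot> (\<iota> i \<cdot> a i) = f i"
    using h(1) by blast
next
  note i = coprod_inj[OF P]
  fix Y g h assume gh: "g \<in> Hom C P Y" "h \<in> Hom C P Y"
    and eq: "\<And>i. i \<in> I \<Longrightarrow> g \<cdot> (\<iota> i \<cdot> a i) = h \<cdot> (\<iota> i \<cdot> a i)"
  show "g = h"
  proof (rule coprod_unique[OF P gh])
    fix j assume j: "j \<in> I"
    show "g \<cdot> \<iota> j = h \<cdot> \<iota> j"
    proof (rule iso_cancel_right[OF a[OF j]])
      show "(g \<cdot> \<iota> j) \<cdot> a j = (h \<cdot> \<iota> j) \<cdot> a j"
        using eq[OF j] gh i[OF j] Isos_hom[OF a[OF j]] by (simp add: in_hom)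
    qed (rule comp[OF i[OF j] gh(1)] comp[OF i[OF j] gh(2)])+
  qed
qed

lemma coprod_reindex:
  assumes g: "bij_betw g J I"
  shows "is_coproduct C I X P \<iota> \<longleftrightarrow> is_coproduct C J (X \<circ> g) P (\<iota> \<circ> g)" (is "?L \<longleftrightarrow> ?R")
proof -
  have I: "I = g ` J" and inj: "inj_on g J"
    using g by (auto simp: bij_betw_def)
  show ?thesis
  proof
    assume L: ?L
    show ?R
    proof (rule coproductI)
      fix Y f assume Y: "Y \<in> Obj C" and f: "\<And>j. j \<in> J \<Longrightarrow> f j \<in> Hom C ((X \<circ> g) j) Y"
      have "f (inv_into J g i) \<in> Hom C (X i) Y" if "i \<in> I" for i
        using f[of "inv_into J g i"] that I by (simp add: f_inv_into_f inv_into_into)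
      then obtain h where h: "h \<in> Hom C P Y" "\<And>i. i \<in> I \<Longrightarrow> h \<cdot> \<iota> i = f (inv_into J g i)"
        using coprod_desc[OF L Y, of "\<lambda>i. f (inv_into J g i)"] by blast
      have "h \<cdot> (\<iota> \<circ> g) j = f j" if "j \<in> J" for j
        using h(2)[of "g j"] that by (simp add: I inj)
      then show "\<exists>h\<in>Hom C P Y. \<forall>j\<in>J. h \<cdot> (\<iota> \<circ> g) j = f j"
        using h(1) by blast
    next
      fix Y g' h assume gh: "g' \<in> Hom C P Y" "h \<in> Hom C P Y"
        and eq: "\<And>j. j \<in> J \<Longrightarrow> g' \<cdot> (\<iota> \<circ> g) j = h \<cdot> (\<iota> \<circ> g) j"
      show "g' = h"
        by (rule coprod_unique[OF L gh]) (use eq in \<open>auto simp: I\<close>)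
    qed (use coprod_obj[OF L] coprod_inj[OF L] in \<open>simp_all add: I\<close>)
  next
    assume R: ?R
    show ?L
    proof (rule coproductI)
      fix Y f assume Y: "Y \<in> Obj C" and f: "\<And>i. i \<in> I \<Longrightarrow> f i \<in> Hom C (X i) Y"
      have "(f \<circ> g) j \<in> Hom C ((X \<circ> g) j) Y" if "j \<in> J" for j
        using f that by (simp add: I)
      then obtain h where h: "h \<in> Hom C P Y" "\<And>j. j \<in> J \<Longrightarrow> h \<cdot> (\<iota> \<circ> g) j = (f \<circ> g) j"
        using coprod_desc[OF R Y, of "f \<circ> g"] by blast
      have "h \<cdot> \<iota> i = f i" if "i \<in> I" for i
        using h(2) that by (auto simp: I)
      then show "\<exists>h\<in>Hom C P Y. \<forall>i\<in>I. h \<cdot> \<iota> i = f i"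
        using h(1) by blast
    next
      fix Y g' h assume gh: "g' \<in> Hom C P Y" "h \<in> Hom C P Y"
        and eq: "\<And>i. i \<in> I \<Longrightarrow> g' \<cdot> \<iota> i = h \<cdot> \<iota> i"
      show "g' = h"
        by (rule coprod_unique[OF R gh]) (use eq in \<open>auto simp: I\<close>)
    next
      fix i assume "i \<in> I"
      then show "\<iota> i \<in> Hom C (X i) P"
        using coprod_inj[OF R] by (auto simp: I)
    qed (rule coprod_obj[OF R])
  qed
qed

lemma has_small_coproducts_any:
  fixes \<kappa> :: "'i rel" and J :: "'b set"
  assumes "uncountable_regular \<kappa>" "has_small_coproducts \<kappa> C" "small \<kappa> J" "\<And>j. j \<in> J \<Longrightarrow> X j \<in> Obj C"
  obtains P \<iota> where "is_coproduct C J X P \<iota>"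
proof -
  obtain g :: "'b \<Rightarrow> 'i" where g: "inj_on g J" "small \<kappa> (g ` J)"
    using small_embedding assms(1,3) by blast
  have "\<forall>i\<in>g ` J. (X \<circ> inv_into J g) i \<in> Obj C"
    using assms(4) g(1) by auto
  then obtain P \<iota> where P: "is_coproduct C (g ` J) (X \<circ> inv_into J g) P \<iota>"
    using assms(2) g(2) unfolding has_small_coproducts_def by blast
  have "is_coproduct C J (X \<circ> inv_into J g \<circ> g) P (\<iota> \<circ> g)"
    using P coprod_reindex[OF inj_on_imp_bij_betw[OF g(1)]] by blast
  \<comment> \<open>Being a coproduct depends only on the values of the two families on
    \<open>J\<close>, where \<open>inv_into J g\<close> undoes \<open>g\<close>.\<close>
  then have "is_coproduct C J X P (\<iota> \<circ> g)"
    unfolding is_coproduct_def by (simp add: g(1))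
  then show ?thesis
    using that by blast
qed

end

section \<open>Functors applied to isomorphisms, retracts and coproducts\<close>

lemma is_functor_hom: "\<lbrakk>is_functor C D F; f \<in> Hom C X Y\<rbrakk> \<Longrightarrow> ar F f \<in> Hom D (ob F X) (ob F Y)"
  and is_functor_ob: "\<lbrakk>is_functor C D F; X \<in> Obj C\<rbrakk> \<Longrightarrow> ob F X \<in> Obj D"
  and is_functor_ident: "\<lbrakk>is_functor C D F; X \<in> Obj C\<rbrakk> \<Longrightarrow> ar F (Ident C X) = Ident D (ob F X)"
  and is_functor_comp: "\<lbrakk>is_functor C D F; f \<in> Hom C X Y; g \<in> Hom C Y Z\<rbrakk>
      \<Longrightarrow> ar F (g \<cdot>\<^bsub>C\<^esub> f) = ar F g \<cdot>\<^bsub>D\<^esub> ar F f"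
  unfolding is_functor_def by blast+

lemma is_functor_arr:
  assumes "is_functor C D F" "f \<in> Arr C"
  shows "ar F f \<in> Arr D" "Dom D (ar F f) = ob F (Dom C f)" "Cod D (ar F f) = ob F (Cod C f)"
  using is_functor_hom[OF assms(1), of f "Dom C f" "Cod C f"] assms(2) by (auto simp: in_hom)

lemma is_functor_Isos:
  assumes "category C" "category D" "is_functor C D F" "f \<in> Isos C X Y"
  shows "ar F f \<in> Isos D (ob F X) (ob F Y)"
proof -
  interpret C: category C by fact
  interpret D: category D by fact
  obtain g where g: "f \<in> Hom C X Y" "g \<in> Hom C Y X" "g \<cdot>\<^bsub>C\<^esub> f = Ident C X" "f \<cdot>\<^bsub>C\<^esub> g = Ident C Y"
    using assms(4) by (rule C.IsosE)
  have "X \<in> Obj C" "Y \<in> Obj C"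
    using C.hom_obj[OF g(1)] by auto
  then show ?thesis
    using is_functor_comp[OF assms(3) g(1,2)] is_functor_comp[OF assms(3) g(2,1)] g
      is_functor_hom[OF assms(3)] is_functor_ident[OF assms(3)]
    by (intro D.IsosI[where g = "ar F g"]) auto
qed

lemma is_functor_retract:
  assumes "category C" "is_functor C D F" "retract C X Y"
  shows "retract D (ob F X) (ob F Y)"
proof -
  interpret C: category C by fact
  obtain i p where ip: "X \<in> Obj C" "i \<in> Hom C X Y" "p \<in> Hom C Y X" "p \<cdot>\<^bsub>C\<^esub> i = Ident C X"
    using assms(3) by (auto simp: retract_def)
  then show ?thesis
    using is_functor_comp[OF assms(2) ip(2,3)] is_functor_ob[OF assms(2)] is_functor_hom[OF assms(2)]
      is_functor_ident[OF assms(2)]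
    unfolding retract_def by metis
qed

lemma preserves_small_coproducts_any:
  fixes \<kappa> :: "'i rel" and J :: "'b set"
  assumes "category C" "category D" "uncountable_regular \<kappa>" "preserves_small_coproducts \<kappa> C D F"
    "small \<kappa> J" "is_coproduct C J X P \<iota>"
  shows "is_coproduct D J (\<lambda>j. ob F (X j)) (ob F P) (\<lambda>j. ar F (\<iota> j))"
proof -
  interpret C: category C by fact
  interpret D: category D by fact
  obtain g :: "'b \<Rightarrow> 'i" where g: "inj_on g J" "small \<kappa> (g ` J)"
    using small_embedding assms(3,5) by blast
  let ?h = "inv_into J g"
  have h: "bij_betw ?h (g ` J) J"
    by (rule bij_betw_inv_into[OF inj_on_imp_bij_betw[OF g(1)]])
  have "is_coproduct C (g ` J) (X \<circ> ?h) P (\<iota> \<circ> ?h)"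
    using C.coprod_reindex[OF h] assms(6) by blast
  then have "is_coproduct D (g ` J) (\<lambda>i. ob F ((X \<circ> ?h) i)) (ob F P) (\<lambda>i. ar F ((\<iota> \<circ> ?h) i))"
    using assms(4) g(2) unfolding preserves_small_coproducts_def by blast
  moreover have "(\<lambda>i. ob F ((X \<circ> ?h) i)) = (\<lambda>j. ob F (X j)) \<circ> ?h" "(\<lambda>i. ar F ((\<iota> \<circ> ?h) i)) = (\<lambda>j. ar F (\<iota> j)) \<circ> ?h"
    by (auto simp: comp_def)
  ultimately show ?thesis
    using D.coprod_reindex[OF h, of "\<lambda>j. ob F (X j)"] by simp
qed

section \<open>Additive categories\<close>

context additive_category
begin

lemma
  assumes "f \<in> Hom C X Y" "g \<in> Hom C X Y"
  shows plus_hom [simp]: "Plus C f g \<in> Hom C X Y"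
    and plus_comm: "Plus C f g = Plus C g f"
    and neg_hom: "neg C f \<in> Hom C X Y"
    and plus_neg: "Plus C f (neg C f) = Null C X Y"
    and plus_null: "Plus C f (Null C X Y) = f"
    and null_plus: "Plus C (Null C X Y) f = f"
proof -
  interpret G: comm_group "hom_group C X Y"
    using hom_comm_group hom_obj[OF assms(1)] by simp
  have c: "carrier (hom_group C X Y) = Hom C X Y" "mult (hom_group C X Y) = Plus C"
    "one (hom_group C X Y) = Null C X Y" "neg C f = inv\<^bsub>hom_group C X Y\<^esub> f"
    using assms by (simp_all add: hom_group_def neg_def in_hom)
  show "Plus C f g \<in> Hom C X Y" "Plus C f g = Plus C g f" "neg C f \<in> Hom C X Y"
    "Plus C f (neg C f) = Null C X Y" "Plus C f (Null C X Y) = f" "Plus C (Null C X Y) f = f"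
    using G.m_closed[of f g] G.m_comm[of f g] G.inv_closed[of f] G.r_inv[of f] G.r_one[of f] G.l_one[of f]
      assms unfolding c by auto
qed

lemma null_hom [simp]: "\<lbrakk>X \<in> Obj C; Y \<in> Obj C\<rbrakk> \<Longrightarrow> Null C X Y \<in> Hom C X Y"
proof -
  assume "X \<in> Obj C" "Y \<in> Obj C"
  then interpret G: comm_group "hom_group C X Y"
    using hom_comm_group by simp
  show ?thesis
    using G.one_closed by (simp add: hom_group_def)
qed

lemma plus_assoc:
  assumes "f \<in> Hom C X Y" "g \<in> Hom C X Y" "h \<in> Hom C X Y"
  shows "Plus C (Plus C f g) h = Plus C f (Plus C g h)"
proof -
  interpret G: comm_group "hom_group C X Y"
    using hom_comm_group hom_obj[OF assms(1)] by simp
  show ?thesis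
    using G.m_assoc[of f g h] assms by (simp add: hom_group_def)
qed

lemma plus_left_cancel:
  assumes "f \<in> Hom C X Y" "g \<in> Hom C X Y" "h \<in> Hom C X Y" "Plus C f g = Plus C f h"
  shows "g = h"
proof -
  interpret G: comm_group "hom_group C X Y"
    using hom_comm_group hom_obj[OF assms(1)] by simp
  show ?thesis
    using G.Units_l_cancel[of f g h] assms unfolding G.Units_eq by (simp add: hom_group_def)
qed

lemma neg_unique:
  assumes "f \<in> Hom C X Y" "g \<in> Hom C X Y" "Plus C f g = Null C X Y"
  shows "neg C f = g"
  by (rule plus_left_cancel[OF assms(1)]) (use assms plus_neg neg_hom in auto)

lemma neg_neg:
  assumes "f \<in> Hom C X Y"
  shows "neg C (neg C f) = f"
proof (rule neg_unique)
  show "Plus C (neg C f) f = Null C X Y"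
    using plus_comm plus_neg neg_hom assms by metis
qed (use neg_hom assms in auto)

lemma diff_null:
  assumes "f \<in> Hom C X Y" "g \<in> Hom C X Y" "Plus C f (neg C g) = Null C X Y"
  shows "f = g"
proof -
  have "neg C f = neg C g"
    using neg_unique assms neg_hom by metis
  then show ?thesis
    using neg_neg assms by metis
qed

lemma diff_plus:
  assumes "f \<in> Hom C X Y" "g \<in> Hom C X Y"
  shows "Plus C (Plus C f (neg C g)) g = f"
proof -
  have "Plus C (neg C g) g = Null C X Y"
    using plus_comm[of "neg C g" X Y g] plus_neg[OF assms(2,2)] neg_hom[OF assms(2,2)] assms by simp
  then show ?thesis
    using plus_assoc[of f X Y "neg C g" g] neg_hom[OF assms(2,2)] plus_null[OF assms(1,1)] assms by simp
qed

lemma comp_null_right: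
  assumes "g \<in> Hom C Y Z" "X \<in> Obj C"
  shows "g \<cdot> Null C X Y = Null C X Z"
proof -
  have o: "Y \<in> Obj C" "Z \<in> Obj C"
    using hom_obj[OF assms(1)] by auto
  note n = null_hom[OF assms(2) o(1)]
  have h: "g \<cdot> Null C X Y \<in> Hom C X Z"
    using comp[OF n assms(1)] .
  have "Plus C (g \<cdot> Null C X Y) (g \<cdot> Null C X Y) = g \<cdot> Null C X Y"
    using comp_plus_left[OF n n assms(1)] plus_null[OF n n] by simp
  then have "Plus C (g \<cdot> Null C X Y) (g \<cdot> Null C X Y) = Plus C (g \<cdot> Null C X Y) (Null C X Z)"
    using plus_null[OF h h] by simp
  then show ?thesis
    using plus_left_cancel[OF h h null_hom[OF assms(2) o(2)]] by simp
qed

lemma comp_null_left: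
  assumes "f \<in> Hom C X Y" "Z \<in> Obj C"
  shows "Null C Y Z \<cdot> f = Null C X Z"
proof -
  have o: "X \<in> Obj C" "Y \<in> Obj C"
    using hom_obj[OF assms(1)] by auto
  note n = null_hom[OF o(2) assms(2)]
  have h: "Null C Y Z \<cdot> f \<in> Hom C X Z"
    using comp[OF assms(1) n] .
  have "Plus C (Null C Y Z \<cdot> f) (Null C Y Z \<cdot> f) = Null C Y Z \<cdot> f"
    using comp_plus_right[OF assms(1) n n] plus_null[OF n n] by simp
  then have "Plus C (Null C Y Z \<cdot> f) (Null C Y Z \<cdot> f) = Plus C (Null C Y Z \<cdot> f) (Null C X Z)"
    using plus_null[OF h h] by simp
  then show ?thesis
    using plus_left_cancel[OF h h null_hom[OF o(1) assms(2)]] by simp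
qed

lemma comp_neg:
  assumes "f \<in> Hom C X Y" "g \<in> Hom C Y Z"
  shows "g \<cdot> neg C f = neg C (g \<cdot> f)" "neg C g \<cdot> f = neg C (g \<cdot> f)"
proof -
  note nf = neg_hom[OF assms(1,1)] and ng = neg_hom[OF assms(2,2)]
  have "Plus C (g \<cdot> f) (g \<cdot> neg C f) = Null C X Z"
    using comp_plus_left[OF assms(1) nf assms(2)] plus_neg[OF assms(1,1)]
      comp_null_right[OF assms(2)] hom_obj[OF assms(1)] by simp
  then show "g \<cdot> neg C f = neg C (g \<cdot> f)"
    using neg_unique comp assms nf by metis
  have "Plus C (g \<cdot> f) (neg C g \<cdot> f) = Null C X Z"
    using comp_plus_right[OF assms(1,2) ng] plus_neg[OF assms(2,2)]
      comp_null_left[OF assms(1)] hom_obj[OF assms(2)] by simp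
  then show "neg C g \<cdot> f = neg C (g \<cdot> f)"
    using neg_unique comp assms ng by metis
qed

lemma neg_null: "\<lbrakk>X \<in> Obj C; Y \<in> Obj C\<rbrakk> \<Longrightarrow> neg C (Null C X Y) = Null C X Y"
  using neg_unique[OF null_hom null_hom] plus_null[OF null_hom null_hom] by simp

lemma neg_eq_null:
  assumes "f \<in> Hom C X Y" "neg C f = Null C X Y"
  shows "f = Null C X Y"
  using neg_neg[OF assms(1)] assms(2) neg_null hom_obj[OF assms(1)] by simp

lemma is_zero_obj: "is_zero C Z \<Longrightarrow> Z \<in> Obj C"
  by (simp add: is_zero_def)

lemma hom_zero:
  assumes "is_zero C Z"
  shows "f \<in> Hom C Z X \<Longrightarrow> f = Null C Z X" "f \<in> Hom C X Z \<Longrightarrow> f = Null C X Z"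
proof -
  note Z = is_zero_obj[OF assms]
  have u: "\<exists>!f. f \<in> Hom C Z Y" "\<exists>!f. f \<in> Hom C Y Z" if "Y \<in> Obj C" for Y
    using assms that by (simp_all add: is_zero_def)
  have ex1: "a = b" if "\<exists>!x. Q x" "Q a" "Q b" for Q and a b :: 'm
    using that by blast
  show "f = Null C Z X" if f: "f \<in> Hom C Z X"
    using ex1[OF u(1) f null_hom[OF Z]] hom_obj[OF f] by simp
  show "f = Null C X Z" if f: "f \<in> Hom C X Z"
    using ex1[OF u(2) f null_hom[OF _ Z]] hom_obj[OF f] by simp
qed

lemma is_zero_iff: "is_zero C X \<longleftrightarrow> X \<in> Obj C \<and> Ident C X = Null C X X"
proof
  assume "is_zero C X"
  then show "X \<in> Obj C \<and> Ident C X = Null C X X"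
    using is_zero_obj hom_zero(1)[OF _ ident] by simp
next
  assume X: "X \<in> Obj C \<and> Ident C X = Null C X X"
  show "is_zero C X"
    unfolding is_zero_def
  proof (intro conjI ballI)
    fix Y assume Y: "Y \<in> Obj C"
    have "f = Null C X Y" if "f \<in> Hom C X Y" for f
      using comp_ident_right[OF that] comp_null_right[OF that] X by simp
    then show "\<exists>!f. f \<in> Hom C X Y"
      using null_hom[of X Y] X Y by (intro ex1I[of _ "Null C X Y"]) simp_all
    have "f = Null C Y X" if "f \<in> Hom C Y X" for f
      using comp_ident_left[OF that] comp_null_left[OF that] X by simp
    then show "\<exists>!f. f \<in> Hom C Y X"
      using null_hom[of Y X] X Y by (intro ex1I[of _ "Null C Y X"]) simp_all
  qed (use X in simp)
qed

lemma is_zero_retract: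
  assumes "is_zero C Z" "retract C X Z"
  shows "is_zero C X"
proof -
  obtain i p where ip: "X \<in> Obj C" "i \<in> Hom C X Z" "p \<in> Hom C Z X" "p \<cdot> i = Ident C X"
    using assms(2) by (auto simp: retract_def)
  have "p = Null C Z X"
    using hom_zero assms(1) ip(3) by blast
  then have "p \<cdot> i = Null C X X"
    using comp_null_left ip by simp
  then show ?thesis
    using ip by (simp add: is_zero_iff)
qed

lemma coproduct_empty_zero:
  assumes "is_coproduct C {} X Z \<iota>"
  shows "is_zero C Z"
proof -
  have Z: "Z \<in> Obj C"
    using assms by (rule coprod_obj)
  show ?thesis
    using coprod_unique[OF assms ident[OF Z] null_hom[OF Z Z]] Z by (simp add: is_zero_iff)
qed

text \<open>Viewing a zero object as an empty coproduct shows that a functor preserving coproducts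
  preserves zero objects, before it is known to be additive.\<close>

lemma zero_coproduct_empty:
  assumes "is_zero C Z"
  shows "is_coproduct C {} X Z \<iota>"
proof (rule coproductI)
  show "\<exists>h\<in>Hom C Z Y. \<forall>i\<in>{}. h \<cdot> \<iota> i = f i" if "Y \<in> Obj C" for Y f
    using null_hom is_zero_obj assms that by blast
  show "g = h" if "g \<in> Hom C Z Y" "h \<in> Hom C Z Y" for Y g h
    using hom_zero(1)[OF assms that(1)] hom_zero(1)[OF assms that(2)] by simp
qed (use assms is_zero_obj in auto)

end

subsection \<open>Finite sums in coproducts\<close>

text \<open>The projection to the summand \<open>k\<close>, which exists because zero maps can be
  used on the other summands. For \<open>k\<close> in \<open>I\<close> the conditions determine it
  uniquely, so the choice made by \<open>SOME\<close> does not matter.\<close>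

definition coproj ::
    "('o, 'm, 'z) add_cat_scheme \<Rightarrow> 'i set \<Rightarrow> ('i \<Rightarrow> 'o) \<Rightarrow> 'o \<Rightarrow> ('i \<Rightarrow> 'm) \<Rightarrow> 'i \<Rightarrow> 'm" where
  "coproj C I X P \<iota> k = (SOME p. p \<in> Hom C P (X k) \<and>
     (\<forall>j\<in>I. p \<cdot>\<^bsub>C\<^esub> \<iota> j = (if j = k then Ident C (X k) else Null C (X j) (X k))))"

text \<open>A relation instead of a sum over a family: no components have to be chosen, and the
  induction rule pushes any operation through that is compatible with adding one summand. The
  condition \<open>j \<notin> J\<close> lets each injection occur once, so the projections recover
  the summands.\<close>

inductive finite_sum ::
    "('o, 'm, 'z) add_cat_scheme \<Rightarrow> 'o \<Rightarrow> 'o \<Rightarrow> ('i \<Rightarrow> 'o) \<Rightarrow> ('i \<Rightarrow> 'm) \<Rightarrow> 'i set \<Rightarrow> 'm \<Rightarrow> bool"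
  for C A P X \<iota> where
  zero: "finite_sum C A P X \<iota> {} (Null C A P)"
| add: "\<lbrakk>finite_sum C A P X \<iota> J w; j \<notin> J; a \<in> Hom C A (X j)\<rbrakk>
    \<Longrightarrow> finite_sum C A P X \<iota> (insert j J) (Plus C w (\<iota> j \<cdot>\<^bsub>C\<^esub> a))"

text \<open>Records that the map from the direct sum of the groups \<open>Hom C A (X i)\<close> to
  \<open>Hom C A P\<close> is onto. Its injectivity comes from the projections
  \<open>coproj\<close>, as \<open>is_compact_iff\<close> shows.\<close>

definition finsum_compact :: "'i rel \<Rightarrow> ('o, 'm, 'z) add_cat_scheme \<Rightarrow> 'o \<Rightarrow> bool" where
  "finsum_compact \<kappa> C A \<longleftrightarrow> A \<in> Obj C \<and>
     (\<forall>(I :: 'i set) X P \<iota>. small \<kappa> I \<and> is_coproduct C I X P \<iota> \<longrightarrow>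
        (\<forall>w\<in>Hom C A P. \<exists>J\<subseteq>I. finite_sum C A P X \<iota> J w))"

lemma finsum_compactD:
  fixes \<kappa> :: "'i rel" and I :: "'i set"
  assumes "finsum_compact \<kappa> C A" "small \<kappa> I" "is_coproduct C I X P \<iota>" "w \<in> Hom C A P"
  shows "\<exists>J\<subseteq>I. finite_sum C A P X \<iota> J w"
  using assms unfolding finsum_compact_def by blast

lemma finite_sum_finite: "finite_sum C A P X \<iota> J w \<Longrightarrow> finite J"
  by (induction rule: finite_sum.induct) auto

context additive_category
begin

lemma coproj:
  assumes P: "is_coproduct C I X P \<iota>" and k: "k \<in> I"
  shows "coproj C I X P \<iota> k \<in> Hom C P (X k)"
    and "j \<in> I \<Longrightarrow> coproj C I X P \<iota> k \<cdot> \<iota> j = (if j = k then Ident C (X k) else Null C (X j) (X k))"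
proof -
  have o: "X j \<in> Obj C" if "j \<in> I" for j
    using hom_obj[OF coprod_inj[OF P that]] by simp
  have "(if j = k then Ident C (X k) else Null C (X j) (X k)) \<in> Hom C (X j) (X k)" if "j \<in> I" for j
    using ident[OF o[OF k]] null_hom[OF o[OF that] o[OF k]] by simp
  from coprod_ex[OF P o[OF k] this]
  have "\<exists>p. p \<in> Hom C P (X k) \<and> (\<forall>j\<in>I. p \<cdot> \<iota> j = (if j = k then Ident C (X k) else Null C (X j) (X k)))"
    by (simp only: Bex_def)
  then have "coproj C I X P \<iota> k \<in> Hom C P (X k) \<and> (\<forall>j\<in>I. coproj C I X P \<iota> k \<cdot> \<iota> j =
      (if j = k then Ident C (X k) else Null C (X j) (X k)))"
    unfolding coproj_def by (rule someI_ex)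
  then show "coproj C I X P \<iota> k \<in> Hom C P (X k)"
    and "j \<in> I \<Longrightarrow> coproj C I X P \<iota> k \<cdot> \<iota> j = (if j = k then Ident C (X k) else Null C (X j) (X k))"
    by simp_all
qed

lemma coproj_comp:
  assumes P: "is_coproduct C I X P \<iota>" and "k \<in> I" "j \<in> I" "a \<in> Hom C A (X j)"
  shows "coproj C I X P \<iota> k \<cdot> (\<iota> j \<cdot> a) = (if j = k then a else Null C A (X k))"
proof -
  note c = coproj[OF P assms(2)]
  have X: "X k \<in> Obj C"
    using hom_obj[OF c(1)] by simp
  have "coproj C I X P \<iota> k \<cdot> (\<iota> j \<cdot> a) = (coproj C I X P \<iota> k \<cdot> \<iota> j) \<cdot> a"
    using c(1) coprod_inj[OF P assms(3)] assms(4) by (simp add: in_hom)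
  then show ?thesis
    using c(2)[OF assms(3)] comp_ident_left[OF assms(4)] comp_null_left[OF assms(4) X] by auto
qed

lemma coproj_unique:
  assumes P: "is_coproduct C I X P \<iota>" and k: "k \<in> I" and p: "p \<in> Hom C P (X k)"
    "\<And>j. j \<in> I \<Longrightarrow> p \<cdot> \<iota> j = (if j = k then Ident C (X k) else Null C (X j) (X k))"
  shows "coproj C I X P \<iota> k = p"
  by (rule coprod_unique[OF P coproj(1)[OF P k] p(1)]) (use coproj(2)[OF P k] p(2) in auto)

lemma finite_sum_hom:
  assumes "finite_sum C A P X \<iota> J w" "is_coproduct C I X P \<iota>" "J \<subseteq> I" "A \<in> Obj C"
  shows "w \<in> Hom C A P"
  using assms
proof (induction rule: finite_sum.induct)
  case (add J w j a)
  then show ?case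
    using comp[OF add(3) coprod_inj[OF assms(2)]] by simp
qed (simp add: coprod_obj)

lemma finite_sum_coproj:
  assumes "finite_sum C A P X \<iota> J w" and P: "is_coproduct C I X P \<iota>" and "J \<subseteq> I" "A \<in> Obj C" "k \<in> I" "k \<notin> J"
  shows "coproj C I X P \<iota> k \<cdot> w = Null C A (X k)"
  using assms(1,3,6)
proof (induction rule: finite_sum.induct)
  case zero
  then show ?case
    using comp_null_right coproj[OF P] assms by auto
next
  case (add J w j a)
  note c = coproj(1)[OF P assms(5)]
  have w: "w \<in> Hom C A P" and j: "j \<in> I"
    using finite_sum_hom[OF add(1) P] add assms by auto
  have X: "X k \<in> Obj C"
    using hom_obj[OF c] by simp
  have "coproj C I X P \<iota> k \<cdot> Plus C w (\<iota> j \<cdot> a)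
      = Plus C (coproj C I X P \<iota> k \<cdot> w) (coproj C I X P \<iota> k \<cdot> (\<iota> j \<cdot> a))"
    by (rule comp_plus_left[OF w comp[OF add(3) coprod_inj[OF P j]] c])
  also have "\<dots> = Null C A (X k)"
    using add coproj_comp[OF P assms(5) j add(3)] plus_null[OF null_hom null_hom] X assms by auto
  finally show ?case .
qed

lemma finite_sum_zero:
  assumes "finite_sum C A P X \<iota> J w" and P: "is_coproduct C I X P \<iota>" and "J \<subseteq> I" "A \<in> Obj C"
    and "\<And>k. k \<in> J \<Longrightarrow> coproj C I X P \<iota> k \<cdot> w = Null C A (X k)"
  shows "w = Null C A P"
  using assms(1,3,5)
proof (induction rule: finite_sum.induct)
  case (add J w j a)
  have j: "j \<in> I" and w: "w \<in> Hom C A P"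
    using finite_sum_hom[OF add(1) P] add assms by auto
  note c = coproj(1)[OF P j]
  have X: "X j \<in> Obj C"
    using hom_obj[OF c] by simp
  have "coproj C I X P \<iota> j \<cdot> Plus C w (\<iota> j \<cdot> a)
      = Plus C (coproj C I X P \<iota> j \<cdot> w) (coproj C I X P \<iota> j \<cdot> (\<iota> j \<cdot> a))"
    by (rule comp_plus_left[OF w comp[OF add(3) coprod_inj[OF P j]] c])
  also have "coproj C I X P \<iota> j \<cdot> w = Null C A (X j)"
    by (rule finite_sum_coproj[OF add(1) P]) (use add j assms in auto)
  also have "coproj C I X P \<iota> j \<cdot> (\<iota> j \<cdot> a) = a"
    using coproj_comp[OF P j j add(3)] by simp
  finally have "a = Null C A (X j)"
    using add(6)[of j] null_plus[OF add(3,3)] by simp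
  then have eq: "Plus C w (\<iota> j \<cdot> a) = w"
    using comp_null_right[OF coprod_inj[OF P j] assms(4)] plus_null[OF w w] by simp
  show ?case
    unfolding eq using add eq by auto
qed simp

text \<open>Carries finite sums along a map \<open>t\<close> of Hom sets that respects the zero map
  and the addition of a summand. It is applied to suspension, to its inverse and to transposition
  along a dual pair.\<close>

lemma finite_sum_map:
  assumes "finite_sum C A P X \<iota> J w" "is_coproduct C I X P \<iota>" "J \<subseteq> I" "A \<in> Obj C"
    and "t (Null C A P) = Null D B Q"
    and "\<And>w j a. \<lbrakk>w \<in> Hom C A P; j \<in> I; a \<in> Hom C A (X j)\<rbrakk>
      \<Longrightarrow> t (Plus C w (\<iota> j \<cdot> a)) = Plus D (t w) (\<iota>' j \<cdot>\<^bsub>D\<^esub> t' j a) \<and> t' j a \<in> Hom D B (X' j)"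
  shows "finite_sum D B Q X' \<iota>' J (t w)"
  using assms(1,3)
proof (induction rule: finite_sum.induct)
  case zero
  then show ?case
    using assms(5) finite_sum.zero[of D B Q X' \<iota>'] by simp
next
  case (add J w j a)
  have "w \<in> Hom C A P"
    using finite_sum_hom[OF add(1) assms(2)] add assms by auto
  then show ?case
    using assms(6)[of w j a] add finite_sum.add[of D B Q X' \<iota>' J "t w" j "t' j a"] by auto
qed

lemma finsum_compact_any:
  fixes \<kappa> :: "'i rel" and J :: "'b set"
  assumes "uncountable_regular \<kappa>" "finsum_compact \<kappa> C A" "small \<kappa> J" "is_coproduct C J X P \<iota>" "w \<in> Hom C A P"
  obtains K where "K \<subseteq> J" "finite_sum C A P X \<iota> K w"
proof -
  obtain g :: "'b \<Rightarrow> 'i" where g: "inj_on g J" "small \<kappa> (g ` J)"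
    using small_embedding assms(1,3) by blast
  let ?h = "inv_into J g"
  have h: "bij_betw ?h (g ` J) J"
    by (rule bij_betw_inv_into[OF inj_on_imp_bij_betw[OF g(1)]])
  have P: "is_coproduct C (g ` J) (X \<circ> ?h) P (\<iota> \<circ> ?h)"
    using coprod_reindex[OF h] assms(4) by blast
  obtain K where K: "K \<subseteq> g ` J" "finite_sum C A P (X \<circ> ?h) (\<iota> \<circ> ?h) K w"
    using finsum_compactD[OF assms(2) g(2) P assms(5)] by blast
  have "finite_sum C A P X \<iota> (?h ` K) w"
    using K(2,1)
  proof (induction rule: finite_sum.induct)
    case zero
    show ?case
      by (simp add: finite_sum.zero)
  next
    case (add K w j a)
    have "?h j \<notin> ?h ` K"
      using inj_on_image_mem_iff[OF bij_betw_imp_inj_on[OF h], of j K] add(2,5) by simp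
    moreover have "finite_sum C A P X \<iota> (?h ` K) w" "a \<in> Hom C A (X (?h j))"
      using add(3-5) by simp_all
    ultimately show ?case
      using finite_sum.add[of C A P X \<iota> "?h ` K" w "?h j" a] by simp
  qed
  moreover have "?h ` K \<subseteq> J"
    using image_mono[OF K(1), of ?h] bij_betw_imp_surj_on[OF h] by simp
  ultimately show ?thesis
    using that by blast
qed

text \<open>In general, a map into an infinite coproduct need not be determined by its projections.
  From a compact source it is, being a finite sum: almost all projections vanish, and a finite sum
  all of whose projections vanish is zero.\<close>

lemma finsum_compact_coproj:
  fixes \<kappa> :: "'i rel" and I :: "'b set"
  assumes \<kappa>: "uncountable_regular \<kappa>" and A: "finsum_compact \<kappa> C A" and I: "small \<kappa> I"
    and P: "is_coproduct C I X P \<iota>" and w: "w \<in> Hom C A P"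
  shows "finite {k \<in> I. coproj C I X P \<iota> k \<cdot> w \<noteq> Null C A (X k)}"
    and "(\<And>k. k \<in> I \<Longrightarrow> coproj C I X P \<iota> k \<cdot> w = Null C A (X k)) \<Longrightarrow> w = Null C A P"
proof -
  obtain K where K: "K \<subseteq> I" "finite_sum C A P X \<iota> K w"
    using finsum_compact_any[OF \<kappa> A I P w] .
  have Ao: "A \<in> Obj C"
    using A by (simp add: finsum_compact_def)
  have "{k \<in> I. coproj C I X P \<iota> k \<cdot> w \<noteq> Null C A (X k)} \<subseteq> K"
    using finite_sum_coproj[OF K(2) P K(1) Ao] by blast
  then show "finite {k \<in> I. coproj C I X P \<iota> k \<cdot> w \<noteq> Null C A (X k)}"
    using finite_sum_finite[OF K(2)] finite_subset by blast
  show "w = Null C A P" if "\<And>k. k \<in> I \<Longrightarrow> coproj C I X P \<iota> k \<cdot> w = Null C A (X k)"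
    using finite_sum_zero[OF K(2) P K(1) Ao] that K(1) by blast
qed

lemma finsum_compact_coproj_eq:
  fixes \<kappa> :: "'i rel" and I :: "'b set"
  assumes \<kappa>: "uncountable_regular \<kappa>" and A: "finsum_compact \<kappa> C A" and I: "small \<kappa> I"
    and P: "is_coproduct C I X P \<iota>" and uv: "u \<in> Hom C A P" "v \<in> Hom C A P"
    and eq: "\<And>k. k \<in> I \<Longrightarrow> coproj C I X P \<iota> k \<cdot> u = coproj C I X P \<iota> k \<cdot> v"
  shows "u = v"
proof (rule diff_null[OF uv])
  note nv = neg_hom[OF uv(2,2)]
  show "Plus C u (neg C v) = Null C A P"
  proof (rule finsum_compact_coproj(2)[OF \<kappa> A I P plus_hom[OF uv(1) nv]])
    fix k assume k: "k \<in> I"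
    note c = coproj(1)[OF P k]
    have "coproj C I X P \<iota> k \<cdot> Plus C u (neg C v)
        = Plus C (coproj C I X P \<iota> k \<cdot> u) (neg C (coproj C I X P \<iota> k \<cdot> v))"
      using comp_plus_left[OF uv(1) nv c] comp_neg(1)[OF uv(2) c] by simp
    also have "\<dots> = Null C A (X k)"
      using eq[OF k] plus_neg[of _ A "X k"] comp[OF uv(2) c] by simp
    finally show "coproj C I X P \<iota> k \<cdot> Plus C u (neg C v) = Null C A (X k)" .
  qed
qed

end

subsection \<open>Compact objects\<close>

context additive_category
begin

lemma carrier_hom_group [simp]: "carrier (hom_group C X Y) = Hom C X Y"
  and mult_hom_group [simp]: "mult (hom_group C X Y) = Plus C"
  and one_hom_group [simp]: "one (hom_group C X Y) = Null C X Y"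
  by (simp_all add: hom_group_def)

lemma finprod_finite_sum:
  assumes P: "is_coproduct C I X P \<iota>" and A: "A \<in> Obj C" and K: "finite K" "K \<subseteq> I"
    and f: "\<And>i. i \<in> I \<Longrightarrow> f i \<in> Hom C A (X i)"
  shows "finite_sum C A P X \<iota> K (finprod (hom_group C A P) (\<lambda>i. \<iota> i \<cdot> f i) K)"
    and "k \<in> I \<Longrightarrow> coproj C I X P \<iota> k \<cdot> finprod (hom_group C A P) (\<lambda>i. \<iota> i \<cdot> f i) K
      = (if k \<in> K then f k else Null C A (X k))"
proof -
  interpret G: comm_group "hom_group C A P"
    using hom_comm_group[OF A coprod_obj[OF P]] .
  have h: "\<iota> i \<cdot> f i \<in> Hom C A P" if "i \<in> I" for i
    using comp[OF f[OF that] coprod_inj[OF P that]] .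
  have ins: "finprod (hom_group C A P) (\<lambda>i. \<iota> i \<cdot> f i) (insert j K)
      = Plus C (finprod (hom_group C A P) (\<lambda>i. \<iota> i \<cdot> f i) K) (\<iota> j \<cdot> f j)
      \<and> finprod (hom_group C A P) (\<lambda>i. \<iota> i \<cdot> f i) K \<in> Hom C A P"
    if "finite K" "j \<notin> K" "insert j K \<subseteq> I" for j K
  proof -
    have "(\<lambda>i. \<iota> i \<cdot> f i) \<in> K \<rightarrow> carrier (hom_group C A P)" "\<iota> j \<cdot> f j \<in> carrier (hom_group C A P)"
      using h that by auto
    then show ?thesis
      using G.finprod_insert[OF that(1,2), of "\<lambda>i. \<iota> i \<cdot> f i"] G.finprod_closed[of "\<lambda>i. \<iota> i \<cdot> f i" K]
        plus_comm[of "\<iota> j \<cdot> f j" A P] by simp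
  qed
  show "finite_sum C A P X \<iota> K (finprod (hom_group C A P) (\<lambda>i. \<iota> i \<cdot> f i) K)"
    using K
  proof (induction K rule: finite_induct)
    case empty
    then show ?case
      using finite_sum.zero[of C A P X \<iota>] by simp
  next
    case (insert j K)
    then show ?case
      using finite_sum.add[of C A P X \<iota> K _ j "f j"] ins[of K j] f by simp
  qed
  assume k: "k \<in> I"
  note c = coproj(1)[OF P k]
  have X: "X k \<in> Obj C"
    using hom_obj[OF c] by simp
  show "coproj C I X P \<iota> k \<cdot> finprod (hom_group C A P) (\<lambda>i. \<iota> i \<cdot> f i) K
      = (if k \<in> K then f k else Null C A (X k))"
    using K
  proof (induction K rule: finite_induct)
    case empty
    then show ?case
      using comp_null_right[OF c A] by simp
  next
    case (insert j K)
    then have j: "j \<in> I"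
      by simp
    have "coproj C I X P \<iota> k \<cdot> finprod (hom_group C A P) (\<lambda>i. \<iota> i \<cdot> f i) (insert j K)
       = Plus C (coproj C I X P \<iota> k \<cdot> finprod (hom_group C A P) (\<lambda>i. \<iota> i \<cdot> f i) K)
           (coproj C I X P \<iota> k \<cdot> (\<iota> j \<cdot> f j))"
      using ins[of K j] insert comp_plus_left[OF _ h[OF j] c] by simp
    then show ?case
      using insert coproj_comp[OF P k j f[OF j]] plus_null[OF f[OF k] f[OF k]]
        null_plus[OF f[OF k] f[OF k]] plus_null[OF null_hom null_hom, OF A X A X] by auto
  qed
qed

lemma sum_group_hom_group_carrier:
  assumes "A \<in> Obj C" "\<And>i. i \<in> I \<Longrightarrow> X i \<in> Obj C"
  shows "f \<in> carrier (sum_group I (\<lambda>i. hom_group C A (X i))) \<longleftrightarrow>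
    f \<in> (\<Pi>\<^sub>E i\<in>I. Hom C A (X i)) \<and> finite {i \<in> I. f i \<noteq> Null C A (X i)}"
proof -
  have "group (hom_group C A (X i))" if "i \<in> I" for i
    using hom_comm_group[OF assms(1) assms(2)[OF that]] comm_group.axioms(2) by blast
  then show ?thesis
    by (subst carrier_sum_group) auto
qed

lemma coproj_gfinprod:
  assumes P: "is_coproduct C I X P \<iota>" and A: "A \<in> Obj C"
    and f: "f \<in> carrier (sum_group I (\<lambda>i. hom_group C A (X i)))"
  shows "gfinprod (hom_group C A P) (\<lambda>i. \<iota> i \<cdot> f i) I \<in> Hom C A P"
    and "k \<in> I \<Longrightarrow> coproj C I X P \<iota> k \<cdot> gfinprod (hom_group C A P) (\<lambda>i. \<iota> i \<cdot> f i) I = f k"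
    and "\<exists>J\<subseteq>I. finite_sum C A P X \<iota> J (gfinprod (hom_group C A P) (\<lambda>i. \<iota> i \<cdot> f i) I)"
proof -
  interpret G: comm_group "hom_group C A P"
    using hom_comm_group[OF A coprod_obj[OF P]] .
  have X: "X i \<in> Obj C" if "i \<in> I" for i
    using hom_obj[OF coprod_inj[OF P that]] by simp
  have f': "f i \<in> Hom C A (X i)" if "i \<in> I" for i
    using sum_group_hom_group_carrier[of A I X f, OF A X] f that by auto
  \<comment> \<open>\<open>gfinprod\<close> multiplies over the indices with nontrivial value, so
    \<open>K\<close> is the support of \<open>\<iota> i \<cdot> f i\<close>. It lies in the support
    of \<open>f\<close> and is therefore finite.\<close>
  define K where "K = {i \<in> I. \<iota> i \<cdot> f i \<noteq> Null C A P}"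
  have "f i \<noteq> Null C A (X i)" if "i \<in> K" for i
    using that comp_null_right[OF coprod_inj[OF P] A] by (auto simp: K_def)
  then have "K \<subseteq> {i \<in> I. f i \<noteq> Null C A (X i)}"
    by (auto simp: K_def)
  moreover have "finite {i \<in> I. f i \<noteq> Null C A (X i)}"
    using sum_group_hom_group_carrier[of A I X f, OF A X] f by simp
  ultimately have K: "finite K" "K \<subseteq> I"
    using finite_subset by (auto simp: K_def)
  have eq: "gfinprod (hom_group C A P) (\<lambda>i. \<iota> i \<cdot> f i) I = finprod (hom_group C A P) (\<lambda>i. \<iota> i \<cdot> f i) K"
    using K(1) by (simp add: gfinprod_def K_def)
  note fs = finprod_finite_sum[OF P A K, of f, OF f']
  show "\<exists>J\<subseteq>I. finite_sum C A P X \<iota> J (gfinprod (hom_group C A P) (\<lambda>i. \<iota> i \<cdot> f i) I)"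
    using fs(1) K(2) eq by auto
  show "gfinprod (hom_group C A P) (\<lambda>i. \<iota> i \<cdot> f i) I \<in> Hom C A P"
    using finite_sum_hom[OF fs(1) P K(2) A] eq by simp
  assume k: "k \<in> I"
  have "f k = Null C A (X k)" if "k \<notin> K"
    using that k coproj_comp[OF P k k f'[OF k]] comp_null_right[OF coproj(1)[OF P k] A]
    by (simp add: K_def)
  then show "coproj C I X P \<iota> k \<cdot> gfinprod (hom_group C A P) (\<lambda>i. \<iota> i \<cdot> f i) I = f k"
    using fs(2)[OF _ k] eq by auto
qed

text \<open>Surjectivity of the comparison map is the finite sum property. Injectivity holds for
  every \<open>A\<close>, because the projections recover the components of a sum.\<close>

lemma is_compact_iff:
  fixes \<kappa> :: "'i rel"
  assumes \<kappa>: "uncountable_regular \<kappa>"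
  shows "is_compact \<kappa> C A \<longleftrightarrow> finsum_compact \<kappa> C A"
proof
  assume c: "is_compact \<kappa> C A"
  then have A: "A \<in> Obj C"
    by (simp add: is_compact_def)
  show "finsum_compact \<kappa> C A"
    unfolding finsum_compact_def
  proof (intro conjI A allI impI ballI)
    fix I :: "'i set" and X P \<iota> w
    assume P: "small \<kappa> I \<and> is_coproduct C I X P \<iota>" and w: "w \<in> Hom C A P"
    have "(\<lambda>f. gfinprod (hom_group C A P) (\<lambda>i. \<iota> i \<cdot> f i) I)
        \<in> iso (sum_group I (\<lambda>i. hom_group C A (X i))) (hom_group C A P)"
      using c P unfolding is_compact_def by blast
    then have "w \<in> (\<lambda>f. gfinprod (hom_group C A P) (\<lambda>i. \<iota> i \<cdot> f i) I) `
        carrier (sum_group I (\<lambda>i. hom_group C A (X i)))"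
      using w by (simp add: iso_def bij_betw_def)
    then obtain f where "f \<in> carrier (sum_group I (\<lambda>i. hom_group C A (X i)))"
      "w = gfinprod (hom_group C A P) (\<lambda>i. \<iota> i \<cdot> f i) I"
      by blast
    then show "\<exists>J\<subseteq>I. finite_sum C A P X \<iota> J w"
      using coproj_gfinprod(3)[of I X P \<iota> A f] P A by simp
  qed
next
  assume c: "finsum_compact \<kappa> C A"
  then have A: "A \<in> Obj C"
    by (simp add: finsum_compact_def)
  show "is_compact \<kappa> C A"
    unfolding is_compact_def
  proof (intro conjI A allI impI)
    fix I :: "'i set" and X P \<iota>
    assume "small \<kappa> I \<and> is_coproduct C I X P \<iota>"
    then have I: "small \<kappa> I" and P: "is_coproduct C I X P \<iota>"
      by auto
    let ?S = "sum_group I (\<lambda>i. hom_group C A (X i))"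
    let ?G = "\<lambda>f. gfinprod (hom_group C A P) (\<lambda>i. \<iota> i \<cdot> f i) I"
    have X: "X i \<in> Obj C" if "i \<in> I" for i
      using hom_obj[OF coprod_inj[OF P that]] by simp
    interpret G: comm_group "hom_group C A P"
      using hom_comm_group[OF A coprod_obj[OF P]] .
    have carr: "f \<in> carrier ?S \<longleftrightarrow> f \<in> (\<Pi>\<^sub>E i\<in>I. Hom C A (X i)) \<and> finite {i \<in> I. f i \<noteq> Null C A (X i)}" for f
      by (rule sum_group_hom_group_carrier[OF A X])
    have "?G \<in> hom ?S (hom_group C A P)"
    proof (rule G.hom_group_sum)
      fix i assume i: "i \<in> I"
      show "(\<cdot>) (\<iota> i) \<in> hom (hom_group C A (X i)) (hom_group C A P)"
        using comp_plus_left[OF _ _ coprod_inj[OF P i]] comp[OF _ coprod_inj[OF P i]] by (auto simp: hom_def)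
      show "group (hom_group C A (X i))"
        using hom_comm_group[OF A X[OF i]] comm_group.axioms(2) by blast
    qed
    moreover have "inj_on ?G (carrier ?S)"
    proof (rule inj_onI)
      fix f g assume fg: "f \<in> carrier ?S" "g \<in> carrier ?S" "?G f = ?G g"
      have "f i = g i" if "i \<in> I" for i
        using coproj_gfinprod(2)[OF P A fg(1) that] coproj_gfinprod(2)[OF P A fg(2) that] fg(3) by simp
      then show "f = g"
        using fg(1,2) unfolding carr by (auto intro: PiE_ext)
    qed
    moreover have "?G ` carrier ?S = Hom C A P"
    proof (intro equalityI subsetI)
      fix w assume w: "w \<in> Hom C A P"
      \<comment> \<open>The preimage of \<open>w\<close> is the family of its projections, almost
        all zero by compactness. It is restricted to \<open>I\<close> because the elements of
        \<open>sum_group\<close> are extensional functions.\<close>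
      define f where "f = (\<lambda>i\<in>I. coproj C I X P \<iota> i \<cdot> w)"
      have "{i \<in> I. f i \<noteq> Null C A (X i)} = {i \<in> I. coproj C I X P \<iota> i \<cdot> w \<noteq> Null C A (X i)}"
        by (auto simp: f_def)
      then have f: "f \<in> carrier ?S"
        using finsum_compact_coproj(1)[OF \<kappa> c I P w] comp[OF w coproj(1)[OF P]]
        unfolding carr by (auto simp: f_def)
      have "?G f = w"
        by (rule finsum_compact_coproj_eq[OF \<kappa> c I P coproj_gfinprod(1)[OF P A f] w])
          (use coproj_gfinprod(2)[OF P A f] in \<open>simp add: f_def\<close>)
      then show "w \<in> ?G ` carrier ?S"
        using f by blast
    qed (use coproj_gfinprod(1)[OF P A] in auto)
    ultimately show "?G \<in> iso ?S (hom_group C A P)"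
      by (simp add: iso_def bij_betw_def)
  qed
qed

end


subsection \<open>Additive functors and adjunctions\<close>

lemma additive_functorD:
  assumes "is_additive_functor C D F"
  shows "is_functor C D F"
    and "\<lbrakk>f \<in> Hom C X Y; g \<in> Hom C X Y\<rbrakk> \<Longrightarrow> ar F (Plus C f g) = Plus D (ar F f) (ar F g)"
  using assms by (auto simp: is_additive_functor_def)

lemma additive_functor_null:
  assumes "additive_category C" "additive_category D" "is_additive_functor C D F" "X \<in> Obj C" "Y \<in> Obj C"
  shows "ar F (Null C X Y) = Null D (ob F X) (ob F Y)"
proof -
  interpret C: additive_category C by fact
  interpret D: additive_category D by fact
  note n = C.null_hom[OF assms(4,5)]
  note h = is_functor_hom[OF additive_functorD(1)[OF assms(3)] n]
  have o: "ob F X \<in> Obj D" "ob F Y \<in> Obj D"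
    using D.hom_obj[OF h] by auto
  have "Plus D (ar F (Null C X Y)) (ar F (Null C X Y)) = Plus D (ar F (Null C X Y)) (Null D (ob F X) (ob F Y))"
    using additive_functorD(2)[OF assms(3) n n] C.plus_null[OF n n] D.plus_null[OF h h] by simp
  then show ?thesis
    using D.plus_left_cancel[OF h h D.null_hom[OF o]] by simp
qed

lemma additive_functor_neg:
  assumes "additive_category C" "additive_category D" "is_additive_functor C D F" "f \<in> Hom C X Y"
  shows "ar F (neg C f) = neg D (ar F f)"
proof -
  interpret C: additive_category C by fact
  interpret D: additive_category D by fact
  note nf = C.neg_hom[OF assms(4,4)] and F = additive_functorD(1)[OF assms(3)]
  have "Plus D (ar F f) (ar F (neg C f)) = Null D (ob F X) (ob F Y)"
    using additive_functorD(2)[OF assms(3,4) nf] C.plus_neg[OF assms(4,4)]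
      additive_functor_null[OF assms(1-3)] C.hom_obj[OF assms(4)] by simp
  then show ?thesis
    using D.neg_unique[OF is_functor_hom[OF F assms(4)] is_functor_hom[OF F nf]] by simp
qed

lemma additive_functor_zero:
  assumes "additive_category C" "additive_category D" "is_additive_functor C D F" "is_zero C Z"
  shows "is_zero D (ob F Z)"
proof -
  interpret C: additive_category C by fact
  interpret D: additive_category D by fact
  note F = additive_functorD(1)[OF assms(3)] and Z = C.is_zero_obj[OF assms(4)]
  have "Ident C Z = Null C Z Z"
    using assms(4) by (simp add: C.is_zero_iff)
  then show ?thesis
    using is_functor_ident[OF F Z] is_functor_ob[OF F Z] additive_functor_null[OF assms(1-3) Z Z]
    by (simp add: D.is_zero_iff)
qed

lemma coproj_functor:
  assumes "additive_category C" "additive_category D" "is_additive_functor C D F"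
    and P: "is_coproduct C I X P \<iota>"
    and Q: "is_coproduct D I (\<lambda>i. ob F (X i)) (ob F P) (\<lambda>i. ar F (\<iota> i))" and k: "k \<in> I"
  shows "coproj D I (\<lambda>i. ob F (X i)) (ob F P) (\<lambda>i. ar F (\<iota> i)) k = ar F (coproj C I X P \<iota> k)"
proof -
  interpret C: additive_category C by fact
  interpret D: additive_category D by fact
  note F = additive_functorD(1)[OF assms(3)] and c = C.coproj[OF P k]
  have X: "X j \<in> Obj C" if "j \<in> I" for j
    using C.hom_obj[OF C.coprod_inj[OF P that]] by simp
  show ?thesis
  proof (rule D.coproj_unique[OF Q k is_functor_hom[OF F c(1)]])
    fix j assume j: "j \<in> I"
    show "ar F (coproj C I X P \<iota> k) \<cdot>\<^bsub>D\<^esub> ar F (\<iota> j) =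
        (if j = k then Ident D (ob F (X k)) else Null D (ob F (X j)) (ob F (X k)))"
      using is_functor_comp[OF F C.coprod_inj[OF P j] c(1)] c(2)[OF j] is_functor_ident[OF F X[OF k]]
        additive_functor_null[OF assms(1-3) X[OF j] X[OF k]] by auto
  qed
qed

text \<open>Addition of parallel maps is expressible by coproducts: the sum of \<open>f\<close> and
  \<open>g\<close> is the map with these components into the coproduct of two copies of
  \<open>Y\<close>, followed by the codiagonal. Index sets of type \<open>bool set\<close> cover
  both the zero object and binary coproducts.\<close>

lemma is_additive_functorI:
  assumes "additive_category C" "additive_category D" and F: "is_functor C D F"
    and coprod: "\<And>(I :: bool set) X P \<iota>. is_coproduct C I X P \<iota>
      \<Longrightarrow> is_coproduct D I (\<lambda>i. ob F (X i)) (ob F P) (\<lambda>i. ar F (\<iota> i))"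
  shows "is_additive_functor C D F"
proof -
  interpret C: additive_category C by fact
  interpret D: additive_category D by fact
  have null: "ar F (Null C X Y) = Null D (ob F X) (ob F Y)" if o: "X \<in> Obj C" "Y \<in> Obj C" for X Y
  proof -
    obtain Z where Z: "is_zero C Z"
      using C.zero_object by blast
    note Zo = C.is_zero_obj[OF Z]
    have FZ: "is_zero D (ob F Z)"
      using D.coproduct_empty_zero[OF coprod[OF C.zero_coproduct_empty[OF Z]]] .
    note n1 = C.null_hom[OF o(1) Zo] and n2 = C.null_hom[OF Zo o(2)]
    have "ar F (Null C X Y) = ar F (Null C Z Y) \<cdot>\<^bsub>D\<^esub> ar F (Null C X Z)"
      using is_functor_comp[OF F n1 n2] C.comp_null_right[OF n2 o(1)] by simp
    also have "\<dots> = Null D (ob F Z) (ob F Y) \<cdot>\<^bsub>D\<^esub> ar F (Null C X Z)"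
      using D.hom_zero(1)[OF FZ is_functor_hom[OF F n2]] by simp
    also have "\<dots> = Null D (ob F X) (ob F Y)"
      by (rule D.comp_null_left[OF is_functor_hom[OF F n1] is_functor_ob[OF F o(2)]])
    finally show ?thesis .
  qed
  show ?thesis
    unfolding is_additive_functor_def
  proof (intro conjI F allI ballI)
    fix X Y f g assume f: "f \<in> Hom C X Y" and g: "g \<in> Hom C X Y"
    have o: "X \<in> Obj C" "Y \<in> Obj C"
      using C.hom_obj[OF f] by auto
    obtain P and \<iota> :: "bool \<Rightarrow> _" where "is_coproduct C UNIV (\<lambda>b. if b then Y else Y) P \<iota>"
      using C.binary_coproducts[OF o(2) o(2)] by blast
    then have P: "is_coproduct C UNIV (\<lambda>b. Y) P \<iota>"
      by simp
    note Q = coprod[OF P]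
    define p where "p = coproj C UNIV (\<lambda>b. Y) P \<iota>"
    have p: "p b \<in> Hom C P Y" "p b \<cdot>\<^bsub>C\<^esub> \<iota> c = (if c = b then Ident C Y else Null C Y Y)" for b c
      using C.coproj(1)[OF P, of b] C.coproj(2)[OF P, of b c] by (simp_all add: p_def)
    have i: "\<iota> b \<in> Hom C Y P" for b
      using C.coprod_inj[OF P] by simp
    have Fp: "ar F (p b) \<cdot>\<^bsub>D\<^esub> ar F (\<iota> c) = (if c = b then Ident D (ob F Y) else Null D (ob F Y) (ob F Y))" for b c
      using is_functor_comp[OF F i p(1)] p(2)[of b c] null[OF o(2,2)] is_functor_ident[OF F o(2)] by metis
    note id = C.ident[OF o(2)] and idF = D.ident[OF is_functor_ob[OF F o(2)]]
    \<comment> \<open>The sum of the two projections is the codiagonal: it restricts to the identity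
      along both injections. So does the sum of the images of the projections under
      \<open>F\<close>.\<close>
    have sum: "ar F (Plus C (p True) (p False)) = Plus D (ar F (p True)) (ar F (p False))"
    proof (rule D.coprod_unique[OF Q is_functor_hom[OF F C.plus_hom[OF p(1) p(1)]]
          D.plus_hom[OF is_functor_hom[OF F p(1)] is_functor_hom[OF F p(1)]]])
      fix b
      have "Plus C (p True) (p False) \<cdot>\<^bsub>C\<^esub> \<iota> b = Ident C Y"
        using C.comp_plus_right[OF i p(1) p(1)] C.plus_null[OF id id] C.null_plus[OF id id]
        by (simp add: p(2))
      moreover have "Plus D (ar F (p True)) (ar F (p False)) \<cdot>\<^bsub>D\<^esub> ar F (\<iota> b) = Ident D (ob F Y)"
        using D.comp_plus_right[OF is_functor_hom[OF F i] is_functor_hom[OF F p(1)] is_functor_hom[OF F p(1)]]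
          D.plus_null[OF idF idF] D.null_plus[OF idF idF]
        by (simp add: Fp)
      ultimately show "ar F (Plus C (p True) (p False)) \<cdot>\<^bsub>D\<^esub> ar F (\<iota> b)
          = Plus D (ar F (p True)) (ar F (p False)) \<cdot>\<^bsub>D\<^esub> ar F (\<iota> b)"
        using is_functor_comp[OF F i C.plus_hom[OF p(1) p(1)]] is_functor_ident[OF F o(2)] by metis
    qed
    \<comment> \<open>Adding up injections produces the map into \<open>P\<close> whose two
      projections are \<open>f\<close> and \<open>g\<close>.\<close>
    define k where "k = Plus C (\<iota> True \<cdot>\<^bsub>C\<^esub> f) (\<iota> False \<cdot>\<^bsub>C\<^esub> g)"
    note kf = C.comp[OF f i] and kg = C.comp[OF g i]
    have k: "k \<in> Hom C X P"
      using C.plus_hom[OF kf kg] by (simp add: k_def)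
    have kp: "p True \<cdot>\<^bsub>C\<^esub> k = f" "p False \<cdot>\<^bsub>C\<^esub> k = g"
      using C.comp_plus_left[OF kf kg p(1)] C.coproj_comp[OF P, of True True f X]
        C.coproj_comp[OF P, of True False g X] C.coproj_comp[OF P, of False True f X]
        C.coproj_comp[OF P, of False False g X] f g C.plus_null[OF f f] C.null_plus[OF g g]
      by (simp_all add: k_def p_def)
    have "Plus C f g = Plus C (p True) (p False) \<cdot>\<^bsub>C\<^esub> k"
      using C.comp_plus_right[OF k p(1) p(1)] kp by simp
    then have "ar F (Plus C f g) = Plus D (ar F (p True)) (ar F (p False)) \<cdot>\<^bsub>D\<^esub> ar F k"
      using is_functor_comp[OF F k C.plus_hom[OF p(1) p(1)]] sum by simp
    also have "\<dots> = Plus D (ar F f) (ar F g)"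
      using D.comp_plus_right[OF is_functor_hom[OF F k] is_functor_hom[OF F p(1)] is_functor_hom[OF F p(1)]]
        is_functor_comp[OF F k p(1)] kp by metis
    finally show "ar F (Plus C f g) = Plus D (ar F f) (ar F g)" .
  qed
qed

definition comp_functor ::
    "('p, 'n, 'q, 'k) fctr \<Rightarrow> ('o, 'm, 'p, 'n) fctr \<Rightarrow> ('o, 'm, 'q, 'k) fctr" where
  "comp_functor G F = \<lparr>ob = ob G \<circ> ob F, ar = ar G \<circ> ar F\<rparr>"

lemma comp_functor_simps [simp]:
  "ob (comp_functor G F) X = ob G (ob F X)" "ar (comp_functor G F) f = ar G (ar F f)"
  by (simp_all add: comp_functor_def)

lemma is_additive_functor_comp:
  assumes "is_additive_functor C D F" "is_additive_functor D E G"
  shows "is_additive_functor C E (comp_functor G F)"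
proof -
  have F: "is_functor C D F" and G: "is_functor D E G"
    using assms additive_functorD(1) by auto
  have "is_functor C E (comp_functor G F)"
    using is_functor_ob[OF F] is_functor_ob[OF G] is_functor_hom[OF F] is_functor_hom[OF G]
      is_functor_ident[OF F] is_functor_ident[OF G]
      is_functor_comp[OF F] is_functor_comp[OF G is_functor_hom[OF F] is_functor_hom[OF F]]
    by (simp add: is_functor_def)
  moreover have "ar (comp_functor G F) (Plus C f g) = Plus E (ar (comp_functor G F) f) (ar (comp_functor G F) g)"
    if "f \<in> Hom C X Y" "g \<in> Hom C X Y" for X Y f g
    using additive_functorD(2)[OF assms(1) that]
      additive_functorD(2)[OF assms(2) is_functor_hom[OF F that(1)] is_functor_hom[OF F that(2)]] by simp
  ultimately show ?thesis
    by (auto simp: is_additive_functor_def)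
qed

text \<open>An adjunction presented by its counit, transposition being
  \<open>g \<mapsto> e Y \<cdot> F g\<close>. The right adjoint is recorded as an object map, so
  that the internal hom fits in directly.\<close>

locale counit_adjunction = C: category C + D: category D
  for C :: "('o, 'm, 'y) cat_scheme" and D :: "('p, 'n, 'z) cat_scheme" +
  fixes F :: "('o, 'm, 'p, 'n) fctr" and R :: "'p \<Rightarrow> 'o" and e :: "'p \<Rightarrow> 'n"
  assumes left_functor: "is_functor C D F"
    and right_ob: "Y \<in> Obj D \<Longrightarrow> R Y \<in> Obj C"
    and counit: "Y \<in> Obj D \<Longrightarrow> e Y \<in> Hom D (ob F (R Y)) Y"
    and transpose_ex: "\<lbrakk>X \<in> Obj C; f \<in> Hom D (ob F X) Y\<rbrakk> \<Longrightarrow> \<exists>g\<in>Hom C X (R Y). e Y \<cdot>\<^bsub>D\<^esub> ar F g = f"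
    and transpose_unique: "\<lbrakk>Y \<in> Obj D; g \<in> Hom C X (R Y); h \<in> Hom C X (R Y);
        e Y \<cdot>\<^bsub>D\<^esub> ar F g = e Y \<cdot>\<^bsub>D\<^esub> ar F h\<rbrakk> \<Longrightarrow> g = h"
begin

lemma counit_comp:
  assumes "Y \<in> Obj D" "g \<in> Hom C X' (R Y)" "a \<in> Hom C X X'"
  shows "e Y \<cdot>\<^bsub>D\<^esub> ar F (g \<cdot>\<^bsub>C\<^esub> a) = (e Y \<cdot>\<^bsub>D\<^esub> ar F g) \<cdot>\<^bsub>D\<^esub> ar F a"
  using is_functor_comp[OF left_functor assms(3,2)] is_functor_hom[OF left_functor assms(2)]
    is_functor_hom[OF left_functor assms(3)] counit[OF assms(1)] by (simp add: in_hom)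

lemma transpose_hom:
  "\<lbrakk>Y \<in> Obj D; g \<in> Hom C X (R Y)\<rbrakk> \<Longrightarrow> e Y \<cdot>\<^bsub>D\<^esub> ar F g \<in> Hom D (ob F X) Y"
  using D.comp[OF is_functor_hom[OF left_functor] counit] .

lemma preserves_coproduct:
  assumes P: "is_coproduct C I X P \<iota>"
  shows "is_coproduct D I (\<lambda>i. ob F (X i)) (ob F P) (\<lambda>i. ar F (\<iota> i))"
proof (rule D.coproductI)
  note F = left_functor and i = C.coprod_inj[OF P]
  note Po = C.coprod_obj[OF P]
  show "ob F P \<in> Obj D"
    by (rule is_functor_ob[OF F Po])
  show "ar F (\<iota> j) \<in> Hom D (ob F (X j)) (ob F P)" if "j \<in> I" for j
    by (rule is_functor_hom[OF F i[OF that]])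
  fix Y f assume Y: "Y \<in> Obj D" and f: "\<And>j. j \<in> I \<Longrightarrow> f j \<in> Hom D (ob F (X j)) Y"
  have "\<exists>g\<in>Hom C (X j) (R Y). e Y \<cdot>\<^bsub>D\<^esub> ar F g = f j" if "j \<in> I" for j
    using transpose_ex[OF _ f[OF that]] C.hom_obj[OF i[OF that]] by blast
  then obtain g where g: "\<And>j. j \<in> I \<Longrightarrow> g j \<in> Hom C (X j) (R Y)"
      "\<And>j. j \<in> I \<Longrightarrow> e Y \<cdot>\<^bsub>D\<^esub> ar F (g j) = f j"
    by metis
  obtain h where h: "h \<in> Hom C P (R Y)" "\<forall>j\<in>I. h \<cdot>\<^bsub>C\<^esub> \<iota> j = g j"
    using C.coprod_ex[OF P right_ob[OF Y] g(1)] by blast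
  have "(e Y \<cdot>\<^bsub>D\<^esub> ar F h) \<cdot>\<^bsub>D\<^esub> ar F (\<iota> j) = f j" if "j \<in> I" for j
    using counit_comp[OF Y h(1) i[OF that]] h(2) g(2)[OF that] that by simp
  then show "\<exists>h\<in>Hom D (ob F P) Y. \<forall>j\<in>I. h \<cdot>\<^bsub>D\<^esub> ar F (\<iota> j) = f j"
    using transpose_hom[OF Y h(1)] by blast
next
  note F = left_functor and i = C.coprod_inj[OF P]
  note Po = C.coprod_obj[OF P]
  fix Y g h assume gh: "g \<in> Hom D (ob F P) Y" "h \<in> Hom D (ob F P) Y"
    and eq: "\<And>j. j \<in> I \<Longrightarrow> g \<cdot>\<^bsub>D\<^esub> ar F (\<iota> j) = h \<cdot>\<^bsub>D\<^esub> ar F (\<iota> j)"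
  have Y: "Y \<in> Obj D"
    using D.hom_obj[OF gh(1)] by simp
  obtain g' where g': "g' \<in> Hom C P (R Y)" "e Y \<cdot>\<^bsub>D\<^esub> ar F g' = g"
    using transpose_ex[OF Po gh(1)] by blast
  obtain h' where h': "h' \<in> Hom C P (R Y)" "e Y \<cdot>\<^bsub>D\<^esub> ar F h' = h"
    using transpose_ex[OF Po gh(2)] by blast
  have "g' = h'"
  proof (rule C.coprod_unique[OF P g'(1) h'(1)])
    fix j assume j: "j \<in> I"
    show "g' \<cdot>\<^bsub>C\<^esub> \<iota> j = h' \<cdot>\<^bsub>C\<^esub> \<iota> j"
      by (rule transpose_unique[OF Y C.comp[OF i[OF j] g'(1)] C.comp[OF i[OF j] h'(1)]])
        (simp add: counit_comp[OF Y g'(1) i[OF j]] counit_comp[OF Y h'(1) i[OF j]] g'(2) h'(2) eq[OF j])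
  qed
  then show "g = h"
    using g' h' by simp
qed

end

section \<open>Triangulated categories\<close>

context triangulated_category
begin

abbreviation SO where "SO \<equiv> ob (Susp C)"
abbreviation SA where "SA \<equiv> ar (Susp C)"

lemma additive: "additive_category C" ..

lemma susp_is_functor: "is_functor C C (Susp C)"
  using susp_functor additive_functorD(1) by blast

lemma susp_obj [simp]: "X \<in> Obj C \<Longrightarrow> SO X \<in> Obj C"
  by (rule is_functor_ob[OF susp_is_functor])

lemma susp_hom: "f \<in> Hom C X Y \<Longrightarrow> SA f \<in> Hom C (SO X) (SO Y)"
  by (rule is_functor_hom[OF susp_is_functor])

lemma susp_comp: "\<lbrakk>f \<in> Hom C X Y; g \<in> Hom C Y Z\<rbrakk> \<Longrightarrow> SA (g \<cdot> f) = SA g \<cdot> SA f"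
  by (rule is_functor_comp[OF susp_is_functor])

lemma susp_null: "\<lbrakk>X \<in> Obj C; Y \<in> Obj C\<rbrakk> \<Longrightarrow> SA (Null C X Y) = Null C (SO X) (SO Y)"
  by (rule additive_functor_null[OF additive additive susp_functor])

lemma susp_neg: "f \<in> Hom C X Y \<Longrightarrow> SA (neg C f) = neg C (SA f)"
  by (rule additive_functor_neg[OF additive additive susp_functor])

lemma susp_zero: "is_zero C Z \<Longrightarrow> is_zero C (SO Z)"
  by (rule additive_functor_zero[OF additive additive susp_functor])

lemma susp_Isos: "f \<in> Isos C X Y \<Longrightarrow> SA f \<in> Isos C (SO X) (SO Y)"
  by (rule is_functor_Isos[OF category_axioms category_axioms susp_is_functor])

lemma susp_ob_inj: "\<lbrakk>X \<in> Obj C; Y \<in> Obj C; SO X = SO Y\<rbrakk> \<Longrightarrow> X = Y"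
  using susp_automorphism(1) by (meson bij_betw_imp_inj_on inj_onD)

lemma susp_inj: "\<lbrakk>f \<in> Hom C X Y; g \<in> Hom C X' Y'; SA f = SA g\<rbrakk> \<Longrightarrow> f = g"
  using susp_automorphism(2) unfolding in_hom by (meson bij_betw_imp_inj_on inj_onD)

lemma desusp_ob:
  assumes "Y \<in> Obj C"
  obtains X where "X \<in> Obj C" "SO X = Y"
proof -
  have "Y \<in> SO ` Obj C"
    using assms bij_betw_imp_surj_on[OF susp_automorphism(1)] by simp
  then show ?thesis
    using that by blast
qed

lemma desusp_hom:
  assumes "g \<in> Hom C (SO X) (SO Y)" "X \<in> Obj C" "Y \<in> Obj C"
  obtains f where "f \<in> Hom C X Y" "SA f = g"
proof -
  have "g \<in> SA ` Arr C"
    using assms(1) bij_betw_imp_surj_on[OF susp_automorphism(2)] by (simp add: in_hom)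
  then obtain f where f: "f \<in> Arr C" "SA f = g"
    by blast
  have "SA f \<in> Hom C (SO (Dom C f)) (SO (Cod C f))"
    using susp_hom[of f "Dom C f" "Cod C f"] f(1) by (simp add: in_hom)
  then have "Dom C f = X" "Cod C f = Y"
    using f assms by (auto simp: in_hom intro: susp_ob_inj)
  then show ?thesis
    using that f by (simp add: in_hom)
qed

lemma susp_zero_iff: "X \<in> Obj C \<Longrightarrow> is_zero C (SO X) \<longleftrightarrow> is_zero C X"
proof
  assume X: "X \<in> Obj C" and z: "is_zero C (SO X)"
  have "SA (Ident C X) = SA (Null C X X)"
    using is_functor_ident[OF susp_is_functor X] susp_null[OF X X] z by (simp add: is_zero_iff)
  then have "Ident C X = Null C X X"
    using susp_inj[OF ident[OF X] null_hom[OF X X]] by simp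
  then show "is_zero C X"
    using X by (simp add: is_zero_iff)
qed (rule susp_zero)

lemma susp_Isos_reflect:
  assumes "SA f \<in> Isos C (SO X) (SO Y)" "f \<in> Hom C X Y"
  shows "f \<in> Isos C X Y"
proof -
  have o: "X \<in> Obj C" "Y \<in> Obj C"
    using hom_obj[OF assms(2)] by auto
  obtain g' where g': "g' \<in> Hom C (SO Y) (SO X)" "g' \<cdot> SA f = Ident C (SO X)" "SA f \<cdot> g' = Ident C (SO Y)"
    using assms(1) by (rule IsosE)
  obtain g where g: "g \<in> Hom C Y X" "SA g = g'"
    using desusp_hom[OF g'(1) o(2,1)] .
  have "SA (g \<cdot> f) = SA (Ident C X)" "SA (f \<cdot> g) = SA (Ident C Y)"
    using susp_comp[OF assms(2) g(1)] susp_comp[OF g(1) assms(2)] g(2) g'(2,3)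
      is_functor_ident[OF susp_is_functor] o by simp_all
  then show ?thesis
    using IsosI[OF assms(2) g(1)] susp_inj[OF comp[OF assms(2) g(1)] ident[OF o(1)]]
      susp_inj[OF comp[OF g(1) assms(2)] ident[OF o(2)]] by simp
qed

lemma iso_desusp:
  assumes "e \<in> Isos C (SO X) (SO Y)" "X \<in> Obj C" "Y \<in> Obj C"
  shows "\<exists>e. e \<in> Isos C X Y"
proof -
  obtain f where "f \<in> Hom C X Y" "SA f = e"
    using desusp_hom[OF Isos_hom[OF assms(1)] assms(2,3)] .
  then show ?thesis
    using susp_Isos_reflect assms(1) by blast
qed

text \<open>Suspension is bijective on objects and on arrows, so test objects, families and induced
  maps can be carried over in both directions.\<close>

lemma coproduct_susp:
  assumes "P \<in> Obj C" "\<And>i. i \<in> I \<Longrightarrow> \<iota> i \<in> Hom C (X i) P"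
  shows "is_coproduct C I (\<lambda>i. SO (X i)) (SO P) (\<lambda>i. SA (\<iota> i)) \<longleftrightarrow> is_coproduct C I X P \<iota>"
    (is "?S \<longleftrightarrow> ?P")
proof
  assume P: ?P
  note i = assms(2)
  show ?S
  proof (rule coproductI)
    fix Y f assume Y: "Y \<in> Obj C" and f: "\<And>j. j \<in> I \<Longrightarrow> f j \<in> Hom C (SO (X j)) Y"
    obtain Y' where Y': "Y' \<in> Obj C" "SO Y' = Y"
      using desusp_ob[OF Y] .
    have "\<exists>g\<in>Hom C (X j) Y'. SA g = f j" if "j \<in> I" for j
      using desusp_hom[of "f j" "X j" Y'] f[OF that] Y' hom_obj[OF i[OF that]] by metis
    then obtain g where g: "\<And>j. j \<in> I \<Longrightarrow> g j \<in> Hom C (X j) Y'" "\<And>j. j \<in> I \<Longrightarrow> SA (g j) = f j"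
      by metis
    obtain h where h: "h \<in> Hom C P Y'" "\<forall>j\<in>I. h \<cdot> \<iota> j = g j"
      using coprod_ex[OF P Y'(1) g(1)] by blast
    have "SA h \<cdot> SA (\<iota> j) = f j" if "j \<in> I" for j
      using susp_comp[OF i[OF that] h(1)] h(2) g(2) that by simp
    then show "\<exists>h\<in>Hom C (SO P) Y. \<forall>j\<in>I. h \<cdot> SA (\<iota> j) = f j"
      using susp_hom[OF h(1)] Y'(2) by auto
  next
    fix Y g h assume gh: "g \<in> Hom C (SO P) Y" "h \<in> Hom C (SO P) Y"
      and eq: "\<And>j. j \<in> I \<Longrightarrow> g \<cdot> SA (\<iota> j) = h \<cdot> SA (\<iota> j)"
    have "Y \<in> Obj C"
      using hom_obj[OF gh(1)] by simp
    then obtain Y' where Y': "Y' \<in> Obj C" "SO Y' = Y"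
      using desusp_ob by blast
    obtain g' where g': "g' \<in> Hom C P Y'" "SA g' = g"
      using desusp_hom[of g P Y'] gh(1) Y' assms(1) by blast
    obtain h' where h': "h' \<in> Hom C P Y'" "SA h' = h"
      using desusp_hom[of h P Y'] gh(2) Y' assms(1) by blast
    have "g' = h'"
    proof (rule coprod_unique[OF P g'(1) h'(1)])
      fix j assume j: "j \<in> I"
      have "SA (g' \<cdot> \<iota> j) = SA (h' \<cdot> \<iota> j)"
        using eq[OF j] susp_comp[OF i[OF j] g'(1)] susp_comp[OF i[OF j] h'(1)] g'(2) h'(2) by simp
      then show "g' \<cdot> \<iota> j = h' \<cdot> \<iota> j"
        using susp_inj[OF comp[OF i[OF j] g'(1)] comp[OF i[OF j] h'(1)]] by simp
    qed
    then show "g = h"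
      using g' h' by simp
  qed (use assms susp_hom in auto)
next
  assume S: ?S
  note i = assms(2)
  show ?P
  proof (rule coproductI)
    fix Y f assume Y: "Y \<in> Obj C" and f: "\<And>j. j \<in> I \<Longrightarrow> f j \<in> Hom C (X j) Y"
    obtain h where h: "h \<in> Hom C (SO P) (SO Y)" "\<forall>j\<in>I. h \<cdot> SA (\<iota> j) = SA (f j)"
      using coprod_ex[OF S susp_obj[OF Y] susp_hom[OF f]] by blast
    obtain h' where h': "h' \<in> Hom C P Y" "SA h' = h"
      using desusp_hom[OF h(1) assms(1) Y] .
    have "h' \<cdot> \<iota> j = f j" if "j \<in> I" for j
      using susp_inj[OF comp[OF i[OF that] h'(1)] f[OF that]] susp_comp[OF i[OF that] h'(1)] h(2) h'(2) that
      by simp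
    then show "\<exists>h\<in>Hom C P Y. \<forall>j\<in>I. h \<cdot> \<iota> j = f j"
      using h'(1) by blast
  next
    fix Y g h assume gh: "g \<in> Hom C P Y" "h \<in> Hom C P Y" and eq: "\<And>j. j \<in> I \<Longrightarrow> g \<cdot> \<iota> j = h \<cdot> \<iota> j"
    have "SA g = SA h"
      by (rule coprod_unique[OF S susp_hom[OF gh(1)] susp_hom[OF gh(2)]])
        (simp add: eq flip: susp_comp[OF i gh(1)] susp_comp[OF i gh(2)])
    then show "g = h"
      using susp_inj gh by blast
  qed (use assms in auto)
qed

lemma desusp_coproduct:
  assumes P: "is_coproduct C I X P \<iota>"
  obtains X' P' \<iota>' where "is_coproduct C I X' P' \<iota>'" "SO P' = P" "\<And>i. i \<in> I \<Longrightarrow> SO (X' i) = X i"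
    "\<And>i. i \<in> I \<Longrightarrow> SA (\<iota>' i) = \<iota> i"
proof -
  obtain P' where P': "P' \<in> Obj C" "SO P' = P"
    using desusp_ob[OF coprod_obj[OF P]] .
  have "\<exists>X'. X' \<in> Obj C \<and> SO X' = X i" if "i \<in> I" for i
    using desusp_ob hom_obj[OF coprod_inj[OF P that]] by metis
  then obtain X' where X': "\<And>i. i \<in> I \<Longrightarrow> X' i \<in> Obj C" "\<And>i. i \<in> I \<Longrightarrow> SO (X' i) = X i"
    by metis
  have "\<exists>k\<in>Hom C (X' i) P'. SA k = \<iota> i" if "i \<in> I" for i
    using desusp_hom[of "\<iota> i" "X' i" P'] coprod_inj[OF P that] X'[OF that] P' by metis
  then obtain \<iota>' where i': "\<And>i. i \<in> I \<Longrightarrow> \<iota>' i \<in> Hom C (X' i) P'" "\<And>i. i \<in> I \<Longrightarrow> SA (\<iota>' i) = \<iota> i"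
    by metis
  have "is_coproduct C I (\<lambda>i. SO (X' i)) (SO P') (\<lambda>i. SA (\<iota>' i))"
    using P X'(2) i'(2) P'(2) unfolding is_coproduct_def by simp
  then have "is_coproduct C I X' P' \<iota>'"
    using coproduct_susp[of P' I \<iota>' X', OF P'(1) i'(1)] by simp
  then show ?thesis
    using that P'(2) X'(2) i'(2) by blast
qed

text \<open>A map \<open>SO A \<rightarrow> P\<close> is desuspended together with the coproduct
  \<open>P\<close>, and the resulting finite sum is suspended again. The converse suspends first and
  desuspends the sum.\<close>

lemma finsum_compact_susp:
  fixes \<kappa> :: "'i rel"
  assumes A: "A \<in> Obj C"
  shows "finsum_compact \<kappa> C (SO A) \<longleftrightarrow> finsum_compact \<kappa> C A"
proof
  assume c: "finsum_compact \<kappa> C A"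
  show "finsum_compact \<kappa> C (SO A)"
    unfolding finsum_compact_def
  proof (intro conjI susp_obj[OF A] allI impI ballI)
    fix I :: "'i set" and X P \<iota> w
    assume "small \<kappa> I \<and> is_coproduct C I X P \<iota>" and w: "w \<in> Hom C (SO A) P"
    then have I: "small \<kappa> I" and P: "is_coproduct C I X P \<iota>"
      by auto
    obtain X' P' \<iota>' where P': "is_coproduct C I X' P' \<iota>'" "SO P' = P" "\<And>i. i \<in> I \<Longrightarrow> SO (X' i) = X i"
        "\<And>i. i \<in> I \<Longrightarrow> SA (\<iota>' i) = \<iota> i"
      using desusp_coproduct[OF P] by blast
    note P'o = coprod_obj[OF P'(1)] and i = coprod_inj[OF P'(1)]
    obtain w' where w': "w' \<in> Hom C A P'" "SA w' = w"
      using desusp_hom[of w A P'] w A P'o P'(2) by blast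
    obtain J where J: "J \<subseteq> I" "finite_sum C A P' X' \<iota>' J w'"
      using finsum_compactD[OF c I P'(1) w'(1)] by blast
    have "finite_sum C (SO A) P X \<iota> J (SA w')"
    proof (rule finite_sum_map[OF J(2) P'(1) J(1) A, where t' = "\<lambda>_. SA"])
      show "SA (Null C A P') = Null C (SO A) P"
        using susp_null[OF A P'o] P'(2) by simp
      fix w j a assume w: "w \<in> Hom C A P'" and j: "j \<in> I" and a: "a \<in> Hom C A (X' j)"
      show "SA (Plus C w (\<iota>' j \<cdot> a)) = Plus C (SA w) (\<iota> j \<cdot> SA a) \<and> SA a \<in> Hom C (SO A) (X j)"
        using additive_functorD(2)[OF susp_functor w comp[OF a i[OF j]]] susp_comp[OF a i[OF j]]
          P'(3,4)[OF j] susp_hom[OF a] by simp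
    qed
    then show "\<exists>J\<subseteq>I. finite_sum C (SO A) P X \<iota> J w"
      using J(1) w'(2) by blast
  qed
next
  assume c: "finsum_compact \<kappa> C (SO A)"
  show "finsum_compact \<kappa> C A"
    unfolding finsum_compact_def
  proof (intro conjI A allI impI ballI)
    fix I :: "'i set" and X P \<iota> w
    assume "small \<kappa> I \<and> is_coproduct C I X P \<iota>" and w: "w \<in> Hom C A P"
    then have I: "small \<kappa> I" and P: "is_coproduct C I X P \<iota>"
      by auto
    note Po = coprod_obj[OF P] and i = coprod_inj[OF P]
    have S: "is_coproduct C I (\<lambda>i. SO (X i)) (SO P) (\<lambda>i. SA (\<iota> i))"
      using P coproduct_susp[of P I \<iota> X, OF Po i] by simp
    obtain J where J: "J \<subseteq> I" "finite_sum C (SO A) (SO P) (\<lambda>i. SO (X i)) (\<lambda>i. SA (\<iota> i)) J (SA w)"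
      using finsum_compactD[OF c I S susp_hom[OF w]] by blast
    \<comment> \<open>Desuspension of arrows, in the form of a map on Hom sets along which
      \<open>finite_sum_map\<close> can carry the sum.\<close>
    let ?t = "inv_into (Arr C) SA"
    have t: "?t (SA f) = f" if "f \<in> Hom C Y Z" for f Y Z
      using that bij_betw_imp_inj_on[OF susp_automorphism(2)] by (simp add: in_hom)
    have "finite_sum C A P X \<iota> J (?t (SA w))"
    proof (rule finite_sum_map[OF J(2) S J(1) susp_obj[OF A], where t' = "\<lambda>_. ?t"])
      show "?t (Null C (SO A) (SO P)) = Null C A P"
        using susp_null[OF A Po] t[OF null_hom[OF A Po]] by simp
      fix w j a assume "w \<in> Hom C (SO A) (SO P)" and j: "j \<in> I" and "a \<in> Hom C (SO A) (SO (X j))"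
      then obtain w' a' where w': "w' \<in> Hom C A P" "SA w' = w" and a': "a' \<in> Hom C A (X j)" "SA a' = a"
        using desusp_hom A Po hom_obj[OF i[OF j]] by metis
      note ia = comp[OF a'(1) i[OF j]]
      have "Plus C w (SA (\<iota> j) \<cdot> a) = SA (Plus C w' (\<iota> j \<cdot> a'))"
        using additive_functorD(2)[OF susp_functor w'(1) ia] susp_comp[OF a'(1) i[OF j]] w'(2) a'(2) by simp
      then show "?t (Plus C w (SA (\<iota> j) \<cdot> a)) = Plus C (?t w) (\<iota> j \<cdot> ?t a) \<and> ?t a \<in> Hom C A (X j)"
        using t[OF w'(1)] t[OF a'(1)] t[OF plus_hom[OF w'(1) ia]] w' a' by simp
    qed
    then show "\<exists>J\<subseteq>I. finite_sum C A P X \<iota> J w"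
      using J(1) t[OF w] by auto
  qed
qed

subsection \<open>Shifts\<close>

lemma desusp_simps:
  assumes "X \<in> Obj C"
  shows "ob (Desusp C) X \<in> Obj C" "SO (ob (Desusp C) X) = X"
  using assms bij_betw_imp_surj_on[OF susp_automorphism(1)]
  by (simp_all add: Desusp_def inv_into_into f_inv_into_f)

lemma shift_obj [simp]: "X \<in> Obj C \<Longrightarrow> ob (shift C n) X \<in> Obj C"
proof -
  assume X: "X \<in> Obj C"
  have "(SO ^^ k) X \<in> Obj C" "(ob (Desusp C) ^^ k) X \<in> Obj C" for k
    by (induction k) (simp_all add: X desusp_simps(1))
  then show ?thesis
    by (simp add: shift_def)
qed

lemma shift_0 [simp]: "ob (shift C 0) X = X"
  by (simp add: shift_def)

text \<open>\<open>shift\<close> is defined by cases on the sign. This single rule covers both, so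
  that statements on shifts can be proved by induction over the integers in both directions.\<close>

lemma shift_succ:
  assumes "X \<in> Obj C"
  shows "ob (shift C (n + 1)) X = SO (ob (shift C n) X)"
proof (cases "0 \<le> n")
  case True
  then have "nat (n + 1) = Suc (nat n)"
    by simp
  then show ?thesis
    using True by (simp add: shift_def)
next
  case False
  then have n: "nat (- n) = Suc (nat (- (n + 1)))"
    by simp
  have "ob (shift C (n + 1)) X = (ob (Desusp C) ^^ nat (- (n + 1))) X"
    using False by (simp add: shift_def)
  then have "ob (shift C n) X = ob (Desusp C) (ob (shift C (n + 1)) X)"
    using False n by (simp add: shift_def)
  then show ?thesis
    using desusp_simps(2)[OF shift_obj[OF assms]] by simp
qed

lemma shift_iso:
  assumes "e \<in> Isos C X Y"
  shows "\<exists>e. e \<in> Isos C (ob (shift C n) X) (ob (shift C n) Y)"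
proof -
  have o: "X \<in> Obj C" "Y \<in> Obj C"
    using hom_obj[OF Isos_hom[OF assms]] by auto
  show ?thesis
  proof (induction n rule: int_induct[where k = 0])
    case base
    then show ?case
      using assms by auto
  next
    case (step1 i)
    then show ?case
      using susp_Isos shift_succ o by metis
  next
    case (step2 i)
    then show ?case
      using iso_desusp[of _ "ob (shift C (i - 1)) X" "ob (shift C (i - 1)) Y"]
        shift_succ[OF o(1), of "i - 1"] shift_succ[OF o(2), of "i - 1"] o by auto
  qed
qed

lemma finsum_compact_shift:
  assumes "finsum_compact \<kappa> C A"
  shows "finsum_compact \<kappa> C (ob (shift C n) A)"
proof -
  have A: "A \<in> Obj C"
    using assms by (simp add: finsum_compact_def)
  show ?thesis
  proof (induction n rule: int_induct[where k = 0])
    case base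
    then show ?case
      using assms by simp
  next
    case (step1 i)
    then show ?case
      using finsum_compact_susp[OF shift_obj[OF A], of \<kappa> i] shift_succ[OF A] by simp
  next
    case (step2 i)
    then show ?case
      using finsum_compact_susp[OF shift_obj[OF A], of \<kappa> "i - 1"] shift_succ[OF A, of "i - 1"] by simp
  qed
qed

end

subsection \<open>Exactness\<close>

context triangulated_category
begin

lemma triD:
  assumes "is_triangle C X Y Z f g h"
  shows "f \<in> Hom C X Y" "g \<in> Hom C Y Z" "h \<in> Hom C Z (SO X)"
    "X \<in> Obj C" "Y \<in> Obj C" "Z \<in> Obj C"
  using assms hom_obj by (auto simp: is_triangle_def is_diagram_def)

lemma tri_rot:
  "is_triangle C X Y Z f g h \<Longrightarrow> is_triangle C Y Z (SO X) g h (neg C (SA f))"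
  using tri_rotate unfolding is_triangle_def by blast

text \<open>Rotation turns \<open>k\<close> into \<open>neg C (SA k)\<close>. Choosing
  \<open>SA k = neg C h\<close> makes the two signs cancel and returns \<open>h\<close>.\<close>

lemma tri_unrot:
  assumes "is_triangle C X Y Z f g h"
  obtains W k where "SO W = Z" "SA k = neg C h" "is_triangle C W X Y k f g"
proof -
  note t = triD[OF assms]
  obtain W where W: "W \<in> Obj C" "SO W = Z"
    using desusp_ob[OF t(6)] .
  obtain k where k: "k \<in> Hom C W X" "SA k = neg C h"
    using desusp_hom[of "neg C h" W X] neg_hom[OF t(3,3)] W t(4) by blast
  have "is_diagram C W X Y k f g"
    using k(1) t W(2) by (simp add: is_diagram_def)
  then have "is_triangle C W X Y k f g"
    using tri_rotate[of W X Y k f g] assms W(2) k(2) neg_neg[OF t(3)] by simp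
  then show ?thesis
    using that W(2) k(2) by blast
qed

lemma zero_triangle:
  assumes "X \<in> Obj C" "is_zero C Z"
  shows "is_triangle C X Z (SO X) (Null C X Z) (Null C Z (SO X)) (neg C (Ident C (SO X)))"
  using tri_rot[OF tri_ident[OF assms]] is_functor_ident[OF susp_is_functor assms(1)] by simp

text \<open>The identity triangle on \<open>X\<close> maps to the given triangle by
  \<open>Ident C X\<close> and \<open>f\<close>. The third component shows that
  \<open>g \<cdot> f\<close> factors through a zero object.\<close>

lemma tri_comp_null:
  assumes "is_triangle C X Y Z f g h"
  shows "g \<cdot> f = Null C X Z"
proof -
  note t = triD[OF assms]
  obtain O' where O': "is_zero C O'"
    using zero_object by blast
  obtain c where c: "c \<in> Hom C O' Z" "c \<cdot> Null C X O' = g \<cdot> f"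
    using tri_fill[OF tri_ident[OF t(4) O'] assms ident[OF t(4)] t(1)] by auto
  then show ?thesis
    using comp_null_right[OF c(1) t(4)] by simp
qed

text \<open>Fill a map from the triangle \<open>A \<rightarrow> 0 \<rightarrow> SO A\<close> to the
  rotated triangle that starts at \<open>Y\<close>, with first component \<open>a\<close>. The third
  component goes from \<open>SO A\<close> to \<open>SO X\<close>, and its desuspension is the lift;
  both triangles end in a negated arrow, so the signs cancel.\<close>

lemma exact_hom:
  assumes "is_triangle C X Y Z f g h" "a \<in> Hom C A Y" "g \<cdot> a = Null C A Z"
  shows "\<exists>b\<in>Hom C A X. f \<cdot> b = a"
proof -
  note t = triD[OF assms(1)]
  have A: "A \<in> Obj C"
    using hom_obj[OF assms(2)] by simp
  obtain O' where O': "is_zero C O'"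
    using zero_object by blast
  note o = is_zero_obj[OF O']
  have "Null C O' Z \<cdot> Null C A O' = g \<cdot> a"
    using assms(3) comp_null_right[OF null_hom[OF o t(6)] A] by simp
  then obtain c where c: "c \<in> Hom C (SO A) (SO X)"
      "SA a \<cdot> neg C (Ident C (SO A)) = neg C (SA f) \<cdot> c"
    using tri_fill[OF zero_triangle[OF A O'] tri_rot[OF assms(1)] assms(2) null_hom[OF o t(6)]] by auto
  obtain b where b: "b \<in> Hom C A X" "SA b = c"
    using desusp_hom[OF c(1) A t(4)] .
  note Sa = susp_hom[OF assms(2)] and Sf = susp_hom[OF t(1)]
  have "neg C (SA a) = neg C (SA f \<cdot> SA b)"
    using c(2) comp_neg(1)[OF ident[OF susp_obj[OF A]] Sa] comp_neg(2)[OF c(1) Sf] b(2)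
      comp_ident_right[OF Sa] by simp
  then have "SA a = SA (f \<cdot> b)"
    using neg_neg[OF Sa] neg_neg[OF comp[OF c(1) Sf]] b(2) susp_comp[OF b(1) t(1)] by metis
  then have "f \<cdot> b = a"
    using susp_inj[OF assms(2) comp[OF b(1) t(1)]] by simp
  then show ?thesis
    using b(1) by blast
qed

text \<open>The dual argument maps the given triangle to
  \<open>V \<rightarrow> W \<rightarrow> W\<close> with \<open>V\<close> zero, obtained by turning
  back the identity triangle of \<open>W\<close>.\<close>

lemma exact_cohom:
  assumes "is_triangle C X Y Z f g h" "c \<in> Hom C Y W" "c \<cdot> f = Null C X W"
  shows "\<exists>d\<in>Hom C Z W. d \<cdot> g = c"
proof -
  note t = triD[OF assms(1)]
  have W: "W \<in> Obj C"
    using hom_obj[OF assms(2)] by simp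
  obtain O' where O': "is_zero C O'"
    using zero_object by blast
  note o = is_zero_obj[OF O']
  obtain V k where V: "SO V = O'" "is_triangle C V W W k (Ident C W) (Null C W O')"
    using tri_unrot[OF tri_ident[OF W O']] by blast
  note v = triD[OF V(2)]
  have "is_zero C V"
    using O' V(1) susp_zero_iff[OF v(4)] by simp
  then have "k = Null C V W"
    using hom_zero(1) v(1) by blast
  then have "c \<cdot> f = k \<cdot> Null C X V"
    using assms(3) comp_null_right[OF v(1) t(4)] by simp
  then obtain d where "d \<in> Hom C Z W" "d \<cdot> g = Ident C W \<cdot> c"
    using tri_fill[OF assms(1) V(2) null_hom[OF t(4) v(4)] assms(2)] by blast
  then show ?thesis
    using comp_ident_left[OF assms(2)] by auto
qed

text \<open>By exactness \<open>f\<close> is bijective on all Hom sets into its source and target: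
  vanishing of \<open>Z\<close> gives surjectivity and vanishing of its desuspension
  \<open>V\<close> gives injectivity.\<close>

lemma tri_iso_of_zero:
  assumes "is_triangle C X Y Z f g h" "is_zero C Z"
  shows "f \<in> Isos C X Y"
proof (rule Isos_by_hom)
  note t = triD[OF assms(1)]
  show "f \<in> Hom C X Y"
    by (rule t(1))
  obtain V k where V: "SO V = Z" "is_triangle C V X Y k f g"
    using tri_unrot[OF assms(1)] by blast
  note v = triD[OF V(2)]
  have V0: "is_zero C V"
    using assms(2) V(1) susp_zero_iff[OF v(4)] by simp
  fix W assume W: "W \<in> Obj C"
  show "bij_betw ((\<cdot>) f) (Hom C W X) (Hom C W Y)"
    unfolding bij_betw_def
  proof (intro conjI inj_onI equalityI subsetI)
    fix a b assume ab: "a \<in> Hom C W X" "b \<in> Hom C W X" "f \<cdot> a = f \<cdot> b"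
    note nb = neg_hom[OF ab(2,2)] and fb = comp[OF ab(2) t(1)]
    have "f \<cdot> Plus C a (neg C b) = Null C W Y"
      using comp_plus_left[OF ab(1) nb t(1)] comp_neg(1)[OF ab(2) t(1)] ab(3) plus_neg[OF fb fb] by simp
    then obtain d where d: "d \<in> Hom C W V" "k \<cdot> d = Plus C a (neg C b)"
      using exact_hom[OF V(2) plus_hom[OF ab(1) nb]] by blast
    have "d = Null C W V"
      using hom_zero(2)[OF V0 d(1)] .
    then have "Plus C a (neg C b) = Null C W X"
      using d(2) comp_null_right[OF v(1) W] by simp
    then show "a = b"
      by (rule diff_null[OF ab(1,2)])
  next
    fix a assume a: "a \<in> Hom C W Y"
    have "g \<cdot> a = Null C W Z"
      by (rule hom_zero(2)[OF assms(2) comp[OF a t(2)]])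
    then show "a \<in> (\<cdot>) f ` Hom C W X"
      using exact_hom[OF assms(1) a] by blast
  qed (use comp[OF _ t(1)] in auto)
qed

lemma tri_iso_of_zero':
  assumes "is_triangle C X Y Z f g h" "is_zero C X"
  shows "g \<in> Isos C Y Z"
  using tri_iso_of_zero[OF tri_rot[OF assms(1)] susp_zero[OF assms(2)]] .

lemma tri_complete_left:
  assumes "g \<in> Hom C Y Z"
  obtains X f h where "is_triangle C X Y Z f g h"
proof -
  obtain W u v where "is_triangle C Y Z W g u v"
    using tri_complete[OF assms] by blast
  then show ?thesis
    using tri_unrot that by blast
qed

lemma tri_complete_mid:
  assumes "h \<in> Hom C Z (SO X)" "X \<in> Obj C"
  obtains Y f g where "is_triangle C X Y Z f g h"
proof -
  obtain Y g k where g: "is_triangle C Y Z (SO X) g h k"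
    using tri_complete_left[OF assms(1)] .
  obtain W l where l: "SO W = SO X" "is_triangle C W Y Z l g h"
    using tri_unrot[OF g] by blast
  have "W = X"
    using susp_ob_inj[OF triD(4)[OF l(2)] assms(2) l(1)] .
  then show ?thesis
    using that l(2) by blast
qed

section \<open>Isomorphisms detected on generators and on compact objects\<close>

lemma shift_pred:
  assumes "X \<in> Obj C"
  shows "SO (ob (shift C (n - 1)) X) = ob (shift C n) X"
  using shift_succ[OF assms, of "n - 1"] by simp

text \<open>The cone \<open>Z\<close> of \<open>f\<close> receives only zero maps from shifts of
  generators. For such a map \<open>a\<close>, injectivity one shift lower shows
  \<open>h \<cdot> a\<close> to be zero; then \<open>a\<close> lifts to \<open>Y\<close>, further to
  \<open>X\<close> by surjectivity, and \<open>g \<cdot> f\<close> is zero.\<close>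

lemma iso_by_generators:
  assumes f: "f \<in> Hom C X Y" and obj: "\<And>A. A \<in> \<G> \<Longrightarrow> A \<in> Obj C"
    and gen: "\<And>Z. \<lbrakk>Z \<in> Obj C; \<forall>A\<in>\<G>. \<forall>n. Hom C (ob (shift C n) A) Z = {Null C (ob (shift C n) A) Z}\<rbrakk>
      \<Longrightarrow> is_zero C Z"
    and bij: "\<And>A n. A \<in> \<G>
      \<Longrightarrow> bij_betw ((\<cdot>) f) (Hom C (ob (shift C n) A) X) (Hom C (ob (shift C n) A) Y)"
  shows "f \<in> Isos C X Y"
proof -
  obtain Z g h where tri: "is_triangle C X Y Z f g h"
    using tri_complete[OF f] by blast
  note t = triD[OF tri]
  have null: "a = Null C (ob (shift C n) A) Z" if A: "A \<in> \<G>" and a: "a \<in> Hom C (ob (shift C n) A) Z" for A n a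
  proof -
    define B where "B = ob (shift C n) A"
    define B0 where "B0 = ob (shift C (n - 1)) A"
    have a: "a \<in> Hom C B Z"
      using a by (simp add: B_def)
    have B0: "B0 \<in> Obj C" "SO B0 = B"
      using obj[OF A] shift_pred[OF obj[OF A]] by (simp_all add: B_def B0_def)
    obtain b where b: "b \<in> Hom C B0 X" "SA b = h \<cdot> a"
      using desusp_hom[of "h \<cdot> a" B0 X] comp[OF a t(3)] B0 t(4) by blast
    note fb = comp[OF b(1) f]
    have "neg C (SA f) \<cdot> h = Null C Z (SO Y)"
      by (rule tri_comp_null[OF tri_rot[OF tri_rot[OF tri]]])
    then have "neg C (SA f) \<cdot> (h \<cdot> a) = Null C B (SO Y)"
      using comp_reassoc[of "neg C (SA f)" h _ a] neg_hom[OF susp_hom[OF f] susp_hom[OF f]] t(3) a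
        comp_null_left[OF a susp_obj[OF t(5)]] by (simp add: in_hom)
    then have "neg C (SA (f \<cdot> b)) = Null C B (SO Y)"
      using comp_neg(2)[OF susp_hom[OF b(1)] susp_hom[OF f]] susp_comp[OF b(1) f] b(2) by simp
    then have "SA (f \<cdot> b) = SA (Null C B0 Y)"
      using neg_eq_null[of "SA (f \<cdot> b)" B "SO Y"] susp_hom[OF fb] B0 susp_null[OF B0(1) t(5)] by simp
    then have "f \<cdot> b = f \<cdot> Null C B0 X"
      using susp_inj[OF fb null_hom[OF B0(1) t(5)]] comp_null_right[OF f B0(1)] by simp
    then have "b = Null C B0 X"
      using bij[OF A, of "n - 1", folded B0_def] b(1) null_hom[OF B0(1) t(4)] by (meson bij_betw_imp_inj_on inj_onD)
    then have "h \<cdot> a = Null C B (SO X)"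
      using b(2) susp_null[OF B0(1) t(4)] B0(2) by simp
    then obtain y where y: "y \<in> Hom C B Y" "g \<cdot> y = a"
      using exact_hom[OF tri_rot[OF tri] a] by blast
    then obtain x where x: "x \<in> Hom C B X" "f \<cdot> x = y"
      using bij_betw_imp_surj_on[OF bij[OF A, of n, folded B_def]] y(1) by (metis imageE)
    have "g \<cdot> (f \<cdot> x) = Null C B Z"
      using comp_reassoc[OF tri_comp_null[OF tri], of x] f t(2) x(1) comp_null_left[OF x(1) t(6)]
      by (simp add: in_hom)
    then show ?thesis
      using x(2) y(2) by (simp add: B_def)
  qed
  have "\<forall>A\<in>\<G>. \<forall>n. Hom C (ob (shift C n) A) Z = {Null C (ob (shift C n) A) Z}"
    using null null_hom[OF shift_obj[OF obj] t(6)] by blast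
  then show ?thesis
    using tri_iso_of_zero[OF tri] gen[OF t(6)] by blast
qed

lemma compact_generators:
  fixes \<kappa> :: "'i rel"
  assumes \<kappa>: "uncountable_regular \<kappa>" and cg: "compactly_generated \<kappa> C"
  obtains \<G> where "small \<kappa> \<G>" "\<forall>A\<in>\<G>. finsum_compact \<kappa> C A"
    "\<forall>Z\<in>Obj C. (\<forall>A\<in>\<G>. \<forall>n. Hom C (ob (shift C n) A) Z = {Null C (ob (shift C n) A) Z}) \<longrightarrow> is_zero C Z"
proof -
  obtain \<G> where "small \<kappa> \<G>" and \<G>: "\<forall>A\<in>\<G>. is_compact \<kappa> C A"
    "\<forall>X\<in>Obj C. (\<forall>A\<in>\<G>. \<forall>n. Hom C (ob (shift C n) A) X = {Null C (ob (shift C n) A) X}) \<longrightarrow> is_zero C X"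
    using cg unfolding compactly_generated_def by (elim conjE exE)
  then show ?thesis
    using that[of \<G>] is_compact_iff[OF \<kappa>] by simp
qed

text \<open>Compact objects are closed under shifts, so a test on them includes all shifts of the
  generators.\<close>

lemma iso_by_compacts:
  fixes \<kappa> :: "'i rel"
  assumes \<kappa>: "uncountable_regular \<kappa>" and cg: "compactly_generated \<kappa> C" and f: "f \<in> Hom C X Y"
    and bij: "\<And>A. finsum_compact \<kappa> C A \<Longrightarrow> bij_betw ((\<cdot>) f) (Hom C A X) (Hom C A Y)"
  shows "f \<in> Isos C X Y"
proof -
  obtain \<G> where "small \<kappa> \<G>" and \<G>: "\<forall>A\<in>\<G>. finsum_compact \<kappa> C A"
    "\<forall>Z\<in>Obj C. (\<forall>A\<in>\<G>. \<forall>n. Hom C (ob (shift C n) A) Z = {Null C (ob (shift C n) A) Z}) \<longrightarrow> is_zero C Z"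
    using compact_generators[OF \<kappa> cg] .
  show ?thesis
  proof (rule iso_by_generators[OF f, of \<G>])
    show "A \<in> Obj C" if "A \<in> \<G>" for A
      using \<G>(1) that by (simp add: finsum_compact_def)
    show "is_zero C Z" if "Z \<in> Obj C"
      "\<forall>A\<in>\<G>. \<forall>n. Hom C (ob (shift C n) A) Z = {Null C (ob (shift C n) A) Z}" for Z
      using \<G>(2) that by simp
    show "bij_betw ((\<cdot>) f) (Hom C (ob (shift C n) A) X) (Hom C (ob (shift C n) A) Y)" if "A \<in> \<G>" for A n
      by (rule bij[OF finsum_compact_shift[OF bspec[OF \<G>(1) that]]])
  qed
qed


subsection \<open>Extensions\<close>

text \<open>The difference \<open>n = w - 1\<close> kills \<open>f\<close>, so it factors through
  \<open>g\<close>, and \<open>g \<cdot> w = g\<close> gives \<open>n \<cdot> w = n\<close>. Hence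
  \<open>n\<close> squares to zero and \<open>1 - n\<close> is a left inverse of
  \<open>w\<close>.\<close>

lemma endo_iso:
  assumes tri: "is_triangle C A E B f g h" and w: "w \<in> Hom C E E" "w \<cdot> f = f" "g \<cdot> w = g"
  shows "\<exists>w'\<in>Hom C E E. w' \<cdot> w = Ident C E"
proof -
  note t = triD[OF tri]
  note id = ident[OF t(5)]
  note nid = neg_hom[OF id id]
  define n where "n = Plus C w (neg C (Ident C E))"
  have n: "n \<in> Hom C E E"
    using plus_hom[OF w(1) nid] by (simp add: n_def)
  note nn = neg_hom[OF n n]
  have wn: "w = Plus C n (Ident C E)"
    using diff_plus[OF w(1) id] by (simp add: n_def)
  have "n \<cdot> f = Null C A E"
    using comp_plus_right[OF t(1) w(1) nid] comp_neg(2)[OF t(1) id] comp_ident_left[OF t(1)]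
      w(2) plus_neg[OF t(1,1)] by (simp add: n_def)
  then obtain m where m: "m \<in> Hom C B E" "m \<cdot> g = n"
    using exact_cohom[OF tri n] by blast
  have "n \<cdot> w = n"
    using m w t(2) by (simp add: in_hom flip: m(2))
  moreover have "n \<cdot> w = Plus C (n \<cdot> n) n"
    using wn comp_plus_left[OF n id n] comp_ident_right[OF n] by metis
  ultimately have "neg C n \<cdot> w = neg C n"
    using comp_neg(2)[OF w(1) n] by simp
  then have "Plus C (neg C n) (Ident C E) \<cdot> w = Plus C (neg C n) w"
    using comp_plus_right[OF w(1) nn id] comp_ident_left[OF w(1)] by simp
  also have "\<dots> = Plus C (Plus C (neg C n) n) (Ident C E)"
    using plus_assoc[OF nn n id] wn by simp
  also have "\<dots> = Ident C E"
    using plus_comm[OF nn n] plus_neg[OF n n] null_plus[OF id id] by simp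
  finally show ?thesis
    using plus_hom[OF nn id] by blast
qed

text \<open>\<open>E'\<close> is the pullback of the extension along the retraction
  \<open>p\<close>. The filled maps \<open>u\<close> and \<open>v\<close> need not compose to the
  identity of \<open>E\<close>, but \<open>v \<cdot> u\<close> is compatible with the identities of
  \<open>A\<close> and \<open>B\<close>, and \<open>endo_iso\<close> repairs it.\<close>

lemma retract_extension:
  assumes tri: "is_triangle C A E B f g h" and i: "i \<in> Hom C B B'" and p: "p \<in> Hom C B' B"
    and pi: "p \<cdot> i = Ident C B" and tri': "is_triangle C A E' B' f' g' (h \<cdot> p)"
  shows "retract C E E'"
proof -
  note t = triD[OF tri] and t' = triD[OF tri']
  \<comment> \<open>\<open>tri_fill\<close> supplies the third vertex of a map of triangles, so both
    triangles are turned back until \<open>E\<close> and \<open>E'\<close> stand there.\<close>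
  obtain W k where W: "SO W = B" "SA k = neg C h" "is_triangle C W A E k f g"
    using tri_unrot[OF tri] .
  obtain W' k' where W': "SO W' = B'" "SA k' = neg C (h \<cdot> p)" "is_triangle C W' A E' k' f' g'"
    using tri_unrot[OF tri'] .
  note w = triD[OF W(3)] and w' = triD[OF W'(3)]
  obtain i0 where i0: "i0 \<in> Hom C W W'" "SA i0 = i"
    using desusp_hom[of i W W'] i W(1) W'(1) w(4) w'(4) by blast
  obtain p0 where p0: "p0 \<in> Hom C W' W" "SA p0 = p"
    using desusp_hom[of p W' W] p W(1) W'(1) w(4) w'(4) by blast
  note hp = comp[OF p t(3)] and id = ident[OF t(4)]
  have "SA (k' \<cdot> i0) = SA k"
    using susp_comp[OF i0(1) w'(1)] W(2) W'(2) i0(2) comp_neg(2)[OF i hp] pi t(3) i p by (simp add: in_hom)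
  then have "k' \<cdot> i0 = k"
    using susp_inj[OF comp[OF i0(1) w'(1)] w(1)] by simp
  then have "Ident C A \<cdot> k = k' \<cdot> i0"
    using comp_ident_left[OF w(1)] by simp
  then obtain u where u: "u \<in> Hom C E E'" "u \<cdot> f = f' \<cdot> Ident C A" "SA i0 \<cdot> g = g' \<cdot> u"
    using tri_fill[OF W(3) W'(3) i0(1) id] by blast
  have "SA (k \<cdot> p0) = SA k'"
    using susp_comp[OF p0(1) w(1)] W(2) W'(2) p0(2) comp_neg(2)[OF p t(3)] by simp
  then have "k \<cdot> p0 = k'"
    using susp_inj[OF comp[OF p0(1) w(1)] w'(1)] by simp
  then have "Ident C A \<cdot> k' = k \<cdot> p0"
    using comp_ident_left[OF w'(1)] by simp
  then obtain v where v: "v \<in> Hom C E' E" "v \<cdot> f' = f \<cdot> Ident C A" "SA p0 \<cdot> g' = g \<cdot> v"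
    using tri_fill[OF W'(3) W(3) p0(1) id] by blast
  have "(v \<cdot> u) \<cdot> f = f"
    using u v t(1) t'(1) by (simp add: in_hom)
  moreover have "g \<cdot> (v \<cdot> u) = g"
  proof -
    have "g \<cdot> (v \<cdot> u) = p \<cdot> (g' \<cdot> u)"
      using comp_reassoc[OF v(3)[symmetric], of u] p0(2) u(1) v(1) t(2) t'(2) p by (simp add: in_hom)
    also have "\<dots> = p \<cdot> (i \<cdot> g)"
      using u(3) i0(2) by simp
    also have "\<dots> = g"
      using comp_reassoc[OF pi, of g] i p t(2) by (simp add: in_hom)
    finally show ?thesis .
  qed
  ultimately obtain w where w: "w \<in> Hom C E E" "w \<cdot> (v \<cdot> u) = Ident C E"
    using endo_iso[OF tri comp[OF u(1) v(1)]] by blast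
  have "(w \<cdot> v) \<cdot> u = Ident C E"
    using w u(1) v(1) by (simp add: in_hom)
  then show ?thesis
    using u(1) comp[OF v(1) w(1)] t(5) by (auto simp: retract_def)
qed

text \<open>Three rotations suspend a triangle and negate all its arrows. Desuspending each arrow
  with a sign therefore undoes them.\<close>

lemma desusp_triangle:
  assumes "is_triangle C (SO X) (SO Y) (SO Z) f g h" "X \<in> Obj C" "Y \<in> Obj C" "Z \<in> Obj C"
  shows "\<exists>f g h. is_triangle C X Y Z f g h"
proof -
  note t = triD[OF assms(1)]
  have "\<exists>f'\<in>Hom C X' Y'. neg C (SA f') = f" if f: "f \<in> Hom C (SO X') (SO Y')" and o: "X' \<in> Obj C" "Y' \<in> Obj C"
    for f X' Y'
  proof -
    obtain k where k: "k \<in> Hom C X' Y'" "SA k = f"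
      using desusp_hom[OF f o] .
    have "neg C (SA (neg C k)) = f"
      using susp_neg[OF k(1)] neg_neg[OF f] k(2) by simp
    then show ?thesis
      using neg_hom[OF k(1,1)] by blast
  qed
  then obtain f' g' h' where f': "f' \<in> Hom C X Y" "neg C (SA f') = f" and g': "g' \<in> Hom C Y Z" "neg C (SA g') = g"
    and h': "h' \<in> Hom C Z (SO X)" "neg C (SA h') = h"
    using t(1-3) assms(2-4) susp_obj by metis
  have d1: "is_diagram C X Y Z f' g' h'"
    using f' g' h' by (simp add: is_diagram_def)
  have d2: "is_diagram C Y Z (SO X) g' h' f"
    using t(1) g' h' by (simp add: is_diagram_def)
  have d3: "is_diagram C Z (SO X) (SO Y) h' f g"
    using t(1,2) h' by (simp add: is_diagram_def)
  have "is_triangle C X Y Z f' g' h'"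
    using tri_rotate[OF d1] tri_rotate[OF d2] tri_rotate[OF d3] f'(2) g'(2) h'(2) assms(1) by simp
  then show ?thesis
    by blast
qed

text \<open>\<open>V\<close> is the fibre of the composite
  \<open>E \<rightarrow> B \<rightarrow> B2\<close>. The octahedral axiom for this composite relates
  the three cones \<open>SO A\<close>, \<open>SO V\<close> and \<open>SO B1\<close>; desuspension
  gives \<open>A \<rightarrow> V \<rightarrow> B1\<close>.\<close>

lemma split_extension:
  assumes 1: "is_triangle C A E B f g h" and 2: "is_triangle C B1 B B2 b1 b2 b3"
  obtains V where "\<exists>f g h. is_triangle C A V B1 f g h" "\<exists>f g h. is_triangle C V E B2 f g h"
proof -
  note t = triD[OF 1] and b = triD[OF 2]
  obtain Y u v where Y: "is_triangle C E B2 Y (b2 \<cdot> g) u v"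
    using tri_complete[OF comp[OF t(2) b(2)]] by blast
  obtain V k where V: "SO V = Y" "is_triangle C V E B2 k (b2 \<cdot> g) u"
    using tri_unrot[OF Y] by blast
  obtain p q where "is_triangle C (SO A) Y (SO B1) p q (SA h \<cdot> neg C (SA b1))"
    using tri_octahedron[OF tri_rot[OF 1] tri_rot[OF 2] Y] by blast
  then have "\<exists>f g h. is_triangle C A V B1 f g h"
    using desusp_triangle[of A V B1] V(1) t(4) triD(4)[OF V(2)] b(4) by blast
  then show ?thesis
    using that V(2) by blast
qed

end


section \<open>Levels of generation\<close>

context triangulated_category
begin

lemma gen_level_1_iff:
  fixes \<kappa> :: "'i rel"
  shows "X \<in> gen_level \<kappa> C G (Suc 0) \<longleftrightarrow> (\<exists>(I :: 'i set) n P \<iota>. small \<kappa> I \<and>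
     is_coproduct C I (\<lambda>i. ob (shift C (n i)) G) P \<iota> \<and> retract C X P)"
  by simp

lemma gen_level_Suc_Suc_iff:
  "X \<in> gen_level \<kappa> C G (Suc (Suc k)) \<longleftrightarrow> (\<exists>A B E f g h. A \<in> gen_level \<kappa> C G (Suc k) \<and>
     B \<in> gen_level \<kappa> C G (Suc 0) \<and> is_triangle C A E B f g h \<and> retract C X E)"
  by simp

lemma gen_level_retract:
  fixes \<kappa> :: "'i rel"
  assumes "E \<in> gen_level \<kappa> C G n" "retract C X E"
  shows "X \<in> gen_level \<kappa> C G n"
proof -
  consider "n = 0" | "n = Suc 0" | k where "n = Suc (Suc k)"
    by (metis not0_implies_Suc)
  then show ?thesis
  proof cases
    case 1
    then show ?thesis
      using assms is_zero_retract by simp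
  next
    case 2
    obtain I :: "'i set" and m P \<iota> where
      "small \<kappa> I" "is_coproduct C I (\<lambda>i. ob (shift C (m i)) G) P \<iota>" "retract C E P"
      using assms(1) unfolding 2 gen_level_1_iff by blast
    then show ?thesis
      unfolding 2 gen_level_1_iff using retract_trans[OF assms(2)] by blast
  next
    case (3 k)
    obtain A B E' f g h where "A \<in> gen_level \<kappa> C G (Suc k)" "B \<in> gen_level \<kappa> C G (Suc 0)"
      "is_triangle C A E' B f g h" "retract C E E'"
      using assms(1) unfolding 3 gen_level_Suc_Suc_iff by blast
    then show ?thesis
      unfolding 3 gen_level_Suc_Suc_iff using retract_trans[OF assms(2)] by blast
  qed
qed

lemma gen_level_subset: "gen_level \<kappa> C G n \<subseteq> Obj C"
proof
  fix X assume X: "X \<in> gen_level \<kappa> C G n"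
  consider "n = 0" | "n = Suc 0" | k where "n = Suc (Suc k)"
    by (metis not0_implies_Suc)
  then show "X \<in> Obj C"
    using X by cases (auto simp: is_zero_def retract_def)
qed

lemma gen_level_iso:
  assumes "E \<in> gen_level \<kappa> C G n" "e \<in> Isos C X E"
  shows "X \<in> gen_level \<kappa> C G n"
  using gen_level_retract[OF assms(1) iso_retract[OF assms(2)]] .

text \<open>\<open>gen_level\<close> attaches single layers on the right, so this is a form of
  associativity. For \<open>b\<close> at least two, \<open>B\<close> is a retract of an extension
  \<open>B'\<close> of \<open>B1\<close> by a layer \<open>B2\<close>; the given extension is pulled
  back to \<open>B'\<close> and then built in two steps, first with \<open>B1\<close> and then with
  \<open>B2\<close>. If \<open>a\<close> or \<open>b\<close> is zero, the triangle reduces to an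
  isomorphism.\<close>

lemma gen_level_extension:
  assumes "A \<in> gen_level \<kappa> C G a" "B \<in> gen_level \<kappa> C G b" "is_triangle C A E B f g h"
  shows "E \<in> gen_level \<kappa> C G (a + b)"
  using assms
proof (induction b arbitrary: A B E f g h rule: induct_nat_012)
  case 0
  then have "f \<in> Isos C A E"
    using tri_iso_of_zero by simp
  then obtain f' where "f' \<in> Isos C E A"
    using inv_arr(1) by blast
  then show ?case
    using 0 gen_level_iso by simp
next
  case 1
  show ?case
  proof (cases a)
    case 0
    then have "g \<in> Isos C E B"
      using 1 tri_iso_of_zero' by simp
    then show ?thesis
      using 1 0 gen_level_iso by (metis One_nat_def add_0)
  next
    case (Suc k)
    have "E \<in> gen_level \<kappa> C G (Suc (Suc k))"
      unfolding gen_level_Suc_Suc_iff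
      using 1 Suc retract_refl triD(5) by (metis One_nat_def)
    then show ?thesis
      using Suc by simp
  qed
next
  case (ge2 k)
  obtain B1 B2 B' b1 b2 b3 where B: "B1 \<in> gen_level \<kappa> C G (Suc k)" "B2 \<in> gen_level \<kappa> C G (Suc 0)"
      "is_triangle C B1 B' B2 b1 b2 b3" "retract C B B'"
    using ge2(4) unfolding gen_level_Suc_Suc_iff by blast
  obtain i p where ip: "i \<in> Hom C B B'" "p \<in> Hom C B' B" "p \<cdot> i = Ident C B"
    using B(4) by (auto simp: retract_def)
  note t = triD[OF ge2(5)]
  obtain E' f' g' where E': "is_triangle C A E' B' f' g' (h \<cdot> p)"
    using tri_complete_mid[OF comp[OF ip(2) t(3)] t(4)] .
  obtain V where V: "\<exists>f g h. is_triangle C A V B1 f g h" "\<exists>f g h. is_triangle C V E' B2 f g h"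
    using split_extension[OF E' B(3)] .
  have "V \<in> gen_level \<kappa> C G (Suc (a + k))"
    using V(1) ge2(2)[OF ge2(3) B(1)] by auto
  then have "E' \<in> gen_level \<kappa> C G (Suc (Suc (a + k)))"
    unfolding gen_level_Suc_Suc_iff using V(2) B(2) retract_refl triD(5) by metis
  moreover have "retract C E E'"
    using retract_extension[OF ge2(5) ip E'] .
  ultimately show ?case
    using gen_level_retract[of E' \<kappa> G "Suc (Suc (a + k))" E] by (simp del: gen_level.simps)
qed

end

section \<open>Exact functors preserving coproducts\<close>

text \<open>The last arrow of an image triangle is left unspecified. That is enough for exactness on
  Hom sets and for counting levels, and it spares choosing a natural comparison of \<open>F\<close>
  with suspension.\<close>

locale coproduct_exact_functor = C: triangulated_category C + D: triangulated_category D
  for C :: "('o, 'm, 'y) tri_cat_scheme" and D :: "('p, 'n, 'z) tri_cat_scheme" +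
  fixes \<kappa> :: "'i rel" and F :: "('o, 'm, 'p, 'n) fctr"
  assumes regular: "uncountable_regular \<kappa>"
    and F_additive: "is_additive_functor C D F"
    and F_coproducts: "preserves_small_coproducts \<kappa> C D F"
    and F_triangle: "is_triangle C X Y Z f g h
      \<Longrightarrow> \<exists>h'. is_triangle D (ob F X) (ob F Y) (ob F Z) (ar F f) (ar F g) h'"
begin

lemma F_functor: "is_functor C D F"
  using F_additive by (rule additive_functorD)

lemmas F_ob = is_functor_ob[OF F_functor]
  and F_hom = is_functor_hom[OF F_functor]
  and F_comp = is_functor_comp[OF F_functor]
  and F_ident = is_functor_ident[OF F_functor]
  and F_null = additive_functor_null[OF C.additive D.additive F_additive]
  and F_neg = additive_functor_neg[OF C.additive D.additive F_additive]
  and F_zero = additive_functor_zero[OF C.additive D.additive F_additive]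
  and F_plus = additive_functorD(2)[OF F_additive]
  and F_retract = is_functor_retract[OF C.category_axioms F_functor]
  and F_coproduct = preserves_small_coproducts_any[OF C.category_axioms D.category_axioms regular F_coproducts]

lemma F_exact:
  assumes "is_triangle C X Y Z f g h" "a \<in> Hom D A (ob F Y)" "ar F g \<cdot>\<^bsub>D\<^esub> a = Null D A (ob F Z)"
  shows "\<exists>b\<in>Hom D A (ob F X). ar F f \<cdot>\<^bsub>D\<^esub> b = a"
  using F_triangle[OF assms(1)] D.exact_hom assms(2,3) by blast

text \<open>The image of the triangle \<open>X \<rightarrow> 0 \<rightarrow> SO X\<close> has a zero
  object in the middle, so its last arrow is an isomorphism.\<close>

lemma F_susp:
  assumes X: "X \<in> Obj C"
  shows "\<exists>e. e \<in> Isos D (ob F (C.SO X)) (D.SO (ob F X))"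
proof -
  obtain Z where Z: "is_zero C Z"
    using C.zero_object by blast
  obtain h where h: "is_triangle D (ob F X) (ob F Z) (ob F (C.SO X))
      (ar F (Null C X Z)) (ar F (Null C Z (C.SO X))) h"
    using F_triangle[OF C.zero_triangle[OF X Z]] by blast
  have "h \<in> Isos D (ob F (C.SO X)) (D.SO (ob F X))"
    by (rule D.tri_iso_of_zero'[OF D.tri_rot[OF h] F_zero[OF Z]])
  then show ?thesis
    by blast
qed

lemma F_shift:
  assumes X: "X \<in> Obj C"
  shows "\<exists>e. e \<in> Isos D (ob F (ob (shift C n) X)) (ob (shift D n) (ob F X))"
proof (induction n rule: int_induct[where k = 0])
  case base
  then show ?case
    using D.Isos_ident[OF F_ob[OF X]] by auto
next
  case (step1 i)
  then obtain e where e: "e \<in> Isos D (ob F (ob (shift C i) X)) (ob (shift D i) (ob F X))"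
    by blast
  obtain e' where e': "e' \<in> Isos D (ob F (C.SO (ob (shift C i) X))) (D.SO (ob F (ob (shift C i) X)))"
    using F_susp[OF C.shift_obj[OF X]] by blast
  show ?case
    using D.Isos_comp[OF e' D.susp_Isos[OF e]] C.shift_succ[OF X] D.shift_succ[OF F_ob[OF X]] by auto
next
  case (step2 i)
  let ?X = "ob (shift C (i - 1)) X" and ?Y = "ob (shift D (i - 1)) (ob F X)"
  obtain e where e: "e \<in> Isos D (ob F (C.SO ?X)) (D.SO ?Y)"
    using step2 C.shift_pred[OF X] D.shift_pred[OF F_ob[OF X]] by auto
  obtain e' where e': "e' \<in> Isos D (ob F (C.SO ?X)) (D.SO (ob F ?X))"
    using F_susp[OF C.shift_obj[OF X]] by blast
  show ?case
    using D.iso_desusp[OF D.Isos_comp[OF D.inv_arr(1)[OF e'] e]] F_ob C.shift_obj[OF X]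
      D.shift_obj[OF F_ob[OF X]] by blast
qed

lemma coproduct_shifts_iso:
  fixes I :: "'i set"
  assumes I: "small \<kappa> I" and Y: "Y \<in> Obj C" and P: "is_coproduct C I (\<lambda>i. ob (shift C (n i)) Y) P \<iota>"
    and Q: "is_coproduct D I (\<lambda>i. ob (shift D (n i)) K) Q \<iota>'" and e: "e \<in> Isos D K (ob F Y)"
  shows "\<exists>e. e \<in> Isos D Q (ob F P)"
proof -
  note FP = F_coproduct[OF I P]
  have "\<exists>a. a \<in> Isos D (ob (shift D m) K) (ob F (ob (shift C m) Y))" for m
    using D.shift_iso[OF e, of m] F_shift[OF Y, of m] D.Isos_comp D.inv_arr(1) by meson
  then obtain a where a: "\<And>m. a m \<in> Isos D (ob (shift D m) K) (ob F (ob (shift C m) Y))"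
    by metis
  have "is_coproduct D I (\<lambda>i. ob (shift D (n i)) K) (ob F P) (\<lambda>i. ar F (\<iota> i) \<cdot>\<^bsub>D\<^esub> a (n i))"
    by (rule D.coprod_change[OF FP a])
  then show ?thesis
    using D.coprod_iso_ex[OF Q] by blast
qed

lemma gen_level_map_1:
  assumes G: "G \<in> Obj C" and X: "X \<in> gen_level \<kappa> C G (Suc 0)"
  shows "ob F X \<in> gen_level \<kappa> D (ob F G) (Suc 0)"
proof -
  obtain I :: "'i set" and n P \<iota> where I: "small \<kappa> I" and P: "is_coproduct C I (\<lambda>i. ob (shift C (n i)) G) P \<iota>"
    and X: "retract C X P"
    using X unfolding C.gen_level_1_iff by blast
  obtain a where a: "\<And>m. a m \<in> Isos D (ob F (ob (shift C m) G)) (ob (shift D m) (ob F G))"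
    using F_shift[OF G] by metis
  have "is_coproduct D I (\<lambda>i. ob (shift D (n i)) (ob F G)) (ob F P)
      (\<lambda>i. ar F (\<iota> i) \<cdot>\<^bsub>D\<^esub> inv_arr D (a (n i)))"
    by (rule D.coprod_change[OF F_coproduct[OF I P] D.inv_arr(1)[OF a]])
  then show ?thesis
    unfolding D.gen_level_1_iff using I F_retract[OF X] by blast
qed

lemma gen_level_map:
  "\<lbrakk>G \<in> Obj C; X \<in> gen_level \<kappa> C G n\<rbrakk> \<Longrightarrow> ob F X \<in> gen_level \<kappa> D (ob F G) n"
proof (induction n arbitrary: X rule: induct_nat_012)
  case 0
  then show ?case
    using F_zero by simp
next
  case 1
  then show ?case
    using gen_level_map_1 by (simp del: gen_level.simps)
next
  case (ge2 k)
  obtain A B E f g h where A: "A \<in> gen_level \<kappa> C G (Suc k)" and B: "B \<in> gen_level \<kappa> C G (Suc 0)"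
    and E: "is_triangle C A E B f g h" and X: "retract C X E"
    using ge2(4) unfolding C.gen_level_Suc_Suc_iff by blast
  obtain h' where "is_triangle D (ob F A) (ob F E) (ob F B) (ar F f) (ar F g) h'"
    using F_triangle[OF E] by blast
  moreover have "ob F B \<in> gen_level \<kappa> D (ob F G) (Suc 0)"
    by (rule gen_level_map_1[OF ge2(3) B])
  ultimately show ?case
    unfolding D.gen_level_Suc_Suc_iff using ge2(2)[OF ge2(3) A] F_retract[OF X] by blast
qed

text \<open>Coproducts of shifts of \<open>K = F Y\<close> are again of the form \<open>F P\<close>. This is why no closure of
  \<open>gen_level \<kappa> D H l\<close> under coproducts or shifts is needed.\<close>

lemma gen_level_mult:
  assumes cop: "has_small_coproducts \<kappa> C" and Y: "Y \<in> Obj C" and e: "e \<in> Isos D K (ob F Y)"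
    and l: "\<And>P. P \<in> Obj C \<Longrightarrow> ob F P \<in> gen_level \<kappa> D H l"
    and Z: "Z \<in> gen_level \<kappa> D K n"
  shows "Z \<in> gen_level \<kappa> D H (l * n)"
proof -
  have level_1: "Z \<in> gen_level \<kappa> D H l" if Z: "Z \<in> gen_level \<kappa> D K (Suc 0)" for Z
  proof -
    obtain I :: "'i set" and n Q \<iota>' where I: "small \<kappa> I" and Q: "is_coproduct D I (\<lambda>i. ob (shift D (n i)) K) Q \<iota>'"
      and Z: "retract D Z Q"
      using Z unfolding D.gen_level_1_iff by blast
    obtain P \<iota> where P: "is_coproduct C I (\<lambda>i. ob (shift C (n i)) Y) P \<iota>"
      using C.has_small_coproducts_any[OF regular cop I, of "\<lambda>i. ob (shift C (n i)) Y"] C.shift_obj[OF Y] by metis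
    obtain e' where "e' \<in> Isos D Q (ob F P)"
      using coproduct_shifts_iso[OF I Y P Q e] by blast
    then show ?thesis
      using D.gen_level_retract[OF l[OF C.coprod_obj[OF P]] D.retract_iso[OF Z]] by blast
  qed
  show ?thesis
    using Z
  proof (induction n arbitrary: Z rule: induct_nat_012)
    case 1
    then show ?case
      using level_1 by simp
  next
    case (ge2 k)
    obtain A B E f g h where A: "A \<in> gen_level \<kappa> D K (Suc k)" and B: "B \<in> gen_level \<kappa> D K (Suc 0)"
      and E: "is_triangle D A E B f g h" and X: "retract D Z E"
      using ge2(3) unfolding D.gen_level_Suc_Suc_iff by blast
    have "E \<in> gen_level \<kappa> D H (l * Suc k + l)"
      by (rule D.gen_level_extension[OF ge2(2)[OF A] level_1[OF B] E])
    then have "Z \<in> gen_level \<kappa> D H (l * Suc k + l)"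
      using D.gen_level_retract X by blast
    then show ?case
      by (simp add: algebra_simps del: gen_level.simps)
  qed simp
qed

end

lemma coproduct_exact_functor_comp:
  fixes \<kappa> :: "'i rel"
  assumes "coproduct_exact_functor C D \<kappa> F" "coproduct_exact_functor D E \<kappa> G"
  shows "coproduct_exact_functor C E \<kappa> (comp_functor G F)"
proof -
  interpret F: coproduct_exact_functor C D \<kappa> F by fact
  interpret G: coproduct_exact_functor D E \<kappa> G by fact
  show ?thesis
  proof unfold_locales
    show "uncountable_regular \<kappa>"
      by (rule F.regular)
    show "is_additive_functor C E (comp_functor G F)"
      by (rule is_additive_functor_comp[OF F.F_additive G.F_additive])
    show "preserves_small_coproducts \<kappa> C E (comp_functor G F)"
      unfolding preserves_small_coproducts_def comp_functor_simps
    proof (intro allI impI)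
      fix I :: "'i set" and X P \<iota> assume "small \<kappa> I \<and> is_coproduct C I X P \<iota>"
      then show "is_coproduct E I (\<lambda>i. ob G (ob F (X i))) (ob G (ob F P)) (\<lambda>i. ar G (ar F (\<iota> i)))"
        using G.F_coproduct[OF _ F.F_coproduct] by blast
    qed
    fix X Y Z f g h assume "is_triangle C X Y Z f g h"
    then obtain h' where "is_triangle D (ob F X) (ob F Y) (ob F Z) (ar F f) (ar F g) h'"
      using F.F_triangle by blast
    from G.F_triangle[OF this]
    show "\<exists>h'. is_triangle E (ob (comp_functor G F) X) (ob (comp_functor G F) Y) (ob (comp_functor G F) Z)
        (ar (comp_functor G F) f) (ar (comp_functor G F) g) h'"
      by simp
  qed
qed

section \<open>Comparison of homological functors\<close>

text \<open>Invertibility of \<open>1 - shift\<close> says that the homotopy colimit of the tower vanishes.\<close>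

lemma (in triangulated_category) tower_shift_iso:
  fixes \<kappa> :: "'i rel" and T :: "nat \<Rightarrow> 'o"
  assumes \<kappa>: "uncountable_regular \<kappa>" and \<G>: "\<forall>A\<in>\<G>. finsum_compact \<kappa> C A"
    "\<forall>Z\<in>Obj C. (\<forall>A\<in>\<G>. \<forall>n. Hom C (ob (shift C n) A) Z = {Null C (ob (shift C n) A) Z}) \<longrightarrow> is_zero C Z"
    and f: "\<And>n. f n \<in> Hom C (T n) (T (Suc n))"
    and kill: "\<And>k A m a. \<lbrakk>A \<in> \<G>; a \<in> Hom C (ob (shift C m) A) (T k)\<rbrakk>
      \<Longrightarrow> f k \<cdot> a = Null C (ob (shift C m) A) (T (Suc k))"
    and P: "is_coproduct C UNIV T P \<iota>"
    and s: "s \<in> Hom C P P" "\<And>n. s \<cdot> \<iota> n = \<iota> (Suc n) \<cdot> f n"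
  shows "Plus C (Ident C P) (neg C s) \<in> Isos C P P"
proof -
  let ?d = "Plus C (Ident C P) (neg C s)"
  have Po: "P \<in> Obj C"
    using coprod_obj[OF P] .
  have i: "\<iota> n \<in> Hom C (T n) P" for n
    using coprod_inj[OF P] by simp
  note id = ident[OF Po] and ns = neg_hom[OF s(1,1)]
  have small: "small \<kappa> (UNIV :: nat set)"
    by (rule small_countable[OF \<kappa>]) simp
  show ?thesis
  proof (rule iso_by_generators[OF plus_hom[OF id ns], of \<G>])
    show "A \<in> Obj C" if "A \<in> \<G>" for A
      using \<G>(1) that by (simp add: finsum_compact_def)
    show "is_zero C Z" if "Z \<in> Obj C"
      "\<forall>A\<in>\<G>. \<forall>n. Hom C (ob (shift C n) A) Z = {Null C (ob (shift C n) A) Z}" for Z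
      using \<G>(2) that by simp
    fix A m assume A: "A \<in> \<G>"
    define B where "B = ob (shift C m) A"
    have B: "finsum_compact \<kappa> C B"
      using finsum_compact_shift[OF bspec[OF \<G>(1) A]] by (simp add: B_def)
    then have Bo: "B \<in> Obj C"
      by (simp add: finsum_compact_def)
    \<comment> \<open>A map from a shift of a generator into \<open>P\<close> is a finite sum of
      maps through stages of the tower, each killed by the next transition map. So \<open>s\<close>
      acts as zero on such maps and \<open>?d\<close> as the identity.\<close>
    have sb: "s \<cdot> b = Null C B P" if b: "b \<in> Hom C B P" for b
    proof -
      obtain J where "J \<subseteq> UNIV" "finite_sum C B P T \<iota> J b"
        using finsum_compact_any[OF \<kappa> B small P b] .
      from this(2) show ?thesis
      proof (induction rule: finite_sum.induct)
        case zero
        then show ?case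
          by (rule comp_null_right[OF s(1) Bo])
      next
        case (add J w j a)
        note w = finite_sum_hom[OF add(1) P subset_UNIV Bo]
        have "s \<cdot> (\<iota> j \<cdot> a) = \<iota> (Suc j) \<cdot> (f j \<cdot> a)"
          using comp_reassoc[OF s(2)[of j], of a] i[of j] i[of "Suc j"] f[of j] s(1) add(3) by (simp add: in_hom)
        also have "\<dots> = Null C B P"
          using kill[OF A, of a m j] add(3) comp_null_right[OF i Bo] by (simp add: B_def)
        finally show ?case
          using comp_plus_left[OF w comp[OF add(3) i] s(1)] add(4)
            plus_null[OF null_hom null_hom, OF Bo Po Bo Po] by simp
      qed
    qed
    have "?d \<cdot> b = b" if b: "b \<in> Hom C B P" for b
      using comp_plus_right[OF b id ns] comp_neg(2)[OF b s(1)] sb[OF b] neg_null[OF Bo Po]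
        comp_ident_left[OF b] plus_null[OF b b] by simp
    then show "bij_betw ((\<cdot>) ?d) (Hom C (ob (shift C m) A) P) (Hom C (ob (shift C m) A) P)"
      using bij_betw_cong[of "Hom C B P" "(\<cdot>) ?d" "\<lambda>b. b"] bij_betw_id unfolding B_def[symmetric] id_def
      by blast
  qed
qed

section \<open>Maps from compact objects into a tower\<close>

context coproduct_exact_functor
begin

text \<open>As \<open>1 - s\<close> is invertible, the image of \<open>z 0\<close> in
  \<open>F P\<close> has a preimage \<open>y\<close> under \<open>F (1 - s)\<close>. The projections
  of \<open>y\<close> satisfy the recursion defining \<open>z\<close>, so they are the
  \<open>z n\<close>; but \<open>A\<close> is compact, so only finitely many of them are
  nonzero.\<close>

lemma tower_dies:
  fixes T :: "nat \<Rightarrow> 'o" and z :: "nat \<Rightarrow> 'n"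
  assumes cop: "has_small_coproducts \<kappa> C" and \<G>: "\<forall>A\<in>\<G>. finsum_compact \<kappa> C A"
    "\<forall>Z\<in>Obj C. (\<forall>A\<in>\<G>. \<forall>n. Hom C (ob (shift C n) A) Z = {Null C (ob (shift C n) A) Z}) \<longrightarrow> is_zero C Z"
    and f: "\<And>n. f n \<in> Hom C (T n) (T (Suc n))"
    and kill: "\<And>k A m a. \<lbrakk>A \<in> \<G>; a \<in> Hom C (ob (shift C m) A) (T k)\<rbrakk>
      \<Longrightarrow> f k \<cdot>\<^bsub>C\<^esub> a = Null C (ob (shift C m) A) (T (Suc k))"
    and A: "finsum_compact \<kappa> D A"
    and z: "z 0 \<in> Hom D A (ob F (T 0))" "\<And>n. z (Suc n) = ar F (f n) \<cdot>\<^bsub>D\<^esub> z n"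
  shows "\<exists>n. z n = Null D A (ob F (T n))"
proof -
  have small: "small \<kappa> (UNIV :: nat set)"
    by (rule small_countable[OF regular]) simp
  have To: "T n \<in> Obj C" for n
    using C.hom_obj[OF f] by blast
  obtain P \<iota> where P: "is_coproduct C UNIV T P \<iota>"
    using C.has_small_coproducts_any[OF regular cop small To] .
  note Po = C.coprod_obj[OF P] and FP = F_coproduct[OF small P]
  have i: "\<iota> n \<in> Hom C (T n) P" for n
    using C.coprod_inj[OF P] by simp
  obtain s where s: "s \<in> Hom C P P" "\<forall>n\<in>UNIV. s \<cdot>\<^bsub>C\<^esub> \<iota> n = \<iota> (Suc n) \<cdot>\<^bsub>C\<^esub> f n"
    using C.coprod_ex[OF P Po C.comp[OF f i]] by blast
  then have s': "s \<cdot>\<^bsub>C\<^esub> \<iota> n = \<iota> (Suc n) \<cdot>\<^bsub>C\<^esub> f n" for n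
    by simp
  define d where "d = Plus C (Ident C P) (neg C s)"
  note id = C.ident[OF Po] and ns = C.neg_hom[OF s(1) s(1)]
  have d: "d \<in> Isos C P P"
    using C.tower_shift_iso[OF regular \<G> f kill P s(1) s'] by (simp add: d_def)
  note dh = C.Isos_hom[OF d]
  have di: "d \<cdot>\<^bsub>C\<^esub> \<iota> n = Plus C (\<iota> n) (neg C (\<iota> (Suc n) \<cdot>\<^bsub>C\<^esub> f n))" for n
    using C.comp_plus_right[OF i id ns] C.comp_neg(2)[OF i s(1)] s' C.comp_ident_left[OF i]
    by (simp add: d_def)
  obtain g where g: "g \<in> Hom C P P" "d \<cdot>\<^bsub>C\<^esub> g = Ident C P"
    using d by (rule C.IsosE)
  define y where "y = ar F (g \<cdot>\<^bsub>C\<^esub> \<iota> 0) \<cdot>\<^bsub>D\<^esub> z 0"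
  have y: "y \<in> Hom D A (ob F P)"
    unfolding y_def by (rule D.comp[OF z(1) F_hom[OF C.comp[OF i g(1)]]])
  have dgi: "d \<cdot>\<^bsub>C\<^esub> (g \<cdot>\<^bsub>C\<^esub> \<iota> 0) = \<iota> 0"
    using C.comp_reassoc[OF g(2), of "\<iota> 0"] g(1) dh i[of 0] by (simp add: in_hom)
  define p where "p = coproj C UNIV T P \<iota>"
  have p: "p n \<in> Hom C P (T n)" for n
    using C.coproj(1)[OF P] by (simp add: p_def)
  have pi: "p n \<cdot>\<^bsub>C\<^esub> \<iota> k = (if k = n then Ident C (T n) else Null C (T k) (T n))" for n k
    using C.coproj(2)[OF P] by (simp add: p_def)
  have pif: "p n \<cdot>\<^bsub>C\<^esub> (\<iota> (Suc k) \<cdot>\<^bsub>C\<^esub> f k) = (if Suc k = n then f k else Null C (T k) (T n))" for n k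
    using C.coproj_comp[OF P _ _ f, of n k] by (simp add: p_def)
  have pd: "p n \<cdot>\<^bsub>C\<^esub> (d \<cdot>\<^bsub>C\<^esub> \<iota> k) = Plus C (p n \<cdot>\<^bsub>C\<^esub> \<iota> k) (neg C (p n \<cdot>\<^bsub>C\<^esub> (\<iota> (Suc k) \<cdot>\<^bsub>C\<^esub> f k)))" for n k
  proof -
    note h = C.comp[OF f[of k] i[of "Suc k"]]
    show ?thesis
      using C.comp_plus_left[OF i C.neg_hom[OF h h] p] C.comp_neg(1)[OF h p] di by simp
  qed
  have pd0: "p 0 \<cdot>\<^bsub>C\<^esub> d = p 0"
  proof (rule C.coprod_unique[OF P C.comp[OF dh p] p])
    fix k
    have "p 0 \<cdot>\<^bsub>C\<^esub> (d \<cdot>\<^bsub>C\<^esub> \<iota> k) = p 0 \<cdot>\<^bsub>C\<^esub> \<iota> k"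
      using pd[of 0 k] pif[of 0 k] C.neg_null[OF To To] C.plus_null[OF C.comp[OF i p] C.comp[OF i p]] by simp
    then show "(p 0 \<cdot>\<^bsub>C\<^esub> d) \<cdot>\<^bsub>C\<^esub> \<iota> k = p 0 \<cdot>\<^bsub>C\<^esub> \<iota> k"
      using C.comp_assoc[OF i dh p] by simp
  qed
  \<comment> \<open>In coordinates, \<open>1 - s\<close> subtracts from each component the image of
    the preceding component under the transition map.\<close>
  have pdS: "p (Suc n) \<cdot>\<^bsub>C\<^esub> d = Plus C (p (Suc n)) (neg C (f n \<cdot>\<^bsub>C\<^esub> p n))" for n
  proof -
    note fp = C.comp[OF p f[of n]]
    note nfp = C.neg_hom[OF fp fp]
    show ?thesis
    proof (rule C.coprod_unique[OF P C.comp[OF dh p] C.plus_hom[OF p nfp]])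
      fix k
      have "(f n \<cdot>\<^bsub>C\<^esub> p n) \<cdot>\<^bsub>C\<^esub> \<iota> k = p (Suc n) \<cdot>\<^bsub>C\<^esub> (\<iota> (Suc k) \<cdot>\<^bsub>C\<^esub> f k)"
        using C.comp_assoc[OF i[of k] p[of n] f[of n]] pi[of n k] pif[of "Suc n" k] C.comp_ident_right[OF f, of n]
          C.comp_null_right[OF f To, of n k] by simp
      then show "(p (Suc n) \<cdot>\<^bsub>C\<^esub> d) \<cdot>\<^bsub>C\<^esub> \<iota> k = Plus C (p (Suc n)) (neg C (f n \<cdot>\<^bsub>C\<^esub> p n)) \<cdot>\<^bsub>C\<^esub> \<iota> k"
        using C.comp_plus_right[OF i p nfp, of k] C.comp_neg(2)[OF i fp] pd[of "Suc n" k]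
          C.comp_assoc[OF i[of k] dh p[of "Suc n"]] by simp
    qed
  qed
  have Fpd: "ar F (p n \<cdot>\<^bsub>C\<^esub> d) \<cdot>\<^bsub>D\<^esub> y = ar F (p n \<cdot>\<^bsub>C\<^esub> \<iota> 0) \<cdot>\<^bsub>D\<^esub> z 0" for n
  proof -
    have gi: "g \<cdot>\<^bsub>C\<^esub> \<iota> 0 \<in> Hom C (T 0) P"
      by (rule C.comp[OF i g(1)])
    have "ar F (p n \<cdot>\<^bsub>C\<^esub> d) \<cdot>\<^bsub>D\<^esub> y = ar F ((p n \<cdot>\<^bsub>C\<^esub> d) \<cdot>\<^bsub>C\<^esub> (g \<cdot>\<^bsub>C\<^esub> \<iota> 0)) \<cdot>\<^bsub>D\<^esub> z 0"
      unfolding y_def F_comp[OF gi C.comp[OF dh p]]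
      by (rule D.comp_assoc[OF z(1) F_hom[OF gi] F_hom[OF C.comp[OF dh p]], symmetric])
    then show ?thesis
      using C.comp_assoc[OF gi dh p, of n] dgi by simp
  qed
  have yz: "ar F (p n) \<cdot>\<^bsub>D\<^esub> y = z n" for n
  proof (induction n)
    case 0
    show ?case
      using Fpd[of 0] pd0 pi[of 0 0] F_ident[OF To] D.comp_ident_left[OF z(1)] by simp
  next
    case (Suc n)
    note fp = C.comp[OF p f[of n]]
    note nfp = C.neg_hom[OF fp fp]
    have zn: "z n \<in> Hom D A (ob F (T n))"
      using D.comp[OF y F_hom[OF p]] Suc by metis
    have zS: "z (Suc n) = ar F (f n \<cdot>\<^bsub>C\<^esub> p n) \<cdot>\<^bsub>D\<^esub> y"
      using z(2) Suc F_comp[OF p f] D.comp_assoc[OF y F_hom[OF p] F_hom[OF f]] by simp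
    have "Plus D (ar F (p (Suc n)) \<cdot>\<^bsub>D\<^esub> y) (neg D (z (Suc n))) = ar F (p (Suc n) \<cdot>\<^bsub>C\<^esub> d) \<cdot>\<^bsub>D\<^esub> y"
      using pdS[of n] F_plus[OF p nfp] F_neg[OF fp] zS
        D.comp_plus_right[OF y F_hom[OF p] F_hom[OF nfp]] D.comp_neg(2)[OF y F_hom[OF fp]] by simp
    also have "\<dots> = Null D A (ob F (T (Suc n)))"
      using Fpd[of "Suc n"] pi[of "Suc n" 0] F_null[OF To To] D.comp_null_left[OF z(1) F_ob[OF To]] by simp
    finally show ?case
      using D.diff_null[OF D.comp[OF y F_hom[OF p]]] D.comp[OF zn F_hom[OF f]] z(2) by simp
  qed
  have "finite {n \<in> UNIV. coproj D UNIV (\<lambda>n. ob F (T n)) (ob F P) (\<lambda>n. ar F (\<iota> n)) n \<cdot>\<^bsub>D\<^esub> y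
      \<noteq> Null D A (ob F (T n))}"
    using D.finsum_compact_coproj(1)[OF regular A small FP y] .
  then have "finite {n. z n \<noteq> Null D A (ob F (T n))}"
    using coproj_functor[OF C.additive D.additive F_additive P FP] yz by (simp add: p_def)
  then show ?thesis
    using infinite_UNIV_nat by (metis (mono_tags, lifting) UNIV_eq_I mem_Collect_eq)
qed

end

text \<open>The setting for a natural transformation \<open>p\<close> from
  \<open>Hom(A, F -)\<close> to \<open>Hom(A', F' -)\<close>. The two functors share their source
  but may take values in different categories, as the two sides of the projection formula
  do.\<close>

locale comparison = F: coproduct_exact_functor C D \<kappa> F + F': coproduct_exact_functor C E \<kappa> F'
  for C :: "('o, 'm, 'y) tri_cat_scheme" and D :: "('p, 'n, 'z) tri_cat_scheme"
    and E :: "('q, 'k, 'x) tri_cat_scheme" and \<kappa> :: "'i rel" and F F' +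
  fixes A :: 'p and A' :: 'q and p :: "'o \<Rightarrow> 'n \<Rightarrow> 'k"
  assumes compactly_generated: "compactly_generated \<kappa> C"
    and compact: "finsum_compact \<kappa> D A" and compact': "finsum_compact \<kappa> E A'"
    and p_hom: "\<lbrakk>X \<in> Obj C; f \<in> Hom D A (ob F X)\<rbrakk> \<Longrightarrow> p X f \<in> Hom E A' (ob F' X)"
    and p_plus: "\<lbrakk>X \<in> Obj C; f \<in> Hom D A (ob F X); g \<in> Hom D A (ob F X)\<rbrakk>
      \<Longrightarrow> p X (Plus D f g) = Plus E (p X f) (p X g)"
    and p_natural: "\<lbrakk>u \<in> Hom C X Y; f \<in> Hom D A (ob F X)\<rbrakk>
      \<Longrightarrow> p Y (ar F u \<cdot>\<^bsub>D\<^esub> f) = ar F' u \<cdot>\<^bsub>E\<^esub> p X f"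
    and p_compact: "finsum_compact \<kappa> C X \<Longrightarrow> bij_betw (p X) (Hom D A (ob F X)) (Hom E A' (ob F' X))"
begin

abbreviation H where "H X \<equiv> Hom D A (ob F X)"
abbreviation H' where "H' X \<equiv> Hom E A' (ob F' X)"
abbreviation N0 where "N0 X \<equiv> Null D A (ob F X)"
abbreviation N0' where "N0' X \<equiv> Null E A' (ob F' X)"

lemma A_obj: "A \<in> Obj D" and A'_obj: "A' \<in> Obj E"
  using compact compact' by (auto simp: finsum_compact_def)

lemma O_hom: "X \<in> Obj C \<Longrightarrow> N0 X \<in> H X" and O'_hom: "X \<in> Obj C \<Longrightarrow> N0' X \<in> H' X"
  using F.D.null_hom[OF A_obj F.F_ob] F'.D.null_hom[OF A'_obj F'.F_ob] by auto

lemma H_map: "\<lbrakk>u \<in> Hom C X Y; f \<in> H X\<rbrakk> \<Longrightarrow> ar F u \<cdot>\<^bsub>D\<^esub> f \<in> H Y"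
  and H'_map: "\<lbrakk>u \<in> Hom C X Y; f' \<in> H' X\<rbrakk> \<Longrightarrow> ar F' u \<cdot>\<^bsub>E\<^esub> f' \<in> H' Y"
  using F.D.comp[OF _ F.F_hom] F'.D.comp[OF _ F'.F_hom] by auto

lemma H'_null: "u \<in> Hom C X Y \<Longrightarrow> ar F' u \<cdot>\<^bsub>E\<^esub> N0' X = N0' Y"
  by (rule F'.D.comp_null_right[OF F'.F_hom A'_obj])

lemma p_null: "X \<in> Obj C \<Longrightarrow> p X (N0 X) = N0' X"
proof -
  assume X: "X \<in> Obj C"
  note o = O_hom[OF X]
  note po = p_hom[OF X o]
  have "Plus E (p X (N0 X)) (p X (N0 X)) = Plus E (p X (N0 X)) (N0' X)"
    using p_plus[OF X o o] F.D.plus_null[OF o o] F'.D.plus_null[OF po po] by simp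
  then show ?thesis
    using F'.D.plus_left_cancel[OF po po O'_hom[OF X]] by simp
qed

lemma p_neg: "\<lbrakk>X \<in> Obj C; f \<in> H X\<rbrakk> \<Longrightarrow> p X (neg D f) = neg E (p X f)"
proof -
  assume X: "X \<in> Obj C" and f: "f \<in> H X"
  note nf = F.D.neg_hom[OF f f]
  have "Plus E (p X f) (p X (neg D f)) = N0' X"
    using p_plus[OF X f nf] F.D.plus_neg[OF f f] p_null[OF X] by simp
  then show ?thesis
    using F'.D.neg_unique[OF p_hom[OF X f] p_hom[OF X nf]] by simp
qed

lemma p_diff: "\<lbrakk>X \<in> Obj C; f \<in> H X; g \<in> H X\<rbrakk>
    \<Longrightarrow> p X (Plus D f (neg D g)) = Plus E (p X f) (neg E (p X g))"
  using p_plus p_neg F.D.neg_hom by simp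

lemma comp_zero:
  assumes "u \<in> Hom C X Y" "v \<in> Hom C Y Z" "v \<cdot>\<^bsub>C\<^esub> u = Null C X Z"
  shows "f \<in> H X \<Longrightarrow> ar F v \<cdot>\<^bsub>D\<^esub> (ar F u \<cdot>\<^bsub>D\<^esub> f) = N0 Z"
    and "f' \<in> H' X \<Longrightarrow> ar F' v \<cdot>\<^bsub>E\<^esub> (ar F' u \<cdot>\<^bsub>E\<^esub> f') = N0' Z"
proof -
  have o: "X \<in> Obj C" "Z \<in> Obj C"
    using F.C.hom_obj assms by blast+
  show "ar F v \<cdot>\<^bsub>D\<^esub> (ar F u \<cdot>\<^bsub>D\<^esub> f) = N0 Z" if f: "f \<in> H X"
    using F.D.comp_assoc[OF f F.F_hom[OF assms(1)] F.F_hom[OF assms(2)]] F.F_comp[OF assms(1,2)] assms(3)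
      F.F_null[OF o] F.D.comp_null_left[OF f F.F_ob[OF o(2)]] by simp
  show "ar F' v \<cdot>\<^bsub>E\<^esub> (ar F' u \<cdot>\<^bsub>E\<^esub> f') = N0' Z" if f: "f' \<in> H' X"
    using F'.D.comp_assoc[OF f F'.F_hom[OF assms(1)] F'.F_hom[OF assms(2)]] F'.F_comp[OF assms(1,2)] assms(3)
      F'.F_null[OF o] F'.D.comp_null_left[OF f F'.F_ob[OF o(2)]] by simp
qed

section \<open>The comparison on coproducts of compact objects and along one step of a tower\<close>

definition cell :: "'o \<Rightarrow> bool" where
  "cell W \<longleftrightarrow> (\<exists>(I :: 'i set) X \<iota>. small \<kappa> I \<and> (\<forall>i\<in>I. finsum_compact \<kappa> C (X i)) \<and> is_coproduct C I X W \<iota>)"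

lemma cell_susp: "cell W \<Longrightarrow> cell (F.C.SO W)"
proof -
  assume "cell W"
  then obtain I :: "'i set" and X \<iota> where I: "small \<kappa> I" and X: "\<forall>i\<in>I. finsum_compact \<kappa> C (X i)"
    and W: "is_coproduct C I X W \<iota>"
    unfolding cell_def by blast
  have "is_coproduct C I (\<lambda>i. F.C.SO (X i)) (F.C.SO W) (\<lambda>i. F.C.SA (\<iota> i))"
    using F.C.coproduct_susp[of W I \<iota> X, OF F.C.coprod_obj[OF W] F.C.coprod_inj[OF W]] W by simp
  moreover have "finsum_compact \<kappa> C (F.C.SO (X i))" if "i \<in> I" for i
    using X that F.C.finsum_compact_susp[of "X i" \<kappa>] by (simp add: finsum_compact_def)
  ultimately show ?thesis
    unfolding cell_def using I
    by (intro exI[of _ I] exI[of _ "\<lambda>i. F.C.SO (X i)"] exI[of _ "\<lambda>i. F.C.SA (\<iota> i)"] conjI ballI)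
qed

text \<open>\<open>A\<close> is compact, so a map into \<open>F W\<close> is zero once its
  projections are, and these belong to compact objects, where \<open>p\<close> is injective.\<close>

lemma cell_inj:
  assumes "cell W" "w \<in> H W" "p W w = N0' W"
  shows "w = N0 W"
proof -
  obtain I :: "'i set" and X \<iota> where I: "small \<kappa> I" and X: "\<forall>i\<in>I. finsum_compact \<kappa> C (X i)"
    and W: "is_coproduct C I X W \<iota>"
    using assms(1) unfolding cell_def by blast
  note FW = F.F_coproduct[OF I W]
  show ?thesis
  proof (rule F.D.finsum_compact_coproj(2)[OF F.regular compact I FW assms(2)])
    fix k assume k: "k \<in> I"
    note c = F.C.coproj(1)[OF W k]
    have Xk: "X k \<in> Obj C" "finsum_compact \<kappa> C (X k)"
      using F.C.hom_obj[OF c] X k by auto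
    have "p (X k) (ar F (coproj C I X W \<iota> k) \<cdot>\<^bsub>D\<^esub> w) = p (X k) (N0 (X k))"
      using p_natural[OF c assms(2)] assms(3) H'_null[OF c] p_null[OF Xk(1)] by simp
    then have "ar F (coproj C I X W \<iota> k) \<cdot>\<^bsub>D\<^esub> w = N0 (X k)"
      using p_compact[OF Xk(2)] H_map[OF c assms(2)] O_hom[OF Xk(1)]
      by (meson bij_betw_imp_inj_on inj_onD)
    then show "coproj D I (\<lambda>i. ob F (X i)) (ob F W) (\<lambda>i. ar F (\<iota> i)) k \<cdot>\<^bsub>D\<^esub> w = Null D A (ob F (X k))"
      using coproj_functor[OF F.C.additive F.D.additive F.F_additive W FW k] by simp
  qed
qed

text \<open>Compactness of \<open>A'\<close> writes \<open>y\<close> as a finite sum whose summands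
  come from compact objects, where \<open>p\<close> is onto.\<close>

lemma cell_surj:
  assumes "cell W" "y \<in> H' W"
  shows "\<exists>w\<in>H W. p W w = y"
proof -
  obtain I :: "'i set" and X \<iota> where I: "small \<kappa> I" and X: "\<forall>i\<in>I. finsum_compact \<kappa> C (X i)"
    and W: "is_coproduct C I X W \<iota>"
    using assms(1) unfolding cell_def by blast
  note FW = F'.F_coproduct[OF I W] and Wo = F.C.coprod_obj[OF W]
  obtain J where "J \<subseteq> I" "finite_sum E A' (ob F' W) (\<lambda>i. ob F' (X i)) (\<lambda>i. ar F' (\<iota> i)) J y"
    using finsum_compactD[OF compact' I FW assms(2)] by blast
  from this(2,1) show ?thesis
  proof (induction rule: finite_sum.induct)
    case zero
    then show ?case
      using p_null[OF Wo] O_hom[OF Wo] by blast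
  next
    case (add J y j a)
    have j: "j \<in> I"
      using add by simp
    note i = F.C.coprod_inj[OF W j]
    obtain w where w: "w \<in> H W" "p W w = y"
      using add by blast
    obtain b where b: "b \<in> H (X j)" "p (X j) b = a"
      using bij_betw_imp_surj_on[OF p_compact[OF bspec[OF X j]]] add(3) by (metis imageE)
    note ib = H_map[OF i b(1)]
    have "p W (Plus D w (ar F (\<iota> j) \<cdot>\<^bsub>D\<^esub> b)) = Plus E y (ar F' (\<iota> j) \<cdot>\<^bsub>E\<^esub> a)"
      using p_plus[OF Wo w(1) ib] p_natural[OF i b(1)] w(2) b(2) by simp
    then show ?case
      using F.D.plus_hom[OF w(1) ib] by blast
  qed
qed

text \<open>One half of the four lemma: \<open>p\<close> is onto at \<open>W\<close> and injective
  at \<open>SO W\<close>. A preimage at \<open>X'\<close> thus comes from some \<open>x\<close> at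
  \<open>X\<close>, and the error \<open>y - p X x\<close> comes from \<open>W\<close>.\<close>

lemma surj_step:
  assumes W: "cell W" and tri: "is_triangle C W X X' w f h" and y: "y \<in> H' X"
    and im: "ar F' f \<cdot>\<^bsub>E\<^esub> y \<in> p X' ` H X'"
  shows "y \<in> p X ` H X"
proof -
  note t = F.C.triD[OF tri]
  note rot = F.C.tri_rot[OF tri]
  obtain z where z: "z \<in> H X'" "p X' z = ar F' f \<cdot>\<^bsub>E\<^esub> y"
    using im by (metis imageE)
  have "p (F.C.SO W) (ar F h \<cdot>\<^bsub>D\<^esub> z) = N0' (F.C.SO W)"
    using p_natural[OF t(3) z(1)] z(2) comp_zero(2)[OF t(2,3) F.C.tri_comp_null[OF rot] y] by simp
  then have "ar F h \<cdot>\<^bsub>D\<^esub> z = N0 (F.C.SO W)"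
    by (rule cell_inj[OF cell_susp[OF W] H_map[OF t(3) z(1)]])
  then obtain x where x: "x \<in> H X" "ar F f \<cdot>\<^bsub>D\<^esub> x = z"
    using F.F_exact[OF rot z(1)] by blast
  note px = p_hom[OF t(5) x(1)]
  note npx = F'.D.neg_hom[OF px px]
  define y' where "y' = Plus E y (neg E (p X x))"
  have y': "y' \<in> H' X"
    using F'.D.plus_hom[OF y npx] by (simp add: y'_def)
  note fy = H'_map[OF t(2) y]
  have "ar F' f \<cdot>\<^bsub>E\<^esub> y' = Plus E (ar F' f \<cdot>\<^bsub>E\<^esub> y) (neg E (p X' z))"
    using F'.D.comp_plus_left[OF y npx F'.F_hom[OF t(2)]] F'.D.comp_neg(1)[OF px F'.F_hom[OF t(2)]]
      p_natural[OF t(2) x(1)] x(2) by (simp add: y'_def)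
  also have "\<dots> = N0' X'"
    using z(2) F'.D.plus_neg[OF fy fy] by simp
  finally obtain y2 where y2: "y2 \<in> H' W" "ar F' w \<cdot>\<^bsub>E\<^esub> y2 = y'"
    using F'.F_exact[OF tri y'] by blast
  obtain w2 where w2: "w2 \<in> H W" "p W w2 = y2"
    using cell_surj[OF W y2(1)] by blast
  note ww = H_map[OF t(1) w2(1)]
  have "p X (Plus D (ar F w \<cdot>\<^bsub>D\<^esub> w2) x) = Plus E y' (p X x)"
    using p_plus[OF t(5) ww x(1)] p_natural[OF t(1) w2(1)] w2(2) y2(2) by simp
  also have "\<dots> = y"
    using F'.D.diff_plus[OF y px] by (simp add: y'_def)
  finally show ?thesis
    using F.D.plus_hom[OF ww x(1)] by blast
qed

text \<open>The other half of the four lemma. It needs surjectivity at the fibre \<open>V\<close> of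
  \<open>W \<rightarrow> X\<close>, an object that is not under control; hence surjectivity is first
  established for all objects.\<close>

lemma inj_step:
  assumes W: "cell W" and tri: "is_triangle C W X X' w f h" and x: "x \<in> H X" "p X x = N0' X"
    and surj: "\<And>V. V \<in> Obj C \<Longrightarrow> p V ` H V = H' V" and fx: "ar F f \<cdot>\<^bsub>D\<^esub> x = N0 X'"
  shows "x = N0 X"
proof -
  note t = F.C.triD[OF tri]
  obtain V v where V: "is_triangle C V W X v w f"
    using F.C.tri_unrot[OF tri] by blast
  note v = F.C.triD[OF V]
  obtain k where k: "k \<in> H W" "ar F w \<cdot>\<^bsub>D\<^esub> k = x"
    using F.F_exact[OF tri x(1) fx] by blast
  have "ar F' w \<cdot>\<^bsub>E\<^esub> p W k = N0' X"
    using p_natural[OF t(1) k(1)] k(2) x(2) by simp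
  then obtain y where y: "y \<in> H' V" "ar F' v \<cdot>\<^bsub>E\<^esub> y = p W k"
    using F'.F_exact[OF V p_hom[OF t(4) k(1)]] by blast
  obtain u where u: "u \<in> H V" "p V u = y"
    using surj[OF v(4)] y(1) by (metis imageE)
  note vu = H_map[OF v(1) u(1)] and pk = p_hom[OF t(4) k(1)]
  have "p W (Plus D k (neg D (ar F v \<cdot>\<^bsub>D\<^esub> u))) = N0' W"
    using p_diff[OF t(4) k(1) vu] p_natural[OF v(1) u(1)] u(2) y(2) F'.D.plus_neg[OF pk pk] by simp
  then have "Plus D k (neg D (ar F v \<cdot>\<^bsub>D\<^esub> u)) = N0 W"
    by (rule cell_inj[OF W F.D.plus_hom[OF k(1) F.D.neg_hom[OF vu vu]]])
  then have "k = ar F v \<cdot>\<^bsub>D\<^esub> u"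
    by (rule F.D.diff_null[OF k(1) vu])
  then show ?thesis
    using k(2) comp_zero(1)[OF v(1,2) F.C.tri_comp_null[OF V] u(1)] by simp
qed

text \<open>\<open>X'\<close> is the cone of the map to \<open>X\<close> from the coproduct of all
  maps out of shifts of generators. Each such map factors through \<open>w\<close> and so dies in
  \<open>X'\<close>. The coproduct is small because \<open>C\<close> is locally small.\<close>

lemma kill_generators:
  assumes \<G>: "small \<kappa> \<G>" "\<forall>A\<in>\<G>. finsum_compact \<kappa> C A" and X: "X \<in> Obj C"
  shows "\<exists>X' f. f \<in> Hom C X X' \<and> (\<exists>W w h. cell W \<and> is_triangle C W X X' w f h) \<and>
    (\<forall>B\<in>\<G>. \<forall>m. \<forall>a\<in>Hom C (ob (shift C m) B) X. f \<cdot>\<^bsub>C\<^esub> a = Null C (ob (shift C m) B) X')"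
proof -
  \<comment> \<open>Each index contains the arrow it stands for, so \<open>snd\<close> is the family
    that defines \<open>w\<close>.\<close>
  define J where "J = Sigma (\<G> \<times> (UNIV :: int set)) (\<lambda>(B, m). Hom C (ob (shift C m) B) X)"
  define Y where "Y = (\<lambda>((B, m), a :: 'm). ob (shift C m) B)"
  have Bo: "B \<in> Obj C" if "B \<in> \<G>" for B
    using \<G>(2) that by (simp add: finsum_compact_def)
  have ls: "locally_small \<kappa> C" and cop: "has_small_coproducts \<kappa> C"
    using compactly_generated by (simp_all add: compactly_generated_def)
  have "small \<kappa> (\<G> \<times> (UNIV :: int set))"
    by (rule small_Sigma[OF F.regular \<G>(1)]) (rule small_countable[OF F.regular], simp)
  then have J: "small \<kappa> J"
    unfolding J_def
  proof (rule small_Sigma[OF F.regular])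
    fix i assume "i \<in> \<G> \<times> (UNIV :: int set)"
    then show "small \<kappa> (case i of (B, m) \<Rightarrow> Hom C (ob (shift C m) B) X)"
      using ls F.C.shift_obj[OF Bo] X by (auto simp: locally_small_def)
  qed
  obtain g :: "(('o \<times> int) \<times> 'm) \<Rightarrow> 'i" where g: "inj_on g J" "small \<kappa> (g ` J)"
    using small_embedding[OF F.regular J] .
  have Yc: "finsum_compact \<kappa> C (Y j)" if "j \<in> J" for j
    using that \<G>(2) F.C.finsum_compact_shift by (auto simp: J_def Y_def)
  have Yo: "Y j \<in> Obj C" if "j \<in> J" for j
    using Yc[OF that] by (simp add: finsum_compact_def)
  obtain W \<iota> where W: "is_coproduct C J Y W \<iota>"
    using F.C.has_small_coproducts_any[OF F.regular cop J Yo] .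
  have "bij_betw (inv_into J g) (g ` J) J"
    by (rule bij_betw_inv_into[OF inj_on_imp_bij_betw[OF g(1)]])
  then have W': "is_coproduct C (g ` J) (Y \<circ> inv_into J g) W (\<iota> \<circ> inv_into J g)"
    using F.C.coprod_reindex W by blast
  have cell: "cell W"
    unfolding cell_def
  proof (intro exI conjI)
    show "\<forall>i\<in>g ` J. finsum_compact \<kappa> C ((Y \<circ> inv_into J g) i)"
      using Yc g(1) by auto
  qed (rule g(2), rule W')
  have snd: "snd j \<in> Hom C (Y j) X" if "j \<in> J" for j
    using that by (auto simp: J_def Y_def)
  obtain w where w: "w \<in> Hom C W X" "\<forall>j\<in>J. w \<cdot>\<^bsub>C\<^esub> \<iota> j = snd j"
    using F.C.coprod_ex[OF W X snd] by blast
  obtain X' f h where tri: "is_triangle C W X X' w f h"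
    using F.C.tri_complete[OF w(1)] by blast
  note t = F.C.triD[OF tri]
  have "f \<cdot>\<^bsub>C\<^esub> a = Null C (ob (shift C m) B) X'" if "B \<in> \<G>" "a \<in> Hom C (ob (shift C m) B) X" for B m a
  proof -
    have j: "((B, m), a) \<in> J"
      using that by (simp add: J_def)
    note i = F.C.coprod_inj[OF W j]
    have "f \<cdot>\<^bsub>C\<^esub> (w \<cdot>\<^bsub>C\<^esub> \<iota> ((B, m), a)) = Null C W X' \<cdot>\<^bsub>C\<^esub> \<iota> ((B, m), a)"
      using F.C.comp_assoc[OF i t(1,2)] F.C.tri_comp_null[OF tri] by simp
    then show ?thesis
      using w(2) j F.C.comp_null_left[OF i t(6)] by (simp add: Y_def)
  qed
  then show ?thesis
    using t(2) cell tri by blast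
qed

theorem bij_p:
  assumes X: "X \<in> Obj C"
  shows "bij_betw (p X) (H X) (H' X)"
proof -
  have cop: "has_small_coproducts \<kappa> C"
    using compactly_generated by (simp add: compactly_generated_def)
  obtain \<G> where \<G>: "small \<kappa> \<G>" "\<forall>A\<in>\<G>. finsum_compact \<kappa> C A"
    "\<forall>Z\<in>Obj C. (\<forall>A\<in>\<G>. \<forall>n. Hom C (ob (shift C n) A) Z = {Null C (ob (shift C n) A) Z}) \<longrightarrow> is_zero C Z"
    using F.C.compact_generators[OF F.regular compactly_generated] .
  define good where "good Y Y' f \<longleftrightarrow> f \<in> Hom C Y Y' \<and> (\<exists>W w h. cell W \<and> is_triangle C W Y Y' w f h) \<and>
    (\<forall>B\<in>\<G>. \<forall>m. \<forall>a\<in>Hom C (ob (shift C m) B) Y. f \<cdot>\<^bsub>C\<^esub> a = Null C (ob (shift C m) B) Y')" for Y Y' f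
  have "\<forall>Y\<in>Obj C. \<exists>Y' f. good Y Y' f"
    unfolding good_def using kill_generators[OF \<G>(1,2)] by blast
  then obtain N s where Ns: "\<And>Y. Y \<in> Obj C \<Longrightarrow> good Y (N Y) (s Y)"
    by metis
  have tower: "\<exists>T f. T 0 = Y \<and> (\<forall>n :: nat. good (T n) (T (Suc n)) (f n))" if Y: "Y \<in> Obj C" for Y
  proof -
    have o: "(N ^^ n) Y \<in> Obj C" for n
    proof (induction n)
      case (Suc n)
      then have "s ((N ^^ n) Y) \<in> Hom C ((N ^^ n) Y) (N ((N ^^ n) Y))"
        using Ns by (simp add: good_def)
      then show ?case
        using F.C.hom_obj by simp
    qed (simp add: Y)
    show ?thesis
      using Ns[OF o] by (intro exI[of _ "\<lambda>n. (N ^^ n) Y"] exI[of _ "\<lambda>n. s ((N ^^ n) Y)"]) simp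
  qed
  have surj: "p Y ` H Y = H' Y" if Y: "Y \<in> Obj C" for Y
  proof (intro equalityI subsetI)
    fix y assume y: "y \<in> H' Y"
    obtain T f where T: "T 0 = Y" "\<And>n :: nat. good (T n) (T (Suc n)) (f n)"
      using tower[OF Y] by blast
    have f: "f n \<in> Hom C (T n) (T (Suc n))" for n
      using T(2)[of n] by (simp add: good_def)
    have kill: "f k \<cdot>\<^bsub>C\<^esub> a = Null C (ob (shift C m) B) (T (Suc k))"
      if "B \<in> \<G>" "a \<in> Hom C (ob (shift C m) B) (T k)" for k B m a
      using T(2)[of k] that by (simp add: good_def)
    have To: "T n \<in> Obj C" for n
      using F.C.hom_obj[OF f] by blast
    define z where "z = rec_nat y (\<lambda>n z. ar F' (f n) \<cdot>\<^bsub>E\<^esub> z)"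
    have z: "z 0 = y" "\<And>n. z (Suc n) = ar F' (f n) \<cdot>\<^bsub>E\<^esub> z n"
      by (simp_all add: z_def)
    have zh: "z n \<in> H' (T n)" for n
      by (induction n) (simp_all add: z y T(1) H'_map[OF f])
    obtain m where m: "z m = N0' (T m)"
      using F'.tower_dies[where \<G> = \<G> and T = T and f = f and A = A' and z = z,
          OF cop \<G>(2,3) f kill compact' _ z(2)] zh[of 0] by blast
    \<comment> \<open>Downward induction: the element vanishes at stage \<open>m\<close>, hence is
      the image of zero there, and \<open>surj_step\<close> goes back one stage at a time.\<close>
    have "z n \<in> p (T n) ` H (T n)" if "n \<le> m" for n
      using that
    proof (induction n rule: inc_induct)
      case base
      show ?case
        using m p_null[OF To] O_hom[OF To] by (metis imageI)
    next
      case (step n)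
      obtain W w h where "cell W" "is_triangle C W (T n) (T (Suc n)) w (f n) h"
        using T(2)[of n] unfolding good_def by blast
      then show ?case
        using surj_step zh step(3) z(2) by simp
    qed
    from this[of 0] show "y \<in> p Y ` H Y"
      using z(1) T(1) by simp
  qed (use p_hom[OF Y] in auto)
  have inj: "x = N0 X" if x: "x \<in> H X" "p X x = N0' X" for x
  proof -
    obtain T f where T: "T 0 = X" "\<And>n :: nat. good (T n) (T (Suc n)) (f n)"
      using tower[OF X] by blast
    have f: "f n \<in> Hom C (T n) (T (Suc n))" for n
      using T(2)[of n] by (simp add: good_def)
    have kill: "f k \<cdot>\<^bsub>C\<^esub> a = Null C (ob (shift C m) B) (T (Suc k))"
      if "B \<in> \<G>" "a \<in> Hom C (ob (shift C m) B) (T k)" for k B m a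
      using T(2)[of k] that by (simp add: good_def)
    define z where "z = rec_nat x (\<lambda>n z. ar F (f n) \<cdot>\<^bsub>D\<^esub> z)"
    have z: "z 0 = x" "\<And>n. z (Suc n) = ar F (f n) \<cdot>\<^bsub>D\<^esub> z n"
      by (simp_all add: z_def)
    \<comment> \<open>By naturality every \<open>z n\<close> stays in the kernel of
      \<open>p\<close>, so \<open>inj_step\<close> is available at each stage of the
      descent.\<close>
    have zh: "z n \<in> H (T n) \<and> p (T n) (z n) = N0' (T n)" for n
      by (induction n) (simp_all add: z x T(1) H_map[OF f] p_natural[OF f] H'_null[OF f])
    obtain m where m: "z m = N0 (T m)"
      using F.tower_dies[where \<G> = \<G> and T = T and f = f and A = A and z = z,
          OF cop \<G>(2,3) f kill compact _ z(2)] zh[of 0] by blast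
    have "z n = N0 (T n)" if "n \<le> m" for n
      using that
    proof (induction n rule: inc_induct)
      case (step n)
      obtain W w h where "cell W" "is_triangle C W (T n) (T (Suc n)) w (f n) h"
        using T(2)[of n] unfolding good_def by blast
      then show ?case
        using inj_step[OF _ _ _ _ surj] zh step(3) z(2) by simp
    qed (rule m)
    from this[of 0] show ?thesis
      using z(1) T(1) by simp
  qed
  have "inj_on (p X) (H X)"
  proof (rule inj_onI)
    fix u v assume uv: "u \<in> H X" "v \<in> H X" "p X u = p X v"
    note pv = p_hom[OF X uv(2)]
    have "Plus D u (neg D v) = N0 X"
      using inj[OF F.D.plus_hom[OF uv(1) F.D.neg_hom[OF uv(2,2)]]] p_diff[OF X uv(1,2)] uv(3)
        F'.D.plus_neg[OF pv pv] by simp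
    then show "u = v"
      by (rule F.D.diff_null[OF uv(1,2)])
  qed
  then show ?thesis
    using surj[OF X] by (simp add: bij_betw_def)
qed

end

section \<open>Monoidal categories\<close>

context category
begin

lemma iso_of_comp_right:
  assumes "f \<cdot> e \<in> Isos C X Z" "e \<in> Isos C X Y" "f \<in> Hom C Y Z"
  shows "f \<in> Isos C Y Z"
proof -
  obtain e' where e: "e \<in> Hom C X Y" "e' \<in> Isos C Y X" "e' \<in> Hom C Y X" "e' \<cdot> e = Ident C X" "e \<cdot> e' = Ident C Y"
    using assms(2) by (rule IsosE)
  have "(f \<cdot> e) \<cdot> e' = f"
    using e assms(3) by (simp add: in_hom)
  then show ?thesis
    using Isos_comp[OF e(2) assms(1)] by simp
qed

lemma iso_of_comp_left:
  assumes "e \<cdot> f \<in> Isos C X Z" "e \<in> Isos C Y Z" "f \<in> Hom C X Y"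
  shows "f \<in> Isos C X Y"
proof -
  obtain e' where e: "e \<in> Hom C Y Z" "e' \<in> Isos C Z Y" "e' \<in> Hom C Z Y" "e' \<cdot> e = Ident C Y" "e \<cdot> e' = Ident C Z"
    using assms(2) by (rule IsosE)
  have "e' \<cdot> (e \<cdot> f) = f"
    using comp_reassoc[OF e(4), of f] e assms(3) by (simp add: in_hom)
  then show ?thesis
    using Isos_comp[OF assms(1) e(2)] by simp
qed

end

context symmetric_monoidal_category
begin

lemma tensor_arr [simp]:
  assumes "f \<in> Arr C" "g \<in> Arr C"
  shows "f \<star> g \<in> Arr C" "Dom C (f \<star> g) = Dom C f \<odot> Dom C g" "Cod C (f \<star> g) = Cod C f \<odot> Cod C g"
  using tensor_ar[of f "Dom C f" "Cod C f" g "Dom C g" "Cod C g"] assms by (auto simp: in_hom)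

lemma tensor_comp_arr:
  "\<lbrakk>f \<in> Arr C; f' \<in> Arr C; g \<in> Arr C; g' \<in> Arr C; Cod C f = Dom C f'; Cod C g = Dom C g'\<rbrakk>
    \<Longrightarrow> (f' \<star> g') \<cdot> (f \<star> g) = (f' \<cdot> f) \<star> (g' \<cdot> g)"
  by (rule tensor_comp[symmetric]) (auto simp: in_hom)

lemma assoc_arr_simps [simp]:
  assumes "X \<in> Obj C" "Y \<in> Obj C" "Z \<in> Obj C"
  shows "Assoc C X Y Z \<in> Arr C" "Dom C (Assoc C X Y Z) = (X \<odot> Y) \<odot> Z" "Cod C (Assoc C X Y Z) = X \<odot> (Y \<odot> Z)"
  using Isos_hom[OF assoc_iso[OF assms]] by (auto simp: in_hom)

lemma unit_arr_simps [simp]: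
  assumes "X \<in> Obj C"
  shows "LUnit C X \<in> Arr C" "Dom C (LUnit C X) = Unit C \<odot> X" "Cod C (LUnit C X) = X"
    "RUnit C X \<in> Arr C" "Dom C (RUnit C X) = X \<odot> Unit C" "Cod C (RUnit C X) = X"
  using Isos_hom[OF lunit_iso[OF assms]] Isos_hom[OF runit_iso[OF assms]] by (auto simp: in_hom)

lemma braid_arr_simps [simp]:
  assumes "X \<in> Obj C" "Y \<in> Obj C"
  shows "Braid C X Y \<in> Arr C" "Dom C (Braid C X Y) = X \<odot> Y" "Cod C (Braid C X Y) = Y \<odot> X"
  using braid_ar[OF assms] by (auto simp: in_hom)

declare tensor_ob [simp] unit_ob [simp]

lemma braid_iso: "\<lbrakk>X \<in> Obj C; Y \<in> Obj C\<rbrakk> \<Longrightarrow> Braid C X Y \<in> Isos C (X \<odot> Y) (Y \<odot> X)"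
  using IsosI[OF braid_ar braid_ar] braid_symmetric by simp

lemma tensor_Isos:
  assumes "f \<in> Isos C X X'" "g \<in> Isos C Y Y'"
  shows "f \<star> g \<in> Isos C (X \<odot> Y) (X' \<odot> Y')"
proof -
  obtain f' where f: "f \<in> Hom C X X'" "f' \<in> Hom C X' X" "f' \<cdot> f = Ident C X" "f \<cdot> f' = Ident C X'"
    using assms(1) by (rule IsosE)
  obtain g' where g: "g \<in> Hom C Y Y'" "g' \<in> Hom C Y' Y" "g' \<cdot> g = Ident C Y" "g \<cdot> g' = Ident C Y'"
    using assms(2) by (rule IsosE)
  have o: "X \<in> Obj C" "Y \<in> Obj C" "X' \<in> Obj C" "Y' \<in> Obj C"
    using hom_obj f(1) g(1) by auto
  show ?thesis
  proof (rule IsosI)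
    show "f \<star> g \<in> Hom C (X \<odot> Y) (X' \<odot> Y')" "f' \<star> g' \<in> Hom C (X' \<odot> Y') (X \<odot> Y)"
      using tensor_ar f(1,2) g(1,2) by auto
    show "(f' \<star> g') \<cdot> (f \<star> g) = Ident C (X \<odot> Y)" "(f \<star> g) \<cdot> (f' \<star> g') = Ident C (X' \<odot> Y')"
      using tensor_comp[OF f(1,2) g(1,2)] tensor_comp[OF f(2,1) g(2,1)] f(3,4) g(3,4) tensor_ident o by auto
  qed
qed

lemma inv_assoc_simps [simp]:
  assumes "X \<in> Obj C" "Y \<in> Obj C" "Z \<in> Obj C"
  shows "inv_arr C (Assoc C X Y Z) \<in> Arr C" "Dom C (inv_arr C (Assoc C X Y Z)) = X \<odot> (Y \<odot> Z)"
    "Cod C (inv_arr C (Assoc C X Y Z)) = (X \<odot> Y) \<odot> Z"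
  using inv_arr(2)[OF assoc_iso[OF assms]] by (auto simp: in_hom)

lemma inv_lunit_simps [simp]:
  assumes "X \<in> Obj C"
  shows "inv_arr C (LUnit C X) \<in> Arr C" "Dom C (inv_arr C (LUnit C X)) = X"
    "Cod C (inv_arr C (LUnit C X)) = Unit C \<odot> X"
  using inv_arr(2)[OF lunit_iso[OF assms]] by (auto simp: in_hom)

subsection \<open>Dual pairs\<close>

definition dual_zigzag :: "'o \<Rightarrow> 'o \<Rightarrow> 'm \<Rightarrow> 'm \<Rightarrow> 'm" where
  "dual_zigzag X D ev coev = (Ident C X \<star> ev) \<cdot> (Assoc C X D X \<cdot> (coev \<star> Ident C X))"

text \<open>Asking only that one zigzag be invertible, rather than that both be identities up to unit
  isomorphisms, spares all coherence laws other than the pentagon and the hexagon.\<close>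

definition half_dual :: "'o \<Rightarrow> 'o \<Rightarrow> 'm \<Rightarrow> 'm \<Rightarrow> bool" where
  "half_dual X D ev coev \<longleftrightarrow> X \<in> Obj C \<and> D \<in> Obj C \<and> ev \<in> Hom C (D \<odot> X) (Unit C) \<and>
     coev \<in> Hom C (Unit C) (X \<odot> D) \<and> dual_zigzag X D ev coev \<in> Isos C (Unit C \<odot> X) (X \<odot> Unit C)"

text \<open>With \<open>dual_unit\<close>, a candidate for the counit and unit of the adjunction
  whose left adjoint tensors with \<open>D\<close> and whose right adjoint tensors with
  \<open>X\<close>, both on the left.\<close>

definition dual_counit :: "'o \<Rightarrow> 'o \<Rightarrow> 'm \<Rightarrow> 'o \<Rightarrow> 'm" where
  "dual_counit X D ev Z = LUnit C Z \<cdot> ((ev \<star> Ident C Z) \<cdot> inv_arr C (Assoc C D X Z))"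

definition dual_unit :: "'o \<Rightarrow> 'o \<Rightarrow> 'm \<Rightarrow> 'o \<Rightarrow> 'm" where
  "dual_unit X D coev Z = Assoc C X D Z \<cdot> ((coev \<star> Ident C Z) \<cdot> inv_arr C (LUnit C Z))"

lemma dual_counit_hom:
  assumes "half_dual X D ev coev" "Z \<in> Obj C"
  shows "dual_counit X D ev Z \<in> Hom C (D \<odot> (X \<odot> Z)) Z" "dual_unit X D coev Z \<in> Hom C Z (X \<odot> (D \<odot> Z))"
  using assms by (auto simp: half_dual_def dual_counit_def dual_unit_def in_hom)

lemma dual_counit_assoc:
  assumes "half_dual X D ev coev" "Z \<in> Obj C"
  shows "dual_counit X D ev Z \<cdot> Assoc C D X Z = LUnit C Z \<cdot> (ev \<star> Ident C Z)"
proof -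
  have o: "X \<in> Obj C" "D \<in> Obj C" and ev: "ev \<in> Arr C" "Dom C ev = D \<odot> X" "Cod C ev = Unit C"
    using assms(1) by (auto simp: half_dual_def in_hom)
  have "inv_arr C (Assoc C D X Z) \<cdot> Assoc C D X Z = Ident C ((D \<odot> X) \<odot> Z)"
    by (rule inv_arr(3)[OF assoc_iso[OF o(2,1) assms(2)]])
  then show ?thesis
    using o ev assms(2) by (simp add: dual_counit_def)
qed

lemma dual_unit_lunit:
  assumes "half_dual X D ev coev" "Z \<in> Obj C"
  shows "dual_unit X D coev Z \<cdot> LUnit C Z = Assoc C X D Z \<cdot> (coev \<star> Ident C Z)"
proof -
  have o: "X \<in> Obj C" "D \<in> Obj C" and coev: "coev \<in> Arr C" "Dom C coev = Unit C" "Cod C coev = X \<odot> D"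
    using assms(1) by (auto simp: half_dual_def in_hom)
  have "inv_arr C (LUnit C Z) \<cdot> LUnit C Z = Ident C (Unit C \<odot> Z)"
    by (rule inv_arr(3)[OF lunit_iso[OF assms(2)]])
  then show ?thesis
    using o coev assms(2) by (simp add: dual_unit_def)
qed

text \<open>Precomposing with the associator removes its inverse from \<open>dual_counit\<close> and
  leaves a composite of maps whose naturality is known.\<close>

lemma dual_counit_natural:
  assumes hd: "half_dual X D ev coev" and f: "f \<in> Hom C Z Z'"
  shows "f \<cdot> dual_counit X D ev Z = dual_counit X D ev Z' \<cdot> (Ident C D \<star> (Ident C X \<star> f))"
proof -
  have o: "X \<in> Obj C" "D \<in> Obj C" "Z \<in> Obj C" "Z' \<in> Obj C"
    and ev: "ev \<in> Hom C (D \<odot> X) (Unit C)"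
    using hd hom_obj[OF f] by (auto simp: half_dual_def)
  note c = dual_counit_hom(1)[OF hd]
  have e1: "ev \<star> Ident C Z \<in> Hom C ((D \<odot> X) \<odot> Z) (Unit C \<odot> Z)"
    by (rule tensor_ar[OF ev ident[OF o(3)]])
  note lZ = Isos_hom[OF lunit_iso[OF o(3)]]
  have DXf: "Ident C D \<star> (Ident C X \<star> f) \<in> Hom C (D \<odot> (X \<odot> Z)) (D \<odot> (X \<odot> Z'))"
    using o f by (simp add: in_hom)
  show ?thesis
  proof (rule iso_cancel_right[OF assoc_iso[OF o(2,1,3)] comp[OF c[OF o(3)] f] comp[OF DXf c[OF o(4)]]])
    have "(f \<cdot> dual_counit X D ev Z) \<cdot> Assoc C D X Z = f \<cdot> (LUnit C Z \<cdot> (ev \<star> Ident C Z))"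
      using dual_counit_assoc[OF hd o(3)] comp_assoc[OF Isos_hom[OF assoc_iso[OF o(2,1,3)]] c[OF o(3)] f] by simp
    also have "\<dots> = LUnit C Z' \<cdot> ((Ident C (Unit C) \<star> f) \<cdot> (ev \<star> Ident C Z))"
      using lunit_natural[OF f] comp_assoc[OF e1 lZ f]
        comp_assoc[OF e1 tensor_ar[OF ident[OF unit_ob] f] Isos_hom[OF lunit_iso[OF o(4)]]] by simp
    also have "(Ident C (Unit C) \<star> f) \<cdot> (ev \<star> Ident C Z) = (ev \<star> Ident C Z') \<cdot> ((Ident C (D \<odot> X)) \<star> f)"
      using o f ev by (simp add: tensor_comp_arr in_hom)
    also have "LUnit C Z' \<cdot> ((ev \<star> Ident C Z') \<cdot> ((Ident C (D \<odot> X)) \<star> f))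
        = dual_counit X D ev Z' \<cdot> (Assoc C D X Z' \<cdot> ((Ident C (D \<odot> X)) \<star> f))"
      using comp_reassoc[OF dual_counit_assoc[OF hd o(4)], of "Ident C (D \<odot> X) \<star> f"] o f ev c[OF o(4)]
      by (simp add: in_hom)
    also have "Assoc C D X Z' \<cdot> ((Ident C (D \<odot> X)) \<star> f) = (Ident C D \<star> (Ident C X \<star> f)) \<cdot> Assoc C D X Z"
      using assoc_natural[OF ident[OF o(2)] ident[OF o(1)] f] tensor_ident[OF o(2,1)] by simp
    also have "dual_counit X D ev Z' \<cdot> ((Ident C D \<star> (Ident C X \<star> f)) \<cdot> Assoc C D X Z)
        = (dual_counit X D ev Z' \<cdot> (Ident C D \<star> (Ident C X \<star> f))) \<cdot> Assoc C D X Z"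
      using o f c[OF o(4)] by (simp add: in_hom)
    finally show "(f \<cdot> dual_counit X D ev Z) \<cdot> Assoc C D X Z
        = (dual_counit X D ev Z' \<cdot> (Ident C D \<star> (Ident C X \<star> f))) \<cdot> Assoc C D X Z" .
  qed
qed

lemma dual_unit_natural:
  assumes hd: "half_dual X D ev coev" and f: "f \<in> Hom C Z Z'"
  shows "dual_unit X D coev Z' \<cdot> f = (Ident C X \<star> (Ident C D \<star> f)) \<cdot> dual_unit X D coev Z"
proof -
  have o: "X \<in> Obj C" "D \<in> Obj C" "Z \<in> Obj C" "Z' \<in> Obj C"
    and ev: "coev \<in> Hom C (Unit C) (X \<odot> D)"
    using hd hom_obj[OF f] by (auto simp: half_dual_def)
  note c = dual_counit_hom(2)[OF hd]
  have XDf: "Ident C X \<star> (Ident C D \<star> f) \<in> Hom C (X \<odot> (D \<odot> Z)) (X \<odot> (D \<odot> Z'))"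
    using o f by (simp add: in_hom)
  show ?thesis
  proof (rule iso_cancel_right[OF lunit_iso[OF o(3)] comp[OF f c[OF o(4)]] comp[OF c[OF o(3)] XDf]])
    have "(dual_unit X D coev Z' \<cdot> f) \<cdot> LUnit C Z = dual_unit X D coev Z' \<cdot> (LUnit C Z' \<cdot> (Ident C (Unit C) \<star> f))"
      using lunit_natural[OF f] comp_assoc[OF Isos_hom[OF lunit_iso[OF o(3)]] f c[OF o(4)]] by simp
    also have "\<dots> = (Assoc C X D Z' \<cdot> (coev \<star> Ident C Z')) \<cdot> (Ident C (Unit C) \<star> f)"
      using comp_reassoc[OF dual_unit_lunit[OF hd o(4)], of "Ident C (Unit C) \<star> f"] o f ev c[OF o(4)]
      by (simp add: in_hom)
    also have "\<dots> = Assoc C X D Z' \<cdot> ((Ident C (X \<odot> D) \<star> f) \<cdot> (coev \<star> Ident C Z))"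
      using o f ev by (simp add: tensor_comp_arr in_hom)
    also have "\<dots> = (Assoc C X D Z' \<cdot> ((Ident C X \<star> Ident C D) \<star> f)) \<cdot> (coev \<star> Ident C Z)"
      using o f ev tensor_ident[OF o(1,2)] by (simp add: in_hom)
    also have "\<dots> = ((Ident C X \<star> (Ident C D \<star> f)) \<cdot> Assoc C X D Z) \<cdot> (coev \<star> Ident C Z)"
      using assoc_natural[OF ident[OF o(1)] ident[OF o(2)] f] by simp
    also have "\<dots> = (Ident C X \<star> (Ident C D \<star> f)) \<cdot> (dual_unit X D coev Z \<cdot> LUnit C Z)"
      using dual_unit_lunit[OF hd o(3)] o f ev by (simp add: in_hom)
    also have "\<dots> = ((Ident C X \<star> (Ident C D \<star> f)) \<cdot> dual_unit X D coev Z) \<cdot> LUnit C Z"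
      using o f c[OF o(3)] by (simp add: in_hom)
    finally show "(dual_unit X D coev Z' \<cdot> f) \<cdot> LUnit C Z
        = ((Ident C X \<star> (Ident C D \<star> f)) \<cdot> dual_unit X D coev Z) \<cdot> LUnit C Z" .
  qed
qed

text \<open>A triangle identity that holds up to an automorphism. After precomposition with the
  canonical isomorphism from \<open>(1 \<otimes> X) \<otimes> Z\<close>, the composite becomes the
  invertible zigzag tensored with \<open>Z\<close>, followed by canonical isomorphisms.\<close>

lemma dual_triangle_iso:
  assumes hd: "half_dual X D ev coev" and Z: "Z \<in> Obj C"
  shows "(Ident C X \<star> dual_counit X D ev Z) \<cdot> dual_unit X D coev (X \<odot> Z) \<in> Isos C (X \<odot> Z) (X \<odot> Z)"
proof -
  let ?I = "Ident C" and ?a = "Assoc C" and ?U = "Unit C"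
  let ?e = "dual_counit X D ev Z" and ?n = "dual_unit X D coev (X \<odot> Z)"
  have o: "X \<in> Obj C" "D \<in> Obj C" and ev: "ev \<in> Hom C (D \<odot> X) ?U" and coev: "coev \<in> Hom C ?U (X \<odot> D)"
    and zz: "dual_zigzag X D ev coev \<in> Isos C (?U \<odot> X) (X \<odot> ?U)"
    using hd by (auto simp: half_dual_def)
  have XZ: "X \<odot> Z \<in> Obj C"
    using o Z by simp
  note e = dual_counit_hom(1)[OF hd Z] and n = dual_counit_hom(2)[OF hd XZ]
  let ?k = "(?I X \<star> ?e) \<cdot> ?n" and ?la = "LUnit C (X \<odot> Z) \<cdot> ?a ?U X Z"
  have k: "?k \<in> Hom C (X \<odot> Z) (X \<odot> Z)"
    using o Z e n by (simp add: in_hom)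
  have la: "?la \<in> Isos C ((?U \<odot> X) \<odot> Z) (X \<odot> Z)"
    using Isos_comp[OF assoc_iso lunit_iso] o Z by simp
  have "?k \<cdot> ?la = (?I X \<star> ?e) \<cdot> ((?n \<cdot> LUnit C (X \<odot> Z)) \<cdot> ?a ?U X Z)"
    using o Z e n by (simp add: in_hom)
  also have "\<dots> = (?I X \<star> ?e) \<cdot> (?a X D (X \<odot> Z) \<cdot> ((coev \<star> ?I (X \<odot> Z)) \<cdot> ?a ?U X Z))"
    using dual_unit_lunit[OF hd XZ] o Z e n coev by (simp add: in_hom)
  also have "(coev \<star> ?I (X \<odot> Z)) \<cdot> ?a ?U X Z = ?a (X \<odot> D) X Z \<cdot> ((coev \<star> ?I X) \<star> ?I Z)"
    using assoc_natural[OF coev ident[OF o(1)] ident[OF Z]] tensor_ident[OF o(1) Z] by simp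
  \<comment> \<open>The pentagon rebrackets so that coevaluation and evaluation meet inside the
    factor in front of \<open>Z\<close>.\<close>
  also have "?a X D (X \<odot> Z) \<cdot> (?a (X \<odot> D) X Z \<cdot> ((coev \<star> ?I X) \<star> ?I Z))
      = (?I X \<star> ?a D X Z) \<cdot> (?a X (D \<odot> X) Z \<cdot> ((?a X D X \<star> ?I Z) \<cdot> ((coev \<star> ?I X) \<star> ?I Z)))"
    using comp_reassoc[OF pentagon[OF o(1,2,1) Z, symmetric], of "(coev \<star> ?I X) \<star> ?I Z"] o Z coev
    by (simp add: in_hom)
  also have "(?I X \<star> ?e) \<cdot> ((?I X \<star> ?a D X Z) \<cdot> (?a X (D \<odot> X) Z \<cdot> ((?a X D X \<star> ?I Z) \<cdot> ((coev \<star> ?I X) \<star> ?I Z))))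
      = ((?I X \<star> ?e) \<cdot> (?I X \<star> ?a D X Z)) \<cdot> (?a X (D \<odot> X) Z \<cdot> ((?a X D X \<star> ?I Z) \<cdot> ((coev \<star> ?I X) \<star> ?I Z)))"
    using o Z e coev by (simp add: in_hom)
  also have "(?I X \<star> ?e) \<cdot> (?I X \<star> ?a D X Z) = (?I X \<star> LUnit C Z) \<cdot> (?I X \<star> (ev \<star> ?I Z))"
    using dual_counit_assoc[OF hd Z] o Z e ev by (simp add: in_hom tensor_comp_arr)
  also have "((?I X \<star> LUnit C Z) \<cdot> (?I X \<star> (ev \<star> ?I Z))) \<cdot>
        (?a X (D \<odot> X) Z \<cdot> ((?a X D X \<star> ?I Z) \<cdot> ((coev \<star> ?I X) \<star> ?I Z)))
      = (?I X \<star> LUnit C Z) \<cdot> (((?I X \<star> (ev \<star> ?I Z)) \<cdot> ?a X (D \<odot> X) Z) \<cdot>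
          ((?a X D X \<star> ?I Z) \<cdot> ((coev \<star> ?I X) \<star> ?I Z)))"
    using o Z ev coev by (simp add: in_hom)
  also have "(?I X \<star> (ev \<star> ?I Z)) \<cdot> ?a X (D \<odot> X) Z = ?a X ?U Z \<cdot> ((?I X \<star> ev) \<star> ?I Z)"
    using assoc_natural[OF ident[OF o(1)] ev ident[OF Z]] by simp
  also have "(?I X \<star> LUnit C Z) \<cdot> ((?a X ?U Z \<cdot> ((?I X \<star> ev) \<star> ?I Z)) \<cdot>
          ((?a X D X \<star> ?I Z) \<cdot> ((coev \<star> ?I X) \<star> ?I Z)))
      = (?I X \<star> LUnit C Z) \<cdot> (?a X ?U Z \<cdot> (dual_zigzag X D ev coev \<star> ?I Z))"
    using o Z ev coev by (simp add: in_hom dual_zigzag_def tensor_comp_arr)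
  finally have eq: "?k \<cdot> ?la = (?I X \<star> LUnit C Z) \<cdot> (?a X ?U Z \<cdot> (dual_zigzag X D ev coev \<star> ?I Z))" .
  have "(?I X \<star> LUnit C Z) \<cdot> (?a X ?U Z \<cdot> (dual_zigzag X D ev coev \<star> ?I Z)) \<in> Isos C ((?U \<odot> X) \<odot> Z) (X \<odot> Z)"
    using Isos_comp[OF Isos_comp[OF tensor_Isos[OF zz Isos_ident[OF Z]] assoc_iso[OF o(1) unit_ob Z]]
        tensor_Isos[OF Isos_ident[OF o(1)] lunit_iso[OF Z]]] .
  then show ?thesis
    using iso_of_comp_right[OF _ la k] eq by simp
qed

definition tensor_right :: "'o \<Rightarrow> ('o, 'm, 'o, 'm) fctr" where
  "tensor_right W = \<lparr>ob = (\<lambda>X. X \<odot> W), ar = (\<lambda>f. f \<star> Ident C W)\<rparr>"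

lemma tensor_right_simps [simp]:
  "ob (tensor_right W) X = X \<odot> W" "ar (tensor_right W) f = f \<star> Ident C W"
  by (simp_all add: tensor_right_def)

lemma tensor_right_functor: "W \<in> Obj C \<Longrightarrow> is_functor C C (tensor_right W)"
  by (auto simp: is_functor_def tensor_ident in_hom tensor_comp_arr)

end

section \<open>Internal hom, rigid objects and dual pairs\<close>

context closed_symmetric_monoidal_category
begin

text \<open>As a left adjoint, tensoring with \<open>W\<close> preserves coproducts and is therefore
  additive.\<close>

lemma tensor_adjunction:
  assumes W: "W \<in> Obj C"
  shows "counit_adjunction C C (tensor_right W) (IHom C W) (Eval C W)"
proof unfold_locales
  show "is_functor C C (tensor_right W)"
    by (rule tensor_right_functor[OF W])
  show "IHom C W Y \<in> Obj C" "Eval C W Y \<in> Hom C (ob (tensor_right W) (IHom C W Y)) Y" if "Y \<in> Obj C" for Y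
    using ihom_ob[OF W that] eval_ar[OF W that] by simp_all
  show "\<exists>g\<in>Hom C X (IHom C W Y). Eval C W Y \<cdot> ar (tensor_right W) g = f"
    if "X \<in> Obj C" "f \<in> Hom C (ob (tensor_right W) X) Y" for X f Y
    using eval_universal[OF that(1) W, of Y f] hom_obj[OF that(2)] that(2) by auto
  show "g = h" if Y: "Y \<in> Obj C" and gh: "g \<in> Hom C X (IHom C W Y)" "h \<in> Hom C X (IHom C W Y)"
    and eq: "Eval C W Y \<cdot> ar (tensor_right W) g = Eval C W Y \<cdot> ar (tensor_right W) h" for Y g h X
  proof -
    have X: "X \<in> Obj C"
      using hom_obj[OF gh(1)] by simp
    have "Eval C W Y \<cdot> (h \<star> Ident C W) \<in> Hom C (X \<odot> W) Y"
      using comp[OF tensor_ar[OF gh(2) ident[OF W]] eval_ar[OF W Y]] .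
    then have ex1: "\<exists>!k. k \<in> Hom C X (IHom C W Y) \<and> Eval C W Y \<cdot> (k \<star> Ident C W) = Eval C W Y \<cdot> (h \<star> Ident C W)"
      by (rule eval_universal[OF X W Y])
    show ?thesis
      by (rule ex1E[OF ex1]) (use gh eq in auto)
  qed
qed

lemma curry_arr:
  assumes "A \<in> Obj C" "X \<in> Obj C" "Y \<in> Obj C" "f \<in> Hom C (A \<odot> X) Y"
  shows "curry_arr C A X Y f \<in> Hom C A (IHom C X Y)" "Eval C X Y \<cdot> (curry_arr C A X Y f \<star> Ident C X) = f"
  using theI'[OF eval_universal[OF assms]] unfolding curry_arr_def by auto

lemma dual_map:
  assumes o: "X \<in> Obj C" "Y \<in> Obj C"
  defines "D \<equiv> IHom C X (Unit C)"
  shows "dual_map C X Y \<in> Hom C (D \<odot> Y) (IHom C X Y)"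
    and "Eval C X Y \<cdot> (dual_map C X Y \<star> Ident C X) =
      LUnit C Y \<cdot> ((Eval C X (Unit C) \<star> Ident C Y) \<cdot> (inv_arr C (Assoc C D X Y)
        \<cdot> ((Ident C D \<star> Braid C Y X) \<cdot> Assoc C D Y X)))"
proof -
  have D: "D \<in> Obj C" and ev: "Eval C X (Unit C) \<in> Hom C (D \<odot> X) (Unit C)"
    using ihom_ob[OF o(1) unit_ob] eval_ar[OF o(1) unit_ob] by (simp_all add: D_def)
  let ?t = "LUnit C Y \<cdot> ((Eval C X (Unit C) \<star> Ident C Y) \<cdot> (inv_arr C (Assoc C D X Y)
        \<cdot> ((Ident C D \<star> Braid C Y X) \<cdot> Assoc C D Y X)))"
  have t: "?t \<in> Hom C ((D \<odot> Y) \<odot> X) Y"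
    using o D ev by (simp add: in_hom)
  have "dual_map C X Y = curry_arr C (D \<odot> Y) X Y ?t"
    using o D ev by (simp add: dual_map_def Let_def in_hom flip: D_def)
  then show "dual_map C X Y \<in> Hom C (D \<odot> Y) (IHom C X Y)" "Eval C X Y \<cdot> (dual_map C X Y \<star> Ident C X) = ?t"
    using curry_arr[OF tensor_ob[OF D o(2)] o t] by simp_all
qed

text \<open>The coevaluation is the map from the unit to \<open>IHom C X X\<close> that names the
  identity, lifted along the invertible \<open>dual_map\<close> and braided. The zigzag then differs
  from a unit isomorphism by a braiding.\<close>

lemma rigid_half_dual:
  assumes r: "is_rigid C X"
  obtains D ev coev where "half_dual X D ev coev"
proof -
  let ?I = "Ident C" and ?a = "Assoc C" and ?U = "Unit C" and ?b = "Braid C"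
  define D where "D = IHom C X ?U"
  define ev where "ev = Eval C X ?U"
  have X: "X \<in> Obj C" and m: "is_iso C (dual_map C X X)"
    using r by (auto simp: is_rigid_def)
  have D: "D \<in> Obj C" and ev: "ev \<in> Hom C (D \<odot> X) ?U"
    using ihom_ob[OF X unit_ob] eval_ar[OF X unit_ob] by (simp_all add: D_def ev_def)
  note dm = dual_map[OF X X, folded D_def ev_def]
  let ?m = "dual_map C X X"
  have m: "?m \<in> Isos C (D \<odot> X) (IHom C X X)"
    using m dm(1) by (simp add: Isos_def)
  obtain m' where m': "m' \<in> Hom C (IHom C X X) (D \<odot> X)" "?m \<cdot> m' = ?I (IHom C X X)"
    using m by (rule IsosE)
  \<comment> \<open>\<open>LUnit C X\<close> corresponds to the identity of \<open>X\<close>, so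
    \<open>j\<close> is the name of the identity.\<close>
  define j where "j = curry_arr C ?U X X (LUnit C X)"
  have j: "j \<in> Hom C ?U (IHom C X X)" "Eval C X X \<cdot> (j \<star> ?I X) = LUnit C X"
    using curry_arr[OF unit_ob X X Isos_hom[OF lunit_iso[OF X]]] by (simp_all add: j_def)
  define c where "c = m' \<cdot> j"
  have c: "c \<in> Hom C ?U (D \<odot> X)"
    using comp[OF j(1) m'(1)] by (simp add: c_def)
  have mc: "?m \<cdot> c = j"
    using comp_reassoc[OF m'(2), of j] j(1) m'(1) dm(1) by (simp add: in_hom c_def)
  note E = eval_ar[OF X X] and ho = ihom_ob[OF X X]
  let ?t = "LUnit C X \<cdot> ((ev \<star> ?I X) \<cdot> (inv_arr C (?a D X X) \<cdot> ((?I D \<star> ?b X X) \<cdot> ?a D X X)))"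
  have "?t \<cdot> (c \<star> ?I X) = Eval C X X \<cdot> ((?m \<star> ?I X) \<cdot> (c \<star> ?I X))"
    using comp_assoc[OF tensor_ar[OF c ident[OF X]] tensor_ar[OF dm(1) ident[OF X]] E] dm(2) by simp
  also have "\<dots> = LUnit C X"
    using mc j dm(1) c X by (simp add: in_hom tensor_comp_arr)
  finally have tc: "?t \<cdot> (c \<star> ?I X) = LUnit C X" .
  define coev where "coev = ?b D X \<cdot> c"
  have coev: "coev \<in> Hom C ?U (X \<odot> D)"
    using comp[OF c braid_ar[OF D X]] by (simp add: coev_def)
  let ?z = "dual_zigzag X D ev coev"
  have z: "?z \<in> Hom C (?U \<odot> X) (X \<odot> ?U)"
    using X D ev coev by (simp add: dual_zigzag_def in_hom)
  \<comment> \<open>The hexagon, with one braiding cancelled by symmetry, matches the associator in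
    the zigzag with the rearrangement of factors in \<open>dual_map\<close>.\<close>
  have h: "?b X (D \<odot> X) \<cdot> (?a X D X \<cdot> (?b D X \<star> ?I X)) = inv_arr C (?a D X X) \<cdot> ((?I D \<star> ?b X X) \<cdot> ?a D X X)"
  proof (rule iso_cancel_left[OF assoc_iso[OF D X X]])
    show "?b X (D \<odot> X) \<cdot> (?a X D X \<cdot> (?b D X \<star> ?I X)) \<in> Hom C ((D \<odot> X) \<odot> X) ((D \<odot> X) \<odot> X)"
      "inv_arr C (?a D X X) \<cdot> ((?I D \<star> ?b X X) \<cdot> ?a D X X) \<in> Hom C ((D \<odot> X) \<odot> X) ((D \<odot> X) \<odot> X)"
      using X D by (simp_all add: in_hom)
    have "?a D X X \<cdot> (?b X (D \<odot> X) \<cdot> (?a X D X \<cdot> (?b D X \<star> ?I X)))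
        = (?a D X X \<cdot> ?b X (D \<odot> X) \<cdot> ?a X D X) \<cdot> (?b D X \<star> ?I X)"
      using X D by simp
    also have "\<dots> = ((?I D \<star> ?b X X) \<cdot> ?a D X X) \<cdot> ((?b X D \<star> ?I X) \<cdot> (?b D X \<star> ?I X))"
      using hexagon[OF X D X] X D by simp
    also have "(?b X D \<star> ?I X) \<cdot> (?b D X \<star> ?I X) = ?I ((D \<odot> X) \<odot> X)"
      using X D by (simp add: tensor_comp_arr braid_symmetric tensor_ident)
    also have "((?I D \<star> ?b X X) \<cdot> ?a D X X) \<cdot> ?I ((D \<odot> X) \<odot> X) = (?I D \<star> ?b X X) \<cdot> ?a D X X"
      using X D by simp
    also have "\<dots> = ?a D X X \<cdot> (inv_arr C (?a D X X) \<cdot> ((?I D \<star> ?b X X) \<cdot> ?a D X X))"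
      using comp_reassoc[OF inv_arr(4)[OF assoc_iso[OF D X X]], of "(?I D \<star> ?b X X) \<cdot> ?a D X X"] X D by simp
    finally show "?a D X X \<cdot> (?b X (D \<odot> X) \<cdot> (?a X D X \<cdot> (?b D X \<star> ?I X)))
        = ?a D X X \<cdot> (inv_arr C (?a D X X) \<cdot> ((?I D \<star> ?b X X) \<cdot> ?a D X X))" .
  qed
  have "(LUnit C X \<cdot> ?b X ?U) \<cdot> ?z
      = LUnit C X \<cdot> ((?b X ?U \<cdot> (?I X \<star> ev)) \<cdot> (?a X D X \<cdot> (coev \<star> ?I X)))"
    using X D ev coev by (simp add: dual_zigzag_def in_hom)
  also have "?b X ?U \<cdot> (?I X \<star> ev) = (ev \<star> ?I X) \<cdot> ?b X (D \<odot> X)"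
    by (rule braid_natural[OF ident[OF X] ev])
  also have "coev \<star> ?I X = (?b D X \<star> ?I X) \<cdot> (c \<star> ?I X)"
    using X D c by (simp add: coev_def in_hom tensor_comp_arr)
  also have "LUnit C X \<cdot> (((ev \<star> ?I X) \<cdot> ?b X (D \<odot> X)) \<cdot> (?a X D X \<cdot> ((?b D X \<star> ?I X) \<cdot> (c \<star> ?I X))))
      = (LUnit C X \<cdot> ((ev \<star> ?I X) \<cdot> (?b X (D \<odot> X) \<cdot> (?a X D X \<cdot> (?b D X \<star> ?I X))))) \<cdot> (c \<star> ?I X)"
    using X D c ev by (simp add: in_hom)
  also have "\<dots> = LUnit C X"
    using h tc by simp
  finally have eq: "(LUnit C X \<cdot> ?b X ?U) \<cdot> ?z = LUnit C X" .
  have "?z \<in> Isos C (?U \<odot> X) (X \<odot> ?U)"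
    using iso_of_comp_left[OF _ Isos_comp[OF braid_iso[OF X unit_ob] lunit_iso[OF X]] z] eq lunit_iso[OF X] by simp
  then have "half_dual X D ev coev"
    using X D ev coev by (simp add: half_dual_def)
  then show ?thesis
    by (rule that)
qed

text \<open>Tensoring with the unit is isomorphic to the identity functor, so evaluation at the unit
  is invertible by Yoneda. In the equation that defines \<open>dual_map\<close> every other factor
  is then invertible, hence so is \<open>dual_map\<close> itself.\<close>

lemma unit_rigid: "is_rigid C (Unit C)"
proof -
  let ?I = "Ident C" and ?U = "Unit C"
  have ev_iso: "Eval C ?U Y \<in> Isos C (IHom C ?U Y \<odot> ?U) Y" if Y: "Y \<in> Obj C" for Y
  proof -
    interpret T: counit_adjunction C C "tensor_right ?U" "IHom C ?U" "Eval C ?U"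
      by (rule tensor_adjunction) simp
    let ?H = "IHom C ?U Y"
    have H: "?H \<in> Obj C"
      using ihom_ob Y by simp
    have E: "Eval C ?U Y \<in> Hom C (?H \<odot> ?U) Y"
      using eval_ar Y by simp
    let ?r = "inv_arr C (RUnit C ?H)"
    have r: "?r \<in> Isos C ?H (?H \<odot> ?U)" "?r \<in> Hom C ?H (?H \<odot> ?U)" "?r \<cdot> RUnit C ?H = ?I (?H \<odot> ?U)"
      using inv_arr[OF runit_iso[OF H]] by simp_all
    have "Eval C ?U Y \<cdot> ?r \<in> Isos C ?H Y"
    proof (rule Isos_by_hom[OF comp[OF r(2) E]])
      fix A assume A: "A \<in> Obj C"
      have eq: "(Eval C ?U Y \<cdot> ?r) \<cdot> g \<cdot> RUnit C A = Eval C ?U Y \<cdot> (g \<star> ?I ?U)" if g: "g \<in> Hom C A ?H" for g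
      proof -
        have "(Eval C ?U Y \<cdot> ?r) \<cdot> g \<cdot> RUnit C A = Eval C ?U Y \<cdot> (?r \<cdot> (g \<cdot> RUnit C A))"
          using E r(2) g A by (simp add: in_hom)
        also have "\<dots> = Eval C ?U Y \<cdot> ((?r \<cdot> RUnit C ?H) \<cdot> (g \<star> ?I ?U))"
          using runit_natural[OF g] r(2) g H by (simp add: in_hom)
        also have "\<dots> = Eval C ?U Y \<cdot> (g \<star> ?I ?U)"
          using r(3) g by (simp add: in_hom)
        finally show ?thesis .
      qed
      have Er: "(Eval C ?U Y \<cdot> ?r) \<cdot> g \<in> Hom C A Y" if "g \<in> Hom C A ?H" for g
        using comp[OF that comp[OF r(2) E]] .
      show "bij_betw ((\<cdot>) (Eval C ?U Y \<cdot> ?r)) (Hom C A ?H) (Hom C A Y)"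
        unfolding bij_betw_def
      proof (intro conjI inj_onI equalityI subsetI)
        fix g h assume gh: "g \<in> Hom C A ?H" "h \<in> Hom C A ?H" "(Eval C ?U Y \<cdot> ?r) \<cdot> g = (Eval C ?U Y \<cdot> ?r) \<cdot> h"
        then have "Eval C ?U Y \<cdot> (g \<star> ?I ?U) = Eval C ?U Y \<cdot> (h \<star> ?I ?U)"
          using eq[OF gh(1)] eq[OF gh(2)] by metis
        then show "g = h"
          using T.transpose_unique[OF Y gh(1,2)] by simp
      next
        fix f assume f: "f \<in> Hom C A Y"
        have "f \<cdot> RUnit C A \<in> Hom C (A \<odot> ?U) Y"
          using f A by (simp add: in_hom)
        then obtain g where g: "g \<in> Hom C A ?H" "Eval C ?U Y \<cdot> (g \<star> ?I ?U) = f \<cdot> RUnit C A"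
          using T.transpose_ex[OF A, of "f \<cdot> RUnit C A" Y] by auto
        have "(Eval C ?U Y \<cdot> ?r) \<cdot> g = f"
          by (rule iso_cancel_right[OF runit_iso[OF A] Er[OF g(1)] f]) (simp only: eq[OF g(1)] g(2))
        then show "f \<in> (\<cdot>) (Eval C ?U Y \<cdot> ?r) ` Hom C A ?H"
          using g(1) by blast
      qed (use Er in auto)
    qed
    then show ?thesis
      using iso_of_comp_right[OF _ r(1) E] by blast
  qed
  show ?thesis
    unfolding is_rigid_def
  proof (intro conjI ballI unit_ob)
    fix Y assume Y: "Y \<in> Obj C"
    let ?D = "IHom C ?U ?U" and ?m = "dual_map C ?U Y"
    note dm = dual_map[OF unit_ob Y]
    have D: "?D \<in> Obj C" and H: "IHom C ?U Y \<in> Obj C"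
      using ihom_ob Y by simp_all
    have "Eval C ?U Y \<cdot> (?m \<star> ?I ?U) \<in> Isos C ((?D \<odot> Y) \<odot> ?U) Y"
      unfolding dm(2)
      using Isos_comp[OF Isos_comp[OF Isos_comp[OF Isos_comp[OF assoc_iso[OF D Y unit_ob]
              tensor_Isos[OF Isos_ident[OF D] braid_iso[OF Y unit_ob]]] inv_arr(1)[OF assoc_iso[OF D unit_ob Y]]]
            tensor_Isos[OF ev_iso[OF unit_ob] Isos_ident[OF Y]]] lunit_iso[OF Y]] .
    then have "?m \<star> ?I ?U \<in> Isos C ((?D \<odot> Y) \<odot> ?U) (IHom C ?U Y \<odot> ?U)"
      using iso_of_comp_left[OF _ ev_iso[OF Y] tensor_ar[OF dm(1) ident[OF unit_ob]]] by blast
    then have "RUnit C (IHom C ?U Y) \<cdot> (?m \<star> ?I ?U) \<in> Isos C ((?D \<odot> Y) \<odot> ?U) (IHom C ?U Y)"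
      by (rule Isos_comp[OF _ runit_iso[OF H]])
    then have "?m \<in> Isos C (?D \<odot> Y) (IHom C ?U Y)"
      using runit_natural[OF dm(1)] iso_of_comp_right[OF _ runit_iso[OF tensor_ob[OF D Y]] dm(1)] by simp
    then show "is_iso C ?m"
      by (simp add: Isos_def)
  qed
qed

end

context tensor_triangulated_category
begin

lemma tensor_right_exact:
  fixes \<kappa> :: "'i rel"
  assumes \<kappa>: "uncountable_regular \<kappa>" and W: "W \<in> Obj C"
  shows "coproduct_exact_functor C C \<kappa> (tensor_right W)"
proof unfold_locales
  interpret T: counit_adjunction C C "tensor_right W" "IHom C W" "Eval C W"
    by (rule tensor_adjunction[OF W])
  show "uncountable_regular \<kappa>"
    by (rule \<kappa>)
  show "is_additive_functor C C (tensor_right W)"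
    by (rule is_additive_functorI[OF additive additive T.left_functor T.preserves_coproduct])
  show "preserves_small_coproducts \<kappa> C C (tensor_right W)"
    unfolding preserves_small_coproducts_def using T.preserves_coproduct by blast
  show "\<exists>h'. is_triangle C (ob (tensor_right W) X) (ob (tensor_right W) Y) (ob (tensor_right W) Z)
      (ar (tensor_right W) f) (ar (tensor_right W) g) h'" if "is_triangle C X Y Z f g h" for X Y Z f g h
    using tensor_exact[OF that W] by auto
qed

end

section \<open>Strong monoidal functors\<close>

locale strong_monoidal_functor = C: symmetric_monoidal_category C + D: symmetric_monoidal_category D
  for C :: "('o, 'm, 'y) tt_cat_scheme" and D :: "('p, 'n, 'z) tt_cat_scheme" +
  fixes F :: "('o, 'm, 'p, 'n) fctr" and \<mu> :: "'o \<Rightarrow> 'o \<Rightarrow> 'n" and \<eta> :: 'n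
  assumes functor_F: "is_functor C D F"
    and unit_iso: "\<eta> \<in> Isos D (Unit D) (ob F (Unit C))"
    and mult_iso: "\<lbrakk>X \<in> Obj C; Y \<in> Obj C\<rbrakk>
      \<Longrightarrow> \<mu> X Y \<in> Isos D (ob F X \<odot>\<^bsub>D\<^esub> ob F Y) (ob F (X \<odot>\<^bsub>C\<^esub> Y))"
    and mult_natural: "\<lbrakk>f \<in> Hom C X X'; g \<in> Hom C Y Y'\<rbrakk>
      \<Longrightarrow> \<mu> X' Y' \<cdot>\<^bsub>D\<^esub> (ar F f \<star>\<^bsub>D\<^esub> ar F g) = ar F (f \<star>\<^bsub>C\<^esub> g) \<cdot>\<^bsub>D\<^esub> \<mu> X Y"
    and mult_assoc: "\<lbrakk>X \<in> Obj C; Y \<in> Obj C; Z \<in> Obj C\<rbrakk>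
      \<Longrightarrow> ar F (Assoc C X Y Z) \<cdot>\<^bsub>D\<^esub> \<mu> (X \<odot>\<^bsub>C\<^esub> Y) Z \<cdot>\<^bsub>D\<^esub> (\<mu> X Y \<star>\<^bsub>D\<^esub> Ident D (ob F Z))
        = \<mu> X (Y \<odot>\<^bsub>C\<^esub> Z) \<cdot>\<^bsub>D\<^esub> (Ident D (ob F X) \<star>\<^bsub>D\<^esub> \<mu> Y Z)
            \<cdot>\<^bsub>D\<^esub> Assoc D (ob F X) (ob F Y) (ob F Z)"
    and mult_lunit: "X \<in> Obj C
      \<Longrightarrow> ar F (LUnit C X) \<cdot>\<^bsub>D\<^esub> \<mu> (Unit C) X \<cdot>\<^bsub>D\<^esub> (\<eta> \<star>\<^bsub>D\<^esub> Ident D (ob F X)) = LUnit D (ob F X)"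
begin

lemmas F_ob [simp] = is_functor_ob[OF functor_F]
  and F_hom = is_functor_hom[OF functor_F]
  and F_arr [simp] = is_functor_arr[OF functor_F]
  and F_comp = is_functor_comp[OF functor_F]
  and F_ident = is_functor_ident[OF functor_F]

lemma mult_arr [simp]:
  assumes "X \<in> Obj C" "Y \<in> Obj C"
  shows "\<mu> X Y \<in> Arr D" "Dom D (\<mu> X Y) = ob F X \<odot>\<^bsub>D\<^esub> ob F Y" "Cod D (\<mu> X Y) = ob F (X \<odot>\<^bsub>C\<^esub> Y)"
  using D.Isos_hom[OF mult_iso[OF assms]] by (auto simp: in_hom)

lemma unit_arr [simp]: "\<eta> \<in> Arr D" "Dom D \<eta> = Unit D" "Cod D \<eta> = ob F (Unit C)"
  using D.Isos_hom[OF unit_iso] by (auto simp: in_hom)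

lemma mult_natural_left:
  assumes "f \<in> Hom C X X'" "Y \<in> Obj C"
  shows "\<mu> X' Y \<cdot>\<^bsub>D\<^esub> (ar F f \<star>\<^bsub>D\<^esub> Ident D (ob F Y)) = ar F (f \<star>\<^bsub>C\<^esub> Ident C Y) \<cdot>\<^bsub>D\<^esub> \<mu> X Y"
  using mult_natural[OF assms(1) C.ident[OF assms(2)]] F_ident[OF assms(2)] by simp

lemma mult_natural_right:
  assumes "f \<in> Hom C Y Y'" "X \<in> Obj C"
  shows "\<mu> X Y' \<cdot>\<^bsub>D\<^esub> (Ident D (ob F X) \<star>\<^bsub>D\<^esub> ar F f) = ar F (Ident C X \<star>\<^bsub>C\<^esub> f) \<cdot>\<^bsub>D\<^esub> \<mu> X Y"
  using mult_natural[OF C.ident[OF assms(2)] assms(1)] F_ident[OF assms(2)] by simp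

lemma mult_assoc':
  assumes "X \<in> Obj C" "Y \<in> Obj C" "Z \<in> Obj C"
  shows "\<mu> X (Y \<odot>\<^bsub>C\<^esub> Z) \<cdot>\<^bsub>D\<^esub> ((Ident D (ob F X) \<star>\<^bsub>D\<^esub> \<mu> Y Z) \<cdot>\<^bsub>D\<^esub> Assoc D (ob F X) (ob F Y) (ob F Z))
    = ar F (Assoc C X Y Z) \<cdot>\<^bsub>D\<^esub> (\<mu> (X \<odot>\<^bsub>C\<^esub> Y) Z \<cdot>\<^bsub>D\<^esub> (\<mu> X Y \<star>\<^bsub>D\<^esub> Ident D (ob F Z)))"
  using mult_assoc[OF assms] assms by simp

lemma mult_lunit':
  assumes "X \<in> Obj C"
  shows "LUnit D (ob F X) = ar F (LUnit C X) \<cdot>\<^bsub>D\<^esub> (\<mu> (Unit C) X \<cdot>\<^bsub>D\<^esub> (\<eta> \<star>\<^bsub>D\<^esub> Ident D (ob F X)))"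
  using mult_lunit[OF assms] assms by simp

section \<open>Dual pairs under a strong monoidal functor\<close>

definition image_ev :: "'o \<Rightarrow> 'o \<Rightarrow> 'm \<Rightarrow> 'n" where
  "image_ev X A ev = inv_arr D \<eta> \<cdot>\<^bsub>D\<^esub> (ar F ev \<cdot>\<^bsub>D\<^esub> \<mu> A X)"

definition image_coev :: "'o \<Rightarrow> 'o \<Rightarrow> 'm \<Rightarrow> 'n" where
  "image_coev X A coev = inv_arr D (\<mu> X A) \<cdot>\<^bsub>D\<^esub> (ar F coev \<cdot>\<^bsub>D\<^esub> \<eta>)"

context
  fixes X A :: 'o and ev coev :: 'm
  assumes hd: "C.half_dual X A ev coev"
begin

lemma hd_simps:
  "X \<in> Obj C" "A \<in> Obj C" "ev \<in> Hom C (A \<odot>\<^bsub>C\<^esub> X) (Unit C)" "coev \<in> Hom C (Unit C) (X \<odot>\<^bsub>C\<^esub> A)"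
  "C.dual_zigzag X A ev coev \<in> Isos C (Unit C \<odot>\<^bsub>C\<^esub> X) (X \<odot>\<^bsub>C\<^esub> Unit C)"
  using hd by (auto simp: C.half_dual_def)

lemma image_ev:
  "image_ev X A ev \<in> Hom D (ob F A \<odot>\<^bsub>D\<^esub> ob F X) (Unit D)"
  "\<eta> \<cdot>\<^bsub>D\<^esub> image_ev X A ev = ar F ev \<cdot>\<^bsub>D\<^esub> \<mu> A X"
proof -
  note o = hd_simps(1,2) and ev = hd_simps(3)
  note ie = D.inv_arr(2)[OF unit_iso]
  show "image_ev X A ev \<in> Hom D (ob F A \<odot>\<^bsub>D\<^esub> ob F X) (Unit D)"
    unfolding image_ev_def by (rule D.comp[OF D.comp[OF D.Isos_hom[OF mult_iso[OF o(2,1)]] F_hom[OF ev]] ie])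
  have m: "ar F ev \<cdot>\<^bsub>D\<^esub> \<mu> A X \<in> Hom D (ob F A \<odot>\<^bsub>D\<^esub> ob F X) (ob F (Unit C))"
    by (rule D.comp[OF D.Isos_hom[OF mult_iso[OF o(2,1)]] F_hom[OF ev]])
  show "\<eta> \<cdot>\<^bsub>D\<^esub> image_ev X A ev = ar F ev \<cdot>\<^bsub>D\<^esub> \<mu> A X"
    unfolding image_ev_def
    using D.comp_assoc[OF m ie D.Isos_hom[OF unit_iso]] D.inv_arr(4)[OF unit_iso] D.comp_ident_left[OF m] by simp
qed

lemma image_coev:
  "image_coev X A coev \<in> Hom D (Unit D) (ob F X \<odot>\<^bsub>D\<^esub> ob F A)"
  "\<mu> X A \<cdot>\<^bsub>D\<^esub> image_coev X A coev = ar F coev \<cdot>\<^bsub>D\<^esub> \<eta>"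
proof -
  note o = hd_simps(1,2) and coev = hd_simps(4)
  note mi = mult_iso[OF o]
  note im = D.inv_arr(2)[OF mi]
  have m: "ar F coev \<cdot>\<^bsub>D\<^esub> \<eta> \<in> Hom D (Unit D) (ob F (X \<odot>\<^bsub>C\<^esub> A))"
    by (rule D.comp[OF D.Isos_hom[OF unit_iso] F_hom[OF coev]])
  show "image_coev X A coev \<in> Hom D (Unit D) (ob F X \<odot>\<^bsub>D\<^esub> ob F A)"
    unfolding image_coev_def by (rule D.comp[OF m im])
  show "\<mu> X A \<cdot>\<^bsub>D\<^esub> image_coev X A coev = ar F coev \<cdot>\<^bsub>D\<^esub> \<eta>"
    unfolding image_coev_def
    using D.comp_assoc[OF m im D.Isos_hom[OF mi]] D.inv_arr(4)[OF mi] D.comp_ident_left[OF m] by simp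
qed

text \<open>Needed both for the zigzag and for the unit of the image pair: associativity and
  naturality of \<mu> push the structure isomorphisms past the coevaluation to the two ends.\<close>

lemma mult_image_coev:
  assumes Z: "Z \<in> Obj C"
  shows "\<mu> X (A \<odot>\<^bsub>C\<^esub> Z) \<cdot>\<^bsub>D\<^esub> ((Ident D (ob F X) \<star>\<^bsub>D\<^esub> \<mu> A Z) \<cdot>\<^bsub>D\<^esub>
      (Assoc D (ob F X) (ob F A) (ob F Z) \<cdot>\<^bsub>D\<^esub> (image_coev X A coev \<star>\<^bsub>D\<^esub> Ident D (ob F Z))))
    = ar F (Assoc C X A Z \<cdot>\<^bsub>C\<^esub> (coev \<star>\<^bsub>C\<^esub> Ident C Z)) \<cdot>\<^bsub>D\<^esub> (\<mu> (Unit C) Z \<cdot>\<^bsub>D\<^esub> (\<eta> \<star>\<^bsub>D\<^esub> Ident D (ob F Z)))"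
proof -
  note o = hd_simps(1,2) Z and coev = hd_simps(4) and c = image_coev
  let ?I = "Ident D" and ?a = "Assoc D (ob F X) (ob F A) (ob F Z)" and ?c = "image_coev X A coev"
  have cz: "coev \<star>\<^bsub>C\<^esub> Ident C Z \<in> Hom C (Unit C \<odot>\<^bsub>C\<^esub> Z) ((X \<odot>\<^bsub>C\<^esub> A) \<odot>\<^bsub>C\<^esub> Z)"
    by (rule C.tensor_ar[OF coev C.ident[OF Z]])
  have "\<mu> X (A \<odot>\<^bsub>C\<^esub> Z) \<cdot>\<^bsub>D\<^esub> ((?I (ob F X) \<star>\<^bsub>D\<^esub> \<mu> A Z) \<cdot>\<^bsub>D\<^esub> (?a \<cdot>\<^bsub>D\<^esub> (?c \<star>\<^bsub>D\<^esub> ?I (ob F Z))))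
      = (\<mu> X (A \<odot>\<^bsub>C\<^esub> Z) \<cdot>\<^bsub>D\<^esub> ((?I (ob F X) \<star>\<^bsub>D\<^esub> \<mu> A Z) \<cdot>\<^bsub>D\<^esub> ?a)) \<cdot>\<^bsub>D\<^esub> (?c \<star>\<^bsub>D\<^esub> ?I (ob F Z))"
    using o c(1) by (simp add: in_hom)
  also have "\<dots> = ar F (Assoc C X A Z) \<cdot>\<^bsub>D\<^esub> (\<mu> (X \<odot>\<^bsub>C\<^esub> A) Z \<cdot>\<^bsub>D\<^esub> ((\<mu> X A \<star>\<^bsub>D\<^esub> ?I (ob F Z)) \<cdot>\<^bsub>D\<^esub> (?c \<star>\<^bsub>D\<^esub> ?I (ob F Z))))"
    unfolding mult_assoc'[OF o] using o c(1) by (simp add: in_hom)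
  also have "(\<mu> X A \<star>\<^bsub>D\<^esub> ?I (ob F Z)) \<cdot>\<^bsub>D\<^esub> (?c \<star>\<^bsub>D\<^esub> ?I (ob F Z))
      = (ar F coev \<star>\<^bsub>D\<^esub> ?I (ob F Z)) \<cdot>\<^bsub>D\<^esub> (\<eta> \<star>\<^bsub>D\<^esub> ?I (ob F Z))"
    using o c coev by (simp add: in_hom D.tensor_comp_arr)
  also have "ar F (Assoc C X A Z) \<cdot>\<^bsub>D\<^esub> (\<mu> (X \<odot>\<^bsub>C\<^esub> A) Z \<cdot>\<^bsub>D\<^esub> ((ar F coev \<star>\<^bsub>D\<^esub> ?I (ob F Z)) \<cdot>\<^bsub>D\<^esub> (\<eta> \<star>\<^bsub>D\<^esub> ?I (ob F Z))))
      = ar F (Assoc C X A Z) \<cdot>\<^bsub>D\<^esub> ((\<mu> (X \<odot>\<^bsub>C\<^esub> A) Z \<cdot>\<^bsub>D\<^esub> (ar F coev \<star>\<^bsub>D\<^esub> ?I (ob F Z))) \<cdot>\<^bsub>D\<^esub> (\<eta> \<star>\<^bsub>D\<^esub> ?I (ob F Z)))"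
    using o coev by (simp add: in_hom)
  also have "\<mu> (X \<odot>\<^bsub>C\<^esub> A) Z \<cdot>\<^bsub>D\<^esub> (ar F coev \<star>\<^bsub>D\<^esub> ?I (ob F Z)) = ar F (coev \<star>\<^bsub>C\<^esub> Ident C Z) \<cdot>\<^bsub>D\<^esub> \<mu> (Unit C) Z"
    by (rule mult_natural_left[OF coev Z])
  also have "ar F (Assoc C X A Z) \<cdot>\<^bsub>D\<^esub> ((ar F (coev \<star>\<^bsub>C\<^esub> Ident C Z) \<cdot>\<^bsub>D\<^esub> \<mu> (Unit C) Z) \<cdot>\<^bsub>D\<^esub> (\<eta> \<star>\<^bsub>D\<^esub> ?I (ob F Z)))
      = (ar F (Assoc C X A Z) \<cdot>\<^bsub>D\<^esub> ar F (coev \<star>\<^bsub>C\<^esub> Ident C Z)) \<cdot>\<^bsub>D\<^esub> (\<mu> (Unit C) Z \<cdot>\<^bsub>D\<^esub> (\<eta> \<star>\<^bsub>D\<^esub> ?I (ob F Z)))"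
    using o coev by (simp add: in_hom)
  also have "ar F (Assoc C X A Z) \<cdot>\<^bsub>D\<^esub> ar F (coev \<star>\<^bsub>C\<^esub> Ident C Z) = ar F (Assoc C X A Z \<cdot>\<^bsub>C\<^esub> (coev \<star>\<^bsub>C\<^esub> Ident C Z))"
    by (rule F_comp[OF cz C.Isos_hom[OF C.assoc_iso[OF o]], symmetric])
  finally show ?thesis .
qed

text \<open>Between structure isomorphisms at both ends, the zigzag of the image pair is
  \<open>F\<close> applied to the original zigzag, so it is invertible.\<close>

lemma half_dual_image: "D.half_dual (ob F X) (ob F A) (image_ev X A ev) (image_coev X A coev)"
proof -
  note o = hd_simps(1,2) and ev = hd_simps(3) and coev = hd_simps(4) and e = image_ev and c = image_coev
  let ?I = "Ident D" and ?X = "ob F X" and ?A = "ob F A" and ?ev = "image_ev X A ev" and ?c = "image_coev X A coev"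
  let ?z = "D.dual_zigzag ?X ?A ?ev ?c" and ?w = "C.dual_zigzag X A ev coev"
  have z: "?z \<in> Hom D (Unit D \<odot>\<^bsub>D\<^esub> ?X) (?X \<odot>\<^bsub>D\<^esub> Unit D)"
    using o e c by (simp add: D.dual_zigzag_def in_hom)
  have Xe: "Ident C X \<star>\<^bsub>C\<^esub> ev \<in> Hom C (X \<odot>\<^bsub>C\<^esub> (A \<odot>\<^bsub>C\<^esub> X)) (X \<odot>\<^bsub>C\<^esub> Unit C)"
    by (rule C.tensor_ar[OF C.ident[OF o(1)] ev])
  have ac: "Assoc C X A X \<cdot>\<^bsub>C\<^esub> (coev \<star>\<^bsub>C\<^esub> Ident C X) \<in> Hom C (Unit C \<odot>\<^bsub>C\<^esub> X) (X \<odot>\<^bsub>C\<^esub> (A \<odot>\<^bsub>C\<^esub> X))"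
    using o coev by (simp add: in_hom)
  let ?ac = "Assoc D ?X ?A ?X \<cdot>\<^bsub>D\<^esub> (?c \<star>\<^bsub>D\<^esub> ?I ?X)"
  have "(\<mu> X (Unit C) \<cdot>\<^bsub>D\<^esub> (?I ?X \<star>\<^bsub>D\<^esub> \<eta>)) \<cdot>\<^bsub>D\<^esub> ?z
      = \<mu> X (Unit C) \<cdot>\<^bsub>D\<^esub> (((?I ?X \<star>\<^bsub>D\<^esub> \<eta>) \<cdot>\<^bsub>D\<^esub> (?I ?X \<star>\<^bsub>D\<^esub> ?ev)) \<cdot>\<^bsub>D\<^esub> ?ac)"
    using o e c by (simp add: D.dual_zigzag_def in_hom)
  also have "(?I ?X \<star>\<^bsub>D\<^esub> \<eta>) \<cdot>\<^bsub>D\<^esub> (?I ?X \<star>\<^bsub>D\<^esub> ?ev) = (?I ?X \<star>\<^bsub>D\<^esub> ar F ev) \<cdot>\<^bsub>D\<^esub> (?I ?X \<star>\<^bsub>D\<^esub> \<mu> A X)"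
    using o e ev by (simp add: in_hom D.tensor_comp_arr)
  also have "\<mu> X (Unit C) \<cdot>\<^bsub>D\<^esub> (((?I ?X \<star>\<^bsub>D\<^esub> ar F ev) \<cdot>\<^bsub>D\<^esub> (?I ?X \<star>\<^bsub>D\<^esub> \<mu> A X)) \<cdot>\<^bsub>D\<^esub> ?ac)
      = (\<mu> X (Unit C) \<cdot>\<^bsub>D\<^esub> (?I ?X \<star>\<^bsub>D\<^esub> ar F ev)) \<cdot>\<^bsub>D\<^esub> ((?I ?X \<star>\<^bsub>D\<^esub> \<mu> A X) \<cdot>\<^bsub>D\<^esub> ?ac)"
    using o c ev by (simp add: in_hom)
  also have "\<mu> X (Unit C) \<cdot>\<^bsub>D\<^esub> (?I ?X \<star>\<^bsub>D\<^esub> ar F ev) = ar F (Ident C X \<star>\<^bsub>C\<^esub> ev) \<cdot>\<^bsub>D\<^esub> \<mu> X (A \<odot>\<^bsub>C\<^esub> X)"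
    by (rule mult_natural_right[OF ev o(1)])
  also have "(ar F (Ident C X \<star>\<^bsub>C\<^esub> ev) \<cdot>\<^bsub>D\<^esub> \<mu> X (A \<odot>\<^bsub>C\<^esub> X)) \<cdot>\<^bsub>D\<^esub> ((?I ?X \<star>\<^bsub>D\<^esub> \<mu> A X) \<cdot>\<^bsub>D\<^esub> ?ac)
      = ar F (Ident C X \<star>\<^bsub>C\<^esub> ev) \<cdot>\<^bsub>D\<^esub> (\<mu> X (A \<odot>\<^bsub>C\<^esub> X) \<cdot>\<^bsub>D\<^esub> ((?I ?X \<star>\<^bsub>D\<^esub> \<mu> A X) \<cdot>\<^bsub>D\<^esub> ?ac))"
    using o c ev by (simp add: in_hom)
  also have "\<dots> = (ar F (Ident C X \<star>\<^bsub>C\<^esub> ev) \<cdot>\<^bsub>D\<^esub> ar F (Assoc C X A X \<cdot>\<^bsub>C\<^esub> (coev \<star>\<^bsub>C\<^esub> Ident C X))) \<cdot>\<^bsub>D\<^esub>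
      (\<mu> (Unit C) X \<cdot>\<^bsub>D\<^esub> (\<eta> \<star>\<^bsub>D\<^esub> ?I ?X))"
    unfolding mult_image_coev[OF o(1)] using o ev coev by (simp add: in_hom)
  also have "ar F (Ident C X \<star>\<^bsub>C\<^esub> ev) \<cdot>\<^bsub>D\<^esub> ar F (Assoc C X A X \<cdot>\<^bsub>C\<^esub> (coev \<star>\<^bsub>C\<^esub> Ident C X)) = ar F ?w"
    unfolding C.dual_zigzag_def by (rule F_comp[OF ac Xe, symmetric])
  finally have eq: "(\<mu> X (Unit C) \<cdot>\<^bsub>D\<^esub> (?I ?X \<star>\<^bsub>D\<^esub> \<eta>)) \<cdot>\<^bsub>D\<^esub> ?z
      = ar F ?w \<cdot>\<^bsub>D\<^esub> (\<mu> (Unit C) X \<cdot>\<^bsub>D\<^esub> (\<eta> \<star>\<^bsub>D\<^esub> ?I ?X))" .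
  note idX = D.Isos_ident[OF F_ob[OF o(1)]]
  have "ar F ?w \<cdot>\<^bsub>D\<^esub> (\<mu> (Unit C) X \<cdot>\<^bsub>D\<^esub> (\<eta> \<star>\<^bsub>D\<^esub> ?I ?X)) \<in> Isos D (Unit D \<odot>\<^bsub>D\<^esub> ?X) (ob F (X \<odot>\<^bsub>C\<^esub> Unit C))"
    by (rule D.Isos_comp[OF D.Isos_comp[OF D.tensor_Isos[OF unit_iso idX] mult_iso[OF C.unit_ob o(1)]]
        is_functor_Isos[OF C.category_axioms D.category_axioms functor_F hd_simps(5)]])
  then have "?z \<in> Isos D (Unit D \<odot>\<^bsub>D\<^esub> ?X) (?X \<odot>\<^bsub>D\<^esub> Unit D)"
    using D.iso_of_comp_left[OF _ D.Isos_comp[OF D.tensor_Isos[OF idX unit_iso] mult_iso[OF o(1) C.unit_ob]] z] eq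
    by simp
  then show ?thesis
    using o e c by (simp add: D.half_dual_def)
qed

lemma dual_counit_image:
  assumes B: "B \<in> Obj C"
  shows "D.dual_counit (ob F X) (ob F A) (image_ev X A ev) (ob F B)
    = ar F (C.dual_counit X A ev B) \<cdot>\<^bsub>D\<^esub> (\<mu> A (X \<odot>\<^bsub>C\<^esub> B) \<cdot>\<^bsub>D\<^esub> (Ident D (ob F A) \<star>\<^bsub>D\<^esub> \<mu> X B))"
proof -
  note o = hd_simps(1,2) B and ev = hd_simps(3) and e = image_ev
  let ?I = "Ident D" and ?X = "ob F X" and ?A = "ob F A" and ?B = "ob F B" and ?ev = "image_ev X A ev"
  let ?a = "Assoc D ?A ?X ?B"
  have Fo: "?X \<in> Obj D" "?A \<in> Obj D" "?B \<in> Obj D"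
    using o by simp_all
  note cD = D.dual_counit_hom(1)[OF half_dual_image Fo(3)] and cC = C.dual_counit_hom(1)[OF hd B]
  let ?m = "\<mu> A (X \<odot>\<^bsub>C\<^esub> B) \<cdot>\<^bsub>D\<^esub> (?I ?A \<star>\<^bsub>D\<^esub> \<mu> X B)"
  have m: "?m \<in> Hom D (?A \<odot>\<^bsub>D\<^esub> (?X \<odot>\<^bsub>D\<^esub> ?B)) (ob F (A \<odot>\<^bsub>C\<^esub> (X \<odot>\<^bsub>C\<^esub> B)))"
    using o by (simp add: in_hom)
  have eB: "ev \<star>\<^bsub>C\<^esub> Ident C B \<in> Hom C ((A \<odot>\<^bsub>C\<^esub> X) \<odot>\<^bsub>C\<^esub> B) (Unit C \<odot>\<^bsub>C\<^esub> B)"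
    by (rule C.tensor_ar[OF ev C.ident[OF B]])
  show ?thesis
  proof (rule D.iso_cancel_right[OF D.assoc_iso[OF Fo(2,1,3)] cD D.comp[OF m F_hom[OF cC]]])
    have "(ar F (C.dual_counit X A ev B) \<cdot>\<^bsub>D\<^esub> ?m) \<cdot>\<^bsub>D\<^esub> ?a
        = ar F (C.dual_counit X A ev B) \<cdot>\<^bsub>D\<^esub> (\<mu> A (X \<odot>\<^bsub>C\<^esub> B) \<cdot>\<^bsub>D\<^esub> ((?I ?A \<star>\<^bsub>D\<^esub> \<mu> X B) \<cdot>\<^bsub>D\<^esub> ?a))"
      using o cC by (simp add: in_hom)
    also have "\<dots> = (ar F (C.dual_counit X A ev B) \<cdot>\<^bsub>D\<^esub> ar F (Assoc C A X B)) \<cdot>\<^bsub>D\<^esub>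
        (\<mu> (A \<odot>\<^bsub>C\<^esub> X) B \<cdot>\<^bsub>D\<^esub> (\<mu> A X \<star>\<^bsub>D\<^esub> ?I ?B))"
      unfolding mult_assoc'[OF o(2,1,3)] using o cC by (simp add: in_hom)
    also have "ar F (C.dual_counit X A ev B) \<cdot>\<^bsub>D\<^esub> ar F (Assoc C A X B) = ar F (LUnit C B) \<cdot>\<^bsub>D\<^esub> ar F (ev \<star>\<^bsub>C\<^esub> Ident C B)"
      using F_comp[OF C.Isos_hom[OF C.assoc_iso[OF o(2,1,3)]] cC] C.dual_counit_assoc[OF hd B]
        F_comp[OF eB C.Isos_hom[OF C.lunit_iso[OF B]]] by simp
    also have "(ar F (LUnit C B) \<cdot>\<^bsub>D\<^esub> ar F (ev \<star>\<^bsub>C\<^esub> Ident C B)) \<cdot>\<^bsub>D\<^esub> (\<mu> (A \<odot>\<^bsub>C\<^esub> X) B \<cdot>\<^bsub>D\<^esub> (\<mu> A X \<star>\<^bsub>D\<^esub> ?I ?B))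
        = ar F (LUnit C B) \<cdot>\<^bsub>D\<^esub> ((ar F (ev \<star>\<^bsub>C\<^esub> Ident C B) \<cdot>\<^bsub>D\<^esub> \<mu> (A \<odot>\<^bsub>C\<^esub> X) B) \<cdot>\<^bsub>D\<^esub> (\<mu> A X \<star>\<^bsub>D\<^esub> ?I ?B))"
      using o ev by (simp add: in_hom)
    also have "ar F (ev \<star>\<^bsub>C\<^esub> Ident C B) \<cdot>\<^bsub>D\<^esub> \<mu> (A \<odot>\<^bsub>C\<^esub> X) B = \<mu> (Unit C) B \<cdot>\<^bsub>D\<^esub> (ar F ev \<star>\<^bsub>D\<^esub> ?I ?B)"
      by (rule mult_natural_left[OF ev B, symmetric])
    also have "ar F (LUnit C B) \<cdot>\<^bsub>D\<^esub> ((\<mu> (Unit C) B \<cdot>\<^bsub>D\<^esub> (ar F ev \<star>\<^bsub>D\<^esub> ?I ?B)) \<cdot>\<^bsub>D\<^esub> (\<mu> A X \<star>\<^bsub>D\<^esub> ?I ?B))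
        = ar F (LUnit C B) \<cdot>\<^bsub>D\<^esub> (\<mu> (Unit C) B \<cdot>\<^bsub>D\<^esub> ((ar F ev \<star>\<^bsub>D\<^esub> ?I ?B) \<cdot>\<^bsub>D\<^esub> (\<mu> A X \<star>\<^bsub>D\<^esub> ?I ?B)))"
      using o ev by (simp add: in_hom)
    also have "(ar F ev \<star>\<^bsub>D\<^esub> ?I ?B) \<cdot>\<^bsub>D\<^esub> (\<mu> A X \<star>\<^bsub>D\<^esub> ?I ?B) = (\<eta> \<star>\<^bsub>D\<^esub> ?I ?B) \<cdot>\<^bsub>D\<^esub> (?ev \<star>\<^bsub>D\<^esub> ?I ?B)"
      using o ev e by (simp add: in_hom D.tensor_comp_arr)
    also have "ar F (LUnit C B) \<cdot>\<^bsub>D\<^esub> (\<mu> (Unit C) B \<cdot>\<^bsub>D\<^esub> ((\<eta> \<star>\<^bsub>D\<^esub> ?I ?B) \<cdot>\<^bsub>D\<^esub> (?ev \<star>\<^bsub>D\<^esub> ?I ?B)))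
        = LUnit D ?B \<cdot>\<^bsub>D\<^esub> (?ev \<star>\<^bsub>D\<^esub> ?I ?B)"
      unfolding mult_lunit'[OF B] using o e by (simp add: in_hom)
    also have "\<dots> = D.dual_counit ?X ?A ?ev ?B \<cdot>\<^bsub>D\<^esub> ?a"
      by (rule D.dual_counit_assoc[OF half_dual_image Fo(3), symmetric])
    finally show "D.dual_counit ?X ?A ?ev ?B \<cdot>\<^bsub>D\<^esub> ?a = (ar F (C.dual_counit X A ev B) \<cdot>\<^bsub>D\<^esub> ?m) \<cdot>\<^bsub>D\<^esub> ?a"
      by (rule sym)
  qed
qed

lemma dual_unit_image:
  assumes Z: "Z \<in> Obj C"
  shows "ar F (C.dual_unit X A coev Z)
    = \<mu> X (A \<odot>\<^bsub>C\<^esub> Z) \<cdot>\<^bsub>D\<^esub> ((Ident D (ob F X) \<star>\<^bsub>D\<^esub> \<mu> A Z) \<cdot>\<^bsub>D\<^esub> D.dual_unit (ob F X) (ob F A) (image_coev X A coev) (ob F Z))"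
proof -
  note o = hd_simps(1,2) Z and coev = hd_simps(4) and c = image_coev
  let ?I = "Ident D" and ?X = "ob F X" and ?A = "ob F A" and ?Z = "ob F Z" and ?c = "image_coev X A coev"
  have Fo: "?X \<in> Obj D" "?A \<in> Obj D" "?Z \<in> Obj D"
    using o by simp_all
  note uD = D.dual_counit_hom(2)[OF half_dual_image Fo(3)] and uC = C.dual_counit_hom(2)[OF hd Z]
  let ?m = "\<mu> X (A \<odot>\<^bsub>C\<^esub> Z) \<cdot>\<^bsub>D\<^esub> ((?I ?X \<star>\<^bsub>D\<^esub> \<mu> A Z) \<cdot>\<^bsub>D\<^esub> D.dual_unit ?X ?A ?c ?Z)"
  have m: "?m \<in> Hom D ?Z (ob F (X \<odot>\<^bsub>C\<^esub> (A \<odot>\<^bsub>C\<^esub> Z)))"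
    using o uD by (simp add: in_hom)
  show ?thesis
  proof (rule D.iso_cancel_right[OF D.lunit_iso[OF Fo(3)] F_hom[OF uC] m])
    have "ar F (C.dual_unit X A coev Z) \<cdot>\<^bsub>D\<^esub> LUnit D ?Z
        = (ar F (C.dual_unit X A coev Z) \<cdot>\<^bsub>D\<^esub> ar F (LUnit C Z)) \<cdot>\<^bsub>D\<^esub> (\<mu> (Unit C) Z \<cdot>\<^bsub>D\<^esub> (\<eta> \<star>\<^bsub>D\<^esub> ?I ?Z))"
      unfolding mult_lunit'[OF Z] using o uC by (simp add: in_hom)
    also have "ar F (C.dual_unit X A coev Z) \<cdot>\<^bsub>D\<^esub> ar F (LUnit C Z) = ar F (Assoc C X A Z \<cdot>\<^bsub>C\<^esub> (coev \<star>\<^bsub>C\<^esub> Ident C Z))"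
      using F_comp[OF C.Isos_hom[OF C.lunit_iso[OF Z]] uC] C.dual_unit_lunit[OF hd Z] by simp
    also have "ar F (Assoc C X A Z \<cdot>\<^bsub>C\<^esub> (coev \<star>\<^bsub>C\<^esub> Ident C Z)) \<cdot>\<^bsub>D\<^esub> (\<mu> (Unit C) Z \<cdot>\<^bsub>D\<^esub> (\<eta> \<star>\<^bsub>D\<^esub> ?I ?Z))
        = \<mu> X (A \<odot>\<^bsub>C\<^esub> Z) \<cdot>\<^bsub>D\<^esub> ((?I ?X \<star>\<^bsub>D\<^esub> \<mu> A Z) \<cdot>\<^bsub>D\<^esub> (Assoc D ?X ?A ?Z \<cdot>\<^bsub>D\<^esub> (?c \<star>\<^bsub>D\<^esub> ?I ?Z)))"
      by (rule mult_image_coev[OF Z, symmetric])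
    also have "Assoc D ?X ?A ?Z \<cdot>\<^bsub>D\<^esub> (?c \<star>\<^bsub>D\<^esub> ?I ?Z) = D.dual_unit ?X ?A ?c ?Z \<cdot>\<^bsub>D\<^esub> LUnit D ?Z"
      by (rule D.dual_unit_lunit[OF half_dual_image Fo(3), symmetric])
    also have "\<mu> X (A \<odot>\<^bsub>C\<^esub> Z) \<cdot>\<^bsub>D\<^esub> ((?I ?X \<star>\<^bsub>D\<^esub> \<mu> A Z) \<cdot>\<^bsub>D\<^esub> (D.dual_unit ?X ?A ?c ?Z \<cdot>\<^bsub>D\<^esub> LUnit D ?Z)) = ?m \<cdot>\<^bsub>D\<^esub> LUnit D ?Z"
      using o uD by (simp add: in_hom)
    finally show "ar F (C.dual_unit X A coev Z) \<cdot>\<^bsub>D\<^esub> LUnit D ?Z = ?m \<cdot>\<^bsub>D\<^esub> LUnit D ?Z" .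
  qed
qed

end

text \<open>For a counit \<open>e\<close>, this is composition with the projection map from
  \<open>X \<otimes> R Y\<close> to \<open>R (F X \<otimes> Y)\<close>, followed by adjoint
  transposition. In this form it can be studied without applying \<open>R\<close> to arrows.\<close>

definition projection :: "'o \<Rightarrow> 'o \<Rightarrow> 'n \<Rightarrow> 'm \<Rightarrow> 'n" where
  "projection X B e f = (Ident D (ob F X) \<star>\<^bsub>D\<^esub> e) \<cdot>\<^bsub>D\<^esub> (inv_arr D (\<mu> X B) \<cdot>\<^bsub>D\<^esub> ar F f)"

text \<open>Duality turns maps \<open>Z \<rightarrow> X \<otimes> R Y\<close> into maps
  \<open>A \<otimes> Z \<rightarrow> R Y\<close>, adjunction turns these into maps
  \<open>F (A \<otimes> Z) \<rightarrow> Y\<close>, and duality for the image pair leads to maps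
  \<open>F Z \<rightarrow> F X \<otimes> Y\<close>. The argument shows that
  \<open>projection\<close> realises this chain up to the automorphisms \<open>k\<close> and
  \<open>k'\<close>.\<close>

lemma projection_bij:
  assumes adj: "counit_adjunction C D F R e" and hd: "C.half_dual X A ev coev"
    and Y: "Y \<in> Obj D" and Z: "Z \<in> Obj C"
  shows "bij_betw (projection X (R Y) (e Y)) (Hom C Z (X \<odot>\<^bsub>C\<^esub> R Y)) (Hom D (ob F Z) (ob F X \<odot>\<^bsub>D\<^esub> Y))"
proof -
  interpret adj: counit_adjunction C D F R e by fact
  let ?I = "Ident D" and ?X = "ob F X" and ?A = "ob F A" and ?Z = "ob F Z" and ?B = "R Y"
  note o = hd_simps(1,2)[OF hd] and hd' = half_dual_image[OF hd]
  have B: "?B \<in> Obj C"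
    using adj.right_ob[OF Y] .
  have Fo: "?X \<in> Obj D" "?A \<in> Obj D" "?Z \<in> Obj D" "ob F ?B \<in> Obj D"
    using o Z B by simp_all
  define c where "c = C.dual_counit X A ev ?B"
  define c' where "c' = D.dual_counit ?X ?A (image_ev X A ev) Y"
  define u where "u = C.dual_unit X A coev Z"
  define u' where "u' = D.dual_unit ?X ?A (image_coev X A coev) ?Z"
  define m where "m = inv_arr D (\<mu> X ?B)"
  have c: "c \<in> Hom C (A \<odot>\<^bsub>C\<^esub> (X \<odot>\<^bsub>C\<^esub> ?B)) ?B" and u: "u \<in> Hom C Z (X \<odot>\<^bsub>C\<^esub> (A \<odot>\<^bsub>C\<^esub> Z))"
    using C.dual_counit_hom[OF hd] B Z by (simp_all add: c_def u_def)
  have c': "c' \<in> Hom D (?A \<odot>\<^bsub>D\<^esub> (?X \<odot>\<^bsub>D\<^esub> Y)) Y" and u': "u' \<in> Hom D ?Z (?X \<odot>\<^bsub>D\<^esub> (?A \<odot>\<^bsub>D\<^esub> ?Z))"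
    using D.dual_counit_hom[OF hd'] Y Fo(3) by (simp_all add: c'_def u'_def)
  have m: "m \<in> Hom D (ob F (X \<odot>\<^bsub>C\<^esub> ?B)) (?X \<odot>\<^bsub>D\<^esub> ob F ?B)"
    and mm: "m \<cdot>\<^bsub>D\<^esub> \<mu> X ?B = ?I (?X \<odot>\<^bsub>D\<^esub> ob F ?B)" "\<mu> X ?B \<cdot>\<^bsub>D\<^esub> m = ?I (ob F (X \<odot>\<^bsub>C\<^esub> ?B))"
    using D.inv_arr[OF mult_iso[OF o(1) B]] by (simp_all add: m_def)
  note e = adj.counit[OF Y]
  let ?p = "projection X ?B (e Y)"
  have p: "?p f = (?I ?X \<star>\<^bsub>D\<^esub> e Y) \<cdot>\<^bsub>D\<^esub> (m \<cdot>\<^bsub>D\<^esub> ar F f)" for f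
    by (simp add: projection_def m_def)
  have p_hom: "?p f \<in> Hom D ?Z (?X \<odot>\<^bsub>D\<^esub> Y)" if "f \<in> Hom C Z (X \<odot>\<^bsub>C\<^esub> ?B)" for f
    using that o e m B unfolding p by (simp add: in_hom)
  \<comment> \<open>Seen from the dual side, \<open>projection\<close> is transposition along the
    adjunction, up to the isomorphism \<open>\<mu> A Z\<close>.\<close>
  have transposed: "c' \<cdot>\<^bsub>D\<^esub> (?I ?A \<star>\<^bsub>D\<^esub> ?p f)
      = (e Y \<cdot>\<^bsub>D\<^esub> ar F (c \<cdot>\<^bsub>C\<^esub> (Ident C A \<star>\<^bsub>C\<^esub> f))) \<cdot>\<^bsub>D\<^esub> \<mu> A Z" if f: "f \<in> Hom C Z (X \<odot>\<^bsub>C\<^esub> ?B)" for f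
  proof -
    note Ff = F_hom[OF f]
    have Af: "Ident C A \<star>\<^bsub>C\<^esub> f \<in> Hom C (A \<odot>\<^bsub>C\<^esub> Z) (A \<odot>\<^bsub>C\<^esub> (X \<odot>\<^bsub>C\<^esub> ?B))"
      by (rule C.tensor_ar[OF C.ident[OF o(2)] f])
    have "c' \<cdot>\<^bsub>D\<^esub> (?I ?A \<star>\<^bsub>D\<^esub> ?p f)
        = (c' \<cdot>\<^bsub>D\<^esub> (?I ?A \<star>\<^bsub>D\<^esub> (?I ?X \<star>\<^bsub>D\<^esub> e Y))) \<cdot>\<^bsub>D\<^esub> ((?I ?A \<star>\<^bsub>D\<^esub> m) \<cdot>\<^bsub>D\<^esub> (?I ?A \<star>\<^bsub>D\<^esub> ar F f))"
      using Fo c' e m Ff unfolding p by (simp add: in_hom D.tensor_comp_arr)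
    also have "c' \<cdot>\<^bsub>D\<^esub> (?I ?A \<star>\<^bsub>D\<^esub> (?I ?X \<star>\<^bsub>D\<^esub> e Y)) = e Y \<cdot>\<^bsub>D\<^esub> D.dual_counit ?X ?A (image_ev X A ev) (ob F ?B)"
      unfolding c'_def by (rule D.dual_counit_natural[OF hd' e, symmetric])
    also have "\<dots> = e Y \<cdot>\<^bsub>D\<^esub> (ar F c \<cdot>\<^bsub>D\<^esub> (\<mu> A (X \<odot>\<^bsub>C\<^esub> ?B) \<cdot>\<^bsub>D\<^esub> (?I ?A \<star>\<^bsub>D\<^esub> \<mu> X ?B)))"
      unfolding c_def dual_counit_image[OF hd B] ..
    also have "(e Y \<cdot>\<^bsub>D\<^esub> (ar F c \<cdot>\<^bsub>D\<^esub> (\<mu> A (X \<odot>\<^bsub>C\<^esub> ?B) \<cdot>\<^bsub>D\<^esub> (?I ?A \<star>\<^bsub>D\<^esub> \<mu> X ?B)))) \<cdot>\<^bsub>D\<^esub>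
          ((?I ?A \<star>\<^bsub>D\<^esub> m) \<cdot>\<^bsub>D\<^esub> (?I ?A \<star>\<^bsub>D\<^esub> ar F f))
        = e Y \<cdot>\<^bsub>D\<^esub> (ar F c \<cdot>\<^bsub>D\<^esub> (\<mu> A (X \<odot>\<^bsub>C\<^esub> ?B) \<cdot>\<^bsub>D\<^esub> (((?I ?A \<star>\<^bsub>D\<^esub> \<mu> X ?B) \<cdot>\<^bsub>D\<^esub> (?I ?A \<star>\<^bsub>D\<^esub> m)) \<cdot>\<^bsub>D\<^esub>
            (?I ?A \<star>\<^bsub>D\<^esub> ar F f))))"
      using o B Fo e c m f by (simp add: in_hom)
    also have "(?I ?A \<star>\<^bsub>D\<^esub> \<mu> X ?B) \<cdot>\<^bsub>D\<^esub> (?I ?A \<star>\<^bsub>D\<^esub> m) = ?I (?A \<odot>\<^bsub>D\<^esub> ob F (X \<odot>\<^bsub>C\<^esub> ?B))"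
      using o B m mm(2) by (simp add: in_hom D.tensor_comp_arr D.tensor_ident)
    also have "e Y \<cdot>\<^bsub>D\<^esub> (ar F c \<cdot>\<^bsub>D\<^esub> (\<mu> A (X \<odot>\<^bsub>C\<^esub> ?B) \<cdot>\<^bsub>D\<^esub> (?I (?A \<odot>\<^bsub>D\<^esub> ob F (X \<odot>\<^bsub>C\<^esub> ?B)) \<cdot>\<^bsub>D\<^esub>
            (?I ?A \<star>\<^bsub>D\<^esub> ar F f))))
        = e Y \<cdot>\<^bsub>D\<^esub> (ar F c \<cdot>\<^bsub>D\<^esub> (\<mu> A (X \<odot>\<^bsub>C\<^esub> ?B) \<cdot>\<^bsub>D\<^esub> (?I ?A \<star>\<^bsub>D\<^esub> ar F f)))"
      using o B f by (simp add: in_hom)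
    also have "\<mu> A (X \<odot>\<^bsub>C\<^esub> ?B) \<cdot>\<^bsub>D\<^esub> (?I ?A \<star>\<^bsub>D\<^esub> ar F f) = ar F (Ident C A \<star>\<^bsub>C\<^esub> f) \<cdot>\<^bsub>D\<^esub> \<mu> A Z"
      by (rule mult_natural_right[OF f o(2)])
    also have "e Y \<cdot>\<^bsub>D\<^esub> (ar F c \<cdot>\<^bsub>D\<^esub> (ar F (Ident C A \<star>\<^bsub>C\<^esub> f) \<cdot>\<^bsub>D\<^esub> \<mu> A Z))
        = (e Y \<cdot>\<^bsub>D\<^esub> (ar F c \<cdot>\<^bsub>D\<^esub> ar F (Ident C A \<star>\<^bsub>C\<^esub> f))) \<cdot>\<^bsub>D\<^esub> \<mu> A Z"
      using o B Z e c f by (simp add: in_hom)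
    also have "ar F c \<cdot>\<^bsub>D\<^esub> ar F (Ident C A \<star>\<^bsub>C\<^esub> f) = ar F (c \<cdot>\<^bsub>C\<^esub> (Ident C A \<star>\<^bsub>C\<^esub> f))"
      by (rule F_comp[OF Af c, symmetric])
    finally show ?thesis .
  qed
  have XB: "X \<odot>\<^bsub>C\<^esub> ?B \<in> Obj C" and XY: "?X \<odot>\<^bsub>D\<^esub> Y \<in> Obj D"
    using o B Fo Y by simp_all
  define k where "k = (Ident C X \<star>\<^bsub>C\<^esub> c) \<cdot>\<^bsub>C\<^esub> C.dual_unit X A coev (X \<odot>\<^bsub>C\<^esub> ?B)"
  define k' where "k' = (?I ?X \<star>\<^bsub>D\<^esub> c') \<cdot>\<^bsub>D\<^esub> D.dual_unit ?X ?A (image_coev X A coev) (?X \<odot>\<^bsub>D\<^esub> Y)"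
  have k: "k \<in> Isos C (X \<odot>\<^bsub>C\<^esub> ?B) (X \<odot>\<^bsub>C\<^esub> ?B)"
    unfolding k_def c_def by (rule C.dual_triangle_iso[OF hd B])
  have k': "k' \<in> Isos D (?X \<odot>\<^bsub>D\<^esub> Y) (?X \<odot>\<^bsub>D\<^esub> Y)"
    unfolding k'_def c'_def by (rule D.dual_triangle_iso[OF hd' Y])
  note uXB = C.dual_counit_hom(2)[OF hd XB] and uXY = D.dual_counit_hom(2)[OF hd' XY]
  \<comment> \<open>With half duals the triangle composite \<open>k\<close> is invertible but
    possibly not the identity. That is enough, since it can be cancelled.\<close>
  have recover: "k \<cdot>\<^bsub>C\<^esub> f = (Ident C X \<star>\<^bsub>C\<^esub> (c \<cdot>\<^bsub>C\<^esub> (Ident C A \<star>\<^bsub>C\<^esub> f))) \<cdot>\<^bsub>C\<^esub> u" if f: "f \<in> Hom C Z (X \<odot>\<^bsub>C\<^esub> ?B)" for f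
  proof -
    have "k \<cdot>\<^bsub>C\<^esub> f = (Ident C X \<star>\<^bsub>C\<^esub> c) \<cdot>\<^bsub>C\<^esub> (C.dual_unit X A coev (X \<odot>\<^bsub>C\<^esub> ?B) \<cdot>\<^bsub>C\<^esub> f)"
      using o c f uXB by (simp add: k_def in_hom)
    also have "\<dots> = (Ident C X \<star>\<^bsub>C\<^esub> c) \<cdot>\<^bsub>C\<^esub> ((Ident C X \<star>\<^bsub>C\<^esub> (Ident C A \<star>\<^bsub>C\<^esub> f)) \<cdot>\<^bsub>C\<^esub> u)"
      unfolding C.dual_unit_natural[OF hd f] u_def ..
    also have "\<dots> = ((Ident C X \<star>\<^bsub>C\<^esub> c) \<cdot>\<^bsub>C\<^esub> (Ident C X \<star>\<^bsub>C\<^esub> (Ident C A \<star>\<^bsub>C\<^esub> f))) \<cdot>\<^bsub>C\<^esub> u"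
      using o c f u by (simp add: in_hom)
    also have "(Ident C X \<star>\<^bsub>C\<^esub> c) \<cdot>\<^bsub>C\<^esub> (Ident C X \<star>\<^bsub>C\<^esub> (Ident C A \<star>\<^bsub>C\<^esub> f)) = Ident C X \<star>\<^bsub>C\<^esub> (c \<cdot>\<^bsub>C\<^esub> (Ident C A \<star>\<^bsub>C\<^esub> f))"
      using o c f by (simp add: in_hom C.tensor_comp_arr)
    finally show ?thesis .
  qed
  have recover': "k' \<cdot>\<^bsub>D\<^esub> g = (?I ?X \<star>\<^bsub>D\<^esub> (c' \<cdot>\<^bsub>D\<^esub> (?I ?A \<star>\<^bsub>D\<^esub> g))) \<cdot>\<^bsub>D\<^esub> u'" if g: "g \<in> Hom D ?Z (?X \<odot>\<^bsub>D\<^esub> Y)" for g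
  proof -
    have "k' \<cdot>\<^bsub>D\<^esub> g = (?I ?X \<star>\<^bsub>D\<^esub> c') \<cdot>\<^bsub>D\<^esub> (D.dual_unit ?X ?A (image_coev X A coev) (?X \<odot>\<^bsub>D\<^esub> Y) \<cdot>\<^bsub>D\<^esub> g)"
      using Fo c' g uXY by (simp add: k'_def in_hom)
    also have "\<dots> = (?I ?X \<star>\<^bsub>D\<^esub> c') \<cdot>\<^bsub>D\<^esub> ((?I ?X \<star>\<^bsub>D\<^esub> (?I ?A \<star>\<^bsub>D\<^esub> g)) \<cdot>\<^bsub>D\<^esub> u')"
      unfolding D.dual_unit_natural[OF hd' g] u'_def ..
    also have "\<dots> = ((?I ?X \<star>\<^bsub>D\<^esub> c') \<cdot>\<^bsub>D\<^esub> (?I ?X \<star>\<^bsub>D\<^esub> (?I ?A \<star>\<^bsub>D\<^esub> g))) \<cdot>\<^bsub>D\<^esub> u'"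
      using Fo c' g u' by (simp add: in_hom)
    also have "(?I ?X \<star>\<^bsub>D\<^esub> c') \<cdot>\<^bsub>D\<^esub> (?I ?X \<star>\<^bsub>D\<^esub> (?I ?A \<star>\<^bsub>D\<^esub> g)) = ?I ?X \<star>\<^bsub>D\<^esub> (c' \<cdot>\<^bsub>D\<^esub> (?I ?A \<star>\<^bsub>D\<^esub> g))"
      using Fo c' g by (simp add: in_hom D.tensor_comp_arr)
    finally show ?thesis .
  qed
  have cf: "c \<cdot>\<^bsub>C\<^esub> (Ident C A \<star>\<^bsub>C\<^esub> f) \<in> Hom C (A \<odot>\<^bsub>C\<^esub> Z) ?B" if "f \<in> Hom C Z (X \<odot>\<^bsub>C\<^esub> ?B)" for f
    by (rule C.comp[OF C.tensor_ar[OF C.ident[OF o(2)] that] c])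
  show ?thesis
    unfolding bij_betw_def
  proof (intro conjI inj_onI equalityI subsetI)
    fix f g assume f: "f \<in> Hom C Z (X \<odot>\<^bsub>C\<^esub> ?B)" and g: "g \<in> Hom C Z (X \<odot>\<^bsub>C\<^esub> ?B)" and eq: "?p f = ?p g"
    have "e Y \<cdot>\<^bsub>D\<^esub> ar F (c \<cdot>\<^bsub>C\<^esub> (Ident C A \<star>\<^bsub>C\<^esub> f)) = e Y \<cdot>\<^bsub>D\<^esub> ar F (c \<cdot>\<^bsub>C\<^esub> (Ident C A \<star>\<^bsub>C\<^esub> g))"
      by (rule D.iso_cancel_right[OF mult_iso[OF o(2) Z] adj.transpose_hom[OF Y cf[OF f]] adj.transpose_hom[OF Y cf[OF g]]])
        (use transposed[OF f] transposed[OF g] eq in simp)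
    then have "c \<cdot>\<^bsub>C\<^esub> (Ident C A \<star>\<^bsub>C\<^esub> f) = c \<cdot>\<^bsub>C\<^esub> (Ident C A \<star>\<^bsub>C\<^esub> g)"
      by (rule adj.transpose_unique[OF Y cf[OF f] cf[OF g]])
    then have "k \<cdot>\<^bsub>C\<^esub> f = k \<cdot>\<^bsub>C\<^esub> g"
      using recover[OF f] recover[OF g] by simp
    then show "f = g"
      by (rule C.iso_cancel_left[OF k f g])
  next
    fix g0 assume g0: "g0 \<in> Hom D ?Z (?X \<odot>\<^bsub>D\<^esub> Y)"
    \<comment> \<open>Going to the dual side and back multiplies by \<open>k'\<close>, so its
      inverse is inserted beforehand.\<close>
    define g where "g = inv_arr D k' \<cdot>\<^bsub>D\<^esub> g0"
    have g: "g \<in> Hom D ?Z (?X \<odot>\<^bsub>D\<^esub> Y)"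
      unfolding g_def by (rule D.comp[OF g0 D.inv_arr(2)[OF k']])
    have kg: "k' \<cdot>\<^bsub>D\<^esub> g = g0"
      using D.comp_assoc[OF g0 D.inv_arr(2)[OF k'] D.Isos_hom[OF k']] D.inv_arr(4)[OF k'] D.comp_ident_left[OF g0]
      by (simp add: g_def)
    note muAZ = mult_iso[OF o(2) Z]
    define h where "h = c' \<cdot>\<^bsub>D\<^esub> (?I ?A \<star>\<^bsub>D\<^esub> g)"
    have h: "h \<in> Hom D (?A \<odot>\<^bsub>D\<^esub> ?Z) Y"
      unfolding h_def by (rule D.comp[OF D.tensor_ar[OF D.ident[OF Fo(2)] g] c'])
    have AZ: "A \<odot>\<^bsub>C\<^esub> Z \<in> Obj C"
      using o Z by simp
    obtain l where l: "l \<in> Hom C (A \<odot>\<^bsub>C\<^esub> Z) ?B" "e Y \<cdot>\<^bsub>D\<^esub> ar F l = h \<cdot>\<^bsub>D\<^esub> inv_arr D (\<mu> A Z)"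
      using adj.transpose_ex[OF AZ D.comp[OF D.inv_arr(2)[OF muAZ] h]] by blast
    have hl: "h = e Y \<cdot>\<^bsub>D\<^esub> (ar F l \<cdot>\<^bsub>D\<^esub> \<mu> A Z)"
    proof -
      have "e Y \<cdot>\<^bsub>D\<^esub> (ar F l \<cdot>\<^bsub>D\<^esub> \<mu> A Z) = (e Y \<cdot>\<^bsub>D\<^esub> ar F l) \<cdot>\<^bsub>D\<^esub> \<mu> A Z"
        by (rule D.comp_assoc[OF D.Isos_hom[OF muAZ] F_hom[OF l(1)] e, symmetric])
      also have "\<dots> = h \<cdot>\<^bsub>D\<^esub> (inv_arr D (\<mu> A Z) \<cdot>\<^bsub>D\<^esub> \<mu> A Z)"
        unfolding l(2) by (rule D.comp_assoc[OF D.Isos_hom[OF muAZ] D.inv_arr(2)[OF muAZ] h])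
      also have "\<dots> = h"
        using D.inv_arr(3)[OF muAZ] D.comp_ident_right[OF h] by simp
      finally show ?thesis
        by (rule sym)
    qed
    define f where "f = (Ident C X \<star>\<^bsub>C\<^esub> l) \<cdot>\<^bsub>C\<^esub> u"
    have Xl: "Ident C X \<star>\<^bsub>C\<^esub> l \<in> Hom C (X \<odot>\<^bsub>C\<^esub> (A \<odot>\<^bsub>C\<^esub> Z)) (X \<odot>\<^bsub>C\<^esub> ?B)"
      by (rule C.tensor_ar[OF C.ident[OF o(1)] l(1)])
    have f: "f \<in> Hom C Z (X \<odot>\<^bsub>C\<^esub> ?B)"
      unfolding f_def by (rule C.comp[OF u Xl])
    have "?p f = (?I ?X \<star>\<^bsub>D\<^esub> e Y) \<cdot>\<^bsub>D\<^esub> (m \<cdot>\<^bsub>D\<^esub> (ar F (Ident C X \<star>\<^bsub>C\<^esub> l) \<cdot>\<^bsub>D\<^esub> ar F u))"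
      unfolding p f_def F_comp[OF u Xl] ..
    also have "ar F u = \<mu> X (A \<odot>\<^bsub>C\<^esub> Z) \<cdot>\<^bsub>D\<^esub> ((?I ?X \<star>\<^bsub>D\<^esub> \<mu> A Z) \<cdot>\<^bsub>D\<^esub> u')"
      unfolding u_def u'_def by (rule dual_unit_image[OF hd Z])
    also have "(?I ?X \<star>\<^bsub>D\<^esub> e Y) \<cdot>\<^bsub>D\<^esub> (m \<cdot>\<^bsub>D\<^esub> (ar F (Ident C X \<star>\<^bsub>C\<^esub> l) \<cdot>\<^bsub>D\<^esub> (\<mu> X (A \<odot>\<^bsub>C\<^esub> Z) \<cdot>\<^bsub>D\<^esub> ((?I ?X \<star>\<^bsub>D\<^esub> \<mu> A Z) \<cdot>\<^bsub>D\<^esub> u'))))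
        = (?I ?X \<star>\<^bsub>D\<^esub> e Y) \<cdot>\<^bsub>D\<^esub> (m \<cdot>\<^bsub>D\<^esub> ((ar F (Ident C X \<star>\<^bsub>C\<^esub> l) \<cdot>\<^bsub>D\<^esub> \<mu> X (A \<odot>\<^bsub>C\<^esub> Z)) \<cdot>\<^bsub>D\<^esub> ((?I ?X \<star>\<^bsub>D\<^esub> \<mu> A Z) \<cdot>\<^bsub>D\<^esub> u')))"
      using o Z B l(1) u' by (simp add: in_hom)
    also have "ar F (Ident C X \<star>\<^bsub>C\<^esub> l) \<cdot>\<^bsub>D\<^esub> \<mu> X (A \<odot>\<^bsub>C\<^esub> Z) = \<mu> X ?B \<cdot>\<^bsub>D\<^esub> (?I ?X \<star>\<^bsub>D\<^esub> ar F l)"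
      by (rule mult_natural_right[OF l(1) o(1), symmetric])
    also have "(?I ?X \<star>\<^bsub>D\<^esub> e Y) \<cdot>\<^bsub>D\<^esub> (m \<cdot>\<^bsub>D\<^esub> ((\<mu> X ?B \<cdot>\<^bsub>D\<^esub> (?I ?X \<star>\<^bsub>D\<^esub> ar F l)) \<cdot>\<^bsub>D\<^esub> ((?I ?X \<star>\<^bsub>D\<^esub> \<mu> A Z) \<cdot>\<^bsub>D\<^esub> u')))
        = (?I ?X \<star>\<^bsub>D\<^esub> e Y) \<cdot>\<^bsub>D\<^esub> ((m \<cdot>\<^bsub>D\<^esub> \<mu> X ?B) \<cdot>\<^bsub>D\<^esub> ((?I ?X \<star>\<^bsub>D\<^esub> ar F l) \<cdot>\<^bsub>D\<^esub> ((?I ?X \<star>\<^bsub>D\<^esub> \<mu> A Z) \<cdot>\<^bsub>D\<^esub> u')))"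
      using o Z B l(1) u' m by (simp add: in_hom)
    also have "\<dots> = ((?I ?X \<star>\<^bsub>D\<^esub> e Y) \<cdot>\<^bsub>D\<^esub> ((?I ?X \<star>\<^bsub>D\<^esub> ar F l) \<cdot>\<^bsub>D\<^esub> (?I ?X \<star>\<^bsub>D\<^esub> \<mu> A Z))) \<cdot>\<^bsub>D\<^esub> u'"
      unfolding mm(1) using o Z B l(1) u' e by (simp add: in_hom)
    also have "(?I ?X \<star>\<^bsub>D\<^esub> e Y) \<cdot>\<^bsub>D\<^esub> ((?I ?X \<star>\<^bsub>D\<^esub> ar F l) \<cdot>\<^bsub>D\<^esub> (?I ?X \<star>\<^bsub>D\<^esub> \<mu> A Z)) = ?I ?X \<star>\<^bsub>D\<^esub> h"
      unfolding hl using o Z B l(1) e by (simp add: in_hom D.tensor_comp_arr)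
    also have "(?I ?X \<star>\<^bsub>D\<^esub> h) \<cdot>\<^bsub>D\<^esub> u' = g0"
      using recover'[OF g] kg by (simp add: h_def)
    finally show "g0 \<in> ?p ` Hom C Z (X \<odot>\<^bsub>C\<^esub> ?B)"
      using f by blast
  qed (use p_hom in auto)
qed

end

section \<open>Dualizable objects are compact\<close>

context tensor_triangulated_category
begin

text \<open>Transposition along the dual pair, from maps
  \<open>1 \<rightarrow> Z \<otimes> D\<close> to maps \<open>X \<rightarrow> Z\<close>.\<close>

definition undual :: "'o \<Rightarrow> 'o \<Rightarrow> 'm \<Rightarrow> 'o \<Rightarrow> 'm \<Rightarrow> 'm" where
  "undual X D ev Z g = RUnit C Z \<cdot> ((Ident C Z \<star> ev) \<cdot> (Assoc C Z D X \<cdot> ((g \<star> Ident C X) \<cdot> inv_arr C (LUnit C X))))"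

context
  fixes X D :: 'o and ev coev :: 'm
  assumes hd: "half_dual X D ev coev"
begin

lemma hd_hom:
  "X \<in> Obj C" "D \<in> Obj C" "ev \<in> Hom C (D \<odot> X) (Unit C)" "coev \<in> Hom C (Unit C) (X \<odot> D)"
  "dual_zigzag X D ev coev \<in> Isos C (Unit C \<odot> X) (X \<odot> Unit C)"
  using hd by (auto simp: half_dual_def)

lemma undual_hom: "\<lbrakk>Z \<in> Obj C; g \<in> Hom C (Unit C) (Z \<odot> D)\<rbrakk> \<Longrightarrow> undual X D ev Z g \<in> Hom C X Z"
  using hd_hom by (simp add: undual_def in_hom)

lemma undual_natural:
  assumes u: "u \<in> Hom C Z Z'" and g: "g \<in> Hom C (Unit C) (Z \<odot> D)"
  shows "undual X D ev Z' ((u \<star> Ident C D) \<cdot> g) = u \<cdot> undual X D ev Z g"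
proof -
  let ?I = "Ident C" and ?U = "Unit C" and ?a = "Assoc C" and ?l = "inv_arr C (LUnit C X)"
  note o = hd_hom(1,2) and ev = hd_hom(3)
  have Z: "Z \<in> Obj C" "Z' \<in> Obj C"
    using hom_obj[OF u] by auto
  have "undual X D ev Z' ((u \<star> ?I D) \<cdot> g)
      = RUnit C Z' \<cdot> ((?I Z' \<star> ev) \<cdot> ((?a Z' D X \<cdot> ((u \<star> ?I D) \<star> ?I X)) \<cdot> ((g \<star> ?I X) \<cdot> ?l)))"
  proof -
    have "((u \<star> ?I D) \<cdot> g) \<star> ?I X = ((u \<star> ?I D) \<star> ?I X) \<cdot> (g \<star> ?I X)"
      using o u g by (simp add: in_hom tensor_comp_arr)
    then show ?thesis
      using o Z u g ev by (simp add: undual_def in_hom)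
  qed
  also have "?a Z' D X \<cdot> ((u \<star> ?I D) \<star> ?I X) = (u \<star> ?I (D \<odot> X)) \<cdot> ?a Z D X"
    using assoc_natural[OF u ident[OF o(2)] ident[OF o(1)]] tensor_ident[OF o(2,1)] by simp
  also have "RUnit C Z' \<cdot> ((?I Z' \<star> ev) \<cdot> (((u \<star> ?I (D \<odot> X)) \<cdot> ?a Z D X) \<cdot> ((g \<star> ?I X) \<cdot> ?l)))
      = RUnit C Z' \<cdot> (((?I Z' \<star> ev) \<cdot> (u \<star> ?I (D \<odot> X))) \<cdot> (?a Z D X \<cdot> ((g \<star> ?I X) \<cdot> ?l)))"
    using o Z u g ev by (simp add: in_hom)
  also have "(?I Z' \<star> ev) \<cdot> (u \<star> ?I (D \<odot> X)) = (u \<star> ?I ?U) \<cdot> (?I Z \<star> ev)"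
    using o Z u ev by (simp add: in_hom tensor_comp_arr)
  also have "RUnit C Z' \<cdot> (((u \<star> ?I ?U) \<cdot> (?I Z \<star> ev)) \<cdot> (?a Z D X \<cdot> ((g \<star> ?I X) \<cdot> ?l)))
      = (RUnit C Z' \<cdot> (u \<star> ?I ?U)) \<cdot> ((?I Z \<star> ev) \<cdot> (?a Z D X \<cdot> ((g \<star> ?I X) \<cdot> ?l)))"
    using o Z u g ev by (simp add: in_hom)
  also have "RUnit C Z' \<cdot> (u \<star> ?I ?U) = u \<cdot> RUnit C Z"
    by (rule runit_natural[OF u])
  also have "(u \<cdot> RUnit C Z) \<cdot> ((?I Z \<star> ev) \<cdot> (?a Z D X \<cdot> ((g \<star> ?I X) \<cdot> ?l))) = u \<cdot> undual X D ev Z g"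
    using o Z u g ev by (simp add: in_hom undual_def)
  finally show ?thesis .
qed

lemma undual_coev: "undual X D ev X coev \<in> Isos C X X"
proof -
  have "undual X D ev X coev = RUnit C X \<cdot> (dual_zigzag X D ev coev \<cdot> inv_arr C (LUnit C X))"
    using hd_hom(1-4) by (simp add: undual_def dual_zigzag_def in_hom)
  then show ?thesis
    using Isos_comp[OF Isos_comp[OF inv_arr(1)[OF lunit_iso[OF hd_hom(1)]] hd_hom(5)] runit_iso[OF hd_hom(1)]]
    by simp
qed

text \<open>Up to an automorphism of \<open>X\<close>, a map \<open>X \<rightarrow> P\<close> is the
  transpose of a map \<open>1 \<rightarrow> P \<otimes> D\<close>. Tensoring with \<open>D\<close>
  preserves the coproduct and the unit is compact, so the latter map is a finite sum; transposition
  is additive and natural and carries the sum back.\<close>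

lemma half_dual_compact:
  fixes \<kappa> :: "'i rel"
  assumes \<kappa>: "uncountable_regular \<kappa>" and unit: "finsum_compact \<kappa> C (Unit C)"
  shows "finsum_compact \<kappa> C X"
  unfolding finsum_compact_def
proof (intro conjI hd_hom(1) allI impI ballI)
  fix I :: "'i set" and Y P \<iota> w0
  assume "small \<kappa> I \<and> is_coproduct C I Y P \<iota>" and w0: "w0 \<in> Hom C X P"
  then have I: "small \<kappa> I" and P: "is_coproduct C I Y P \<iota>"
    by auto
  note o = hd_hom(1,2) and coev = hd_hom(4)
  interpret D: coproduct_exact_functor C C \<kappa> "tensor_right D"
    by (rule tensor_right_exact[OF \<kappa> o(2)])
  interpret X: coproduct_exact_functor C C \<kappa> "tensor_right X"
    by (rule tensor_right_exact[OF \<kappa> o(1)])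
  note i = coprod_inj[OF P] and Po = coprod_obj[OF P]
  have Yo: "Y j \<in> Obj C" if "j \<in> I" for j
    using hom_obj[OF i[OF that]] by simp
  have PD: "is_coproduct C I (\<lambda>i. Y i \<odot> D) (P \<odot> D) (\<lambda>i. \<iota> i \<star> Ident C D)"
    using D.F_coproduct[OF I P] by simp
  let ?k = "undual X D ev X coev"
  \<comment> \<open>Transposing \<open>coev\<close> back yields \<open>?k\<close> in place of the
    identity, so the inverse of \<open>?k\<close> is built into \<open>w\<close>.\<close>
  define w where "w = w0 \<cdot> inv_arr C ?k"
  have w: "w \<in> Hom C X P"
    unfolding w_def by (rule comp[OF inv_arr(2)[OF undual_coev] w0])
  have wk: "w \<cdot> ?k = w0"
    unfolding w_def
    using comp_assoc[OF Isos_hom[OF undual_coev] inv_arr(2)[OF undual_coev] w0] inv_arr(3)[OF undual_coev]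
      comp_ident_right[OF w0] by simp
  have wD: "(w \<star> Ident C D) \<cdot> coev \<in> Hom C (Unit C) (P \<odot> D)"
    by (rule comp[OF coev tensor_ar[OF w ident[OF o(2)]]])
  obtain J where J: "J \<subseteq> I" "finite_sum C (Unit C) (P \<odot> D) (\<lambda>i. Y i \<odot> D) (\<lambda>i. \<iota> i \<star> Ident C D) J
      ((w \<star> Ident C D) \<cdot> coev)"
    using finsum_compactD[OF unit I PD wD] by blast
  have plus: "undual X D ev Z (Plus C g g') = Plus C (undual X D ev Z g) (undual X D ev Z g')"
    if Z: "Z \<in> Obj C" and g: "g \<in> Hom C (Unit C) (Z \<odot> D)" "g' \<in> Hom C (Unit C) (Z \<odot> D)" for Z g g'
  proof -
    let ?l = "inv_arr C (LUnit C X)" and ?r = "RUnit C Z \<cdot> ((Ident C Z \<star> ev) \<cdot> Assoc C Z D X)"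
    have gX: "h \<star> Ident C X \<in> Hom C (Unit C \<odot> X) ((Z \<odot> D) \<odot> X)" if "h \<in> Hom C (Unit C) (Z \<odot> D)" for h
      by (rule tensor_ar[OF that ident[OF o(1)]])
    have l: "?l \<in> Hom C X (Unit C \<odot> X)"
      using inv_arr(2)[OF lunit_iso[OF o(1)]] .
    have r: "?r \<in> Hom C ((Z \<odot> D) \<odot> X) Z"
      using Z o hd_hom(3) by (simp add: in_hom)
    have ud: "undual X D ev Z h = ?r \<cdot> ((h \<star> Ident C X) \<cdot> ?l)" if "h \<in> Hom C (Unit C) (Z \<odot> D)" for h
      using that Z o hd_hom(3) by (simp add: undual_def in_hom)
    show ?thesis
      using X.F_plus[OF g] ud[OF g(1)] ud[OF g(2)] ud[OF plus_hom[OF g]]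
        comp_plus_right[OF l gX[OF g(1)] gX[OF g(2)]]
        comp_plus_left[OF comp[OF l gX[OF g(1)]] comp[OF l gX[OF g(2)]] r] by simp
  qed
  have null: "undual X D ev P (Null C (Unit C) (P \<odot> D)) = Null C X P"
  proof -
    have n: "Null C (Unit C) (P \<odot> D) \<in> Hom C (Unit C) (P \<odot> D)"
      using null_hom Po o by simp
    note un = undual_hom[OF Po n]
    have "Plus C (undual X D ev P (Null C (Unit C) (P \<odot> D))) (undual X D ev P (Null C (Unit C) (P \<odot> D)))
        = Plus C (undual X D ev P (Null C (Unit C) (P \<odot> D))) (Null C X P)"
      using plus[OF Po n n] plus_null[OF n n] plus_null[OF un un] by simp
    then show ?thesis
      by (rule plus_left_cancel[OF un un null_hom[OF o(1) Po]])
  qed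
  have "finite_sum C X P Y \<iota> J (undual X D ev P ((w \<star> Ident C D) \<cdot> coev))"
  proof (rule finite_sum_map[where t = "undual X D ev P" and t' = "\<lambda>j. undual X D ev (Y j)",
        OF J(2) PD J(1) unit_ob null])
    fix v j a assume v: "v \<in> Hom C (Unit C) (P \<odot> D)" and j: "j \<in> I" and a: "a \<in> Hom C (Unit C) (Y j \<odot> D)"
    show "undual X D ev P (Plus C v ((\<iota> j \<star> Ident C D) \<cdot> a))
        = Plus C (undual X D ev P v) (\<iota> j \<cdot> undual X D ev (Y j) a) \<and> undual X D ev (Y j) a \<in> Hom C X (Y j)"
      using plus[OF Po v comp[OF a tensor_ar[OF i[OF j] ident[OF o(2)]]]] undual_natural[OF i[OF j] a]
        undual_hom[OF Yo[OF j] a] by simp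
  qed
  then show "\<exists>J\<subseteq>I. finite_sum C X P Y \<iota> J w0"
    using J(1) undual_natural[OF w coev] wk by auto
qed

end

end

section \<open>Right adjoints of exact functors\<close>

text \<open>The counit \<open>e Y\<close> is the arrow that \<Phi> sends to the identity of
  \<open>R Y\<close>. Naturality of \<Phi> then shows that \<Phi> undoes transposition by
  \<open>e\<close>, from which the universal property and the naturality of \<open>e\<close>
  follow.\<close>

lemma right_adjoint_counit:
  assumes "category C" "category D" and F: "is_functor C D F" and R: "is_right_adjoint C D F R"
  obtains e where "counit_adjunction C D F (ob R) e"
    "\<And>Y Y' b. b \<in> Hom D Y Y' \<Longrightarrow> e Y' \<cdot>\<^bsub>D\<^esub> ar F (ar R b) = b \<cdot>\<^bsub>D\<^esub> e Y"
proof -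
  interpret C: category C by fact
  interpret D: category D by fact
  have R_functor: "is_functor D C R"
    using R by (simp add: is_right_adjoint_def)
  obtain \<Phi> where bij: "\<forall>X\<in>Obj C. \<forall>Y\<in>Obj D. bij_betw (\<Phi> X Y) (Hom D (ob F X) Y) (Hom C X (ob R Y))"
    and nat: "\<forall>X X' Y Y'. \<forall>a\<in>Hom C X' X. \<forall>b\<in>Hom D Y Y'. \<forall>f\<in>Hom D (ob F X) Y.
             \<Phi> X' Y' (b \<cdot>\<^bsub>D\<^esub> f \<cdot>\<^bsub>D\<^esub> ar F a) = ar R b \<cdot>\<^bsub>C\<^esub> \<Phi> X Y f \<cdot>\<^bsub>C\<^esub> a"
    using R unfolding is_right_adjoint_def by blast
  note R_ob = is_functor_ob[OF R_functor]
  have inj: "f = g" if "X \<in> Obj C" "f \<in> Hom D (ob F X) Y" "g \<in> Hom D (ob F X) Y" "\<Phi> X Y f = \<Phi> X Y g" for X Y f g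
  proof -
    have "Y \<in> Obj D"
      using D.hom_obj[OF that(2)] by simp
    then have "inj_on (\<Phi> X Y) (Hom D (ob F X) Y)"
      using bij that(1) by (simp add: bij_betw_def)
    then show ?thesis
      by (rule inj_onD[OF _ that(4,2,3)])
  qed
  have "\<exists>f\<in>Hom D (ob F (ob R Y)) Y. \<Phi> (ob R Y) Y f = Ident C (ob R Y)" if Y: "Y \<in> Obj D" for Y
  proof -
    have "Ident C (ob R Y) \<in> \<Phi> (ob R Y) Y ` Hom D (ob F (ob R Y)) Y"
      using bij R_ob[OF Y] Y C.ident[OF R_ob[OF Y]] by (simp add: bij_betw_def)
    then show ?thesis
      by (metis imageE)
  qed
  then obtain e where e: "\<And>Y. Y \<in> Obj D \<Longrightarrow> e Y \<in> Hom D (ob F (ob R Y)) Y"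
    "\<And>Y. Y \<in> Obj D \<Longrightarrow> \<Phi> (ob R Y) Y (e Y) = Ident C (ob R Y)"
    by metis
  have \<Phi>e: "\<Phi> X Y (e Y \<cdot>\<^bsub>D\<^esub> ar F g) = g" if Y: "Y \<in> Obj D" and g: "g \<in> Hom C X (ob R Y)" for X Y g
  proof -
    have "\<Phi> X Y (Ident D Y \<cdot>\<^bsub>D\<^esub> e Y \<cdot>\<^bsub>D\<^esub> ar F g) = ar R (Ident D Y) \<cdot>\<^bsub>C\<^esub> \<Phi> (ob R Y) Y (e Y) \<cdot>\<^bsub>C\<^esub> g"
      using nat g D.ident[OF Y] e(1)[OF Y] by blast
    then show ?thesis
      using e[OF Y] D.comp_ident_left[OF e(1)[OF Y]] is_functor_ident[OF R_functor Y] C.comp_ident_left[OF g]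
        C.comp_ident_left[OF C.ident[OF R_ob[OF Y]]] by simp
  qed
  have adj: "counit_adjunction C D F (ob R) e"
  proof unfold_locales
    show "is_functor C D F"
      by (rule F)
    show "ob R Y \<in> Obj C" "e Y \<in> Hom D (ob F (ob R Y)) Y" if "Y \<in> Obj D" for Y
      using R_ob e that by auto
    show "\<exists>g\<in>Hom C X (ob R Y). e Y \<cdot>\<^bsub>D\<^esub> ar F g = f" if X: "X \<in> Obj C" and f: "f \<in> Hom D (ob F X) Y" for X f Y
    proof -
      have Y: "Y \<in> Obj D"
        using D.hom_obj[OF f] by simp
      have g: "\<Phi> X Y f \<in> Hom C X (ob R Y)"
        using bij X Y f by (meson bij_betwE)
      have "e Y \<cdot>\<^bsub>D\<^esub> ar F (\<Phi> X Y f) = f"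
        by (rule inj[OF X D.comp[OF is_functor_hom[OF F g] e(1)[OF Y]] f \<Phi>e[OF Y g]])
      then show ?thesis
        using g by blast
    qed
    show "g = h" if "Y \<in> Obj D" "g \<in> Hom C X (ob R Y)" "h \<in> Hom C X (ob R Y)"
      "e Y \<cdot>\<^bsub>D\<^esub> ar F g = e Y \<cdot>\<^bsub>D\<^esub> ar F h" for Y g X h
      using \<Phi>e[OF that(1,2)] \<Phi>e[OF that(1,3)] that(4) by metis
  qed
  have "e Y' \<cdot>\<^bsub>D\<^esub> ar F (ar R b) = b \<cdot>\<^bsub>D\<^esub> e Y" if b: "b \<in> Hom D Y Y'" for Y Y' b
  proof -
    have Y: "Y \<in> Obj D" "Y' \<in> Obj D"
      using D.hom_obj[OF b] by auto
    note Rb = is_functor_hom[OF R_functor b] and FR = is_functor_ob[OF F R_ob[OF Y(1)]]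
    note be = D.comp[OF e(1)[OF Y(1)] b]
    have "\<Phi> (ob R Y) Y' (b \<cdot>\<^bsub>D\<^esub> e Y \<cdot>\<^bsub>D\<^esub> ar F (Ident C (ob R Y))) = ar R b \<cdot>\<^bsub>C\<^esub> \<Phi> (ob R Y) Y (e Y) \<cdot>\<^bsub>C\<^esub> Ident C (ob R Y)"
      using nat C.ident[OF R_ob[OF Y(1)]] b e(1)[OF Y(1)] by blast
    then have "\<Phi> (ob R Y) Y' (b \<cdot>\<^bsub>D\<^esub> e Y) = ar R b"
      using e(2)[OF Y(1)] C.comp_ident_right[OF Rb] is_functor_ident[OF F R_ob[OF Y(1)]] D.comp_ident_right[OF be]
      by simp
    then show ?thesis
      using inj[OF R_ob[OF Y(1)] D.comp[OF is_functor_hom[OF F Rb] e(1)[OF Y(2)]] be] \<Phi>e[OF Y(2) Rb] by simp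
  qed
  then show ?thesis
    using that adj by blast
qed

locale exact_adjunction = coproduct_exact_functor C D \<kappa> F + counit_adjunction C D F "ob R" e
  for C :: "('o, 'm, 'y) tri_cat_scheme" and D :: "('p, 'n, 'z) tri_cat_scheme"
    and \<kappa> :: "'i rel" and F and R :: "('p, 'n, 'o, 'm) fctr" and e +
  assumes exact: "is_exact_functor C D F"
    and R_functor: "is_functor D C R"
    and counit_natural: "b \<in> Hom D Y Y' \<Longrightarrow> e Y' \<cdot>\<^bsub>D\<^esub> ar F (ar R b) = b \<cdot>\<^bsub>D\<^esub> e Y"
    and compactly_generated: "compactly_generated \<kappa> C"
    and F_compact: "finsum_compact \<kappa> C A \<Longrightarrow> finsum_compact \<kappa> D (ob F A)"
begin

abbreviation hat where "hat Y g \<equiv> e Y \<cdot>\<^bsub>D\<^esub> ar F g"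

lemmas R_ob = is_functor_ob[OF R_functor] and R_hom = is_functor_hom[OF R_functor]
  and R_comp = is_functor_comp[OF R_functor]

lemma hat_hom: "\<lbrakk>Y \<in> Obj D; g \<in> Hom C X (ob R Y)\<rbrakk> \<Longrightarrow> hat Y g \<in> Hom D (ob F X) Y"
  using transpose_hom .

lemma hat_R:
  assumes b: "b \<in> Hom D Y Y'" and g: "g \<in> Hom C X (ob R Y)"
  shows "hat Y' (ar R b \<cdot>\<^bsub>C\<^esub> g) = b \<cdot>\<^bsub>D\<^esub> hat Y g"
proof -
  have Y: "Y \<in> Obj D" "Y' \<in> Obj D"
    using D.hom_obj[OF b] by auto
  note Rb = R_hom[OF b]
  have "hat Y' (ar R b \<cdot>\<^bsub>C\<^esub> g) = (e Y' \<cdot>\<^bsub>D\<^esub> ar F (ar R b)) \<cdot>\<^bsub>D\<^esub> ar F g"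
    unfolding F_comp[OF g Rb] by (rule D.comp_assoc[OF F_hom[OF g] F_hom[OF Rb] counit[OF Y(2)], symmetric])
  then show ?thesis
    using counit_natural[OF b] D.comp_assoc[OF F_hom[OF g] counit[OF Y(1)] b] by simp
qed

lemma hat_plus:
  assumes "Y \<in> Obj D" "g \<in> Hom C X (ob R Y)" "h \<in> Hom C X (ob R Y)"
  shows "hat Y (Plus C g h) = Plus D (hat Y g) (hat Y h)"
  using F_plus[OF assms(2,3)] D.comp_plus_left[OF F_hom[OF assms(2)] F_hom[OF assms(3)] counit[OF assms(1)]]
  by simp

lemma hat_null:
  assumes "Y \<in> Obj D" "X \<in> Obj C"
  shows "hat Y (Null C X (ob R Y)) = Null D (ob F X) Y"
  using F_null[OF assms(2) R_ob[OF assms(1)]] D.comp_null_right[OF counit[OF assms(1)] F_ob[OF assms(2)]] by simp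

lemma R_additive: "is_additive_functor D C R"
  unfolding is_additive_functor_def
proof (intro conjI R_functor allI ballI)
  fix X Y f g assume f: "f \<in> Hom D X Y" and g: "g \<in> Hom D X Y"
  have o: "X \<in> Obj D" "Y \<in> Obj D"
    using D.hom_obj[OF f] by auto
  show "ar R (Plus D f g) = Plus C (ar R f) (ar R g)"
  proof (rule transpose_unique[OF o(2) R_hom[OF D.plus_hom[OF f g]] C.plus_hom[OF R_hom[OF f] R_hom[OF g]]])
    show "hat Y (ar R (Plus D f g)) = hat Y (Plus C (ar R f) (ar R g))"
      using counit_natural[OF f] counit_natural[OF g] counit_natural[OF D.plus_hom[OF f g]]
        hat_plus[OF o(2) R_hom[OF f] R_hom[OF g]] D.comp_plus_right[OF counit[OF o(1)] f g] by simp
  qed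
qed

text \<open>Let \<open>Q\<close> be the coproduct of the objects \<open>R (X i)\<close>. A map from
  a compact \<open>A\<close> into \<open>R P\<close> transposes to a map from the compact
  \<open>F A\<close> into \<open>P\<close>, which is a finite sum and so comes from
  \<open>Q\<close>. Hence \<open>q\<close> is bijective on maps from compact objects.\<close>

lemma R_coproduct:
  fixes I :: "'i set"
  assumes I: "small \<kappa> I" and P: "is_coproduct D I X P \<iota>"
  shows "is_coproduct C I (\<lambda>i. ob R (X i)) (ob R P) (\<lambda>i. ar R (\<iota> i))"
proof -
  note i = D.coprod_inj[OF P] and Po = D.coprod_obj[OF P]
  have Xo: "X j \<in> Obj D" if "j \<in> I" for j
    using D.hom_obj[OF i[OF that]] by simp
  have cop: "has_small_coproducts \<kappa> C"
    using compactly_generated by (simp add: compactly_generated_def)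
  obtain Q j where Q: "is_coproduct C I (\<lambda>i. ob R (X i)) Q j"
    using C.has_small_coproducts_any[OF regular cop I, of "\<lambda>i. ob R (X i)"] R_ob[OF Xo] by metis
  note ji = C.coprod_inj[OF Q] and Qo = C.coprod_obj[OF Q]
  obtain q where q: "q \<in> Hom C Q (ob R P)" "\<forall>k\<in>I. q \<cdot>\<^bsub>C\<^esub> j k = ar R (\<iota> k)"
    using C.coprod_ex[OF Q R_ob[OF Po] R_hom[OF i]] by blast
  let ?p = "coproj D I X P \<iota>" and ?r = "coproj C I (\<lambda>i. ob R (X i)) Q j"
  \<comment> \<open>The projections of \<open>Q\<close> factor through \<open>q\<close>, and they
    jointly detect maps from a compact object; this yields injectivity.\<close>
  have r: "?r k = ar R (?p k) \<cdot>\<^bsub>C\<^esub> q" if k: "k \<in> I" for k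
  proof (rule C.coproj_unique[OF Q k])
    note pk = D.coproj[OF P k]
    show "ar R (?p k) \<cdot>\<^bsub>C\<^esub> q \<in> Hom C Q (ob R (X k))"
      by (rule C.comp[OF q(1) R_hom[OF pk(1)]])
    fix l assume l: "l \<in> I"
    have "(ar R (?p k) \<cdot>\<^bsub>C\<^esub> q) \<cdot>\<^bsub>C\<^esub> j l = ar R (?p k \<cdot>\<^bsub>D\<^esub> \<iota> l)"
      using C.comp_assoc[OF ji[OF l] q(1) R_hom[OF pk(1)]] q(2) l R_comp[OF i[OF l] pk(1)] by simp
    then show "(ar R (?p k) \<cdot>\<^bsub>C\<^esub> q) \<cdot>\<^bsub>C\<^esub> j l
        = (if l = k then Ident C (ob R (X k)) else Null C (ob R (X l)) (ob R (X k)))"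
      using pk(2)[OF l] is_functor_ident[OF R_functor Xo[OF k]]
        additive_functor_null[OF D.additive C.additive R_additive Xo[OF l] Xo[OF k]] by simp
  qed
  have "q \<in> Isos C Q (ob R P)"
  proof (rule C.iso_by_compacts[OF regular compactly_generated q(1)])
    fix A assume A: "finsum_compact \<kappa> C A"
    then have Ao: "A \<in> Obj C"
      by (simp add: finsum_compact_def)
    show "bij_betw ((\<cdot>\<^bsub>C\<^esub>) q) (Hom C A Q) (Hom C A (ob R P))"
      unfolding bij_betw_def
    proof (intro conjI inj_onI equalityI subsetI)
      fix u v assume uv: "u \<in> Hom C A Q" "v \<in> Hom C A Q" "q \<cdot>\<^bsub>C\<^esub> u = q \<cdot>\<^bsub>C\<^esub> v"
      show "u = v"
      proof (rule C.finsum_compact_coproj_eq[OF regular A I Q uv(1,2)])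
        fix k assume k: "k \<in> I"
        note Rp = R_hom[OF D.coproj(1)[OF P k]]
        show "?r k \<cdot>\<^bsub>C\<^esub> u = ?r k \<cdot>\<^bsub>C\<^esub> v"
          using C.comp_assoc[OF uv(1) q(1) Rp] C.comp_assoc[OF uv(2) q(1) Rp] uv(3) r[OF k] by simp
      qed
    next
      fix g assume g: "g \<in> Hom C A (ob R P)"
      obtain J where J: "J \<subseteq> I" "finite_sum D (ob F A) P X \<iota> J (hat P g)"
        using finsum_compactD[OF F_compact[OF A] I P hat_hom[OF Po g]] by blast
      \<comment> \<open>Summands are lifted one by one: the component is transposed to a map into
        \<open>R (X k)\<close>, which enters \<open>Q\<close> through \<open>j k\<close>.\<close>
      have "\<exists>u\<in>Hom C A Q. hat P (q \<cdot>\<^bsub>C\<^esub> u) = w" if "finite_sum D (ob F A) P X \<iota> J w" "J \<subseteq> I" for w J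
        using that
      proof (induction rule: finite_sum.induct)
        case zero
        have "hat P (q \<cdot>\<^bsub>C\<^esub> Null C A Q) = Null D (ob F A) P"
          using C.comp_null_right[OF q(1) Ao] hat_null[OF Po Ao] by simp
        then show ?case
          using C.null_hom[OF Ao Qo] by blast
      next
        case (add J w k a)
        have k: "k \<in> I"
          using add by simp
        obtain u where u: "u \<in> Hom C A Q" "hat P (q \<cdot>\<^bsub>C\<^esub> u) = w"
          using add by blast
        obtain b where b: "b \<in> Hom C A (ob R (X k))" "hat (X k) b = a"
          using transpose_ex[OF Ao add(3)] by blast
        note jb = C.comp[OF b(1) ji[OF k]]
        have "q \<cdot>\<^bsub>C\<^esub> (j k \<cdot>\<^bsub>C\<^esub> b) = ar R (\<iota> k) \<cdot>\<^bsub>C\<^esub> b"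
          using C.comp_assoc[OF b(1) ji[OF k] q(1)] q(2) k by simp
        then have "hat P (q \<cdot>\<^bsub>C\<^esub> Plus C u (j k \<cdot>\<^bsub>C\<^esub> b)) = Plus D w (\<iota> k \<cdot>\<^bsub>D\<^esub> a)"
          using C.comp_plus_left[OF u(1) jb q(1)] hat_plus[OF Po C.comp[OF u(1) q(1)] C.comp[OF jb q(1)]]
            hat_R[OF i[OF k] b(1)] u(2) b(2) by simp
        then show ?case
          using C.plus_hom[OF u(1) jb] by blast
      qed
      then obtain u where u: "u \<in> Hom C A Q" "hat P (q \<cdot>\<^bsub>C\<^esub> u) = hat P g"
        using J by blast
      have "q \<cdot>\<^bsub>C\<^esub> u = g"
        by (rule transpose_unique[OF Po C.comp[OF u(1) q(1)] g u(2)])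
      then show "g \<in> (\<cdot>\<^bsub>C\<^esub>) q ` Hom C A Q"
        using u(1) by blast
    qed (use C.comp[OF _ q(1)] in auto)
  qed
  then show ?thesis
    by (rule C.coprod_iso[OF Q _ bspec[OF q(2)]])
qed

text \<open>Complete \<open>R f\<close> to a triangle with third object \<open>W\<close>. The
  counits at \<open>X\<close> and \<open>Y\<close> extend to a map of triangles, and transposing its
  third component gives \<open>w\<close> from \<open>W\<close> to \<open>R Z\<close>. It is
  invertible by a four lemma chase that compares Hom sets out of \<open>A\<close> with Hom sets out
  of \<open>F A\<close>.\<close>

lemma R_triangle:
  assumes tri: "is_triangle D X Y Z f g h"
  shows "\<exists>h'. is_triangle C (ob R X) (ob R Y) (ob R Z) (ar R f) (ar R g) h'"
proof -
  note t = D.triD[OF tri]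
  obtain \<phi> where \<phi>: "\<forall>X\<in>Obj C. \<phi> X \<in> Isos D (ob F (C.SO X)) (D.SO (ob F X))"
    and \<phi>_nat: "\<forall>X Y. \<forall>f\<in>Hom C X Y. \<phi> Y \<cdot>\<^bsub>D\<^esub> ar F (C.SA f) = D.SA (ar F f) \<cdot>\<^bsub>D\<^esub> \<phi> X"
    and \<phi>_tri: "\<forall>X Y Z f g h. is_triangle C X Y Z f g h \<longrightarrow>
       is_triangle D (ob F X) (ob F Y) (ob F Z) (ar F f) (ar F g) (\<phi> X \<cdot>\<^bsub>D\<^esub> ar F h)"
    using exact unfolding is_exact_functor_def by (elim conjE exE)
  have \<phi>_hom: "\<phi> V \<in> Hom D (ob F (C.SO V)) (D.SO (ob F V))" if "V \<in> Obj C" for V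
    using D.Isos_hom \<phi> that by blast
  note Rf = R_hom[OF t(1)] and Rg = R_hom[OF t(2)]
  note Ro = R_ob[OF t(4)] R_ob[OF t(5)] R_ob[OF t(6)]
  obtain W g' h' where W: "is_triangle C (ob R X) (ob R Y) W (ar R f) g' h'"
    using C.tri_complete[OF Rf] by blast
  note tW = C.triD[OF W]
  have FW: "is_triangle D (ob F (ob R X)) (ob F (ob R Y)) (ob F W) (ar F (ar R f)) (ar F g') (\<phi> (ob R X) \<cdot>\<^bsub>D\<^esub> ar F h')"
    using \<phi>_tri W by blast
  obtain c where c: "c \<in> Hom D (ob F W) Z" "c \<cdot>\<^bsub>D\<^esub> ar F g' = g \<cdot>\<^bsub>D\<^esub> e Y"
    "D.SA (e X) \<cdot>\<^bsub>D\<^esub> (\<phi> (ob R X) \<cdot>\<^bsub>D\<^esub> ar F h') = h \<cdot>\<^bsub>D\<^esub> c"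
    using D.tri_fill[OF FW tri counit[OF t(4)] counit[OF t(5)] counit_natural[OF t(1)]] by blast
  obtain w where w: "w \<in> Hom C W (ob R Z)" "hat Z w = c"
    using transpose_ex[OF tW(6) c(1)] by blast
  have wg: "w \<cdot>\<^bsub>C\<^esub> g' = ar R g"
    by (rule transpose_unique[OF t(6) C.comp[OF tW(2) w(1)] Rg])
      (simp only: counit_comp[OF t(6) w(1) tW(2)] w(2) c(2) counit_natural[OF t(2)])
  \<comment> \<open>Transposition for suspended targets, from maps into \<open>SO (R V)\<close> to
    maps into \<open>SO V\<close>. The isomorphism \<phi> bridges \<open>F\<close> and suspension,
    and desuspending reduces bijectivity to the ordinary transposition.\<close>
  define psi where "psi V t = D.SA (e V) \<cdot>\<^bsub>D\<^esub> (\<phi> (ob R V) \<cdot>\<^bsub>D\<^esub> ar F t)" for V t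
  have psi_SA: "psi V (C.SA s) = D.SA (hat V s) \<cdot>\<^bsub>D\<^esub> \<phi> B"
    if V: "V \<in> Obj D" and s: "s \<in> Hom C B (ob R V)" for V s B
  proof -
    have B: "B \<in> Obj C"
      using C.hom_obj[OF s] by simp
    have "psi V (C.SA s) = D.SA (e V) \<cdot>\<^bsub>D\<^esub> (D.SA (ar F s) \<cdot>\<^bsub>D\<^esub> \<phi> B)"
      using \<phi>_nat s by (simp add: psi_def)
    also have "\<dots> = (D.SA (e V) \<cdot>\<^bsub>D\<^esub> D.SA (ar F s)) \<cdot>\<^bsub>D\<^esub> \<phi> B"
      by (rule D.comp_assoc[OF \<phi>_hom[OF B] D.susp_hom[OF F_hom[OF s]] D.susp_hom[OF counit[OF V]], symmetric])
    finally show ?thesis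
      using D.susp_comp[OF F_hom[OF s] counit[OF V]] by simp
  qed
  have psi_inj: "t = t'" if V: "V \<in> Obj D" and tt: "t \<in> Hom C A (C.SO (ob R V))" "t' \<in> Hom C A (C.SO (ob R V))"
    and eq: "psi V t = psi V t'" for V t t' A
  proof -
    have "A \<in> Obj C"
      using C.hom_obj[OF tt(1)] by simp
    then obtain B where B: "B \<in> Obj C" "C.SO B = A"
      using C.desusp_ob by blast
    obtain s where s: "s \<in> Hom C B (ob R V)" "C.SA s = t"
      using C.desusp_hom[of t B "ob R V"] tt(1) B R_ob[OF V] by blast
    obtain s' where s': "s' \<in> Hom C B (ob R V)" "C.SA s' = t'"
      using C.desusp_hom[of t' B "ob R V"] tt(2) B R_ob[OF V] by blast
    note hs = hat_hom[OF V s(1)] and hs' = hat_hom[OF V s'(1)]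
    have "D.SA (hat V s) = D.SA (hat V s')"
      by (rule D.iso_cancel_right[OF bspec[OF \<phi> B(1)] D.susp_hom[OF hs] D.susp_hom[OF hs']])
        (use eq psi_SA[OF V s(1)] psi_SA[OF V s'(1)] s(2) s'(2) in simp)
    then have "hat V s = hat V s'"
      by (rule D.susp_inj[OF hs hs'])
    then show ?thesis
      using transpose_unique[OF V s(1) s'(1)] s(2) s'(2) by simp
  qed
  have psi_surj: "\<exists>t\<in>Hom C A (C.SO (ob R V)). psi V t = y"
    if V: "V \<in> Obj D" and A: "A \<in> Obj C" and y: "y \<in> Hom D (ob F A) (D.SO V)" for V A y
  proof -
    obtain B where B: "B \<in> Obj C" "C.SO B = A"
      using C.desusp_ob[OF A] .
    note \<phi>B = bspec[OF \<phi> B(1)]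
    have "y \<cdot>\<^bsub>D\<^esub> inv_arr D (\<phi> B) \<in> Hom D (D.SO (ob F B)) (D.SO V)"
      using D.comp[OF D.inv_arr(2)[OF \<phi>B]] y B(2) by simp
    then obtain k where k: "k \<in> Hom D (ob F B) V" "D.SA k = y \<cdot>\<^bsub>D\<^esub> inv_arr D (\<phi> B)"
      using D.desusp_hom[OF _ F_ob[OF B(1)] V] by blast
    obtain s where s: "s \<in> Hom C B (ob R V)" "hat V s = k"
      using transpose_ex[OF B(1) k(1)] by blast
    have y': "y \<in> Hom D (ob F (C.SO B)) (D.SO V)"
      using y B(2) by simp
    have "psi V (C.SA s) = y"
      using psi_SA[OF V s(1)] s(2) k(2) D.comp_assoc[OF D.Isos_hom[OF \<phi>B] D.inv_arr(2)[OF \<phi>B] y']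
        D.inv_arr(3)[OF \<phi>B] D.comp_ident_right[OF y'] by simp
    then show ?thesis
      using C.susp_hom[OF s(1)] B(2) by blast
  qed
  have psi_nat: "psi Y (C.SA (ar R f) \<cdot>\<^bsub>C\<^esub> s) = D.SA f \<cdot>\<^bsub>D\<^esub> psi X s" if s: "s \<in> Hom C A (C.SO (ob R X))" for s A
  proof -
    note Fs = F_hom[OF s] and FSR = F_hom[OF C.susp_hom[OF Rf]] and SFR = D.susp_hom[OF F_hom[OF Rf]]
    note px = \<phi>_hom[OF Ro(1)] and py = \<phi>_hom[OF Ro(2)]
    note SeX = D.susp_hom[OF counit[OF t(4)]] and SeY = D.susp_hom[OF counit[OF t(5)]] and Sf = D.susp_hom[OF t(1)]
    have "psi Y (C.SA (ar R f) \<cdot>\<^bsub>C\<^esub> s)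
        = D.SA (e Y) \<cdot>\<^bsub>D\<^esub> ((\<phi> (ob R Y) \<cdot>\<^bsub>D\<^esub> ar F (C.SA (ar R f))) \<cdot>\<^bsub>D\<^esub> ar F s)"
      unfolding psi_def F_comp[OF s C.susp_hom[OF Rf]] D.comp_assoc[OF Fs FSR py] ..
    also have "\<phi> (ob R Y) \<cdot>\<^bsub>D\<^esub> ar F (C.SA (ar R f)) = D.SA (ar F (ar R f)) \<cdot>\<^bsub>D\<^esub> \<phi> (ob R X)"
      using \<phi>_nat Rf by blast
    also have "D.SA (e Y) \<cdot>\<^bsub>D\<^esub> ((D.SA (ar F (ar R f)) \<cdot>\<^bsub>D\<^esub> \<phi> (ob R X)) \<cdot>\<^bsub>D\<^esub> ar F s)
        = (D.SA (e Y) \<cdot>\<^bsub>D\<^esub> D.SA (ar F (ar R f))) \<cdot>\<^bsub>D\<^esub> (\<phi> (ob R X) \<cdot>\<^bsub>D\<^esub> ar F s)"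
      unfolding D.comp_assoc[OF Fs px SFR] by (rule D.comp_assoc[OF D.comp[OF Fs px] SFR SeY, symmetric])
    also have "D.SA (e Y) \<cdot>\<^bsub>D\<^esub> D.SA (ar F (ar R f)) = D.SA f \<cdot>\<^bsub>D\<^esub> D.SA (e X)"
      using D.susp_comp[OF F_hom[OF Rf] counit[OF t(5)]] D.susp_comp[OF counit[OF t(4)] t(1)] counit_natural[OF t(1)]
      by simp
    also have "(D.SA f \<cdot>\<^bsub>D\<^esub> D.SA (e X)) \<cdot>\<^bsub>D\<^esub> (\<phi> (ob R X) \<cdot>\<^bsub>D\<^esub> ar F s) = D.SA f \<cdot>\<^bsub>D\<^esub> psi X s"
      unfolding psi_def by (rule D.comp_assoc[OF D.comp[OF Fs px] SeX Sf])
    finally show ?thesis .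
  qed
  have psi_h: "psi X (h' \<cdot>\<^bsub>C\<^esub> s) = h \<cdot>\<^bsub>D\<^esub> hat Z (w \<cdot>\<^bsub>C\<^esub> s)" if s: "s \<in> Hom C A W" for s A
  proof -
    note Fs = F_hom[OF s] and Fh = F_hom[OF tW(3)] and px = \<phi>_hom[OF Ro(1)]
    note SeX = D.susp_hom[OF counit[OF t(4)]]
    have "psi X (h' \<cdot>\<^bsub>C\<^esub> s) = (D.SA (e X) \<cdot>\<^bsub>D\<^esub> (\<phi> (ob R X) \<cdot>\<^bsub>D\<^esub> ar F h')) \<cdot>\<^bsub>D\<^esub> ar F s"
      unfolding psi_def F_comp[OF s tW(3)] D.comp_assoc[OF Fs Fh px, symmetric]
      by (rule D.comp_assoc[OF Fs D.comp[OF Fh px] SeX, symmetric])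
    also have "\<dots> = h \<cdot>\<^bsub>D\<^esub> (c \<cdot>\<^bsub>D\<^esub> ar F s)"
      unfolding c(3) by (rule D.comp_assoc[OF Fs c(1) t(3)])
    also have "c \<cdot>\<^bsub>D\<^esub> ar F s = hat Z (w \<cdot>\<^bsub>C\<^esub> s)"
      unfolding counit_comp[OF t(6) w(1) s] w(2) ..
    finally show ?thesis .
  qed
  have psi_null: "psi V (Null C A (C.SO (ob R V))) = Null D (ob F A) (D.SO V)"
    if V: "V \<in> Obj D" and A: "A \<in> Obj C" for V A
    using F_null[OF A C.susp_obj[OF R_ob[OF V]]] D.comp_null_right[OF \<phi>_hom[OF R_ob[OF V]] F_ob[OF A]]
      D.comp_null_right[OF D.susp_hom[OF counit[OF V]] F_ob[OF A]] by (simp add: psi_def)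
  have fh: "D.SA f \<cdot>\<^bsub>D\<^esub> h = Null D Z (D.SO Y)"
  proof (rule D.neg_eq_null[OF D.comp[OF t(3) D.susp_hom[OF t(1)]]])
    show "neg D (D.SA f \<cdot>\<^bsub>D\<^esub> h) = Null D Z (D.SO Y)"
      using D.tri_comp_null[OF D.tri_rot[OF D.tri_rot[OF tri]]] D.comp_neg(2)[OF t(3) D.susp_hom[OF t(1)]] by simp
  qed
  have wi: "w \<in> Isos C W (ob R Z)"
  proof (rule C.Isos_by_hom[OF w(1)])
    fix A assume A: "A \<in> Obj C"
    show "bij_betw ((\<cdot>\<^bsub>C\<^esub>) w) (Hom C A W) (Hom C A (ob R Z))"
      unfolding bij_betw_def
    proof (intro conjI inj_onI equalityI subsetI)
      \<comment> \<open>An element killed by \<open>w\<close> has zero boundary, so it comes from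
        \<open>R Y\<close>. Exactness of the given triangle brings it from \<open>R X\<close>, where
        the composite into \<open>W\<close> is zero.\<close>
      have inj: "u = Null C A W" if u: "u \<in> Hom C A W" "w \<cdot>\<^bsub>C\<^esub> u = Null C A (ob R Z)" for u
      proof -
        have "psi X (h' \<cdot>\<^bsub>C\<^esub> u) = psi X (Null C A (C.SO (ob R X)))"
          using psi_h[OF u(1)] u(2) hat_null[OF t(6) A] D.comp_null_right[OF t(3) F_ob[OF A]] psi_null[OF t(4) A] by simp
        then have "h' \<cdot>\<^bsub>C\<^esub> u = Null C A (C.SO (ob R X))"
          using psi_inj[OF t(4) C.comp[OF u(1) tW(3)]] C.null_hom[OF A C.susp_obj[OF Ro(1)]] by blast
        then obtain y where y: "y \<in> Hom C A (ob R Y)" "g' \<cdot>\<^bsub>C\<^esub> y = u"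
          using C.exact_hom[OF C.tri_rot[OF W] u(1)] by blast
        have "ar R g \<cdot>\<^bsub>C\<^esub> y = Null C A (ob R Z)"
          using C.comp_assoc[OF y(1) tW(2) w(1)] wg y(2) u(2) by simp
        then have "g \<cdot>\<^bsub>D\<^esub> hat Y y = Null D (ob F A) Z"
          using hat_R[OF t(2) y(1)] hat_null[OF t(6) A] by simp
        then obtain x' where x': "x' \<in> Hom D (ob F A) X" "f \<cdot>\<^bsub>D\<^esub> x' = hat Y y"
          using D.exact_hom[OF tri hat_hom[OF t(5) y(1)]] by blast
        obtain x where x: "x \<in> Hom C A (ob R X)" "hat X x = x'"
          using transpose_ex[OF A x'(1)] by blast
        have "ar R f \<cdot>\<^bsub>C\<^esub> x = y"
          by (rule transpose_unique[OF t(5) C.comp[OF x(1) Rf] y(1)]) (simp only: hat_R[OF t(1) x(1)] x(2) x'(2))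
        then have "u = (g' \<cdot>\<^bsub>C\<^esub> ar R f) \<cdot>\<^bsub>C\<^esub> x"
          using C.comp_assoc[OF x(1) Rf tW(2)] y(2) by simp
        then show ?thesis
          using C.tri_comp_null[OF W] C.comp_null_left[OF x(1) tW(6)] by simp
      qed
      fix u v assume uv: "u \<in> Hom C A W" "v \<in> Hom C A W" "w \<cdot>\<^bsub>C\<^esub> u = w \<cdot>\<^bsub>C\<^esub> v"
      note nv = C.neg_hom[OF uv(2) uv(2)] and wv = C.comp[OF uv(2) w(1)]
      have "w \<cdot>\<^bsub>C\<^esub> Plus C u (neg C v) = Null C A (ob R Z)"
        using C.comp_plus_left[OF uv(1) nv w(1)] C.comp_neg(1)[OF uv(2) w(1)] uv(3) C.plus_neg[OF wv wv] by simp
      then show "u = v"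
        using C.diff_null[OF uv(1,2)] inj[OF C.plus_hom[OF uv(1) nv]] by blast
    next
      fix z assume z: "z \<in> Hom C A (ob R Z)"
      note hz = hat_hom[OF t(6) z]
      \<comment> \<open>\<open>x\<close> corresponds to the boundary of \<open>z\<close>. It is the
        boundary of some \<open>s\<close> into \<open>W\<close>, and the remaining difference
        between \<open>z\<close> and the image of \<open>s\<close> comes from
        \<open>Y\<close>.\<close>
      obtain x where x: "x \<in> Hom C A (C.SO (ob R X))" "psi X x = h \<cdot>\<^bsub>D\<^esub> hat Z z"
        using psi_surj[OF t(4) A D.comp[OF hz t(3)]] by blast
      have "psi Y (C.SA (ar R f) \<cdot>\<^bsub>C\<^esub> x) = psi Y (Null C A (C.SO (ob R Y)))"
        using psi_nat[OF x(1)] x(2) D.comp_assoc[OF hz t(3) D.susp_hom[OF t(1)]] fh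
          D.comp_null_left[OF hz D.susp_obj[OF t(5)]] psi_null[OF t(5) A] by simp
      then have "C.SA (ar R f) \<cdot>\<^bsub>C\<^esub> x = Null C A (C.SO (ob R Y))"
        using psi_inj[OF t(5) C.comp[OF x(1) C.susp_hom[OF Rf]]] C.null_hom[OF A C.susp_obj[OF Ro(2)]] by blast
      then have "neg C (C.SA (ar R f)) \<cdot>\<^bsub>C\<^esub> x = Null C A (C.SO (ob R Y))"
        using C.comp_neg(2)[OF x(1) C.susp_hom[OF Rf]] C.neg_null[OF A C.susp_obj[OF Ro(2)]] by simp
      then obtain s where s: "s \<in> Hom C A W" "h' \<cdot>\<^bsub>C\<^esub> s = x"
        using C.exact_hom[OF C.tri_rot[OF C.tri_rot[OF W]] x(1)] by blast
      note ws = C.comp[OF s(1) w(1)]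
      note hws = hat_hom[OF t(6) ws]
      note nws = D.neg_hom[OF hws hws] and hhws = D.comp[OF hws t(3)]
      have "h \<cdot>\<^bsub>D\<^esub> Plus D (hat Z z) (neg D (hat Z (w \<cdot>\<^bsub>C\<^esub> s))) = Null D (ob F A) (D.SO X)"
        using D.comp_plus_left[OF hz nws t(3)] D.comp_neg(1)[OF hws t(3)] psi_h[OF s(1)] s(2) x(2)
          D.plus_neg[OF hhws hhws] by simp
      then obtain y' where y': "y' \<in> Hom D (ob F A) Y" "g \<cdot>\<^bsub>D\<^esub> y' = Plus D (hat Z z) (neg D (hat Z (w \<cdot>\<^bsub>C\<^esub> s)))"
        using D.exact_hom[OF D.tri_rot[OF tri] D.plus_hom[OF hz nws]] by blast
      obtain y where y: "y \<in> Hom C A (ob R Y)" "hat Y y = y'"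
        using transpose_ex[OF A y'(1)] by blast
      note gy = C.comp[OF y(1) tW(2)]
      have "hat Z (w \<cdot>\<^bsub>C\<^esub> (g' \<cdot>\<^bsub>C\<^esub> y)) = g \<cdot>\<^bsub>D\<^esub> y'"
        using C.comp_assoc[OF y(1) tW(2) w(1)] wg hat_R[OF t(2) y(1)] y(2) by simp
      then have "hat Z (w \<cdot>\<^bsub>C\<^esub> Plus C (g' \<cdot>\<^bsub>C\<^esub> y) s) = hat Z z"
        using C.comp_plus_left[OF gy s(1) w(1)] hat_plus[OF t(6) C.comp[OF gy w(1)] ws] y'(2)
          D.diff_plus[OF hz hws] by simp
      then have "w \<cdot>\<^bsub>C\<^esub> Plus C (g' \<cdot>\<^bsub>C\<^esub> y) s = z"
        by (rule transpose_unique[OF t(6) C.comp[OF C.plus_hom[OF gy s(1)] w(1)] z])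
      then show "z \<in> (\<cdot>\<^bsub>C\<^esub>) w ` Hom C A W"
        using C.plus_hom[OF gy s(1)] by blast
    qed (use C.comp[OF _ w(1)] in auto)
  qed
  note iw = C.inv_arr(2)[OF wi]
  have d: "is_diagram C (ob R X) (ob R Y) (ob R Z) (ar R f) (ar R g) (h' \<cdot>\<^bsub>C\<^esub> inv_arr C w)"
    using Rf Rg C.comp[OF iw tW(3)] by (simp add: is_diagram_def)
  have "is_triangle C (ob R X) (ob R Y) (ob R Z) (ar R f) (ar R g) (h' \<cdot>\<^bsub>C\<^esub> inv_arr C w)"
  proof (rule C.tri_iso[OF W d C.Isos_ident[OF Ro(1)] C.Isos_ident[OF Ro(2)] wi])
    show "Ident C (ob R Y) \<cdot>\<^bsub>C\<^esub> ar R f = ar R f \<cdot>\<^bsub>C\<^esub> Ident C (ob R X)"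
      using C.comp_ident_left[OF Rf] C.comp_ident_right[OF Rf] by simp
    show "w \<cdot>\<^bsub>C\<^esub> g' = ar R g \<cdot>\<^bsub>C\<^esub> Ident C (ob R Y)"
      using wg C.comp_ident_right[OF Rg] by simp
    show "C.SA (Ident C (ob R X)) \<cdot>\<^bsub>C\<^esub> h' = (h' \<cdot>\<^bsub>C\<^esub> inv_arr C w) \<cdot>\<^bsub>C\<^esub> w"
      using is_functor_ident[OF C.susp_is_functor Ro(1)] C.comp_ident_left[OF tW(3)] C.comp_assoc[OF w(1) iw tW(3)]
        C.inv_arr(3)[OF wi] C.comp_ident_right[OF tW(3)] by simp
  qed
  then show ?thesis
    by blast
qed

lemma R_exact: "coproduct_exact_functor D C \<kappa> R"
proof unfold_locales
  show "preserves_small_coproducts \<kappa> D C R"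
    unfolding preserves_small_coproducts_def using R_coproduct by blast
qed (rule regular R_additive R_triangle, assumption?)+

end

section \<open>The projection formula\<close>

locale rigid_adjunction = S: tensor_triangulated_category S + T: tensor_triangulated_category T +
    adj: exact_adjunction S T \<kappa> F R e + mon: strong_monoidal_functor S T F \<mu> \<eta>
  for S :: "('o, 'm, 'y) tt_cat_scheme" and T :: "('p, 'n, 'z) tt_cat_scheme"
    and \<kappa> :: "'i rel" and F R e \<mu> \<eta> +
  assumes compact_dual: "finsum_compact \<kappa> S X \<Longrightarrow> \<exists>A ev coev. S.half_dual X A ev coev"
begin

text \<open>The two functors of \<open>X\<close> are \<open>X \<otimes> R Y\<close> inside
  \<open>S\<close> and \<open>F X \<otimes> Y\<close> in \<open>T\<close>. A compact
  \<open>X\<close> belongs to a dual pair, and there bijectivity is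
  \<open>projection_bij\<close>.\<close>

lemma projection_comparison:
  assumes A: "finsum_compact \<kappa> S A" and Y: "Y \<in> Obj T"
  shows "comparison S S T \<kappa> (S.tensor_right (ob R Y)) (comp_functor (T.tensor_right Y) F) A (ob F A)
    (\<lambda>X. mon.projection X (ob R Y) (e Y))"
proof -
  let ?B = "ob R Y" and ?I = "Ident T"
  have B: "?B \<in> Obj S" and Ao: "A \<in> Obj S"
    using adj.R_ob[OF Y] A by (auto simp: finsum_compact_def)
  interpret F1: coproduct_exact_functor S S \<kappa> "S.tensor_right ?B"
    by (rule S.tensor_right_exact[OF adj.regular B])
  interpret F2: coproduct_exact_functor S T \<kappa> "comp_functor (T.tensor_right Y) F"
    by (rule coproduct_exact_functor_comp[OF adj.coproduct_exact_functor_axioms T.tensor_right_exact[OF adj.regular Y]])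
  have m: "inv_arr T (\<mu> X ?B) \<in> Hom T (ob F (X \<odot>\<^bsub>S\<^esub> ?B)) (ob F X \<odot>\<^bsub>T\<^esub> ob F ?B)" if "X \<in> Obj S" for X
    by (rule T.inv_arr(2)[OF mon.mult_iso[OF that B]])
  note e = adj.counit[OF Y]
  have Ie: "?I (ob F X) \<star>\<^bsub>T\<^esub> e Y \<in> Hom T (ob F X \<odot>\<^bsub>T\<^esub> ob F ?B) (ob F X \<odot>\<^bsub>T\<^esub> Y)" if "X \<in> Obj S" for X
    by (rule T.tensor_ar[OF T.ident[OF adj.F_ob[OF that]] e])
  show ?thesis
  proof unfold_locales
    show "compactly_generated \<kappa> S"
      by (rule adj.compactly_generated)
    show "finsum_compact \<kappa> S A" "finsum_compact \<kappa> T (ob F A)"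
      using A adj.F_compact by auto
    fix X assume X: "X \<in> Obj S"
    fix f assume "f \<in> Hom S A (ob (S.tensor_right ?B) X)"
    then have f: "f \<in> Hom S A (X \<odot>\<^bsub>S\<^esub> ?B)"
      by simp
    note mf = T.comp[OF adj.F_hom[OF f] m[OF X]]
    show "mon.projection X ?B (e Y) f \<in> Hom T (ob F A) (ob (comp_functor (T.tensor_right Y) F) X)"
      using T.comp[OF mf Ie[OF X]] by (simp add: mon.projection_def)
    fix g assume "g \<in> Hom S A (ob (S.tensor_right ?B) X)"
    then have g: "g \<in> Hom S A (X \<odot>\<^bsub>S\<^esub> ?B)"
      by simp
    note mg = T.comp[OF adj.F_hom[OF g] m[OF X]]
    show "mon.projection X ?B (e Y) (Plus S f g) = Plus T (mon.projection X ?B (e Y) f) (mon.projection X ?B (e Y) g)"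
      using adj.F_plus[OF f g] T.comp_plus_left[OF adj.F_hom[OF f] adj.F_hom[OF g] m[OF X]]
        T.comp_plus_left[OF mf mg Ie[OF X]] by (simp add: mon.projection_def)
  next
    fix u X X' f assume u: "u \<in> Hom S X X'" and "f \<in> Hom S A (ob (S.tensor_right ?B) X)"
    then have f: "f \<in> Hom S A (X \<odot>\<^bsub>S\<^esub> ?B)"
      by simp
    have X: "X \<in> Obj S" "X' \<in> Obj S"
      using S.hom_obj[OF u] by auto
    have uB: "u \<star>\<^bsub>S\<^esub> Ident S ?B \<in> Hom S (X \<odot>\<^bsub>S\<^esub> ?B) (X' \<odot>\<^bsub>S\<^esub> ?B)"
      by (rule S.tensor_ar[OF u S.ident[OF B]])
    note Ff = adj.F_hom[OF f] and FuB = adj.F_hom[OF uB] and Fu = adj.F_hom[OF u]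
    note muX = mon.mult_iso[OF X(1) B] and muX' = mon.mult_iso[OF X(2) B]
    have FuI: "ar F u \<star>\<^bsub>T\<^esub> ?I (ob F ?B) \<in> Hom T (ob F X \<odot>\<^bsub>T\<^esub> ob F ?B) (ob F X' \<odot>\<^bsub>T\<^esub> ob F ?B)"
      by (rule T.tensor_ar[OF Fu T.ident[OF adj.F_ob[OF B]]])
    \<comment> \<open>Naturality of \<mu> in its first argument, transferred to the
      inverses.\<close>
    have nat: "inv_arr T (\<mu> X' ?B) \<cdot>\<^bsub>T\<^esub> ar F (u \<star>\<^bsub>S\<^esub> Ident S ?B)
        = (ar F u \<star>\<^bsub>T\<^esub> ?I (ob F ?B)) \<cdot>\<^bsub>T\<^esub> inv_arr T (\<mu> X ?B)"
    proof (rule T.iso_cancel_left[OF muX' T.comp[OF FuB m[OF X(2)]] T.comp[OF m[OF X(1)] FuI]])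
      have "\<mu> X' ?B \<cdot>\<^bsub>T\<^esub> (inv_arr T (\<mu> X' ?B) \<cdot>\<^bsub>T\<^esub> ar F (u \<star>\<^bsub>S\<^esub> Ident S ?B)) = ar F (u \<star>\<^bsub>S\<^esub> Ident S ?B)"
        using T.comp_assoc[OF FuB m[OF X(2)] T.Isos_hom[OF muX']] T.inv_arr(4)[OF muX'] T.comp_ident_left[OF FuB]
        by simp
      also have "\<dots> = (ar F (u \<star>\<^bsub>S\<^esub> Ident S ?B) \<cdot>\<^bsub>T\<^esub> \<mu> X ?B) \<cdot>\<^bsub>T\<^esub> inv_arr T (\<mu> X ?B)"
        using T.comp_assoc[OF m[OF X(1)] T.Isos_hom[OF muX] FuB] T.inv_arr(4)[OF muX] T.comp_ident_right[OF FuB]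
        by simp
      also have "ar F (u \<star>\<^bsub>S\<^esub> Ident S ?B) \<cdot>\<^bsub>T\<^esub> \<mu> X ?B = \<mu> X' ?B \<cdot>\<^bsub>T\<^esub> (ar F u \<star>\<^bsub>T\<^esub> ?I (ob F ?B))"
        by (rule mon.mult_natural_left[OF u B, symmetric])
      also have "(\<mu> X' ?B \<cdot>\<^bsub>T\<^esub> (ar F u \<star>\<^bsub>T\<^esub> ?I (ob F ?B))) \<cdot>\<^bsub>T\<^esub> inv_arr T (\<mu> X ?B)
          = \<mu> X' ?B \<cdot>\<^bsub>T\<^esub> ((ar F u \<star>\<^bsub>T\<^esub> ?I (ob F ?B)) \<cdot>\<^bsub>T\<^esub> inv_arr T (\<mu> X ?B))"
        by (rule T.comp_assoc[OF m[OF X(1)] FuI T.Isos_hom[OF muX']])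
      finally show "\<mu> X' ?B \<cdot>\<^bsub>T\<^esub> (inv_arr T (\<mu> X' ?B) \<cdot>\<^bsub>T\<^esub> ar F (u \<star>\<^bsub>S\<^esub> Ident S ?B))
          = \<mu> X' ?B \<cdot>\<^bsub>T\<^esub> ((ar F u \<star>\<^bsub>T\<^esub> ?I (ob F ?B)) \<cdot>\<^bsub>T\<^esub> inv_arr T (\<mu> X ?B))" .
    qed
    have swap: "(?I (ob F X') \<star>\<^bsub>T\<^esub> e Y) \<cdot>\<^bsub>T\<^esub> (ar F u \<star>\<^bsub>T\<^esub> ?I (ob F ?B))
        = (ar F u \<star>\<^bsub>T\<^esub> ?I Y) \<cdot>\<^bsub>T\<^esub> (?I (ob F X) \<star>\<^bsub>T\<^esub> e Y)"
      using Fu e X B Y by (simp add: in_hom T.tensor_comp_arr)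
    have FuY: "ar F u \<star>\<^bsub>T\<^esub> ?I Y \<in> Hom T (ob F X \<odot>\<^bsub>T\<^esub> Y) (ob F X' \<odot>\<^bsub>T\<^esub> Y)"
      by (rule T.tensor_ar[OF Fu T.ident[OF Y]])
    note mf = T.comp[OF Ff m[OF X(1)]]
    have "mon.projection X' ?B (e Y) ((u \<star>\<^bsub>S\<^esub> Ident S ?B) \<cdot>\<^bsub>S\<^esub> f)
        = (?I (ob F X') \<star>\<^bsub>T\<^esub> e Y) \<cdot>\<^bsub>T\<^esub> ((inv_arr T (\<mu> X' ?B) \<cdot>\<^bsub>T\<^esub> ar F (u \<star>\<^bsub>S\<^esub> Ident S ?B)) \<cdot>\<^bsub>T\<^esub> ar F f)"
      unfolding mon.projection_def adj.F_comp[OF f uB] T.comp_assoc[OF Ff FuB m[OF X(2)]] ..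
    also have "\<dots> = (?I (ob F X') \<star>\<^bsub>T\<^esub> e Y) \<cdot>\<^bsub>T\<^esub> ((ar F u \<star>\<^bsub>T\<^esub> ?I (ob F ?B)) \<cdot>\<^bsub>T\<^esub> (inv_arr T (\<mu> X ?B) \<cdot>\<^bsub>T\<^esub> ar F f))"
      unfolding nat T.comp_assoc[OF Ff m[OF X(1)] FuI] ..
    also have "\<dots> = ((ar F u \<star>\<^bsub>T\<^esub> ?I Y) \<cdot>\<^bsub>T\<^esub> (?I (ob F X) \<star>\<^bsub>T\<^esub> e Y)) \<cdot>\<^bsub>T\<^esub> (inv_arr T (\<mu> X ?B) \<cdot>\<^bsub>T\<^esub> ar F f)"
      unfolding T.comp_assoc[OF mf FuI Ie[OF X(2)], symmetric] swap ..
    also have "\<dots> = (ar F u \<star>\<^bsub>T\<^esub> ?I Y) \<cdot>\<^bsub>T\<^esub> mon.projection X ?B (e Y) f"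
      unfolding mon.projection_def by (rule T.comp_assoc[OF mf Ie[OF X(1)] FuY])
    finally show "mon.projection X' ?B (e Y) (ar (S.tensor_right ?B) u \<cdot>\<^bsub>S\<^esub> f)
        = ar (comp_functor (T.tensor_right Y) F) u \<cdot>\<^bsub>T\<^esub> mon.projection X ?B (e Y) f"
      by simp
  next
    fix X assume "finsum_compact \<kappa> S X"
    then obtain D ev coev where "S.half_dual X D ev coev"
      using compact_dual by blast
    from mon.projection_bij[OF adj.counit_adjunction_axioms this Y Ao]
    show "bij_betw (mon.projection X ?B (e Y)) (Hom S A (ob (S.tensor_right ?B) X))
        (Hom T (ob F A) (ob (comp_functor (T.tensor_right Y) F) X))"
      by simp
  qed
qed

text \<open>The map \<open>q\<close> is defined by its transpose, the counit tensored with
  \<open>F X\<close>. By adjunction, composing with \<open>q\<close> becomes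
  \<open>projection\<close>, which the comparison theorem shows to be bijective on maps from compact
  objects.\<close>

theorem projection_formula:
  assumes X: "X \<in> Obj S" and Y: "Y \<in> Obj T"
  shows "\<exists>q. q \<in> Isos S (X \<odot>\<^bsub>S\<^esub> ob R Y) (ob R (ob F X \<odot>\<^bsub>T\<^esub> Y))"
proof -
  let ?B = "ob R Y" and ?V = "ob F X \<odot>\<^bsub>T\<^esub> Y"
  have B: "?B \<in> Obj S" and V: "?V \<in> Obj T" and XB: "X \<odot>\<^bsub>S\<^esub> ?B \<in> Obj S"
    using adj.R_ob[OF Y] adj.F_ob[OF X] X Y by auto
  let ?j = "Ident T (ob F X) \<star>\<^bsub>T\<^esub> e Y" and ?m = "inv_arr T (\<mu> X ?B)"
  note m = T.inv_arr(2)[OF mon.mult_iso[OF X B]]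
  have j: "?j \<in> Hom T (ob F X \<odot>\<^bsub>T\<^esub> ob F ?B) ?V"
    by (rule T.tensor_ar[OF T.ident[OF adj.F_ob[OF X]] adj.counit[OF Y]])
  obtain q where q: "q \<in> Hom S (X \<odot>\<^bsub>S\<^esub> ?B) (ob R ?V)" "adj.hat ?V q = ?j \<cdot>\<^bsub>T\<^esub> ?m"
    using adj.transpose_ex[OF XB T.comp[OF m j]] by blast
  have "q \<in> Isos S (X \<odot>\<^bsub>S\<^esub> ?B) (ob R ?V)"
  proof (rule S.iso_by_compacts[OF adj.regular adj.compactly_generated q(1)])
    fix A assume A: "finsum_compact \<kappa> S A"
    then have Ao: "A \<in> Obj S"
      by (simp add: finsum_compact_def)
    let ?p = "mon.projection X ?B (e Y)"
    have bij: "bij_betw ?p (Hom S A (X \<odot>\<^bsub>S\<^esub> ?B)) (Hom T (ob F A) ?V)"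
      using comparison.bij_p[OF projection_comparison[OF A Y] X] by simp
    have hat: "adj.hat ?V (q \<cdot>\<^bsub>S\<^esub> f) = ?p f" if f: "f \<in> Hom S A (X \<odot>\<^bsub>S\<^esub> ?B)" for f
      unfolding adj.counit_comp[OF V q(1) f] q(2) mon.projection_def
      by (rule T.comp_assoc[OF adj.F_hom[OF f] m j])
    show "bij_betw ((\<cdot>\<^bsub>S\<^esub>) q) (Hom S A (X \<odot>\<^bsub>S\<^esub> ?B)) (Hom S A (ob R ?V))"
      unfolding bij_betw_def
    proof (intro conjI inj_onI equalityI subsetI)
      fix f g assume fg: "f \<in> Hom S A (X \<odot>\<^bsub>S\<^esub> ?B)" "g \<in> Hom S A (X \<odot>\<^bsub>S\<^esub> ?B)" "q \<cdot>\<^bsub>S\<^esub> f = q \<cdot>\<^bsub>S\<^esub> g"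
      then have "?p f = ?p g"
        using hat by metis
      then show "f = g"
        by (rule inj_onD[OF bij_betw_imp_inj_on[OF bij] _ fg(1,2)])
    next
      fix g assume g: "g \<in> Hom S A (ob R ?V)"
      have "adj.hat ?V g \<in> ?p ` Hom S A (X \<odot>\<^bsub>S\<^esub> ?B)"
        unfolding bij_betw_imp_surj_on[OF bij] by (rule adj.hat_hom[OF V g])
      then obtain f where f: "f \<in> Hom S A (X \<odot>\<^bsub>S\<^esub> ?B)" "?p f = adj.hat ?V g"
        by (rule imageE) (rule that, assumption, rule sym)
      have "q \<cdot>\<^bsub>S\<^esub> f = g"
        by (rule adj.transpose_unique[OF V S.comp[OF f(1) q(1)] g]) (simp only: hat[OF f(1)] f(2))
      then show "g \<in> (\<cdot>\<^bsub>S\<^esub>) q ` Hom S A (X \<odot>\<^bsub>S\<^esub> ?B)"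
        using f(1) by blast
    qed (use S.comp[OF _ q(1)] in auto)
  qed
  then show ?thesis
    by blast
qed

lemma generation_of_unit:
  assumes cop: "has_small_coproducts \<kappa> T" and G: "G \<in> Obj T" and l: "gen_level \<kappa> T G l = Obj T"
    and n: "Unit S \<in> gen_level \<kappa> S (ob R G) n"
  shows "gen_level \<kappa> S (ob R G) (l * n) = Obj S"
proof (intro equalityI S.gen_level_subset subsetI)
  fix X assume X: "X \<in> Obj S"
  let ?H = "ob R G"
  have H: "?H \<in> Obj S" and Y: "ob F X \<odot>\<^bsub>T\<^esub> G \<in> Obj T"
    using adj.R_ob[OF G] adj.F_ob[OF X] G by auto
  interpret tX: coproduct_exact_functor S S \<kappa> "S.tensor_right X"
    by (rule S.tensor_right_exact[OF adj.regular X])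
  interpret R: coproduct_exact_functor T S \<kappa> R
    by (rule adj.R_exact)
  have unit: "Unit S \<odot>\<^bsub>S\<^esub> X \<in> gen_level \<kappa> S (?H \<odot>\<^bsub>S\<^esub> X) n"
    using tX.gen_level_map[OF H n] by simp
  obtain q where "q \<in> Isos S (X \<odot>\<^bsub>S\<^esub> ?H) (ob R (ob F X \<odot>\<^bsub>T\<^esub> G))"
    using projection_formula[OF X G] by blast
  \<comment> \<open>\<open>tensor_right\<close> puts \<open>X\<close> behind \<open>H\<close>,
    whereas the projection formula has it in front; the braiding exchanges the two.\<close>
  then have q: "q \<cdot>\<^bsub>S\<^esub> Braid S ?H X \<in> Isos S (?H \<odot>\<^bsub>S\<^esub> X) (ob R (ob F X \<odot>\<^bsub>T\<^esub> G))"
    by (rule S.Isos_comp[OF S.braid_iso[OF H X]])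
  have "ob R P \<in> gen_level \<kappa> S ?H l" if "P \<in> Obj T" for P
    using R.gen_level_map[OF G] l that by blast
  \<comment> \<open>The isomorphism \<open>q\<close> exhibits the generator of the outer
    \<open>n\<close> layers as an object in the image of \<open>R\<close>, so each layer has level
    \<open>l\<close> over \<open>H\<close> and the bounds multiply.\<close>
  then have "Unit S \<odot>\<^bsub>S\<^esub> X \<in> gen_level \<kappa> S ?H (l * n)"
    by (rule R.gen_level_mult[OF cop Y q _ unit])
  then show "X \<in> gen_level \<kappa> S ?H (l * n)"
    by (rule S.gen_level_iso[OF _ S.inv_arr(1)[OF S.lunit_iso[OF X]]])
qed

end

section \<open>From the hypotheses of the theorem to the setting of the projection formula\<close>

lemma tensor_exact_rigid_adjunction:
  fixes \<kappa> :: "'i rel" and S :: "('o, 'm, 'y) tt_cat_scheme" and T :: "('p, 'n, 'z) tt_cat_scheme"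
  assumes \<kappa>: "uncountable_regular \<kappa>"
    and S: "rigidly_compactly_generated \<kappa> S" and T: "rigidly_compactly_generated \<kappa> T"
    and F: "is_tensor_exact S T F" and cop: "preserves_small_coproducts \<kappa> S T F"
    and R: "is_right_adjoint S T F R"
  obtains e \<mu> \<eta> where "rigid_adjunction S T \<kappa> F R e \<mu> \<eta>"
proof -
  interpret S: tensor_triangulated_category S
    using S by (simp add: rigidly_compactly_generated_def)
  interpret T: tensor_triangulated_category T
    using T by (simp add: rigidly_compactly_generated_def)
  have exact: "is_exact_functor S T F" and mon: "is_strong_symmetric_monoidal S T F"
    using F by (auto simp: is_tensor_exact_def)
  have add: "is_additive_functor S T F"
    using exact by (simp add: is_exact_functor_def)
  have F_functor: "is_functor S T F"
    by (rule additive_functorD(1)[OF add])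
  obtain \<mu> \<eta> where "\<eta> \<in> Isos T (Unit T) (ob F (Unit S))" and
    "\<forall>X\<in>Obj S. \<forall>Y\<in>Obj S. \<mu> X Y \<in> Isos T (ob F X \<odot>\<^bsub>T\<^esub> ob F Y) (ob F (X \<odot>\<^bsub>S\<^esub> Y))" and
    "\<forall>X X' Y Y'. \<forall>f\<in>Hom S X X'. \<forall>g\<in>Hom S Y Y'.
          \<mu> X' Y' \<cdot>\<^bsub>T\<^esub> (ar F f \<star>\<^bsub>T\<^esub> ar F g) = ar F (f \<star>\<^bsub>S\<^esub> g) \<cdot>\<^bsub>T\<^esub> \<mu> X Y" and
    "\<forall>X\<in>Obj S. \<forall>Y\<in>Obj S. \<forall>Z\<in>Obj S.
          ar F (Assoc S X Y Z) \<cdot>\<^bsub>T\<^esub> \<mu> (X \<odot>\<^bsub>S\<^esub> Y) Z \<cdot>\<^bsub>T\<^esub> (\<mu> X Y \<star>\<^bsub>T\<^esub> Ident T (ob F Z))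
            = \<mu> X (Y \<odot>\<^bsub>S\<^esub> Z) \<cdot>\<^bsub>T\<^esub> (Ident T (ob F X) \<star>\<^bsub>T\<^esub> \<mu> Y Z)
                \<cdot>\<^bsub>T\<^esub> Assoc T (ob F X) (ob F Y) (ob F Z)" and
    "\<forall>X\<in>Obj S.
          ar F (LUnit S X) \<cdot>\<^bsub>T\<^esub> \<mu> (Unit S) X \<cdot>\<^bsub>T\<^esub> (\<eta> \<star>\<^bsub>T\<^esub> Ident T (ob F X)) = LUnit T (ob F X) \<and>
          ar F (RUnit S X) \<cdot>\<^bsub>T\<^esub> \<mu> X (Unit S) \<cdot>\<^bsub>T\<^esub> (Ident T (ob F X) \<star>\<^bsub>T\<^esub> \<eta>) = RUnit T (ob F X)"
    using mon unfolding is_strong_symmetric_monoidal_def by (elim conjE exE)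
  then interpret mon: strong_monoidal_functor S T F \<mu> \<eta>
    by unfold_locales (use F_functor in simp_all)
  interpret F: coproduct_exact_functor S T \<kappa> F
  proof unfold_locales
    fix X Y Z f g h assume "is_triangle S X Y Z f g h"
    then show "\<exists>h'. is_triangle T (ob F X) (ob F Y) (ob F Z) (ar F f) (ar F g) h'"
      using exact unfolding is_exact_functor_def by blast
  qed (rule \<kappa> add cop)+
  obtain e where e: "counit_adjunction S T F (ob R) e"
    and e_nat: "\<And>Y Y' b. b \<in> Hom T Y Y' \<Longrightarrow> e Y' \<cdot>\<^bsub>T\<^esub> ar F (ar R b) = b \<cdot>\<^bsub>T\<^esub> e Y"
    using right_adjoint_counit[OF S.category_axioms T.category_axioms F_functor R] by metis
  have dual: "\<exists>A ev coev. S.half_dual X A ev coev" if "finsum_compact \<kappa> S X" for X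
  proof -
    have "X \<in> Obj S"
      using that by (simp add: finsum_compact_def)
    then have "is_rigid S X"
      using S that S.is_compact_iff[OF \<kappa>] by (simp add: rigidly_compactly_generated_def)
    then show ?thesis
      using S.rigid_half_dual by metis
  qed
  \<comment> \<open>The unit is rigid in every closed symmetric monoidal category, and rigid objects
    of \<open>T\<close> are compact.\<close>
  have unit: "finsum_compact \<kappa> T (Unit T)"
    using T T.unit_rigid T.unit_ob T.is_compact_iff[OF \<kappa>] by (simp add: rigidly_compactly_generated_def)
  \<comment> \<open>A compact object of \<open>S\<close> has a dual pair, \<open>F\<close> carries
    it to a dual pair in \<open>T\<close>, and compactness of the unit of \<open>T\<close> passes to
    objects with a dual.\<close>
  have F_compact: "finsum_compact \<kappa> T (ob F X)" if X: "finsum_compact \<kappa> S X" for X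
  proof -
    obtain A ev coev where "S.half_dual X A ev coev"
      using dual[OF X] by blast
    from T.half_dual_compact[OF mon.half_dual_image[OF this] \<kappa> unit] show ?thesis .
  qed
  interpret e: counit_adjunction S T F "ob R" e
    by (rule e)
  have "rigid_adjunction S T \<kappa> F R e \<mu> \<eta>"
  proof unfold_locales
    show "is_functor T S R"
      using R by (simp add: is_right_adjoint_def)
    show "compactly_generated \<kappa> S"
      using S by (simp add: rigidly_compactly_generated_def)
  qed (fact exact e_nat F_compact dual)+
  then show ?thesis
    by (rule that)
qed

theorem theorem3:
  fixes \<kappa> :: "'i rel"
    and S :: "('o, 'm) tt_cat" and T :: "('p, 'n) tt_cat"
    and pi_upper :: "('o, 'm, 'p, 'n) fctr" and pi_lower :: "('p, 'n, 'o, 'm) fctr"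
    and G :: 'p
  assumes "uncountable_regular \<kappa>"
    and "rigidly_compactly_generated \<kappa> S" and "rigidly_compactly_generated \<kappa> T"
    and "is_tensor_exact S T pi_upper" and "preserves_small_coproducts \<kappa> S T pi_upper"
    and "is_right_adjoint S T pi_upper pi_lower"
    and "strong_generator \<kappa> T G"
  shows "(strong_generator \<kappa> S (ob pi_lower G)
            \<longleftrightarrow> (\<exists>n. Unit S \<in> gen_level \<kappa> S (ob pi_lower G) n))
       \<and> (\<forall>l n. gen_level \<kappa> T G l = Obj T \<and> Unit S \<in> gen_level \<kappa> S (ob pi_lower G) n
            \<longrightarrow> gen_level \<kappa> S (ob pi_lower G) (l * n) = Obj S)"
proof -
  obtain e \<mu> \<eta> where "rigid_adjunction S T \<kappa> pi_upper pi_lower e \<mu> \<eta>"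
    using tensor_exact_rigid_adjunction[OF assms(1-6)] .
  then interpret rigid_adjunction S T \<kappa> pi_upper pi_lower e \<mu> \<eta> .
  have G: "G \<in> Obj T" and l: "\<exists>l. gen_level \<kappa> T G l = Obj T"
    using assms(7) by (auto simp: strong_generator_def)
  have cop: "has_small_coproducts \<kappa> T"
    using assms(3) by (simp add: rigidly_compactly_generated_def compactly_generated_def)
  have mult: "\<forall>l n. gen_level \<kappa> T G l = Obj T \<and> Unit S \<in> gen_level \<kappa> S (ob pi_lower G) n
            \<longrightarrow> gen_level \<kappa> S (ob pi_lower G) (l * n) = Obj S"
    using generation_of_unit[OF cop G] by blast
  \<comment> \<open>If one level contains all objects, it contains the unit. For the converse,
    \<open>mult\<close> is applied to a level of \<open>G\<close> that exhausts
    \<open>T\<close>.\<close>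
  moreover have "strong_generator \<kappa> S (ob pi_lower G) \<longleftrightarrow> (\<exists>n. Unit S \<in> gen_level \<kappa> S (ob pi_lower G) n)"
    unfolding strong_generator_def using mult l adj.R_ob[OF G] S.unit_ob by blast
  ultimately show ?thesis
    by blast
qed

end
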